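(* Let $\frac{3}{4}<s<1$, $0<t<1$ and $2_s^*:=\frac{6}{3-2s}$. Assume: (a) $V\in C^0(\mathbb{R}^3)\cap L^\infty(\mathbb{R}^3)$ and $0$ lies in a spectral gap of the self-adjoint operator $(-\Delta)^s+V$ on $L^2(\mathbb{R}^3)$ (with domain $H^s(\mathbb{R}^3)$); (b) $K\in L^{\frac{3}{4s-3}}(\mathbb{R}^3)\cap L^\infty(\mathbb{R}^3)$ and $K(x)>0$ for a.e. $x\in\mathbb{R}^3$; (c) $\frac{4}{3}\le q<2$, $g\in L^{q_0}(\mathbb{R}^3)$ with $q_0=\frac{6}{6-q(3-2s)}$, and $g(x)<0$ for a.e. $x\in\mathbb{R}^3$. Then the system $$(-\Delta)^s u+V(x)u=K(x)\phi u+g(x)|u|^{q-2}u,\qquad (I-\Delta)^t\phi=K(x)u^2,\qquad x\in\mathbb{R}^3,$$ possesses infinitely many (weak) solutions $\{(u_n,\phi_{u_n})\}\subset H^s(\mathbb{R}^3)\times L^{t,2}(\mathbb{R}^3)$ satisfying $\lim_{n\to\infty}\|u_n\|_{H^s(\mathbb{R}^3)}=+\infty$.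
   Context: $(-\Delta)^s$ is the fractional Laplacian, $\widehat{(-\Delta)^s u}(\xi)=|\xi|^{2s}\hat u(\xi)$, and $H^s(\mathbb{R}^3)$ the usual fractional Sobolev space. The Bessel space $L^{t,2}(\mathbb{R}^3)$ is the set of $f\in L^2(\mathbb{R}^3)$ with $f=G_t*h$ for some $h\in L^2(\mathbb{R}^3)$, where $G_t=\mathcal{F}^{-1}\big((1+|\xi|^2)^{-t/2}\big)$ is the Bessel kernel; its norm is $\|f\|_{L^{t,2}}=\|h\|_{L^2}=\|(I-\Delta)^{t/2}f\|_{L^2}$, with associated inner product $(\cdot,\cdot)_{L^{t,2}}$. For $u\in H^s(\mathbb{R}^3)$, $\phi_u\in L^{t,2}(\mathbb{R}^3)$ denotes the unique element with $(\phi_u,v)_{L^{t,2}}=\int_{\mathbb{R}^3}K u^2 v\,dx$ for all $v\in L^{t,2}(\mathbb{R}^3)$; equivalently $\phi_u=G_{2t}*(Ku^2)$. A pair $(u,\phi)\in H^s\times L^{t,2}$ is a weak solution of the system if $\phi=\phi_u$ and $\int_{\mathbb{R}^3}\big[(-\Delta)^{s/2}u(-\Delta)^{s/2}v+V uv-K\phi_u uv-g|u|^{q-2}uv\big]dx=0$ for all $v\in H^s(\mathbb{R}^3)$.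
   Formalization: The self-adjoint operator (-Δ)^s+V on L² is taken with operator domain H^{2s}(R³) instead of the stated H^s(R³), which is only its form domain, since (-Δ)^s does not map H^s into L²; 0 lying in a spectral gap is read as 0 not belonging to the spectrum. *)

theory Defs
  imports "HOL-Analysis.Analysis"
begin

type_synonym R3fun = "real^3 \<Rightarrow> real"

text \<open>Lebesgue spaces on R^3 (functions modulo nothing; a.e. statements are explicit).\<close>
definition in_L2 :: "R3fun \<Rightarrow> bool" where
  "in_L2 f \<longleftrightarrow> f \<in> borel_measurable lborel \<and> integrable lborel (\<lambda>x. (f x)\<^sup>2)"

definition in_Lp :: "real \<Rightarrow> R3fun \<Rightarrow> bool" where
  "in_Lp p f \<longleftrightarrow> f \<in> borel_measurable lborel \<and> integrable lborel (\<lambda>x. \<bar>f x\<bar> powr p)"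

definition in_Linf :: "R3fun \<Rightarrow> bool" where
  "in_Linf f \<longleftrightarrow> f \<in> borel_measurable lborel \<and> (\<exists>M. AE x in lborel. \<bar>f x\<bar> \<le> M)"

definition is_FT :: "R3fun \<Rightarrow> (real^3 \<Rightarrow> complex) \<Rightarrow> bool" where
  "is_FT f F \<longleftrightarrow> in_L2 f \<and> F \<in> borel_measurable lborel \<and>
     integrable lborel (\<lambda>\<xi>. (cmod (F \<xi>))\<^sup>2) \<and>
     ((\<lambda>R::real. \<integral>\<^sup>+\<xi>. ennreal ((cmod (F \<xi> -
         (LINT x:cball 0 R|lborel. exp (- \<i> * complex_of_real (x \<bullet> \<xi>)) * complex_of_real (f x))))\<^sup>2) \<partial>lborel)
       \<longlongrightarrow> 0) at_top"

definition in_Hs :: "real \<Rightarrow> R3fun \<Rightarrow> bool" where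
  "in_Hs s u \<longleftrightarrow> (\<exists>F. is_FT u F \<and> integrable lborel (\<lambda>\<xi>. (1 + (norm \<xi>)\<^sup>2) powr s * (cmod (F \<xi>))\<^sup>2))"

definition Hs_norm :: "real \<Rightarrow> R3fun \<Rightarrow> real" where
  "Hs_norm s u = (let F = (SOME F. is_FT u F) in
     sqrt ((2 * pi) powr (-3) * (LINT \<xi>|lborel. (1 + (norm \<xi>)\<^sup>2) powr s * (cmod (F \<xi>))\<^sup>2)))"

definition frac_lap :: "real \<Rightarrow> R3fun \<Rightarrow> R3fun" where
  "frac_lap a u = (SOME w. \<exists>F. is_FT u F \<and> is_FT w (\<lambda>\<xi>. complex_of_real ((norm \<xi>) powr (2 * a)) * F \<xi>))"

definition bessel_rel :: "real \<Rightarrow> R3fun \<Rightarrow> R3fun \<Rightarrow> bool" where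
  "bessel_rel a f h \<longleftrightarrow> (\<exists>F. is_FT f F \<and> is_FT h (\<lambda>\<xi>. complex_of_real ((1 + (norm \<xi>)\<^sup>2) powr a) * F \<xi>))"

definition bessel_op :: "real \<Rightarrow> R3fun \<Rightarrow> R3fun" where
  "bessel_op a f = (SOME h. bessel_rel a f h)"

definition in_Lt2 :: "real \<Rightarrow> R3fun \<Rightarrow> bool" where
  "in_Lt2 t f \<longleftrightarrow> (\<exists>h. bessel_rel (t / 2) f h)"

definition Lt2_inner :: "real \<Rightarrow> R3fun \<Rightarrow> R3fun \<Rightarrow> real" where
  "Lt2_inner t f g = (LINT x|lborel. bessel_op (t / 2) f x * bessel_op (t / 2) g x)"

definition is_phi_u :: "real \<Rightarrow> R3fun \<Rightarrow> R3fun \<Rightarrow> R3fun \<Rightarrow> bool" where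
  "is_phi_u t K u \<phi> \<longleftrightarrow> in_Lt2 t \<phi> \<and>
     (\<forall>v. in_Lt2 t v \<longrightarrow> Lt2_inner t \<phi> v = (LINT x|lborel. K x * (u x)\<^sup>2 * v x))"

definition weak_solution ::
  "real \<Rightarrow> real \<Rightarrow> real \<Rightarrow> R3fun \<Rightarrow> R3fun \<Rightarrow> R3fun \<Rightarrow> R3fun \<Rightarrow> R3fun \<Rightarrow> bool" where
  "weak_solution s t q V K g u \<phi> \<longleftrightarrow> in_Hs s u \<and> in_Lt2 t \<phi> \<and> is_phi_u t K u \<phi> \<and>
     (\<forall>v. in_Hs s v \<longrightarrow>
        (LINT x|lborel. frac_lap (s / 2) u x * frac_lap (s / 2) v x + V x * u x * v x
           - K x * \<phi> x * u x * v x - g x * (\<bar>u x\<bar> powr (q - 2) * u x) * v x) = 0)"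

text \<open>0 lies in a spectral gap of A = (-Delta)^s + V (domain H^{2s}), i.e. 0 belongs to the
  resolvent set: A is a bijection from its domain onto L^2 (modulo null functions) with bounded inverse.\<close>
definition zero_in_spectral_gap :: "real \<Rightarrow> R3fun \<Rightarrow> bool" where
  "zero_in_spectral_gap s V \<longleftrightarrow>
     (\<forall>f. in_L2 f \<longrightarrow> (\<exists>u. in_Hs (2 * s) u \<and> (AE x in lborel. frac_lap s u x + V x * u x = f x))) \<and>
     (\<forall>u. in_Hs (2 * s) u \<longrightarrow> (AE x in lborel. frac_lap s u x + V x * u x = 0) \<longrightarrow> (AE x in lborel. u x = 0)) \<and>
     (\<exists>C. \<forall>u. in_Hs (2 * s) u \<longrightarrow>
        (LINT x|lborel. (u x)\<^sup>2) \<le> C * (LINT x|lborel. (frac_lap s u x + V x * u x)\<^sup>2))"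

end

theory Submission
 imports Defs "HOL-Probability.Probability"
begin

text \<open>Solutions are critical points of the strongly indefinite functional
  \<open>I u = (L u, u) / 2 - |\<beta> u u|^2 / 4 + G u\<close> on \<open>H^s\<close>, where \<open>\<beta> u v\<close> is the Bessel potential of order
  \<open>t\<close> of \<open>K u v\<close> (so \<open>|\<beta> u u|^2\<close> is the nonlocal term) and \<open>G u\<close> is the integral of \<open>|g| |u|^q / q\<close>. The space
  \<open>H^s\<close> is parametrised by \<open>L^2\<close> through the Bessel potential \<open>J s\<close>, and the sign operator of \<open>L\<close>
  splits it into a positive and a negative part. A critical level above any given number comes from linking,
  by the Borsuk-Ulam theorem, on finite-dimensional (Galerkin) subspaces; the limit of the Galerkin
  critical points is controlled because \<open>\<beta>\<close> and \<open>G\<close> are weakly continuous, the weights \<open>K^2\<close> and \<open>|g|\<close> lying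
  exactly in the Lebesgue spaces dual to the critical Sobolev exponent. High levels force large norms.\<close>

text \<open>Two obstacles shape the argument. The quartic term \<open>|\<beta> u u|^2\<close>
  dominates no power of the norm; it only bounds the fourth power of the weak norm
  \<open>w u = sqrt (Q u, u)\<close>, obtained by testing \<open>K u^2\<close> against a Gaussian,
  which lies in the range of \<open>J t\<close>. On finite-dimensional spaces \<open>w\<close> is as
  good as the norm, and elsewhere the Ehrling inequality \<open>\<kappa> u <= e |u| + C w u\<close>
  replaces coercivity: with \<open>S u\<close> as a test vector, \<open>S\<close> the sign operator,
  it bounds Galerkin critical points by a constant that does not depend on the Galerkin space. For
  this the Galerkin spaces are kept invariant under \<open>S\<close>. Next, for \<open>q < 2\<close>
  the gradient is only Hoelder continuous with exponent \<open>q - 1\<close>, so no gradient flow is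
  integrated: in finite dimension a single step along the gradient, uniform on a compact set,
  already raises the minimax value. No spectral theorem is invoked either: the gap makes
  \<open>L\<close> bounded below, and \<open>S\<close> is \<open>L\<close> times a binomial series
  for the inverse square root of \<open>L^2\<close>.\<close>

abbreviation cor :: "real => complex" where "cor == complex_of_real"

abbreviation almost_all :: "(real^3 => bool) => bool" (binder "AA " 10) where
 "almost_all P == almost_everywhere lborel P"

lemmas bint_bound = Bochner_Integration.integrable_bound
lemmas bint_add = Bochner_Integration.integrable_add
lemmas bint_diff = Bochner_Integration.integrable_diff
lemmas bint_sum = Bochner_Integration.integral_add
lemmas bint_difference = Bochner_Integration.integral_diff

section \<open>The Borsuk-Ulam theorem\<close>

primrec bdry :: "'a list => 'a list list" where
 "bdry [] = []"
| "bdry (x # xs) = xs # map ((#) x) (bdry xs)"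

text \<open>Chains with coefficients mod 2 are lists of simplices with repetitions. Two lists are
  the same chain exactly when \<open>parity P\<close> agrees on them for every \<open>P\<close>, so
  identities of chains are stated with a free \<open>P\<close> and no quotient is formed.\<close>

definition parity :: "('a => bool) => 'a list => bool" where
 "parity P xs \<longleftrightarrow> odd (length (filter P xs))"

lemma parity_simps [simp]:
 "parity P [] = False"
 "parity P (x # xs) = (P x ~= parity P xs)"
 "parity P (xs @ ys) = (parity P xs ~= parity P ys)"
 by (auto simp: parity_def)

lemma parity_map: "parity P (map f xs) = parity (%x. P (f x)) xs"
 by (induction xs) auto

lemma parity_concat: "parity P (concat xss) = parity (%xs. parity P xs) xss"
 by (induction xss) auto

lemma parity_xor: "parity (%x. P x ~= Q x) xs = (parity P xs ~= parity Q xs)"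
 by (induction xs) auto

lemma parity_cong: "(!!x. x \<in> set xs ==> P x = Q x) ==> parity P xs = parity Q xs"
 by (induction xs) auto

lemma parity_mset: "mset xs = mset ys ==> parity P xs = parity P ys"
 unfolding parity_def by (metis mset_filter size_mset)

lemma parity_False [simp]: "parity (%x. False) xs = False"
 by (induction xs) auto

lemma parity_imp_ex: "parity P xs ==> \<exists>x\<in>set xs. P x"
 by (induction xs) auto

abbreviation bdry_chain :: "'a list list => 'a list list" where
 "bdry_chain c \<equiv> concat (map bdry c)"

lemma length_bdry: "tau \<in> set (bdry \<sigma>) ==> Suc (length tau) = length \<sigma>"
 by (induction \<sigma> arbitrary: tau) auto

lemma set_bdry: "tau \<in> set (bdry \<sigma>) ==> set tau \<subseteq> set \<sigma>"
proof (induction \<sigma> arbitrary: tau)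
 case (Cons x xs)
 then show ?case by (auto; blast)
qed auto

lemma bdry_map: "bdry (map f \<sigma>) = map (map f) (bdry \<sigma>)"
 by (induction \<sigma>) auto

text \<open>The cone formula: the boundary of the cone from \<open>b\<close> over \<open>c\<close>
  is \<open>c\<close> plus the cone over the boundary of \<open>c\<close>, mod 2.\<close>

lemma parity_bdry_cone:
 "parity P (bdry_chain (map ((#) b) c)) = (parity P c ~= parity (%tau. P (b # tau)) (bdry_chain c))"
 by (induction c) (auto simp: parity_map)

lemma parity_bdry_bdry: "parity P (bdry_chain (bdry \<sigma>)) = False"
proof (induction \<sigma> arbitrary: P)
 case (Cons x xs)
 then show ?case by (simp add: parity_bdry_cone del: map_map)
qed auto

section \<open>Barycentric subdivision and its mesh\<close>

definition barycenter :: "'a::real_vector list => 'a" where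
 "barycenter \<sigma> = (1 / real (length \<sigma>)) *\<^sub>R sum_list \<sigma>"

text \<open>The empty simplex belongs to the complex (augmented chains): a vertex has boundary
  \<open>[[]]\<close> and \<open>sd [] = [[]]\<close>, so the recursion handles vertices like all
  other simplices.\<close>

function sd :: "'a::real_vector list => 'a list list" where
 "sd \<sigma> = (if \<sigma> = [] then [[]] else map ((#) (barycenter \<sigma>)) (concat (map sd (bdry \<sigma>))))"
 by pat_completeness auto
termination
 by (relation "Wellfounded.measure length") (auto dest!: length_bdry)

declare sd.simps [simp del]

abbreviation sd_chain :: "'a::real_vector list list => 'a list list" where
 "sd_chain c \<equiv> concat (map sd c)"

lemma sd_Nil: "sd [] = [[]]" by (simp add: sd.simps)

lemma sd_nonempty: "\<sigma> ~= [] ==> sd \<sigma> = map ((#) (barycenter \<sigma>)) (sd_chain (bdry \<sigma>))"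
 by (subst sd.simps) simp

lemma parity_sd_chain: "parity P (sd_chain c) = parity (%tau. parity P (sd tau)) c"
 by (simp add: parity_concat parity_map)

lemma parity_bdry_chain: "parity P (bdry_chain c) = parity (%tau. parity P (bdry tau)) c"
 by (simp add: parity_concat parity_map)

text \<open>Subdivision is a chain map. By the cone formula the boundary of
  \<open>sd \<sigma>\<close> is the subdivided boundary of \<open>\<sigma>\<close> plus the cone
  over its boundary; by induction the latter is the cone over the subdivision of the boundary of the
  boundary, which vanishes.\<close>

lemma parity_bdry_sd: "parity P (bdry_chain (sd \<sigma>)) = parity P (sd_chain (bdry \<sigma>))"
proof (induction "length \<sigma>" arbitrary: \<sigma> P rule: less_induct)
 case less
 show ?case
 proof (cases "\<sigma> = []")
  case True
  then show ?thesis by (simp add: sd_Nil)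
 next
  case False
  let ?b = "barycenter \<sigma>"
  let ?P = "%tau. P (?b # tau)"
  have "parity ?P (bdry_chain (sd_chain (bdry \<sigma>)))
    = parity (%tau. parity ?P (bdry_chain (sd tau))) (bdry \<sigma>)"
   by (simp only: parity_bdry_chain parity_sd_chain)
  also have "... = parity (%tau. parity ?P (sd_chain (bdry tau))) (bdry \<sigma>)"
   by (rule parity_cong, rule less) (auto dest!: length_bdry)
  also have "... = parity (%\<rho>. parity ?P (sd \<rho>)) (bdry_chain (bdry \<sigma>))"
   by (simp only: parity_bdry_chain parity_sd_chain)
  also have "... = False"
   by (rule parity_bdry_bdry)
  finally show ?thesis
   using False by (simp add: sd_nonempty parity_bdry_cone del: map_map)
 qed
qed

lemma barycenter_uminus: "barycenter (map uminus \<sigma>) = - barycenter \<sigma>"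
proof -
 have "sum_list (map uminus \<sigma>) = - sum_list \<sigma>" by (induction \<sigma>) auto
 then show ?thesis by (simp add: barycenter_def)
qed

lemma sd_uminus: "sd (map uminus \<sigma>) = map (map uminus) (sd \<sigma>)"
proof (induction "length \<sigma>" arbitrary: \<sigma> rule: less_induct)
 case less
 show ?case
 proof (cases "\<sigma> = []")
  case True
  then show ?thesis by (simp add: sd_Nil)
 next
  case False
  have "map sd (bdry (map uminus \<sigma>)) = map (%tau. map (map uminus) (sd tau)) (bdry \<sigma>)"
   using less by (auto simp: bdry_map dest!: length_bdry)
  then show ?thesis using False
   by (simp add: sd_nonempty barycenter_uminus map_concat comp_def)
 qed
qed

lemma length_sd: "tau \<in> set (sd \<sigma>) ==> length tau = length \<sigma>"
proof (induction "length \<sigma>" arbitrary: \<sigma> tau rule: less_induct)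
 case less
 show ?case
 proof (cases "\<sigma> = []")
  case True
  then show ?thesis using less by (simp add: sd_Nil)
 next
  case False
  then obtain tau' \<rho> where "tau = barycenter \<sigma> # tau'" "\<rho> \<in> set (bdry \<sigma>)" "tau' \<in> set (sd \<rho>)"
   using less(2) by (auto simp: sd_nonempty)
  then show ?thesis using less(1)[of \<rho> tau'] length_bdry[of \<rho> \<sigma>] by auto
 qed
qed

lemma barycenter_in_hull: "\<sigma> ~= [] ==> barycenter \<sigma> \<in> convex hull (set \<sigma>)"
proof -
 assume "\<sigma> ~= []"
 then have n: "length \<sigma> > 0" by simp
 have "barycenter \<sigma> = (\<Sum>i<length \<sigma>. (1 / real (length \<sigma>)) *\<^sub>R \<sigma> ! i)"
  by (simp add: barycenter_def sum_list_sum_nth scaleR_sum_right atLeast0LessThan)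
 also have "... \<in> convex hull (set \<sigma>)"
  using n by (intro convex_sum) (auto intro!: hull_inc)
 finally show ?thesis .
qed

lemma sd_hull: "tau \<in> set (sd \<sigma>) ==> set tau \<subseteq> convex hull (set \<sigma>)"
proof (induction "length \<sigma>" arbitrary: \<sigma> tau rule: less_induct)
 case less
 show ?case
 proof (cases "\<sigma> = []")
  case True
  then show ?thesis using less by (simp add: sd_Nil)
 next
  case False
  then obtain tau' \<rho> where *: "tau = barycenter \<sigma> # tau'" "\<rho> \<in> set (bdry \<sigma>)" "tau' \<in> set (sd \<rho>)"
   using less(2) by (auto simp: sd_nonempty)
  have "set tau' \<subseteq> convex hull (set \<rho>)"
   using less(1)[of \<rho> tau'] * length_bdry[of \<rho> \<sigma>] by auto
  also have "... \<subseteq> convex hull (set \<sigma>)"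
   using * by (intro hull_mono set_bdry)
  finally show ?thesis using * barycenter_in_hull[OF False] by auto
 qed
qed

text \<open>For a vertex \<open>v\<close> among \<open>k\<close>, the barycenter minus
  \<open>v\<close> averages \<open>k\<close> vectors of which one is zero, hence the factor
  \<open>(k - 1) / k\<close>, which increases with \<open>k\<close>. Other points of the hull follow
  because a ball is convex.\<close>

lemma barycenter_dist:
 fixes \<sigma> :: "'a::real_normed_vector list"
 assumes "\<sigma> ~= []" "!!x y. x \<in> set \<sigma> ==> y \<in> set \<sigma> ==> dist x y <= D" "length \<sigma> <= Suc n" "v \<in> convex hull (set \<sigma>)"
 shows "dist (barycenter \<sigma>) v <= real n / real (Suc n) * D"
proof -
 define k where "k = length \<sigma>"
 have k: "k > 0" "k <= Suc n" using assms by (auto simp: k_def)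
 have D0: "D >= 0" using assms(1) assms(2)[of "hd \<sigma>" "hd \<sigma>"] by simp
 have "dist (barycenter \<sigma>) v <= real n / real (Suc n) * D" if vs: "v \<in> set \<sigma>" for v
 proof -
  obtain j where j: "j < k" "v = \<sigma> ! j" using vs unfolding in_set_conv_nth k_def by metis
  have "barycenter \<sigma> - v = (1 / real k) *\<^sub>R (sum_list \<sigma> - real k *\<^sub>R v)"
   using k by (simp add: barycenter_def k_def scaleR_diff_right)
  also have "sum_list \<sigma> - real k *\<^sub>R v = (\<Sum>i<k. \<sigma> ! i - v)"
   by (simp add: sum_list_sum_nth sum_subtractf k_def atLeast0LessThan sum_constant_scaleR)
  also have "... = (\<Sum>i\<in>{..<k}-{j}. \<sigma> ! i - v)"
   using j by (intro sum.mono_neutral_right) auto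
  finally have "norm (barycenter \<sigma> - v) = (1 / real k) * norm (\<Sum>i\<in>{..<k}-{j}. \<sigma> ! i - v)"
   by simp
  also have "... <= (1 / real k) * (\<Sum>i\<in>{..<k}-{j}. D)"
   using assms(2) vs by (intro mult_left_mono order_trans[OF norm_sum] sum_mono)
    (auto simp: dist_norm k_def)
  also have "... = (real k - 1) / real k * D"
   using j k by (simp add: of_nat_diff)
  also have "... <= real n / real (Suc n) * D"
   using k D0 by (intro mult_right_mono) (auto simp: field_simps)
  finally show ?thesis by (simp add: dist_norm)
 qed
 then have "set \<sigma> \<subseteq> cball (barycenter \<sigma>) (real n / real (Suc n) * D)"
  by auto
 then have "convex hull (set \<sigma>) \<subseteq> cball (barycenter \<sigma>) (real n / real (Suc n) * D)"
  by (intro hull_minimal convex_cball)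
 then show ?thesis using assms by auto
qed

lemma sd_mesh:
 fixes \<sigma> :: "'a::real_normed_vector list"
 assumes "!!x y. x \<in> set \<sigma> ==> y \<in> set \<sigma> ==> dist x y <= D" "length \<sigma> <= Suc n" "D >= 0"
  "tau \<in> set (sd \<sigma>)" "x \<in> set tau" "y \<in> set tau"
 shows "dist x y <= real n / real (Suc n) * D"
 using assms
proof (induction "length \<sigma>" arbitrary: \<sigma> tau x y rule: less_induct)
 case less
 show ?case
 proof (cases "\<sigma> = []")
  case True
  then show ?thesis using less by (simp add: sd_Nil)
 next
  case False
  then obtain tau' \<rho> where *: "tau = barycenter \<sigma> # tau'" "\<rho> \<in> set (bdry \<sigma>)" "tau' \<in> set (sd \<rho>)"
   using less(5) by (auto simp: sd_nonempty)
  have sub: "set \<rho> \<subseteq> set \<sigma>" and len: "length \<rho> < length \<sigma>"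
   using * set_bdry length_bdry[of \<rho> \<sigma>] by auto
  have hull: "set tau' \<subseteq> convex hull (set \<sigma>)"
   using sd_hull[OF *(3)] hull_mono[OF sub, of convex] by auto
  have b: "dist (barycenter \<sigma>) v <= real n / real (Suc n) * D" if "v \<in> set tau'" for v
   using barycenter_dist[OF False less(2) less(3)] hull that by blast
  have rest: "dist x y <= real n / real (Suc n) * D" if "x \<in> set tau'" "y \<in> set tau'" for x y
   using less(1)[OF len _ _ _ *(3) that] less(2,3,4) sub len by (meson le_trans less_imp_le subsetD)
  have z: "0 <= real n / real (Suc n) * D" using less(4) by simp
  show ?thesis
   using less(6,7) b rest z unfolding *(1) by (auto simp: dist_commute)
 qed
qed

text \<open>The facets of the cross-polytope with vertices plus and minus the listed vectors: a
  sphere whose dimension is one less than the length of the list.\<close>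

primrec sphere_chain :: "'a::real_vector list => 'a list list" where
 "sphere_chain [] = [[]]"
| "sphere_chain (b # bs) = map ((#) b) (sphere_chain bs) @ map ((#) (- b)) (sphere_chain bs)"

text \<open>The cones from \<open>b\<close> and \<open>- b\<close> have the same base, which cancels
  mod 2.\<close>

lemma parity_bdry_sphere: "parity P (bdry_chain (sphere_chain bs)) = False"
proof (induction bs arbitrary: P)
 case (Cons b bs)
 then show ?case by (simp add: parity_bdry_cone del: map_map)
qed auto

lemma parity_sphere_uminus:
 fixes bs :: "'a::real_vector list"
 shows
 "parity P (map (map uminus) (sphere_chain bs)) = parity P (sphere_chain bs)"
proof (induction bs arbitrary: P)
 case (Cons b bs)
 have "parity (%x. P (b # map uminus x)) (sphere_chain bs) = parity (%x. P (b # x)) (sphere_chain bs)"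
  "parity (%x. P (- b # map uminus x)) (sphere_chain bs) = parity (%x. P (- b # x)) (sphere_chain bs)"
  using Cons[of "%x. P (b # x)"] Cons[of "%x. P (- b # x)"] by (simp_all add: parity_map)
 then show ?case by (auto simp: parity_map)
qed auto

lemma length_sphere_chain: "\<sigma> \<in> set (sphere_chain bs) ==> length \<sigma> = length bs"
 by (induction bs arbitrary: \<sigma>) auto

lemma parity_bdry_sd_iter:
 "parity P (bdry_chain ((sd_chain ^^ m) c)) = parity P ((sd_chain ^^ m) (bdry_chain c))"
proof (induction m arbitrary: P)
 case (Suc m)
 let ?c = "(sd_chain ^^ m) c"
 have "parity P (bdry_chain (sd_chain ?c)) = parity (%tau. parity P (bdry_chain (sd tau))) ?c"
  by (simp only: parity_bdry_chain parity_sd_chain)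
 also have "... = parity (%tau. parity P (sd_chain (bdry tau))) ?c"
  by (simp only: parity_bdry_sd)
 also have "... = parity (%\<rho>. parity P (sd \<rho>)) (bdry_chain ?c)"
  by (simp only: parity_bdry_chain parity_sd_chain)
 also have "... = parity (%\<rho>. parity P (sd \<rho>)) ((sd_chain ^^ m) (bdry_chain c))"
  by (rule Suc)
 finally show ?case by (simp add: parity_sd_chain)
qed auto

lemma parity_sd_iter_cong:
 assumes "!!P. parity P c = parity P c'"
 shows "parity P ((sd_chain ^^ m) c) = parity P ((sd_chain ^^ m) c')"
 using assms by (induction m arbitrary: P) (auto simp: parity_sd_chain)

lemma sd_iter_append: "(sd_chain ^^ m) (c @ c') = (sd_chain ^^ m) c @ (sd_chain ^^ m) c'"
 by (induction m) auto

lemma sd_iter_uminus: "(sd_chain ^^ m) (map (map uminus) c) = map (map uminus) ((sd_chain ^^ m) c)"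
 by (induction m) (auto simp: map_concat sd_uminus comp_def)

lemma length_sd_iter:
 "tau \<in> set ((sd_chain ^^ m) c) ==> (!!\<sigma>. \<sigma> \<in> set c ==> length \<sigma> = n) ==> length tau = n"
 by (induction m arbitrary: tau) (auto dest!: length_sd)

lemma sd_iter_hull:
 "tau \<in> set ((sd_chain ^^ m) c) ==> \<exists>\<sigma>\<in>set c. set tau \<subseteq> convex hull (set \<sigma>)"
proof (induction m arbitrary: tau)
 case 0
 then show ?case by (auto intro: hull_inc)
next
 case (Suc m)
 then obtain \<rho> where "\<rho> \<in> set ((sd_chain ^^ m) c)" "tau \<in> set (sd \<rho>)" by auto
 moreover then obtain \<sigma> where "\<sigma> \<in> set c" "set \<rho> \<subseteq> convex hull (set \<sigma>)" using Suc by blast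
 ultimately show ?case using sd_hull[of tau \<rho>]
  by (meson convex_convex_hull hull_minimal order_trans)
qed

lemma sd_iter_mesh:
 fixes c :: "'a::real_normed_vector list list"
 assumes "!!\<sigma> x y. \<sigma> \<in> set c ==> x \<in> set \<sigma> ==> y \<in> set \<sigma> ==> dist x y <= D"
  "!!\<sigma>. \<sigma> \<in> set c ==> length \<sigma> <= Suc n" "D >= 0"
  "tau \<in> set ((sd_chain ^^ m) c)" "x \<in> set tau" "y \<in> set tau"
 shows "dist x y <= (real n / real (Suc n)) ^ m * D"
 using assms(4-)
proof (induction m arbitrary: tau x y)
 case 0
 then show ?case using assms by auto
next
 case (Suc m)
 then obtain \<rho> where *: "\<rho> \<in> set ((sd_chain ^^ m) c)" "tau \<in> set (sd \<rho>)" by auto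
 have "\<exists>\<sigma>\<in>set c. length \<rho> = length \<sigma>" if "\<rho> \<in> set ((sd_chain ^^ m) c)" for \<rho>
  using that by (induction m arbitrary: \<rho>) (auto dest!: length_sd)
 then have "length \<rho> <= Suc n" using * assms(2) by metis
 then have "dist x y <= real n / real (Suc n) * ((real n / real (Suc n)) ^ m * D)"
  using sd_mesh[OF Suc(1)[OF *(1)] _ _ *(2) Suc(3,4)] assms(3) by simp
 then show ?case by simp
qed

section \<open>Sign patterns of labels and Ky Fan's lemma\<close>

fun altsgn :: "bool => bool list => bool" where
 "altsgn p [] = True"
| "altsgn p (x # xs) = (x = p \<and> altsgn (\<not> p) xs)"

lemma altsgn_exclusive: "bs ~= [] ==> \<not> (altsgn True bs \<and> altsgn False bs)"
 by (cases bs) auto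

lemma altsgn_Not: "altsgn p (map Not bs) = altsgn (\<not> p) bs"
 by (induction bs arbitrary: p) auto

text \<open>Deleting a letter from an alternating word leaves an alternating word only at the two
  ends, and one of the two results starts with \<open>p\<close> (for a single letter the face is the
  empty word, which counts for both signs). A word with a single adjacent repetition has two
  alternating faces, equal to each other; any other word has none, since a deletion removes at most
  one repetition.\<close>

lemma parity_altsgn:
 "bs ~= [] ==> parity (altsgn p) (bdry bs) = (altsgn True bs \<or> altsgn False bs)"
proof (induction bs arbitrary: p)
 case (Cons x xs)
 show ?case
 proof (cases "xs = []")
  case False
  have "parity (altsgn p) (bdry (x # xs)) = (altsgn p xs ~= parity (%tau. x = p \<and> altsgn (\<not> p) tau) (bdry xs))"
   by (simp add: parity_map)
  also have "parity (%tau. x = p \<and> altsgn (\<not> p) tau) (bdry xs) = (x = p \<and> parity (altsgn (\<not> p)) (bdry xs))"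
   by (cases "x = p") auto
  also have "... = (x = p \<and> (altsgn True xs \<or> altsgn False xs))"
   using Cons False by blast
  finally show ?thesis using altsgn_exclusive[OF False] by (cases p; cases x) auto
 qed auto
qed auto

definition alternating :: "bool => int list => bool" where
 "alternating p l = altsgn p (map (%i. i > 0) (sort_key abs l))"

definition noncompl :: "int list => bool" where
 "noncompl l \<longleftrightarrow> (\<forall>i\<in>set l. \<forall>j\<in>set l. i ~= - j)"

lemma noncompl_inj: "noncompl l ==> inj_on abs (set l)"
 unfolding noncompl_def inj_on_def by (metis abs_eq_iff)

lemma noncompl_mono: "noncompl l ==> set l' \<subseteq> set l ==> noncompl l'"
 unfolding noncompl_def by blast

lemma noncompl_nonzero: "noncompl l ==> i \<in> set l ==> i ~= 0"
 unfolding noncompl_def by force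

text \<open>Without complementary labels, labels of equal absolute value are equal, so sorting by
  absolute value depends on the multiset alone.\<close>

lemma sort_key_eqI:
 "mset l = mset l' ==> noncompl l ==> sort_key abs l = sort_key abs l'"
 by (rule sort_key_inj_key_eq) (auto simp: noncompl_inj)

text \<open>Up to the order within faces, the faces depend only on the multiset of labels; this
  permits sorting the labels before faces are counted.\<close>

lemma mset_bdry: "image_mset mset (mset (bdry l)) = image_mset (%x. mset l - {#x#}) (mset l)"
proof (induction l)
 case (Cons x xs)
 have "image_mset mset (mset (bdry (x # xs))) = add_mset (mset xs) (image_mset (add_mset x) (image_mset mset (mset (bdry xs))))"
  by (simp add: multiset.map_comp comp_def)
 also have "... = add_mset (mset xs) (image_mset (%y. add_mset x (mset xs - {#y#})) (mset xs))"
  unfolding Cons by (simp add: multiset.map_comp comp_def)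
 also have "image_mset (%y. add_mset x (mset xs - {#y#})) (mset xs) = image_mset (%y. add_mset x (mset xs) - {#y#}) (mset xs)"
  by (intro image_mset_cong) (auto simp: multiset_eq_iff)
 finally show ?case by simp
qed auto

lemma sorted_bdry: "sorted (map f l) ==> tau \<in> set (bdry l) ==> sorted (map f tau)"
proof (induction l arbitrary: tau)
 case (Cons x xs)
 consider "tau = xs" | \<rho> where "\<rho> \<in> set (bdry xs)" "tau = x # \<rho>"
  using Cons.prems(2) by auto
 then show ?case
 proof cases
  case 2
  then show ?thesis using Cons.IH[OF _ 2(1)] Cons.prems(1) set_bdry[OF 2(1)] by auto
 qed (use Cons.prems in auto)
qed auto

lemma parity_alternating:
 assumes "l ~= []" "noncompl l"
 shows "parity (alternating p) (bdry l) = (alternating True l \<or> alternating False l)"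
proof -
 define ls where "ls = sort_key abs l"
 define \<Phi> where "\<Phi> M = alternating p (sorted_list_of_multiset M)" for M
 have ms: "mset ls = mset l" and nc: "noncompl ls" and ne: "ls ~= []"
  using assms by (auto simp: ls_def noncompl_def) (metis mset_eq_setD mset_sort mset_zero_iff)
 have nc': "noncompl tau" if "tau \<in> set (bdry k)" "noncompl k" for tau k
  using that noncompl_mono set_bdry by blast
 have \<Phi>: "parity (alternating p) (bdry k) = parity \<Phi> (map mset (bdry k))" if "noncompl k" for k
  unfolding parity_map
 proof (rule parity_cong)
  fix tau assume "tau \<in> set (bdry k)"
  then show "alternating p tau = \<Phi> (mset tau)"
   unfolding \<Phi>_def alternating_def using nc'[OF _ that] sort_key_eqI[of tau "sorted_list_of_multiset (mset tau)"]
   by simp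
 qed
 have "mset (map mset (bdry l)) = mset (map mset (bdry ls))"
  by (simp add: mset_bdry ms)
 then have "parity (alternating p) (bdry l) = parity (alternating p) (bdry ls)"
  using \<Phi>[OF assms(2)] \<Phi>[OF nc] parity_mset by metis
 also have "... = parity (%tau. altsgn p (map (%i. i > 0) tau)) (bdry ls)"
 proof (rule parity_cong)
  fix tau assume "tau \<in> set (bdry ls)"
  moreover have "sorted (map abs ls)" by (simp add: ls_def)
  ultimately have "sorted (map abs tau)" "noncompl tau"
   using sorted_bdry nc'[OF _ nc] by blast+
  then have "sort_key abs tau = tau"
   by (intro sort_key_inj_key_eq[OF refl] noncompl_inj)
  then show "alternating p tau = altsgn p (map (%i. i > 0) tau)" by (simp add: alternating_def)
 qed
 also have "... = parity (altsgn p) (bdry (map (%i. i > 0) ls))"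
  by (simp add: bdry_map parity_map)
 also have "... = (alternating True l \<or> alternating False l)"
  using ne by (simp add: parity_altsgn alternating_def ls_def)
 finally show ?thesis .
qed

lemma alternating_uminus:
 assumes "noncompl l"
 shows "alternating p (map uminus l) = alternating (\<not> p) l"
proof -
 have "sort_key abs (map uminus l) = map uminus (sort_key abs l)"
 proof (rule sort_key_inj_key_eq)
  show "inj_on abs (set (map uminus l))"
   using noncompl_inj[OF assms] by (auto simp: inj_on_def)
 qed (auto simp: comp_def)
 moreover have "map (%i. 0 < i) (map uminus (sort_key abs l)) = map Not (map (%i. 0 < i) (sort_key abs l))"
  using noncompl_nonzero[OF assms] by (auto simp: not_less order_less_le)
 ultimately show ?thesis
  unfolding alternating_def by (simp only: altsgn_Not)
qed

text \<open>Neighbours of opposite sign differ, and equal absolute values would make them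
  complementary, so the absolute values increase strictly. An alternating simplex thus needs as many
  absolute values as it has vertices.\<close>

lemma altsgn_distinct:
 "sorted (map abs l) ==> noncompl l ==> altsgn p (map (%i. i > 0) l) ==> distinct (map abs l)"
proof (induction l arbitrary: p)
 case (Cons x xs)
 have nc: "noncompl xs" using Cons noncompl_mono[of "x # xs" xs] by auto
 have d: "distinct (map abs xs)" using Cons nc by auto
 have "\<bar>x\<bar> ~= \<bar>z\<bar>" if "z \<in> set xs" for z
 proof (cases xs)
  case (Cons y ys)
  have "y ~= x" using Cons.prems(3) Cons by auto
  moreover have "y ~= - x" using Cons.prems(2) Cons by (auto simp: noncompl_def)
  ultimately have "\<bar>x\<bar> < \<bar>y\<bar>" using Cons.prems(1) Cons by auto
  moreover have "\<bar>y\<bar> <= \<bar>z\<bar>" using that Cons Cons.prems(1) by auto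
  ultimately show ?thesis by linarith
 qed (use that in auto)
 then show ?case using d by auto
qed auto

text \<open>The half of \<open>sphere_chain bs\<close> on the side of the first vector; its boundary
  mod 2 is the equator \<open>sphere_chain (tl bs)\<close>.\<close>

definition hemisphere :: "'a::real_vector list => 'a list list" where
 "hemisphere bs = map ((#) (hd bs)) (sphere_chain (tl bs))"

text \<open>Mod 2, the alternating simplices of the hemisphere are counted by the facets of pattern
  \<open>True\<close> in its boundary, the equator. The equator is a smaller hemisphere together
  with its antipode, and the antipodal map exchanges the patterns \<open>True\<close> and
  \<open>False\<close>, so the count equals that of the alternating simplices of either pattern in
  the smaller hemisphere. The assumption covers every \<open>drop k bs\<close> so that the induction
  can descend.\<close>

lemma ky_fan:
 fixes bs :: "'a::real_vector list" and lab :: "'a => int"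
 assumes "bs ~= []"
  and "!!k tau. tau \<in> set ((sd_chain ^^ m) (sphere_chain (drop k bs))) ==>
   noncompl (map lab tau) \<and> (\<forall>x\<in>set tau. lab (- x) = - lab x)"
 shows "parity (%tau. alternating True (map lab tau) \<or> alternating False (map lab tau)) ((sd_chain ^^ m) (hemisphere bs))"
 using assms
proof (induction bs)
 case (Cons b bs)
 let ?A = "%p tau. alternating p (map lab tau)"
 have hs: "sphere_chain bs = hemisphere bs @ map ((#) (- hd bs)) (sphere_chain (tl bs))" if "bs ~= []" for bs :: "'a list"
  using that by (cases bs) (auto simp: hemisphere_def)
 show ?case
 proof (cases "bs = []")
  case True
  \<comment> \<open>A single vertex is its own subdivision, and a single label alternates for the
    pattern given by its sign.\<close>
  have "(sd_chain ^^ m) [[b]] = [[b]]"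
   by (induction m) (auto simp: sd_nonempty sd_Nil barycenter_def)
  then show ?thesis using True by (auto simp: hemisphere_def alternating_def)
 next
  case False
  let ?C = "(sd_chain ^^ m) (hemisphere (b # bs))"
  let ?H = "(sd_chain ^^ m) (hemisphere bs)"
  have ncC: "noncompl (map lab tau)" if "tau \<in> set ?C" for tau
   using Cons(3)[of tau 0] that hs[of "b # bs"] by (simp add: sd_iter_append)
  have ncH: "noncompl (map lab tau) \<and> (\<forall>x\<in>set tau. lab (- x) = - lab x)" if "tau \<in> set ?H" for tau
   using Cons(3)[of tau 1] that hs[of bs] False by (simp add: sd_iter_append)
  have lenC: "tau ~= []" if "tau \<in> set ?C" for tau
   using length_sd_iter[OF that, of "Suc (length bs)"] by (force simp: hemisphere_def dest: length_sphere_chain)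
  have lenH: "tau ~= []" if "tau \<in> set ?H" for tau
   using length_sd_iter[OF that, of "length bs"] False
   by (cases bs) (force simp: hemisphere_def dest: length_sphere_chain)+
  have "parity (%tau. ?A True tau \<or> ?A False tau) ?C = parity (%tau. parity (alternating True) (bdry (map lab tau))) ?C"
   by (rule parity_cong) (use parity_alternating ncC lenC in auto)
  also have "... = parity (?A True) (bdry_chain ?C)"
   by (simp add: parity_bdry_chain bdry_map parity_map del: map_map)
  also have "... = parity (?A True) ((sd_chain ^^ m) (bdry_chain (hemisphere (b # bs))))"
   by (rule parity_bdry_sd_iter)
  also have "... = parity (?A True) ((sd_chain ^^ m) (sphere_chain bs))"
   by (rule parity_sd_iter_cong)
    (simp add: hemisphere_def parity_bdry_cone parity_bdry_sphere del: map_map)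
  also have "... = parity (?A True) ((sd_chain ^^ m) (hemisphere bs @ map (map uminus) (hemisphere bs)))"
  proof (rule parity_sd_iter_cong)
   fix P
   have "parity P (map ((#) (- hd bs)) (sphere_chain (tl bs))) = parity P (map (map uminus) (hemisphere bs))"
    using parity_sphere_uminus[of "%tau. P (- hd bs # tau)" "tl bs"]
    by (simp add: hemisphere_def parity_map)
   then show "parity P (sphere_chain bs) = parity P (hemisphere bs @ map (map uminus) (hemisphere bs))"
    using hs[OF False] by simp
  qed
  also have "... = (parity (?A True) ?H ~= parity (%tau. ?A True (map uminus tau)) ?H)"
   by (simp add: sd_iter_append sd_iter_uminus parity_map)
  also have "parity (%tau. ?A True (map uminus tau)) ?H = parity (?A False) ?H"
  proof (rule parity_cong)
   fix tau assume t: "tau \<in> set ?H"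
   then have "map lab (map uminus tau) = map uminus (map lab tau)" using ncH by auto
   then show "?A True (map uminus tau) = ?A False tau"
    using alternating_uminus[of "map lab tau" True] ncH[OF t] by (simp del: map_map)
  qed
  also have "(parity (?A True) ?H ~= parity (?A False) ?H) = parity (%tau. ?A True tau ~= ?A False tau) ?H"
   by (rule parity_xor[symmetric])
  also have "... = parity (%tau. ?A True tau \<or> ?A False tau) ?H"
  proof (rule parity_cong)
   fix tau assume t: "tau \<in> set ?H"
   have "\<not> (?A True tau \<and> ?A False tau)"
    unfolding alternating_def by (rule altsgn_exclusive) (use lenH[OF t] in \<open>metis length_0_conv length_map length_sort\<close>)
   then show "(?A True tau ~= ?A False tau) = (?A True tau \<or> ?A False tau)" by blast
  qed
  also have "... = True"
  proof -
   have "noncompl (map lab tau) \<and> (\<forall>x\<in>set tau. lab (- x) = - lab x)"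
    if "tau \<in> set ((sd_chain ^^ m) (sphere_chain (drop k bs)))" for k tau
    using Cons.prems(2)[of tau "Suc k"] that by simp
   then show ?thesis using Cons.IH[OF False] by simp
  qed
  finally show ?thesis by simp
 qed
qed auto

lemma sphere_chain_independent:
 "independent (set bs) ==> distinct bs ==> \<sigma> \<in> set (sphere_chain bs) ==>
  independent (set \<sigma>) \<and> span (set \<sigma>) = span (set bs)"
proof (induction bs arbitrary: \<sigma>)
 case (Cons b bs)
 have b: "b \<notin> span (set bs)" and ind: "independent (set bs)"
  using Cons.prems by (auto simp: independent_insert)
 from Cons.prems obtain tau c where *: "\<sigma> = c # tau" "c = b \<or> c = - b" "tau \<in> set (sphere_chain bs)"
  by auto
 have IH: "independent (set tau)" "span (set tau) = span (set bs)"
  using Cons.IH[OF ind _ *(3)] Cons.prems by auto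
 have c: "c \<notin> span (set bs)" using b *(2) span_neg[of c "set bs"] by auto
 have "b \<in> span (insert c (set tau))" "c \<in> span (insert b (set bs))"
  using *(2) span_neg[of c "insert c (set tau)"] span_neg[of b "insert b (set bs)"]
   span_base[of c "insert c (set tau)"] span_base[of b "insert b (set bs)"] by auto
 moreover have "set tau \<subseteq> span (insert b (set bs))" "set bs \<subseteq> span (insert c (set tau))"
  using IH(2) span_superset span_mono[of "set bs" "insert b (set bs)"] span_mono[of "set tau" "insert c (set tau)"] by blast+
 ultimately have "span (insert c (set tau)) = span (insert b (set bs))"
  unfolding span_eq by auto
 moreover have "independent (insert c (set tau))"
  using IH c by (simp add: independent_insertI)
 ultimately show ?case using * by simp
qed (auto simp: independent_empty)

text \<open>A map without zeros labels each vertex of a fine subdivision by the first coordinate of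
  absolute value at least \<open>\<eta>\<close>, with its sign. Labels are odd, and uniform
  continuity excludes complementary labels in one small simplex. Ky Fan then yields a simplex with
  \<open>length bs\<close> different absolute labels, while at most \<open>d\<close> occur. Maps are
  given on the punctured span, so that the cross-polytope needs no radial projection.\<close>

theorem borsuk_ulam_span:
 fixes bs :: "'a::real_normed_vector list" and f :: "nat => 'a => real"
 assumes ind: "independent (set bs)" "distinct bs" and d: "d < length bs"
  and cont: "!!j. j < d ==> continuous_on (span (set bs) - {0}) (f j)"
  and odd: "!!j x. j < d ==> x \<in> span (set bs) ==> x ~= 0 ==> f j (- x) = - f j x"
 shows "\<exists>x\<in>span (set bs). x ~= 0 \<and> (\<forall>j<d. f j x = 0)"
proof (rule ccontr)
 assume "\<not> ?thesis"
 then have nz: "\<exists>j<d. f j x ~= 0" if "x \<in> span (set bs)" "x ~= 0" for x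
  using that by blast
 \<comment> \<open>All lower cross-polytopes are included because the labelling must be controlled
   on every equator met by the Ky Fan induction.\<close>
 define X where "X = (\<Union>k\<le>length bs. \<Union>\<sigma>\<in>set (sphere_chain (drop k bs)). convex hull (set \<sigma>))"
 have "compact X"
  unfolding X_def by (intro compact_UN finite_imp_compact_convex_hull) auto
 have hullX: "convex hull (set \<sigma>) \<subseteq> X" if "\<sigma> \<in> set (sphere_chain (drop k bs))" for k \<sigma>
 proof (cases "k <= length bs")
  case True
  then show ?thesis unfolding X_def using that by blast
 next
  case False
  then have "\<sigma> = []" using that by simp
  then show ?thesis by simp
 qed
 have X0: "X \<subseteq> span (set bs) - {0}"
 proof
  fix x assume "x \<in> X"
  then obtain k \<sigma> where k: "\<sigma> \<in> set (sphere_chain (drop k bs))" "x \<in> convex hull (set \<sigma>)"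
   unfolding X_def by auto
  have sub: "set (drop k bs) \<subseteq> set bs" by (rule set_drop_subset)
  have i: "independent (set \<sigma>)" "span (set \<sigma>) = span (set (drop k bs))"
   using sphere_chain_independent[OF independent_mono[OF ind(1) sub] _ k(1)] ind by auto
  have "x \<in> span (set \<sigma>)"
   using k(2) hull_minimal[of "set \<sigma>" "span (set \<sigma>)" convex] span_superset subspace_imp_convex[OF subspace_span] by blast
  then have "x \<in> span (set bs)" using i span_mono[OF sub] by auto
  moreover have "x ~= 0"
  proof
   assume "x = 0"
   then obtain u where u: "\<forall>y\<in>set \<sigma>. 0 <= u y" "sum u (set \<sigma>) = 1" "(\<Sum>y\<in>set \<sigma>. u y *\<^sub>R y) = (0::'a)"
    using k(2) by (auto simp: convex_hull_finite)
   then have "\<forall>y\<in>set \<sigma>. u y = 0"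
    using independentD[OF i(1) _ subset_refl u(3)] by blast
   then show False using u(2) by simp
  qed
  ultimately show "x \<in> span (set bs) - {0}" by simp
 qed
 have contX: "continuous_on X (f j)" if "j < d" for j
  using cont[OF that] X0 continuous_on_subset by blast
 obtain \<eta> where \<eta>: "\<eta> > 0" "!!x. x \<in> X ==> \<exists>j<d. \<eta> <= \<bar>f j x\<bar>"
 proof (cases "X = {}")
  case True
  then show ?thesis using that[of 1] by simp
 next
  case False
  have "continuous_on X (%x. \<Sum>j<d. \<bar>f j x\<bar>)"
   using contX by (intro continuous_intros) auto
  then obtain x0 where x0: "x0 \<in> X" "!!x. x \<in> X ==> (\<Sum>j<d. \<bar>f j x0\<bar>) <= (\<Sum>j<d. \<bar>f j x\<bar>)"
   using continuous_attains_inf[OF \<open>compact X\<close> False] by blast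
  define e where "e = (\<Sum>j<d. \<bar>f j x0\<bar>)"
  obtain j where j: "j < d" "f j x0 ~= 0" using nz x0 X0 by blast
  have "e > 0"
   unfolding e_def using j by (intro sum_pos2[of _ j]) auto
  have "\<exists>j<d. e / real (Suc d) <= \<bar>f j x\<bar>" if "x \<in> X" for x
  proof (rule ccontr)
   assume "\<not> ?thesis"
   then have "(\<Sum>j<d. \<bar>f j x\<bar>) <= (\<Sum>j<d. e / real (Suc d))"
    by (intro sum_mono) (auto simp: not_le less_imp_le)
   also have "... < e" using \<open>e > 0\<close> by (simp add: field_simps)
   finally show False using x0(2)[OF that] by (simp add: e_def)
  qed
  then show ?thesis using that[of "e / real (Suc d)"] \<open>e > 0\<close> by simp
 qed
 have "\<exists>\<delta>>0. \<forall>j<d. \<forall>x\<in>X. \<forall>y\<in>X. dist x y < \<delta> --> \<bar>f j x - f j y\<bar> < \<eta>"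
 proof -
  have "\<exists>\<delta>>0. \<forall>x\<in>X. \<forall>y\<in>X. dist x y < \<delta> --> \<bar>f j x - f j y\<bar> < \<eta>" if "j < d" for j
  proof -
   have "uniformly_continuous_on X (f j)"
    using compact_uniformly_continuous[OF contX[OF that] \<open>compact X\<close>] .
   then show ?thesis using \<eta>(1)
    unfolding uniformly_continuous_on_def dist_real_def by (metis dist_commute)
  qed
  then obtain \<delta> where \<delta>: "!!j. j < d ==> \<delta> j > 0 \<and> (\<forall>x\<in>X. \<forall>y\<in>X. dist x y < \<delta> j --> \<bar>f j x - f j y\<bar> < \<eta>)"
   by metis
  define \<epsilon> where "\<epsilon> = Min (insert 1 (\<delta> ` {..<d}))"
  have "\<epsilon> > 0" unfolding \<epsilon>_def using \<delta> by (subst Min_gr_iff) auto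
  moreover have "\<epsilon> <= \<delta> j" if "j < d" for j unfolding \<epsilon>_def using that by (intro Min_le) auto
  ultimately show ?thesis using \<delta> by (intro exI[of _ \<epsilon>]) force
 qed
 then obtain \<delta> where \<delta>: "\<delta> > 0" "!!j x y. j < d ==> x \<in> X ==> y \<in> X ==> dist x y < \<delta> ==> \<bar>f j x - f j y\<bar> < \<eta>"
  by blast
 define J where "J x = (LEAST j. j < d \<and> \<eta> <= \<bar>f j x\<bar>)" for x
 \<comment> \<open>The shift by 1 keeps labels nonzero, so that they carry a sign.\<close>
 define lab :: "'a => int" where "lab x = (if f (J x) x > 0 then 1 + int (J x) else - (1 + int (J x)))" for x
 have J: "J x < d \<and> \<eta> <= \<bar>f (J x) x\<bar>" if "x \<in> X" for x
  unfolding J_def using \<eta>(2)[OF that] by (rule LeastI_ex)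
 have lab_odd: "lab (- x) = - lab x" if "x \<in> X" for x
 proof -
  have "f j (- x) = - f j x" if "j < d" for j using odd[OF that] X0 \<open>x \<in> X\<close> by auto
  then have "(j < d \<and> \<eta> <= \<bar>f j (- x)\<bar>) = (j < d \<and> \<eta> <= \<bar>f j x\<bar>)" for j by auto
  then have "J (- x) = J x" unfolding J_def by simp
  moreover have "f (J x) (- x) = - f (J x) x" "f (J x) x ~= 0"
   using \<open>!!j. j < d ==> f j (- x) = - f j x\<close> J[OF that] \<eta>(1) by auto
  ultimately show ?thesis by (auto simp: lab_def)
 qed
 obtain B where B: "!!x. x \<in> X ==> norm x <= B"
  using compact_imp_bounded[OF \<open>compact X\<close>] by (auto simp: bounded_iff)
 define D where "D = \<bar>2 * B\<bar>"
 define n where "n = length bs"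
 have "(%m. (real n / real (Suc n)) ^ m * D) \<longlonglongrightarrow> 0 * D"
  by (intro tendsto_mult LIMSEQ_realpow_zero tendsto_const) auto
 then have "\<forall>\<^sub>F m in sequentially. (real n / real (Suc n)) ^ m * D < \<delta>"
  using \<delta>(1) by (auto dest: order_tendstoD(2))
 then obtain m where m: "(real n / real (Suc n)) ^ m * D < \<delta>"
  by (auto simp: eventually_sequentially)
 have inX: "set tau \<subseteq> X" if "tau \<in> set ((sd_chain ^^ m) (sphere_chain (drop k bs)))" for tau k
  using sd_iter_hull[OF that] hullX by blast
 have nc: "noncompl (map lab tau)" if t: "tau \<in> set ((sd_chain ^^ m) (sphere_chain (drop k bs)))" for tau k
  unfolding noncompl_def
 proof (clarsimp)
  fix x y assume xy: "x \<in> set tau" "y \<in> set tau" "lab x = - lab y"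
  have X: "x \<in> X" "y \<in> X" using xy inX[OF t] by auto
  have vert: "dist u v <= D" if "\<sigma> \<in> set (sphere_chain (drop k bs))" "u \<in> set \<sigma>" "v \<in> set \<sigma>" for \<sigma> u v
  proof -
   have "u \<in> X" "v \<in> X" using hullX[OF that(1)] hull_inc[OF that(2), of convex] hull_inc[OF that(3), of convex] by auto
   then show ?thesis using norm_triangle_ineq4[of u v] B[of u] B[of v] by (simp add: dist_norm D_def)
  qed
  have "length \<sigma> <= Suc n" if "\<sigma> \<in> set (sphere_chain (drop k bs))" for \<sigma>
   using length_sphere_chain[OF that] by (simp add: n_def)
  then have "dist x y <= (real n / real (Suc n)) ^ m * D"
   using sd_iter_mesh[OF vert _ _ t xy(1,2)] by (simp add: D_def)
  then have dxy: "dist x y < \<delta>" using m by simp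
  have eq: "J x = J y" and sg: "f (J x) x > 0 \<longleftrightarrow> \<not> f (J x) y > 0"
   using xy(3) unfolding lab_def by (auto split: if_splits)
  have "\<bar>f (J x) x - f (J x) y\<bar> < \<eta>" using \<delta>(2)[OF _ X dxy] J[OF X(1)] by blast
  then show False using J[OF X(1)] J[OF X(2)] sg \<eta>(1) unfolding eq by linarith
 qed
 have "bs ~= []" using d by auto
 have "parity (%tau. alternating True (map lab tau) \<or> alternating False (map lab tau)) ((sd_chain ^^ m) (hemisphere bs))"
  by (rule ky_fan[OF \<open>bs ~= []\<close>]) (use nc inX lab_odd in blast)
 then obtain tau p where tau: "tau \<in> set ((sd_chain ^^ m) (hemisphere bs))" "alternating p (map lab tau)"
  by (auto dest!: parity_imp_ex)
 have tau': "tau \<in> set ((sd_chain ^^ m) (sphere_chain (drop 0 bs)))"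
  using tau(1) \<open>bs ~= []\<close> by (cases bs) (auto simp: hemisphere_def sd_iter_append)
 have len: "length tau = length bs"
  by (rule length_sd_iter[OF tau']) (use length_sphere_chain in force)
 let ?l = "sort_key abs (map lab tau)"
 have "noncompl ?l" using nc[OF tau'] by (simp add: noncompl_def)
 moreover have "altsgn p (map (%i. 0 < i) ?l)" using tau(2) by (simp add: alternating_def)
 ultimately have dist: "distinct (map abs ?l)"
  by (intro altsgn_distinct[of _ p]) simp_all
 have "abs ` lab ` set tau = set (map abs ?l)" by simp
 then have "card (abs ` lab ` set tau) = length (map abs ?l)"
  using distinct_card[OF dist] by metis
 then have "card (abs ` lab ` set tau) = length bs"
  using len by simp
 moreover have "abs ` lab ` set tau \<subseteq> {1..int d}"
 proof (clarify)
  fix x assume "x \<in> set tau"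
  then have "J x < d" using J inX[OF tau'] by blast
  then show "\<bar>lab x\<bar> \<in> {1..int d}" by (simp add: lab_def)
 qed
 then have "card (abs ` lab ` set tau) <= d"
  using card_mono[of "{1..int d}"] by fastforce
 ultimately show False using d by simp
qed

section \<open>Symmetric operators on a Hilbert space\<close>

text \<open>A minimizing sequence is Cauchy by the parallelogram law; perturbing its limit in a
  direction \<open>z\<close> of \<open>M\<close> shows orthogonality.\<close>

lemma orth_proj_exists:
 fixes M :: "'a::{real_inner,banach} set"
 assumes M: "subspace M" "closed M"
 shows "\<exists>y\<in>M. \<forall>z\<in>M. inner (x - y) z = 0"
proof -
 define d where "d = infdist x M"
 have ne: "M ~= {}" using subspace_0[OF M(1)] by auto
 have dle: "d <= norm (x - y)" if "y \<in> M" for y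
  unfolding d_def using infdist_le[OF that, of x] by (simp add: dist_norm)
 have d0: "d >= 0" by (simp add: d_def infdist_nonneg)
 have "\<exists>y\<in>M. norm (x - y) < d + 1 / real (Suc n)" for n
 proof (rule ccontr)
  assume *: "\<not> ?thesis"
  have "d + 1 / real (Suc n) <= infdist x M"
   unfolding infdist_notempty[OF ne] by (rule cINF_greatest[OF ne]) (use * in \<open>auto simp: dist_norm not_less\<close>)
  then show False by (simp add: d_def)
 qed
 then obtain y where y: "!!n. y n \<in> M" "!!n. norm (x - y n) < d + 1 / real (Suc n)"
  by metis
 have cz: "(norm (y m - y n))^2 <= 2 * (2 * d + 1) * (1 / real (Suc m) + 1 / real (Suc n))" for m n
 proof -
  let ?a = "x - y m" and ?b = "x - y n"
  have "(1/2) *\<^sub>R (y m + y n) \<in> M"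
   using M(1) y(1) by (intro subspace_scale subspace_add)
  then have "d <= norm (x - (1/2) *\<^sub>R (y m + y n))" by (rule dle)
  also have "x - (1/2) *\<^sub>R (y m + y n) = (1/2) *\<^sub>R (?a + ?b)"
   by (simp add: algebra_simps flip: scaleR_2)
  finally have 1: "4 * d^2 <= (norm (?a + ?b))^2"
   using d0 power_mono[of "2 * d" "norm (?a + ?b)" 2] by (simp add: power_mult_distrib)
  have 2: "(norm (?a - ?b))^2 + (norm (?a + ?b))^2 = 2 * (norm ?a)^2 + 2 * (norm ?b)^2"
   by (simp add: power2_norm_eq_inner inner_add_left inner_add_right inner_diff_left inner_diff_right inner_commute)
  have 3: "(norm (x - y k))^2 <= d^2 + (2 * d + 1) * (1 / real (Suc k))" for k
  proof -
   have "(norm (x - y k))^2 <= (d + 1 / real (Suc k))^2"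
    using y(2)[of k] by (intro power_mono) auto
   also have "... = d^2 + (2 * d + 1 / real (Suc k)) * (1 / real (Suc k))"
    by (simp add: power2_eq_square algebra_simps)
   also have "... <= d^2 + (2 * d + 1) * (1 / real (Suc k))"
    by (intro add_left_mono mult_right_mono) auto
   finally show ?thesis .
  qed
  have eq: "norm (y m - y n) = norm (?a - ?b)" by (simp add: norm_minus_commute)
  have "(norm (y m - y n))^2 <= 2 * ((2 * d + 1) * (1 / real (Suc m))) + 2 * ((2 * d + 1) * (1 / real (Suc n)))"
   unfolding eq using 1 2 3[of m] 3[of n] by linarith
  moreover have "2 * (2 * d + 1) * (A + B) = 2 * ((2 * d + 1) * A) + 2 * ((2 * d + 1) * B)" for A B :: real
   by algebra
  ultimately show ?thesis by simp
 qed
 have "Cauchy y"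
 proof (rule metric_CauchyI)
  fix e :: real assume "e > 0"
  have "(%n. 1 / real (Suc n)) \<longlonglongrightarrow> 0"
   using LIMSEQ_inverse_real_of_nat by (simp add: inverse_eq_divide)
  then have "\<forall>\<^sub>F n in sequentially. 1 / real (Suc n) < e\<^sup>2 / (4 * (2 * d + 1))"
   using \<open>e > 0\<close> d0 by (auto intro!: order_tendstoD(2) divide_pos_pos)
  then obtain N where N: "!!n. n >= N ==> 1 / real (Suc n) < e\<^sup>2 / (4 * (2 * d + 1))"
   by (auto simp: eventually_sequentially)
  have "dist (y m) (y n) < e" if "m >= N" "n >= N" for m n
  proof -
   have "(norm (y m - y n))^2 <= 2 * (2 * d + 1) * (1 / real (Suc m) + 1 / real (Suc n))" by (rule cz)
   also have "... < 2 * (2 * d + 1) * (2 * (e^2 / (4 * (2 * d + 1))))"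
    using N[OF that(1)] N[OF that(2)] d0 by (intro mult_strict_left_mono) auto
   also have "... = e^2" using d0 by (simp add: field_simps)
   finally show ?thesis using \<open>e > 0\<close> by (simp add: dist_norm power_less_imp_less_base)
  qed
  then show "\<exists>N. \<forall>m\<ge>N. \<forall>n\<ge>N. dist (y m) (y n) < e" by blast
 qed
 then obtain p where p: "y \<longlonglongrightarrow> p" using Cauchy_convergent_iff convergent_def by blast
 have pM: "p \<in> M" using M(2) y(1) p by (metis closed_sequentially)
 have "norm (x - p) <= d"
 proof (rule LIMSEQ_le)
  show "(%n. norm (x - y n)) \<longlonglongrightarrow> norm (x - p)" by (intro tendsto_intros p)
  have "(%n. d + 1 / real (Suc n)) \<longlonglongrightarrow> d + 0"
   using LIMSEQ_inverse_real_of_nat by (intro tendsto_intros) (simp add: inverse_eq_divide)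
  then show "(%n. d + 1 / real (Suc n)) \<longlonglongrightarrow> d" by simp
 qed (use y(2) in \<open>auto intro: less_imp_le\<close>)
 have "inner (x - p) z = 0" if z: "z \<in> M" for z
 proof (cases "z = 0")
  case False
  \<comment> \<open>The value of \<open>c\<close> that minimizes the distance from \<open>x\<close>
    to \<open>p + c *\<^sub>R z\<close>.\<close>
  define c where "c = inner (x - p) z / (norm z)^2"
  have "p + c *\<^sub>R z \<in> M" using M(1) pM z by (intro subspace_add subspace_scale)
  then have "norm (x - p) <= norm (x - (p + c *\<^sub>R z))" using dle \<open>norm (x - p) <= d\<close> by force
  then have "(norm (x - p))^2 <= (norm ((x - p) - c *\<^sub>R z))^2"
   by (intro power_mono) (auto simp: algebra_simps)
  also have "... = (norm (x - p))^2 - 2 * c * inner (x - p) z + c^2 * (norm z)^2"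
   by (simp only: power2_norm_eq_inner) (simp add: inner_diff_left inner_diff_right inner_commute power2_eq_square algebra_simps)
  also have "c^2 * (norm z)^2 = c * inner (x - p) z"
   using False by (simp add: c_def power2_eq_square)
  finally have "c * inner (x - p) z <= 0" by simp
  then have "(c * inner (x - p) z) * (norm z)^2 <= 0" by (rule mult_nonpos_nonneg) simp
  also have "(c * inner (x - p) z) * (norm z)^2 = (inner (x - p) z)^2"
   using False by (simp add: c_def power2_eq_square)
  finally have "(inner (x - p) z)^2 <= 0" .
  then show ?thesis by simp
 qed simp
 then show ?thesis using pM by blast
qed

lemma riesz_representation:
 fixes l :: "'a::{real_inner,banach} => real"
 assumes l: "bounded_linear l"
 shows "\<exists>f. \<forall>x. l x = inner f x"
proof (cases "\<forall>x. l x = 0")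
 case True
 then show ?thesis by (intro exI[of _ 0]) simp
next
 case False
 then obtain x where x: "l x ~= 0" by blast
 interpret l: bounded_linear l by fact
 have sub: "subspace {y. l y = 0}"
  by (auto simp: subspace_def l.add l.scaleR l.zero)
 have cl: "closed {y. l y = 0}"
  by (intro closed_Collect_eq continuous_intros linear_continuous_on l)
 obtain y where y: "l y = 0" "!!z. l z = 0 ==> inner (x - y) z = 0"
  using orth_proj_exists[OF sub cl, of x] by auto
 define w where "w = x - y"
 have lw: "l w = l x" using y by (simp add: w_def l.diff)
 have w0: "w ~= 0" using lw x by auto
 have "l v = inner ((l w / (norm w)^2) *\<^sub>R w) v" for v
 proof -
  have "l (v - (l v / l w) *\<^sub>R w) = 0" using lw x by (simp add: l.diff l.scaleR)
  then have "inner w (v - (l v / l w) *\<^sub>R w) = 0" using y(2) by (simp add: w_def)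
  then have "inner w v = (l v / l w) * (norm w)^2"
   by (simp add: inner_diff_right power2_norm_eq_inner)
  then show ?thesis using w0 lw x by simp
 qed
 then show ?thesis by blast
qed

lemma closure_subspace':
 fixes S :: "'a::real_normed_vector set"
 assumes "subspace S"
 shows "subspace (closure S)"
proof (rule subspaceI)
 show "0 \<in> closure S" using subspace_0[OF assms] closure_subset by blast
next
 fix x y assume "x \<in> closure S" "y \<in> closure S"
 then obtain a b where "!!n. a n \<in> S" "a \<longlonglongrightarrow> x" "!!n. b n \<in> S" "b \<longlonglongrightarrow> y"
  unfolding closure_sequential by blast
 then show "x + y \<in> closure S"
  unfolding closure_sequential using subspace_add[OF assms] tendsto_add[of a x sequentially b y]
  by (intro exI[of _ "%n. a n + b n"]) auto
next
 fix c x assume "x \<in> closure S"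
 then obtain a where "!!n. a n \<in> S" "a \<longlonglongrightarrow> x"
  unfolding closure_sequential by blast
 then show "c *\<^sub>R x \<in> closure S"
  unfolding closure_sequential using subspace_scale[OF assms]
  by (intro exI[of _ "%n. c *\<^sub>R a n"]) (auto intro!: tendsto_intros)
qed

lemma subspace_range_linear: "bounded_linear f ==> subspace (range f)"
 using linear_subspace_image[OF bounded_linear.linear subspace_UNIV] .

text \<open>The orthogonal complement of the range of a symmetric operator is its kernel, here
  trivial.\<close>

lemma symmetric_injective_dense_range:
 fixes Q :: "'a::{real_inner,banach} => 'a"
 assumes Q: "bounded_linear Q" "!!x y. inner (Q x) y = inner x (Q y)" "!!x. Q x = 0 ==> x = 0" and "e > 0"
 shows "\<exists>v. norm (Q v - f) < e"
proof -
 obtain y where y: "y \<in> closure (range Q)" "!!z. z \<in> closure (range Q) ==> inner (f - y) z = 0"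
  using orth_proj_exists[OF closure_subspace'[OF subspace_range_linear[OF Q(1)]] closed_closure, of f] by blast
 have "inner (Q (f - y)) z = 0" for z
  using y(2)[of "Q z"] closure_subset[of "range Q"] by (auto simp: Q(2))
 then have "Q (f - y) = 0" by (metis inner_eq_zero_iff)
 then have "f \<in> closure (range Q)" using Q(3) y(1) by (metis right_minus_eq)
 then show ?thesis using \<open>e > 0\<close> unfolding closure_approachable by (auto simp: dist_norm)
qed

text \<open>The lower bound makes the range closed, and its orthogonal complement is the kernel,
  again trivial.\<close>

lemma symmetric_bounded_below_surj:
 fixes L :: "'a::{real_inner,banach} => 'a"
 assumes L: "bounded_linear L" "!!x y. inner (L x) y = inner x (L y)" "c > 0" "!!x. c * norm x <= norm (L x)"
 shows "\<exists>x. L x = y"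
proof -
 have cl: "closed (range L)"
  by (rule complete_imp_closed, rule complete_isometric_image[OF L(3) subspace_UNIV L(1)])
   (use L in \<open>auto simp: complete_UNIV\<close>)
 obtain p where p: "p \<in> range L" "!!z. z \<in> range L ==> inner (y - p) z = 0"
  using orth_proj_exists[OF subspace_range_linear[OF L(1)] cl, of y] by blast
 have "inner (L (y - p)) z = 0" for z using p(2)[of "L z"] by (simp add: L(2))
 then have "L (y - p) = 0" by (metis inner_eq_zero_iff)
 then have "c * norm (y - p) <= 0" using L(4)[of "y - p"] by simp
 then have "y = p" using L(3) by (simp add: mult_le_0_iff)
 then show ?thesis using p(1) by auto
qed

text \<open>The Taylor coefficients of \<open>(1 - x) powr (- 1 / 2)\<close> at 0.\<close>

definition binom_coeff :: "nat => real" where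
 "binom_coeff n = (- 1) ^ n * ((- 1 / 2) gchoose n)"

lemma binom_coeff_rec: "binom_coeff (Suc n) = binom_coeff n * ((real n + 1 / 2) / (real n + 1))"
proof -
 have "((- 1 / 2 :: real) gchoose Suc n) = ((- 1 / 2) gchoose n) * (- 1 / 2 - real n) / (real n + 1)"
  by (simp add: gbinomial_prod_rev field_simps)
 then have "((- 1 / 2 :: real) gchoose Suc n) = - (((- 1 / 2) gchoose n) * ((real n + 1 / 2) / (real n + 1)))"
  by (simp add: divide_simps) (simp add: algebra_simps)
 then show ?thesis by (simp add: binom_coeff_def)
qed

lemma binom_coeff_bounds: "0 <= binom_coeff n \<and> binom_coeff n <= 1"
proof (induction n)
 case (Suc n)
 have "(real n + 1 / 2) / (real n + 1) <= 1" "0 <= (real n + 1 / 2) / (real n + 1)" by auto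
 then show ?case unfolding binom_coeff_rec using Suc by (intro conjI mult_nonneg_nonneg mult_le_one) auto
qed (auto simp: binom_coeff_def)

text \<open>The square of \<open>(1 - x) powr (- 1 / 2)\<close> is the geometric series; on
  coefficients this is Vandermonde's identity.\<close>

lemma binom_coeff_convolution: "(\<Sum>i\<le>k. binom_coeff i * binom_coeff (k - i)) = 1"
proof -
 have "(\<Sum>i\<le>k. binom_coeff i * binom_coeff (k - i)) = (\<Sum>i\<le>k. (- 1) ^ k * (((- 1 / 2) gchoose i) * ((- 1 / 2) gchoose (k - i))))"
  by (intro sum.cong) (auto simp: binom_coeff_def mult.assoc mult.left_commute simp flip: power_add mult.assoc)
 also have "... = (- 1) ^ k * ((- 1 :: real) gchoose k)"
  using gbinomial_Vandermonde[of "- 1 / 2 :: real" "- 1 / 2" k] by (simp add: sum_distrib_left[symmetric] atLeast0AtMost)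
 also have "((- 1 :: real) gchoose k) = (- 1) ^ k"
  using gbinomial_minus[of "1::real" k] by (simp add: binomial_gbinomial[symmetric] del: of_nat_Suc)
 finally show ?thesis by (simp flip: power_add)
qed

text \<open>The sign of \<open>L\<close> is \<open>L\<close> times the inverse square root of
  \<open>L^2\<close>. With \<open>X = 1 - L^2 / M^2\<close>, whose norm is at most
  \<open>\<theta> < 1\<close>, the operator \<open>R\<close> is the power series of
  \<open>(1 - X) powr (- 1 / 2)\<close> and \<open>S = L R / M\<close>. Since \<open>R >= 1\<close>,
  the form \<open>(L x, S x) = (R L x, L x) / M\<close> is at least
  \<open>c^2 |x|^2 / M\<close>.\<close>

lemma sign_operator:
 fixes L :: "'a::{real_inner,banach} => 'a"
 assumes L: "bounded_linear L" "!!x y. inner (L x) y = inner x (L y)" "c > 0" "!!x. c * norm x <= norm (L x)"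
 obtains S c1 where "bounded_linear S" "!!x y. inner (S x) y = inner x (S y)" "!!x. S (S x) = x"
  "!!x. S (L x) = L (S x)" "c1 > 0" "!!x. c1 * (norm x)^2 <= inner (L x) (S x)"
proof -
 interpret L: bounded_linear L by fact
 obtain K where K: "K > 0" "!!x. norm (L x) <= norm x * K" using L.pos_bounded by blast
 \<comment> \<open>\<open>M\<close> exceeds both the norm bound \<open>K\<close> and
   \<open>c\<close>; the latter makes \<open>1 - c^2 / M^2\<close> positive.\<close>
 define M where "M = K + c"
 have M: "M > c" "M > 0" "norm (L x) <= M * norm x" for x
  using K L(3) mult_left_mono[of K M "norm x"] by (auto simp: M_def mult.commute intro: order_trans)
 define X where "X x = x - (1 / M^2) *\<^sub>R L (L x)" for x
 define \<theta> where "\<theta> = sqrt (1 - c\<^sup>2 / M^2)"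
 have cM: "c^2 < M\<^sup>2" using M L(3) by (intro power_strict_mono) auto
 then have \<theta>: "0 <= \<theta>" "\<theta> < 1" and \<theta>2: "\<theta>^2 = 1 - c\<^sup>2 / M^2"
  using L(3) M by (auto simp: \<theta>_def)
 have Xbl: "bounded_linear X"
  unfolding X_def by (intro bounded_linear_sub bounded_linear_ident bounded_linear_const_scaleR L.bounded_linear_axioms bounded_linear_compose[OF L(1)])
 interpret X: bounded_linear X by fact
 have LX: "L (X x) = X (L x)" for x by (simp add: X_def L.diff L.scaleR)
 have Xsym: "inner (X x) y = inner x (X y)" for x y
  by (simp add: X_def inner_diff_left inner_diff_right L(2))
 have Xpos: "0 <= inner (X x) x" for x
 proof -
  have "inner (X x) x = (norm x)^2 - (norm (L x))\<^sup>2 / M^2"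
   by (simp add: X_def inner_diff_left L(2) power2_norm_eq_inner)
  moreover have "(norm (L x))^2 <= (M * norm x)^2" using M(3) by (intro power_mono) auto
  then have "(norm (L x))^2 / M^2 <= (norm x)^2"
   using M by (simp add: power_mult_distrib divide_le_eq mult.commute)
  ultimately show ?thesis by simp
 qed
 have Xn1: "norm (X x) <= \<theta> * norm x" for x
 proof -
  have LL: "inner x (L (L x)) = (norm (L x))^2" by (simp add: L(2)[symmetric] power2_norm_eq_inner)
  have "(norm (X x))^2 = (norm x)^2 - 2 / M^2 * (norm (L x))^2 + (norm (L (L x)))^2 / (M^2)^2"
   unfolding X_def using LL
   by (simp add: power2_norm_eq_inner[of "x - _"] inner_diff_left inner_diff_right inner_commute[of "L (L x)" x])
    (simp add: dot_square_norm diff_divide_distrib power2_eq_square numeral_eq_Suc)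
  also have "(norm (L (L x)))^2 <= (M * norm (L x))^2" using M(3) by (intro power_mono) auto
  then have "(norm (L (L x)))^2 / (M^2)^2 <= (norm (L x))^2 / M^2"
   using M by (simp add: power_mult_distrib field_simps power2_eq_square)
  then have "(norm x)^2 - 2 / M^2 * (norm (L x))^2 + (norm (L (L x)))^2 / (M^2)^2 <= (norm x)^2 - (norm (L x))\<^sup>2 / M^2"
   by simp
  also have "(c * norm x)^2 <= (norm (L x))^2" using L(3,4) by (intro power_mono) auto
  then have "(norm x)^2 - (norm (L x))\<^sup>2 / M^2 <= (norm x)^2 - (c * norm x)\<^sup>2 / M^2"
   by (simp add: divide_right_mono)
  also have "... = (\<theta> * norm x)^2" by (simp add: power_mult_distrib \<theta>2 algebra_simps)
  finally show ?thesis using \<theta> by (meson mult_nonneg_nonneg norm_ge_zero power2_le_imp_le)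
 qed
 define Y where "Y n = X ^^ n" for n
 have Y0: "Y 0 x = x" and YS: "Y (Suc n) x = X (Y n x)" for n x by (simp_all add: Y_def)
 have Yadd: "Y (m + n) x = Y m (Y n x)" for m n x by (simp add: Y_def funpow_add)
 have Ybl: "bounded_linear (Y n)" for n
  by (induction n) (auto simp: Y_def id_def comp_def intro: bounded_linear_compose[OF Xbl] bounded_linear_ident)
 have YL: "L (Y n x) = Y n (L x)" for n x by (induction n) (auto simp: Y0 YS LX)
 have YX: "Y n (X x) = X (Y n x)" for n x by (simp add: Y_def funpow_swap1)
 have Ysym: "inner (Y n x) y = inner x (Y n y)" for n x y
  by (induction n arbitrary: x y) (auto simp: Y0 YS Xsym YX)
 have Ynorm: "norm (Y n x) <= \<theta> ^ n * norm x" for n x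
 proof (induction n)
  case (Suc n)
  have "norm (Y (Suc n) x) <= \<theta> * norm (Y n x)" by (simp add: YS Xn1)
  also have "... <= \<theta> * (\<theta> ^ n * norm x)" using Suc \<theta> by (intro mult_left_mono) auto
  finally show ?case by simp
 qed (simp add: Y0)
 \<comment> \<open>Even powers are squares of symmetric operators, and an odd power is the positive
   form of \<open>X\<close> at \<open>Y k x\<close>. Positivity of all terms is what gives
   \<open>R >= 1\<close>.\<close>
 have Ypos: "0 <= inner (Y n x) x" for n x
 proof -
  have "Y (k + k) x = Y k (Y k x)" for k by (simp add: Yadd)
  then have ev: "0 <= inner (Y (k + k) x) x" for k by (simp add: Ysym[of k "Y k x"])
  have "Y (Suc (k + k)) x = Y k (X (Y k x))" for k using Yadd[of k k x] by (simp add: YS YX)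
  then have od: "0 <= inner (Y (Suc (k + k)) x) x" for k by (simp add: Ysym[of k "X _"] Xpos)
  have "n = n div 2 + n div 2 \<or> n = Suc (n div 2 + n div 2)" by presburger
  then show ?thesis using ev od by metis
 qed
 let ?a = binom_coeff
 have an: "norm (?a n *\<^sub>R Y n x) <= \<theta> ^ n * norm x" for n x
  using mult_mono[of "?a n" 1 "norm (Y n x)" "\<theta> ^ n * norm x"] binom_coeff_bounds[of n] Ynorm[of n x] by auto
 have sg: "summable (%n. \<theta> ^ n * norm x)" for x :: 'a
  using \<theta> by (intro summable_mult2 summable_geometric) auto
 have sumR: "summable (%n. ?a n *\<^sub>R Y n x)" for x
  by (rule summable_comparison_test'[OF sg]) (rule an)
 define R where "R x = (\<Sum>n. ?a n *\<^sub>R Y n x)" for x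
 define RN where "RN N x = (\<Sum>n<N. ?a n *\<^sub>R Y n x)" for N x
 define B where "B = 1 / (1 - \<theta>)"
 have B0: "B > 0" using \<theta> by (simp add: B_def)
 have gs: "(\<Sum>n. \<theta> ^ n * norm x) = B * norm x" for x :: 'a
  using \<theta> by (simp add: B_def suminf_mult2[symmetric] suminf_geometric summable_geometric)
 have RNlim: "(%N. RN N x) \<longlonglongrightarrow> R x" for x
  using summable_LIMSEQ[OF sumR] by (simp add: RN_def R_def)
 have RNnorm: "norm (RN N x) <= B * norm x" for N x
 proof -
  have "norm (RN N x) <= (\<Sum>n<N. \<theta> ^ n * norm x)" unfolding RN_def by (intro sum_norm_le an)
  also have "... <= (\<Sum>n. \<theta> ^ n * norm x)" using \<theta> by (intro sum_le_suminf sg) auto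
  finally show ?thesis by (simp add: gs)
 qed
 have RNbl: "bounded_linear (RN N)" for N
  unfolding RN_def by (intro bounded_linear_sum bounded_linear_scaleR_right[THEN bounded_linear_compose] Ybl)
 have Rbl: "bounded_linear R"
 proof (rule bounded_linear_intro[where K = B])
  show "R (x + y) = R x + R y" for x y
   unfolding R_def by (subst suminf_add[OF sumR sumR]) (simp add: linear_add[OF bounded_linear.linear[OF Ybl]] scaleR_add_right)
  show "R (r *\<^sub>R x) = r *\<^sub>R R x" for r x
   unfolding R_def bounded_linear.suminf[OF bounded_linear_scaleR_right sumR] by (simp add: linear_cmul[OF bounded_linear.linear[OF Ybl]] mult.commute)
  show "norm (R x) <= norm x * B" for x
  proof (rule LIMSEQ_le_const2)
   show "(%N. norm (RN N x)) \<longlonglongrightarrow> norm (R x)" by (intro tendsto_norm RNlim)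
  qed (use RNnorm in \<open>auto simp: mult.commute\<close>)
 qed
 have Rsym: "inner (R x) y = inner x (R y)" for x y
 proof -
  have "inner (R x) y = (\<Sum>n. inner (?a n *\<^sub>R Y n x) y)"
   unfolding R_def by (rule bounded_linear.suminf[OF bounded_linear_inner_left sumR])
  also have "... = (\<Sum>n. inner x (?a n *\<^sub>R Y n y))" by (simp add: Ysym)
  also have "... = inner x (R y)"
   unfolding R_def by (rule bounded_linear.suminf[OF bounded_linear_inner_right sumR, symmetric])
  finally show ?thesis .
 qed
 have LR: "L (R x) = R (L x)" for x
  unfolding R_def bounded_linear.suminf[OF L(1) sumR] by (simp add: L.scaleR YL)
 have Rpos: "(norm x)^2 <= inner (R x) x" for x
 proof (rule LIMSEQ_le_const)
  show "(%N. inner (RN N x) x) \<longlonglongrightarrow> inner (R x) x" by (intro tendsto_inner RNlim tendsto_const)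
  have "(norm x)^2 <= inner (RN N x) x" if "N >= 1" for N
  proof -
   have "(\<Sum>n\<in>{0::nat}. ?a n * inner (Y n x) x) <= (\<Sum>n<N. ?a n * inner (Y n x) x)"
    using that by (intro sum_mono2) (auto simp: Ypos binom_coeff_bounds)
   then show ?thesis by (simp add: RN_def inner_sum_left Y0 binom_coeff_def power2_norm_eq_inner)
  qed
  then show "\<exists>N. \<forall>n\<ge>N. (norm x)\<^sup>2 <= inner (RN n x) x" by blast
 qed
 \<comment> \<open>Cauchy product: the square of the partial sum and the sum over
   \<open>m + n < N\<close> differ by at most \<open>N^2\<close> terms, each of norm at most
   \<open>\<theta> ^ N * norm x\<close>. The convolution identity turns the second sum into a
   partial geometric series.\<close>
 have RR: "(%N. \<Sum>k<N. Y k x) \<longlonglongrightarrow> R (R x)" for x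
 proof -
  have 1: "RN N (RN N x) = (\<Sum>(m,n)\<in>{..<N}\<times>{..<N}. (?a m * ?a n) *\<^sub>R Y (m + n) x)" for N
  proof -
   have "RN N (RN N x) = (\<Sum>m<N. ?a m *\<^sub>R Y m (\<Sum>n<N. ?a n *\<^sub>R Y n x))" by (simp add: RN_def)
   also have "... = (\<Sum>m<N. \<Sum>n<N. (?a m * ?a n) *\<^sub>R Y (m + n) x)"
    by (simp add: linear_sum[OF bounded_linear.linear[OF Ybl]] linear_cmul[OF bounded_linear.linear[OF Ybl]] scaleR_sum_right Yadd)
   finally show ?thesis by (simp add: sum.cartesian_product)
  qed
  have 2: "(\<Sum>k<N. Y k x) = (\<Sum>(m,n)\<in>{(m,n). m + n < N}. (?a m * ?a n) *\<^sub>R Y (m + n) x)" for N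
  proof -
   have "(\<Sum>(m,n)\<in>{(m,n). m + n < N}. (?a m * ?a n) *\<^sub>R Y (m + n) x)
    = (\<Sum>k<N. \<Sum>i\<le>k. (?a i * ?a (k - i)) *\<^sub>R Y k x)"
    by (subst sum.triangle_reindex) simp
   also have "... = (\<Sum>k<N. (\<Sum>i\<le>k. ?a i * ?a (k - i)) *\<^sub>R Y k x)" by (simp add: scaleR_sum_left)
   finally show ?thesis by (simp add: binom_coeff_convolution)
  qed
  have 3: "norm (RN N (RN N x) - (\<Sum>k<N. Y k x)) <= (real N * real N) * \<theta> ^ N * norm x" for N
  proof -
   have sub: "{(m,n). m + n < N} \<subseteq> {..<N}\<times>{..<N}" by auto
   have "RN N (RN N x) - (\<Sum>k<N. Y k x) = (\<Sum>(m,n)\<in>{..<N}\<times>{..<N} - {(m,n). m + n < N}. (?a m * ?a n) *\<^sub>R Y (m + n) x)"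
    unfolding 1 2 using sub by (subst sum_diff) auto
   also have "norm ... <= (\<Sum>(m,n)\<in>{..<N}\<times>{..<N} - {(m,n). m + n < N}. \<theta> ^ N * norm x)"
   proof (rule sum_norm_le, clarsimp)
    fix m n assume "\<not> m + n < N"
    have a1: "?a m * ?a n <= 1" "0 <= ?a m * ?a n" using binom_coeff_bounds by (auto intro: mult_le_one)
    have "norm (Y (m + n) x) <= \<theta> ^ (m + n) * norm x" by (rule Ynorm)
    also have "... <= \<theta> ^ N * norm x" using \<theta> \<open>\<not> m + n < N\<close>
     by (intro mult_right_mono power_decreasing) auto
    finally have "?a m * ?a n * norm (Y (m + n) x) <= 1 * (\<theta> ^ N * norm x)"
     using a1 by (intro mult_mono) auto
    then show "\<bar>?a m * ?a n\<bar> * norm (Y (m + n) x) <= \<theta> ^ N * norm x" using a1 by simp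
   qed
   also have "... <= (\<Sum>(m,n)\<in>{..<N}\<times>{..<N}. \<theta> ^ N * norm x)"
    using \<theta> by (intro sum_mono2) auto
   also have "... = (real N * real N) * \<theta> ^ N * norm x" by simp
   finally show ?thesis .
  qed
  \<comment> \<open>The factor \<open>N^2 * \<theta> ^ N\<close> is the square of
    \<open>N * sqrt \<theta> ^ N\<close>, whose limit is known.\<close>
  have "(%N. (real N * (sqrt \<theta>) ^ N) * (real N * (sqrt \<theta>) ^ N) * norm x) \<longlonglongrightarrow> 0 * 0 * norm x"
   using \<theta> by (intro tendsto_mult powser_times_n_limit_0 tendsto_const) auto
  moreover have "(real N * (sqrt \<theta>) ^ N) * (real N * (sqrt \<theta>) ^ N) * norm x = (real N * real N) * \<theta> ^ N * norm x" for N
   using \<theta> by (simp add: power_mult_distrib[symmetric] mult.assoc mult.left_commute)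
  ultimately have "(%N. (real N * real N) * \<theta> ^ N * norm x) \<longlonglongrightarrow> 0" by simp
  then have 4: "(%N. RN N (RN N x) - (\<Sum>k<N. Y k x)) \<longlonglongrightarrow> 0"
   by (rule Lim_null_comparison[rotated]) (use 3 in auto)
  have "(%N. RN N (RN N x - R x)) \<longlonglongrightarrow> 0"
  proof (rule Lim_null_comparison)
   show "\<forall>\<^sub>F N in sequentially. norm (RN N (RN N x - R x)) <= B * norm (RN N x - R x)"
    using RNnorm by auto
   have "(%N. B * norm (RN N x - R x)) \<longlonglongrightarrow> B * norm (R x - R x)"
    by (intro tendsto_intros RNlim)
   then show "(%N. B * norm (RN N x - R x)) \<longlonglongrightarrow> 0" by simp
  qed
  then have "(%N. RN N (RN N x - R x) + RN N (R x) - (RN N (RN N x) - (\<Sum>k<N. Y k x))) \<longlonglongrightarrow> 0 + R (R x) - 0"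
   by (intro tendsto_intros RNlim 4)
  moreover have "RN N (RN N x - R x) + RN N (R x) = RN N (RN N x)" for N
   by (simp add: linear_diff[OF bounded_linear.linear[OF RNbl]])
  ultimately show ?thesis by simp
 qed
 \<comment> \<open>Telescoping: \<open>1 - X\<close> applied to the partial geometric series leaves
   \<open>x - Y N x\<close>, so \<open>R\<close> squared inverts
   \<open>1 - X = L^2 / M^2\<close>.\<close>
 have key: "(1 / M^2) *\<^sub>R L (L (R (R x))) = x" for x
 proof -
  have a: "(%N. (\<Sum>k<N. Y k x) - X (\<Sum>k<N. Y k x)) \<longlonglongrightarrow> R (R x) - X (R (R x))"
   by (intro tendsto_diff RR X.tendsto)
  have b: "(\<Sum>k<N. Y k x) - X (\<Sum>k<N. Y k x) = x - Y N x" for N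
  proof (induction N)
   case (Suc N)
   have "(\<Sum>k<Suc N. Y k x) - X (\<Sum>k<Suc N. Y k x) = ((\<Sum>k<N. Y k x) - X (\<Sum>k<N. Y k x)) + Y N x - X (Y N x)"
    by (simp only: sum.lessThan_Suc X.add) simp
   then show ?case unfolding Suc by (simp add: YS)
  qed (simp add: Y0 X.zero)
  have "(%N. Y N x) \<longlonglongrightarrow> 0"
  proof (rule Lim_null_comparison)
   show "\<forall>\<^sub>F N in sequentially. norm (Y N x) <= \<theta> ^ N * norm x" using Ynorm by auto
   show "(%N. \<theta> ^ N * norm x) \<longlonglongrightarrow> 0" using sg summable_LIMSEQ_zero by blast
  qed
  then have "(%N. x - Y N x) \<longlonglongrightarrow> x - 0" by (intro tendsto_intros)
  then have "R (R x) - X (R (R x)) = x" using a b LIMSEQ_unique by fastforce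
  then show ?thesis by (simp add: X_def)
 qed
 define S where "S x = (1 / M) *\<^sub>R L (R x)" for x
 show thesis
 proof (rule that[of S "c^2 / M"])
  show "bounded_linear S"
   unfolding S_def by (intro bounded_linear_const_scaleR bounded_linear_compose[OF L(1)] Rbl)
  show "inner (S x) y = inner x (S y)" for x y by (simp add: S_def L(2) Rsym LR[symmetric])
  show "S (S x) = x" for x
   using key[of x] by (simp add: S_def LR L.scaleR linear_cmul[OF bounded_linear.linear[OF Rbl]] power2_eq_square)
  show "S (L x) = L (S x)" for x by (simp add: S_def LR L.scaleR)
  show "c^2 / M > 0" using L(3) M by simp
  show "c^2 / M * (norm x)^2 <= inner (L x) (S x)" for x
  proof -
   have "(c * norm x)^2 <= (norm (L x))^2" using L(3,4) by (intro power_mono) auto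
   also have "... <= inner (R (L x)) (L x)" by (rule Rpos)
   finally have "(1 / M) * (c * norm x)^2 <= (1 / M) * inner (R (L x)) (L x)"
    using M by (intro mult_left_mono) auto
   then show ?thesis by (simp add: S_def LR power_mult_distrib inner_commute)
  qed
 qed
qed

section \<open>Critical points of strongly indefinite functionals\<close>

lemma compact_finite_span_ball:
 fixes B :: "'a::real_inner set"
 assumes "finite B"
 shows "compact (span B \<inter> cball 0 r)"
proof -
 obtain C where C: "finite C" "span C = span B" "pairwise orthogonal C"
  using basis_orthogonal[OF assms] by blast
 have "\<exists>T. compact T \<and> T \<subseteq> span C \<and> span C \<inter> cball 0 r \<subseteq> T"
  using C(1,3)
 proof (induction C rule: finite_induct)
  case empty
  show ?case by (rule exI[of _ "{0}"]) auto
 next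
  case (insert c C)
  then have ortho: "!!x. x \<in> C ==> inner c x = 0"
   by (fastforce simp: pairwise_insert orthogonal_def)
  obtain T where T: "compact T" "T \<subseteq> span C" "span C \<inter> cball 0 r \<subseteq> T"
   using insert by (auto simp: pairwise_insert)
  show ?case
  proof (cases "c = 0")
   case True
   then show ?thesis using T by (auto simp: span_insert_0)
  next
   case False
   \<comment> \<open>By orthogonality a vector of the ball splits into a multiple of
     \<open>c\<close> and a vector of \<open>span C\<close>, both of norm at most
     \<open>r\<close>.\<close>
   define T' where "T' = (%(t, x). t *\<^sub>R c + x) ` ({- (r / norm c)..r / norm c} \<times> T)"
   have "compact T'"
    unfolding T'_def by (intro compact_continuous_image compact_Times T compact_Icc)
     (auto simp: case_prod_unfold intro!: continuous_intros)
   moreover have "T' \<subseteq> span (insert c C)"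
   proof (clarsimp simp: T'_def)
    fix t x assume "x \<in> T"
    then have "x \<in> span (insert c C)" using T(2) span_mono[of C "insert c C"] by blast
    then show "t *\<^sub>R c + x \<in> span (insert c C)" by (intro span_add span_scale) (auto intro: span_base)
   qed
   moreover have "span (insert c C) \<inter> cball 0 r \<subseteq> T'"
   proof
    fix x assume x: "x \<in> span (insert c C) \<inter> cball 0 r"
    then obtain k where k: "x - k *\<^sub>R c \<in> span C" by (auto simp: span_insert)
    define y where "y = x - k *\<^sub>R c"
    have "orthogonal c y"
     by (rule orthogonal_to_span[OF k[folded y_def]]) (use ortho in \<open>auto simp: orthogonal_def\<close>)
    then have cy: "inner c y = 0" by (simp add: orthogonal_def)
    have "(norm x)^2 = (\<bar>k\<bar> * norm c)^2 + (norm y)^2"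
    proof -
     have x: "x = k *\<^sub>R c + y" by (simp add: y_def)
     have "orthogonal (k *\<^sub>R c) y" using cy by (simp add: orthogonal_def)
     then show ?thesis unfolding x by (simp add: norm_add_Pythagorean)
    qed
    moreover have "norm x <= r" "0 <= r" using x by (auto intro: order_trans[OF norm_ge_zero])
    then have "(norm x)^2 <= r^2" by (intro power_mono) auto
    ultimately have "(\<bar>k\<bar> * norm c)^2 <= r^2" "(norm y)^2 <= r^2"
     using zero_le_power2[of "\<bar>k\<bar> * norm c"] zero_le_power2[of "norm y"] by linarith+
    then have "\<bar>k\<bar> * norm c <= r" "norm y <= r" using \<open>0 <= r\<close> by (auto intro: power2_le_imp_le)
    then have "\<bar>k\<bar> <= r / norm c" using False by (simp add: pos_le_divide_eq)
    then have "k \<in> {- (r / norm c)..r / norm c}" by (auto simp: abs_le_iff)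
    moreover have "y \<in> T" using T(3) k \<open>norm y <= r\<close> by (auto simp: y_def)
    moreover have "x = k *\<^sub>R c + y" by (simp add: y_def)
    ultimately show "x \<in> T'" unfolding T'_def by (auto intro!: image_eqI[of _ _ "(k, y)"])
   qed
   ultimately show ?thesis by blast
  qed
 qed
 then obtain T where T: "compact T" "T \<subseteq> span C" "span C \<inter> cball 0 r \<subseteq> T" by blast
 then have "span B \<inter> cball 0 r = T \<inter> cball 0 r" using C(2) by auto
 then show ?thesis using T(1) by (simp add: compact_Int_closed)
qed

lemma closed_finite_span:
 fixes B :: "'a::real_inner set"
 assumes "finite B"
 shows "closed (span B)"
 unfolding closed_sequential_limits
proof clarify
 fix x l assume x: "\<forall>n. x n \<in> span B" "x \<longlonglongrightarrow> l"
 obtain r where r: "!!n. norm (x n) <= r"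
  using convergent_imp_bounded[OF x(2)] by (auto simp: bounded_iff)
 have "closed (span B \<inter> cball 0 r)" using compact_imp_closed[OF compact_finite_span_ball[OF assms]] .
 then have "l \<in> span B \<inter> cball 0 r"
  by (rule closed_sequentially[of _ x]) (use x r in auto)
 then show "l \<in> span B" by simp
qed

definition proj :: "'a::{real_inner,banach} set => 'a => 'a" where
 "proj B x = (SOME y. y \<in> span B \<and> (\<forall>z\<in>span B. inner (x - y) z = 0))"

context
 fixes B :: "'a::{real_inner,banach} set"
 assumes fin: "finite B"
begin

lemma proj_in: "proj B x \<in> span B" and proj_orth: "z \<in> span B ==> inner (x - proj B x) z = 0"
proof -
 have "\<exists>y. y \<in> span B \<and> (\<forall>z\<in>span B. inner (x - y) z = 0)"
  using orth_proj_exists[OF subspace_span closed_finite_span[OF fin], of x] by blast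
 then have "proj B x \<in> span B \<and> (\<forall>z\<in>span B. inner (x - proj B x) z = 0)"
  unfolding proj_def by (rule someI_ex)
 then show "proj B x \<in> span B" "z \<in> span B ==> inner (x - proj B x) z = 0" by auto
qed

lemma proj_unique:
 assumes "y \<in> span B" "!!z. z \<in> span B ==> inner (x - y) z = 0"
 shows "proj B x = y"
proof -
 have "proj B x - y \<in> span B" using assms(1) proj_in by (intro span_diff)
 then have "inner (x - y) (proj B x - y) = 0" "inner (x - proj B x) (proj B x - y) = 0"
  using assms(2) proj_orth by auto
 then have "inner (proj B x - y) (proj B x - y) = 0"
  by (simp add: inner_diff_left)
 then show ?thesis by simp
qed

lemma proj_inner: "z \<in> span B ==> inner (proj B x) z = inner x z"
 using proj_orth[of z x] by (simp add: inner_diff_left)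

lemma proj_norm: "norm (proj B x) <= norm x"
proof -
 have "norm (proj B x) * norm (proj B x) = inner x (proj B x)"
  using proj_inner[OF proj_in, of x x] by (simp add: dot_square_norm power2_eq_square)
 also have "... <= norm x * norm (proj B x)" by (rule norm_cauchy_schwarz)
 finally show ?thesis by (metis mult_right_le_imp_le norm_ge_zero order_le_less norm_zero mult_zero_right)
qed

lemma proj_diff_norm: "norm (x - proj B x) <= norm x"
proof -
 have "inner (x - proj B x) (proj B x) = 0" using proj_orth proj_in by blast
 then have "norm (x - proj B x) * norm (x - proj B x) = inner x (x - proj B x)"
  by (metis (no_types, lifting) diff_zero dot_square_norm inner_commute inner_diff_left power2_eq_square)
 also have "... <= norm x * norm (x - proj B x)" by (rule norm_cauchy_schwarz)
 finally show ?thesis by (metis mult_right_le_imp_le norm_ge_zero order_le_less norm_zero mult_zero_right)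
qed

lemma proj_bounded_linear: "bounded_linear (proj B)"
proof (rule bounded_linear_intro[where K = 1])
 show "proj B (x + y) = proj B x + proj B y" for x y
  by (rule proj_unique) (auto simp: span_add proj_in inner_diff_left inner_add_left proj_inner)
 show "proj B (r *\<^sub>R x) = r *\<^sub>R proj B x" for r x
  by (rule proj_unique) (auto simp: span_scale proj_in inner_diff_left proj_inner)
qed (simp add: proj_norm)

lemma proj_minus: "proj B (- x) = - proj B x"
 using linear_neg[OF bounded_linear.linear[OF proj_bounded_linear]] .

end

text \<open>The value \<open>c\<close> is the supremum, over odd maps \<open>h\<close> from
  \<open>S\<close> into the space, of the levels below which \<open>I\<close> does not fall on the
  image of \<open>h\<close>; \<open>link\<close> caps it by \<open>b\<close>. Were \<open>c\<close>
  not critical, moving a nearly optimal \<open>h\<close> by one step along \<open>D\<close> would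
  beat it. Coercivity confines the relevant points to a compact set, on which the step size can be
  chosen uniformly.\<close>

lemma fd_minimax:
 fixes I :: "'a::real_inner => real" and D :: "'a => 'a"
 and S :: "'a set"
 assumes F: "finite B"
  and DF: "!!u. u \<in> span B ==> D u \<in> span B" and Dodd: "!!u. u \<in> span B ==> D (- u) = - D u"
  and Dcont: "continuous_on (span B) D" and Icont: "continuous_on (span B) I"
  and q: "1 < q"
  and expand: "!!R. \<exists>C. \<forall>u\<in>span B. \<forall>d\<in>span B. norm u <= R --> norm d <= 1 -->
    \<bar>I (u + d) - I u - inner (D u) d\<bar> <= C * norm d powr q"
  and coercive: "!!m. \<exists>R. \<forall>u\<in>span B. m <= I u --> norm u <= R"
  and S: "compact S" "S ~= {}" "!!x. x \<in> S ==> - x \<in> S"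
  and hs: "continuous_on S hs" "!!x. x \<in> S ==> hs (- x) = - hs x" "!!x. x \<in> S ==> hs x \<in> span B"
   "!!x. x \<in> S ==> a <= I (hs x)"
  and link: "!!h. continuous_on S h ==> (!!x. x \<in> S ==> h (- x) = - h x) ==> (!!x. x \<in> S ==> h x \<in> span B) ==>
   \<exists>x\<in>S. I (h x) <= b"
 shows "\<exists>u\<in>span B. D u = 0 \<and> a <= I u \<and> I u <= b"
proof -
 define cls where "cls h \<longleftrightarrow> continuous_on S h \<and> (\<forall>x\<in>S. h (- x) = - h x) \<and> (\<forall>x\<in>S. h x \<in> span B)" for h :: "'a => 'a"
 define M where "M = {m. \<exists>h. cls h \<and> (\<forall>x\<in>S. m <= I (h x))}"
 define c where "c = Sup M"
 have aM: "a \<in> M" unfolding M_def cls_def using hs by blast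
 have Mb: "m <= b" if "m \<in> M" for m
  using that link unfolding M_def cls_def by (smt (verit) mem_Collect_eq)
 have bdd: "bdd_above M" using Mb by (auto simp: bdd_above_def)
 have ac: "a <= c" unfolding c_def using aM bdd by (rule cSup_upper)
 have cb: "c <= b" unfolding c_def using aM Mb by (intro cSup_least) auto
 have "\<exists>u\<in>span B. D u = 0 \<and> I u = c"
 proof (rule ccontr)
  assume nocrit: "\<not> ?thesis"
  obtain R where R: "!!u. u \<in> span B ==> c - 2 <= I u ==> norm u <= R" using coercive[of "c - 2"] by blast
  define K where "K = span B \<inter> cball 0 R"
  have K: "compact K" unfolding K_def by (rule compact_finite_span_ball[OF F])
  have contK: "continuous_on K I" "continuous_on K D"
   using Icont Dcont by (auto simp: K_def intro: continuous_on_subset)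
  \<comment> \<open>By compactness the gradient stays away from zero near the level
    \<open>c\<close>.\<close>
  obtain \<epsilon> where \<epsilon>: "0 < \<epsilon>" "\<epsilon> <= 1" "!!u. u \<in> span B ==> \<bar>I u - c\<bar> <= \<epsilon> ==> \<epsilon> <= norm (D u)"
  proof -
   have "\<exists>\<epsilon>>0. \<forall>u\<in>K. \<epsilon> <= \<bar>I u - c\<bar> + norm (D u)"
   proof (cases "K = {}")
    case False
    have "continuous_on K (%u. \<bar>I u - c\<bar> + norm (D u))" by (intro continuous_intros contK)
    then obtain u0 where u0: "u0 \<in> K" "!!u. u \<in> K ==> \<bar>I u0 - c\<bar> + norm (D u0) <= \<bar>I u - c\<bar> + norm (D u)"
     using continuous_attains_inf[OF K False] by blast
    have "D u0 ~= 0 \<or> I u0 ~= c" using nocrit u0(1) by (auto simp: K_def)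
    then have "0 < \<bar>I u0 - c\<bar> + norm (D u0)"
     by (metis abs_ge_zero add_nonneg_pos add_pos_nonneg norm_ge_zero right_minus_eq zero_less_abs_iff zero_less_norm_iff)
    then show ?thesis using u0(2) by blast
   qed (auto intro: exI[of _ 1])
   then obtain e where e: "e > 0" "!!u. u \<in> K ==> e <= \<bar>I u - c\<bar> + norm (D u)" by blast
   show ?thesis
   proof (rule that[of "min 1 (e / 2)"])
    fix u assume u: "u \<in> span B" "\<bar>I u - c\<bar> <= min 1 (e / 2)"
    then have "u \<in> K" unfolding K_def using R[of u] by (auto simp: abs_le_iff)
    then show "min 1 (e / 2) <= norm (D u)" using e(2)[of u] u(2) by linarith
   qed (use e in auto)
  qed
  obtain Md where Md: "Md > 0" "!!u. u \<in> K ==> norm (D u) <= Md"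
  proof -
   have "bounded (D ` K)" using compact_imp_bounded[OF compact_continuous_image[OF contK(2) K]] .
   then show ?thesis using that bounded_pos[of "D ` K"] by auto
  qed
  obtain C0 where C0: "!!u d. u \<in> span B ==> d \<in> span B ==> norm u <= R ==> norm d <= 1 ==>
    \<bar>I (u + d) - I u - inner (D u) d\<bar> <= C0 * norm d powr q"
   using expand[of R] by blast
  define C where "C = max C0 1"
  have C: "!!u d. u \<in> span B ==> d \<in> span B ==> norm u <= R ==> norm d <= 1 ==>
    \<bar>I (u + d) - I u - inner (D u) d\<bar> <= C * norm d powr q"
   by (rule order_trans[OF C0]) (auto simp: C_def intro!: mult_right_mono)
  have C1: "C > 0" by (simp add: C_def)
  \<comment> \<open>The remainder is of order \<open>tau powr q\<close> with \<open>q > 1\<close>,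
    the gain of order \<open>tau\<close>; a small step keeps the former below half of the
    gain.\<close>
  obtain tau where tau: "0 < tau" "tau <= 1" "tau * Md <= 1" "C * (tau * Md) powr q <= tau * \<epsilon>^2 / 2"
  proof -
   have "((%tau. C * Md powr q * tau powr (q - 1)) \<longlongrightarrow> C * Md powr q * 0) (at_right 0)"
    using q by (intro tendsto_mult tendsto_const tendsto_zero_powrI[where b = "q - 1"] tendsto_ident_at) (auto simp: eventually_at_right_less eventually_at_filter)
   then have "\<forall>\<^sub>F tau in at_right 0. C * Md powr q * tau powr (q - 1) < \<epsilon>\<^sup>2 / 2"
    using \<epsilon>(1) by (intro order_tendstoD(2)) auto
   moreover have "\<forall>\<^sub>F tau in at_right (0::real). tau < min 1 (1 / Md)"
    using Md(1) by (intro eventually_at_right_less[THEN eventually_mono, of 0] order_tendstoD(2)[OF tendsto_ident_at]) auto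
   moreover have "\<forall>\<^sub>F tau in at_right (0::real). 0 < tau" by (rule eventually_at_right_less)
   ultimately have "\<forall>\<^sub>F tau in at_right 0. C * Md powr q * tau powr (q - 1) < \<epsilon>\<^sup>2 / 2 \<and> tau < min 1 (1 / Md) \<and> 0 < tau"
    by eventually_elim auto
   then obtain tau where t: "C * Md powr q * tau powr (q - 1) < \<epsilon>\<^sup>2 / 2" "tau < min 1 (1 / Md)" "0 < tau"
    using eventually_happens[of _ "at_right (0::real)"] by auto
   have "C * (tau * Md) powr q = tau * (C * Md powr q * tau powr (q - 1))"
    using t(3) Md(1) by (simp add: powr_mult powr_diff)
   also have "... <= tau * (\<epsilon>^2 / 2)" using t by (intro mult_left_mono) auto
   finally show ?thesis using that[of tau] t Md(1) by (auto simp: field_simps)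
  qed
  \<comment> \<open>At least four units \<open>g\<close> are gained where the level is close to
    \<open>c\<close>, at most two are lost to the remainder, and one separates \<open>h\<close> from
    \<open>c\<close>: the new level is \<open>c + g\<close>. Where the level exceeds
    \<open>c + \<epsilon>\<close>, which is at least \<open>c + 4 * g\<close>, losing two units is
    harmless.\<close>
  define g where "g = tau * \<epsilon>^2 / 4"
  have g: "0 < g" "g <= \<epsilon> / 4"
  proof -
   show "0 < g" using tau \<epsilon> by (simp add: g_def)
   have "tau * \<epsilon>^2 <= 1 * \<epsilon>" using tau \<epsilon> by (intro mult_mono) (auto simp: power2_eq_square mult_left_le)
   then show "g <= \<epsilon> / 4" by (simp add: g_def)
  qed
  have "\<exists>m\<in>M. c - g < m"
   using less_cSupE[of "c - g" M] aM g(1) unfolding c_def by (metis empty_iff diff_less_eq less_add_same_cancel1)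
  then obtain m h where h: "cls h" "!!x. x \<in> S ==> c - g < I (h x)" unfolding M_def by force
  define h' where "h' x = h x + tau *\<^sub>R D (h x)" for x
  have hK: "h x \<in> K" if "x \<in> S" for x
   using h(2)[OF that] h(1) that R[of "h x"] g(2) \<epsilon>(2) unfolding K_def cls_def by auto
  have "c + g <= I (h' x)" if x: "x \<in> S" for x
  proof -
   let ?u = "h x"
   have u: "?u \<in> span B" "norm ?u <= R" using hK[OF x] by (auto simp: K_def)
   have nd: "norm (tau *\<^sub>R D ?u) <= tau * Md" using Md(2)[OF hK[OF x]] tau by (simp add: mult_left_mono)
   have "\<bar>I (h' x) - I ?u - inner (D ?u) (tau *\<^sub>R D ?u)\<bar> <= C * norm (tau *\<^sub>R D ?u) powr q"
    unfolding h'_def using u nd tau(3) by (intro C span_scale DF) auto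
   also have "... <= C * (tau * Md) powr q"
    using nd C1 q by (intro mult_left_mono powr_mono2) auto
   also have "... <= 2 * g" using tau(4) by (simp add: g_def)
   finally have 1: "I (h' x) >= I ?u + tau * (norm (D ?u))^2 - 2 * g"
    by (simp add: dot_square_norm)
   show ?thesis
   proof (cases "I ?u <= c + \<epsilon>")
    case True
    then have "\<epsilon> <= norm (D ?u)" using \<epsilon>(3)[OF u(1)] h(2)[OF x] g by auto
    then have "tau * \<epsilon>^2 <= tau * (norm (D ?u))^2" using tau \<epsilon> by (intro mult_left_mono power_mono) auto
    then have "4 * g <= tau * (norm (D ?u))^2" by (simp add: g_def)
    then show ?thesis using 1 h(2)[OF x] by linarith
   next
    case False
    moreover have "0 <= tau * (norm (D ?u))^2" using tau by simp
    ultimately show ?thesis using 1 g by linarith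
   qed
  qed
  moreover have "cls h'"
   unfolding cls_def h'_def
  proof (intro conjI ballI)
   have "continuous_on S (%x. D (h x))"
    by (rule continuous_on_compose2[OF contK(2)]) (use h hK in \<open>auto simp: cls_def\<close>)
   then show "continuous_on S (%x. h x + tau *\<^sub>R D (h x))"
    using h(1) unfolding cls_def by (intro continuous_intros) auto
   fix x assume x: "x \<in> S"
   show "h (- x) + tau *\<^sub>R D (h (- x)) = - (h x + tau *\<^sub>R D (h x))"
    using h(1) x Dodd by (simp add: cls_def)
   show "h x + tau *\<^sub>R D (h x) \<in> span B"
    using h(1) x DF by (auto simp: cls_def intro!: span_add span_scale)
  qed
  ultimately have "c + g \<in> M" unfolding M_def by blast
  then have "c + g <= c" unfolding c_def using bdd by (rule cSup_upper)
  then show False using g by simp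
 qed
 then show ?thesis using ac cb by auto
qed

lemma powr_le_square:
 fixes q \<eta> :: real
 assumes "0 < q" "q < 2" "\<eta> > 0"
 shows "\<exists>K\<ge>0. \<forall>x\<ge>0. x powr q <= \<eta> * x^2 + K"
proof -
 \<comment> \<open>The threshold where \<open>x powr (q - 2) = \<eta>\<close>: beyond it the power
   is below \<open>\<eta> * x^2\<close>, before it below a constant.\<close>
 define X where "X = (1 / \<eta>) powr (1 / (2 - q))"
 have X: "X > 0" using assms by (simp add: X_def)
 have XX: "X powr (q - 2) = \<eta>"
 proof -
  have "X powr (q - 2) = (1 / \<eta>) powr (- 1)"
  proof -
   have "(q - 2) / (2 - q) = - 1" using assms by (simp add: field_simps)
   then show ?thesis by (simp add: X_def powr_powr)
  qed
  also have "... = \<eta>" using assms by (simp add: powr_minus)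
  finally show ?thesis .
 qed
 have "x powr q <= \<eta> * x^2 + X powr q" if "x >= 0" for x
 proof (cases "x <= X")
  case True
  then have "x powr q <= X powr q" using assms that by (intro powr_mono2) auto
  then show ?thesis using assms by (simp add: add_increasing)
 next
  case False
  then have x: "x > 0" "X <= x" using X by auto
  have "x powr q = x powr (q - 2) * x powr 2" by (simp flip: powr_add)
  also have "... <= X powr (q - 2) * x powr 2"
   using assms X x by (intro mult_right_mono powr_mono2') auto
  also have "... = \<eta> * x^2" using x by (simp add: XX powr_numeral)
  finally show ?thesis by (simp add: add_increasing2)
 qed
 then show ?thesis by (intro exI[of _ "X powr q"]) simp
qed

section \<open>Regularity of the abstract functional\<close>

lemma norm_le_inner_bound:
 fixes z :: "'a::real_inner"
 assumes "!!v. inner z v <= K * norm v" "0 <= K"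
 shows "norm z <= K"
proof (cases "z = 0")
 case False
 have "norm z * norm z <= K * norm z" using assms(1)[of z] by (simp add: dot_square_norm power2_eq_square)
 then show ?thesis using False by simp
qed (use assms in simp)

lemma continuous_on_modulus:
 fixes F :: "'a::real_normed_vector => 'b::real_normed_vector"
 assumes "p > 0" "!!R. \<exists>C. \<forall>u w. norm u <= R --> norm w <= R --> norm (u - w) <= 1 -->
  norm (F u - F w) <= C * norm (u - w) powr p"
 shows "continuous_on A F"
proof (rule continuous_at_imp_continuous_on, rule ballI)
 fix w :: 'a
 obtain C where "\<forall>u v. norm u <= norm w + 1 --> norm v <= norm w + 1 --> norm (u - v) <= 1 -->
   norm (F u - F v) <= C * norm (u - v) powr p"
  using assms(2) by blast
 then have C: "norm (F u - F w) <= C * norm (u - w) powr p" if "norm u <= norm w + 1" "norm (u - w) <= 1" for u :: 'a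
  using that by simp
 have lim: "((%u. C * norm (u - w) powr p) \<longlongrightarrow> 0) (at w)"
 proof (intro tendsto_mult_right_zero tendsto_const tendsto_zero_powrI[where b = p])
  have "((%u. norm (u - w)) \<longlongrightarrow> norm (w - w)) (at w)" by (intro tendsto_intros)
  then show "((%u. norm (u - w)) \<longlongrightarrow> 0) (at w)" by simp
 qed (use assms(1) in auto)
 have "\<forall>\<^sub>F u in at w. norm (F u - F w) <= C * norm (u - w) powr p"
 proof -
  have "\<forall>\<^sub>F u in at w. dist u w < 1" by (auto simp: eventually_at intro: exI[of _ 1])
  then show ?thesis
  proof eventually_elim
   case (elim u)
   then have "norm (u - w) <= 1" by (simp add: dist_norm)
   moreover have "norm u <= norm w + norm (u - w)" using norm_triangle_ineq[of w "u - w"] by simp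
   ultimately show ?case using C by simp
  qed
 qed
 then have "((%u. F u - F w) \<longlongrightarrow> 0) (at w)"
  using lim by (rule Lim_null_comparison)
 then show "isCont F w" unfolding isCont_def by (rule LIM_zero_cancel)
qed

text \<open>\<open>\<kappa>\<close> measures a vector in the lower order terms: it is homogeneous,
  subadditive up to a factor 2, and small relative to the norm off finitely many directions
  (\<open>\<kappa>_compact\<close>). \<open>D2\<close> is the gradient of \<open>G\<close>, Hoelder
  with exponent \<open>q - 1\<close> in \<open>\<kappa>\<close>. \<open>Q\<close> gives a weak inner
  product controlled by the quartic term, and \<open>posdir\<close> says that the positive part of
  \<open>L\<close> is not finite-dimensional.\<close>

locale indef_functional =
 fixes L :: "'a::{real_inner,banach} => 'a" and \<beta> :: "'a => 'a => 'b::real_inner"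
  and G :: "'a => real" and D2 :: "'a => 'a" and \<kappa> :: "'a => real" and Q :: "'a => 'a"
  and c Ck Cq Cg q :: real
 assumes L_bl: "bounded_linear L" and L_sym: "!!x y. inner (L x) y = inner x (L y)"
  and c_pos: "c > 0" and L_bb: "!!x. c * norm x <= norm (L x)"
  and posdir: "!!A. finite A ==> \<exists>u. (\<forall>a\<in>A. inner u a = 0) \<and> 0 < inner (L u) u"
  and \<beta>_add: "!!x y z. \<beta> (x + y) z = \<beta> x z + \<beta> y z" and \<beta>_scale: "!!r x z. \<beta> (r *\<^sub>R x) z = r *\<^sub>R \<beta> x z"
  and \<beta>_sym: "!!x y. \<beta> x y = \<beta> y x" and \<beta>_bound: "!!x y. norm (\<beta> x y) <= \<kappa> x * \<kappa> y"
  and \<kappa>_nonneg: "!!x. 0 <= \<kappa> x" and Ck_pos: "Ck > 0" and \<kappa>_bound: "!!x. \<kappa> x <= Ck * norm x"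
  and \<kappa>_add: "!!x y. \<kappa> (x + y) <= 2 * (\<kappa> x + \<kappa> y)" and \<kappa>_scale: "!!r x. \<kappa> (r *\<^sub>R x) = \<bar>r\<bar> * \<kappa> x"
  and \<kappa>_compact: "!!e. e > 0 ==> \<exists>A. finite A \<and> (\<forall>u. (\<forall>a\<in>A. inner u a = 0) --> \<kappa> u <= e * norm u)"
  and Q_bl: "bounded_linear Q" and Q_sym: "!!x y. inner (Q x) y = inner x (Q y)"
  and Q_inj: "!!x. Q x = 0 ==> x = 0" and Q_pos: "!!x. 0 <= inner (Q x) x"
  and Cq_pos: "Cq > 0" and Q_bound: "!!u. (inner (Q u) u)\<^sup>2 <= Cq * (norm (\<beta> u u))^2"
  and q_bounds: "1 < q" "q < 2" and Cg_pos: "Cg > 0"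
  and G_nonneg: "!!u. 0 <= G u" and G_even: "!!u. G (- u) = G u" and D2_odd: "!!u. D2 (- u) = - D2 u"
  and D2_euler: "!!u. inner (D2 u) u = q * G u"
  and G_convex: "!!u w. G u + inner (D2 u) (w - u) <= G w"
  and D2_bound: "!!u v. \<bar>inner (D2 u) v\<bar> <= Cg * (1 + G u) * \<kappa> v"
  and D2_diff: "!!u w v. \<bar>inner (D2 u - D2 w) v\<bar> <= Cg * \<kappa> (u - w) powr (q - 1) * \<kappa> v"
begin

lemma \<beta>_add_right: "\<beta> z (x + y) = \<beta> z x + \<beta> z y" using \<beta>_add[of x y z] by (simp add: \<beta>_sym)
lemma \<beta>_scale_right: "\<beta> z (r *\<^sub>R x) = r *\<^sub>R \<beta> z x" using \<beta>_scale[of r x z] by (simp add: \<beta>_sym)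
lemma \<beta>_minus: "\<beta> (- x) z = - \<beta> x z" "\<beta> z (- x) = - \<beta> z x"
 using \<beta>_scale[of "-1" x z] \<beta>_scale_right[of z "-1" x] by simp_all
lemma \<beta>_diff: "\<beta> (x - y) z = \<beta> x z - \<beta> y z" "\<beta> z (x - y) = \<beta> z x - \<beta> z y"
 using \<beta>_add[of x "- y" z] \<beta>_add_right[of z x "- y"] by (simp_all add: \<beta>_minus)

text \<open>The gradient of \<open>|\<beta> u u|^2 / 4\<close>, given as a Riesz vector.\<close>

definition D1 :: "'a => 'a" where
 "D1 u = (SOME w. \<forall>v. inner (\<beta> u u) (\<beta> u v) = inner w v)"

lemma D1_inner: "inner (D1 u) v = inner (\<beta> u u) (\<beta> u v)"
proof -
 have "bounded_linear (%v. inner (\<beta> u u) (\<beta> u v))"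
 proof (rule bounded_linear_intro[where K = "norm (\<beta> u u) * (\<kappa> u * Ck)"])
  fix v
  have "\<kappa> u * \<kappa> v <= \<kappa> u * (Ck * norm v)" by (intro mult_left_mono \<kappa>_bound \<kappa>_nonneg)
  then have "norm (\<beta> u v) <= \<kappa> u * Ck * norm v" using \<beta>_bound[of u v] by (simp add: mult.assoc)
  then have "norm (\<beta> u u) * norm (\<beta> u v) <= norm (\<beta> u u) * (\<kappa> u * Ck * norm v)"
   by (intro mult_left_mono) auto
  then show "norm (inner (\<beta> u u) (\<beta> u v)) <= norm v * (norm (\<beta> u u) * (\<kappa> u * Ck))"
   using Cauchy_Schwarz_ineq2[of "\<beta> u u" "\<beta> u v"] by (simp add: mult_ac)
 qed (simp_all add: \<beta>_add_right \<beta>_scale_right inner_add_right)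
 then have "\<exists>w. \<forall>v. inner (\<beta> u u) (\<beta> u v) = inner w v" by (rule riesz_representation)
 then show ?thesis unfolding D1_def by (rule someI2_ex) simp
qed

definition D :: "'a => 'a" where "D u = D1 u - D2 u"
definition grad :: "'a => 'a" where "grad u = L u - D u"
definition I :: "'a => real" where
 "I u = inner (L u) u / 2 - (norm (\<beta> u u))\<^sup>2 / 4 + G u"

lemma grad_inner: "inner (grad u) v = inner (L u) v - inner (\<beta> u u) (\<beta> u v) + inner (D2 u) v"
 by (simp add: grad_def D_def inner_diff_left D1_inner)

lemma D1_odd: "D1 (- u) = - D1 u"
proof -
 have "inner (D1 (- u)) v = inner (- D1 u) v" for v
  by (simp add: D1_inner \<beta>_minus)
 then show ?thesis using vector_eq_rdot by blast
qed

lemma D_odd: "D (- u) = - D u" by (simp add: D_def D1_odd D2_odd)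

lemma grad_odd: "grad (- u) = - grad u"
 by (simp add: grad_def D_odd linear_neg[OF bounded_linear.linear[OF L_bl]])

text \<open>The bound is in \<open>\<kappa> (u - w)\<close> and not in the norm; that is the source
  of the compactness of \<open>D\<close>. The \<open>\<beta>\<close> part expands into three terms,
  hence the factor 3.\<close>

lemma D_diff:
 assumes "norm u <= R" "norm w <= R"
 shows "norm (D u - D w) <= 3 * Ck ^ 3 * R^2 * \<kappa> (u - w) + Cg * Ck * \<kappa> (u - w) powr (q - 1)"
proof (rule norm_le_inner_bound)
 have R0: "R >= 0" using assms(1) norm_ge_zero order_trans by blast
 fix v
 let ?d = "u - w"
 have k: "\<kappa> u <= Ck * R" "\<kappa> w <= Ck * R" "\<kappa> v <= Ck * norm v"
  using \<kappa>_bound assms Ck_pos by (meson mult_left_mono order_trans less_imp_le)+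
 have eq: "\<beta> u u - \<beta> w w = \<beta> ?d u + \<beta> w ?d"
  by (simp add: \<beta>_diff)
 have "inner (D1 u - D1 w) v = inner (\<beta> u u - \<beta> w w) (\<beta> u v) + inner (\<beta> w w) (\<beta> ?d v)"
  by (simp add: D1_inner \<beta>_diff inner_diff_left inner_diff_right)
 also have "... <= (norm (\<beta> ?d u) + norm (\<beta> w ?d)) * norm (\<beta> u v) + norm (\<beta> w w) * norm (\<beta> ?d v)"
  unfolding eq by (intro add_mono order_trans[OF norm_cauchy_schwarz] mult_right_mono norm_triangle_ineq) auto
 also have "... <= (\<kappa> ?d * (Ck * R) + (Ck * R) * \<kappa> ?d) * ((Ck * R) * (Ck * norm v)) + ((Ck * R) * (Ck * R)) * (\<kappa> ?d * (Ck * norm v))"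
  using k \<kappa>_nonneg R0 Ck_pos
  by (intro add_mono mult_mono order_trans[OF \<beta>_bound] mult_nonneg_nonneg add_nonneg_nonneg) auto
 also have "... = 3 * Ck ^ 3 * R^2 * \<kappa> ?d * norm v"
  by (simp add: power2_eq_square power3_eq_cube algebra_simps)
 finally have 1: "inner (D1 u - D1 w) v <= 3 * Ck ^ 3 * R^2 * \<kappa> ?d * norm v" .
 have "- inner (D2 u - D2 w) v <= Cg * \<kappa> ?d powr (q - 1) * \<kappa> v"
  using D2_diff[of u w v] by (simp add: abs_le_iff)
 also have "... <= Cg * \<kappa> ?d powr (q - 1) * (Ck * norm v)"
  using k Cg_pos by (intro mult_left_mono) auto
 finally have "- inner (D2 u - D2 w) v <= Cg * Ck * \<kappa> ?d powr (q - 1) * norm v" by (simp add: mult_ac)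
 with 1 show "inner (D u - D w) v <= (3 * Ck ^ 3 * R^2 * \<kappa> ?d + Cg * Ck * \<kappa> ?d powr (q - 1)) * norm v"
  by (simp add: D_def inner_diff_left algebra_simps)
 show "0 <= 3 * Ck ^ 3 * R^2 * \<kappa> ?d + Cg * Ck * \<kappa> ?d powr (q - 1)"
  using Ck_pos Cg_pos \<kappa>_nonneg by (intro add_nonneg_nonneg mult_nonneg_nonneg) auto
qed

lemma powr_le_1: "x <= x powr (q - 1)" "x^2 <= x powr q" "x powr q <= x powr (q - 1)" if "0 <= x" "x <= 1" for x :: real
proof -
 show "x <= x powr (q - 1)"
  using powr_mono'[of "q - 1" 1 x] that q_bounds by (cases "x = 0") auto
 show "x^2 <= x powr q"
  using powr_mono'[of q 2 x] that q_bounds by (cases "x = 0") (auto simp: powr_numeral)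
 show "x powr q <= x powr (q - 1)"
  using powr_mono'[of "q - 1" q x] that q_bounds by (cases "x = 0") auto
qed

lemma \<kappa>_powr: "p > 0 ==> \<kappa> d powr p <= Ck powr p * norm d powr p"
 using powr_mono2[of p "\<kappa> d" "Ck * norm d"] \<kappa>_bound[of d] \<kappa>_nonneg[of d] Ck_pos by (simp add: powr_mult)

lemma D_modulus: "\<exists>C\<ge>0. \<forall>u w. norm u <= R --> norm w <= R --> norm (u - w) <= 1 -->
  norm (D u - D w) <= C * norm (u - w) powr (q - 1)"
proof (intro exI[of _ "3 * Ck ^ 3 * R^2 * Ck + Cg * Ck * Ck powr (q - 1)"] conjI allI impI)
 fix u w :: 'a assume a: "norm u <= R" "norm w <= R" "norm (u - w) <= 1"
 let ?d = "u - w"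
 have k1: "\<kappa> ?d <= Ck * norm ?d powr (q - 1)"
  using \<kappa>_bound[of ?d] powr_le_1(1)[of "norm ?d"] a(3) Ck_pos by (meson mult_left_mono norm_ge_zero order_trans less_imp_le)
 have k2: "\<kappa> ?d powr (q - 1) <= Ck powr (q - 1) * norm ?d powr (q - 1)"
  using q_bounds by (intro \<kappa>_powr) auto
 have "norm (D u - D w) <= 3 * Ck ^ 3 * R^2 * \<kappa> ?d + Cg * Ck * \<kappa> ?d powr (q - 1)" by (rule D_diff[OF a(1,2)])
 also have "... <= 3 * Ck ^ 3 * R^2 * (Ck * norm ?d powr (q - 1)) + Cg * Ck * (Ck powr (q - 1) * norm ?d powr (q - 1))"
  using k1 k2 Ck_pos Cg_pos by (intro add_mono mult_left_mono) auto
 finally show "norm (D u - D w) <= (3 * Ck ^ 3 * R^2 * Ck + Cg * Ck * Ck powr (q - 1)) * norm ?d powr (q - 1)"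
  by (simp add: algebra_simps)
qed (use Ck_pos Cg_pos in simp)

lemma D_cont: "continuous_on A D"
proof (rule continuous_on_modulus)
 show "0 < q - 1" using q_bounds by simp
qed (use D_modulus in blast)

lemma L_cont: "continuous_on A L" using L_bl by (rule linear_continuous_on)

lemma grad_cont: "continuous_on A grad"
 unfolding grad_def by (intro continuous_intros L_cont D_cont)

text \<open>The remainder of the first two terms is at most a multiple of \<open>(norm d)^2\<close>
  on a ball. Convexity puts that of \<open>G\<close> between 0 and
  \<open>(D2 (u + d) - D2 u, d)\<close>, which is of order \<open>norm d powr q\<close>; the
  quadratic terms are absorbed because \<open>norm d <= 1\<close> and \<open>q < 2\<close>.\<close>

lemma I_expand: "\<exists>C\<ge>0. \<forall>u d. norm u <= R --> norm d <= 1 --> \<bar>I (u + d) - I u - inner (grad u) d\<bar> <= C * norm d powr q"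
proof -
 obtain K where K: "K > 0" "!!x. norm (L x) <= norm x * K" using bounded_linear.pos_bounded[OF L_bl] by blast
 define C where "C = K / 2 + (Ck * R)^2 * Ck^2 / 2 + (2 * (Ck * R) * Ck + Ck^2)^2 / 4 + Cg * Ck powr q"
 have "\<bar>I (u + d) - I u - inner (grad u) d\<bar> <= C * norm d powr q" if ud: "norm u <= R" "norm d <= 1" for u d
 proof -
  have R0: "R >= 0" using ud(1) norm_ge_zero order_trans by blast
  have ku: "\<kappa> u <= Ck * R" using \<kappa>_bound ud(1) Ck_pos by (meson mult_left_mono order_trans less_imp_le)
  have kd: "\<kappa> d <= Ck * norm d" by (rule \<kappa>_bound)
  define a where "a = \<beta> u u"
  define b where "b = 2 *\<^sub>R \<beta> u d + \<beta> d d"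
  have ab: "\<beta> (u + d) (u + d) = a + b"
   by (simp add: a_def b_def \<beta>_add \<beta>_add_right \<beta>_sym[of d u] scaleR_2 algebra_simps)
  have q1: "(norm (a + b))^2 = (norm a)^2 + 4 * inner a (\<beta> u d) + 2 * inner a (\<beta> d d) + (norm b)^2"
   by (simp only: power2_norm_eq_inner) (simp add: b_def inner_add_left inner_add_right inner_commute algebra_simps)
  have Luu: "inner (L (u + d)) (u + d) = inner (L u) u + 2 * inner (L u) d + inner (L d) d"
   by (simp add: linear_add[OF bounded_linear.linear[OF L_bl]] inner_add_left inner_add_right L_sym[of d u] inner_commute[of d])
  have split: "I (u + d) - I u - inner (grad u) d = inner (L d) d / 2 - inner a (\<beta> d d) / 2 - (norm b)\<^sup>2 / 4 + (G (u + d) - G u - inner (D2 u) d)"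
   unfolding I_def ab q1 Luu grad_inner a_def[symmetric] by (simp add: add_divide_distrib diff_divide_distrib)
  have n0: "norm d >= 0" by simp
  have d2: "(norm d)^2 <= norm d powr q" using powr_le_1(2)[of "norm d"] ud by simp
  have t1: "\<bar>inner (L d) d\<bar> <= K * (norm d)^2"
   using Cauchy_Schwarz_ineq2[of "L d" d] mult_right_mono[OF K(2)[of d] n0] by (simp add: power2_eq_square mult_ac)
  have na: "norm a <= (Ck * R)^2"
   unfolding a_def power2_eq_square using ku \<kappa>_nonneg R0 Ck_pos by (intro order_trans[OF \<beta>_bound] mult_mono) auto
  have ndd: "norm (\<beta> d d) <= Ck^2 * (norm d)^2"
  proof -
   have "norm (\<beta> d d) <= (Ck * norm d) * (Ck * norm d)"
    using kd \<kappa>_nonneg Ck_pos by (intro order_trans[OF \<beta>_bound] mult_mono) auto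
   then show ?thesis by (simp add: power2_eq_square mult_ac)
  qed
  have t2: "\<bar>inner a (\<beta> d d)\<bar> <= (Ck * R)^2 * (Ck^2 * (norm d)^2)"
   using na ndd by (intro order_trans[OF Cauchy_Schwarz_ineq2] mult_mono) auto
  have "norm b <= (2 * (Ck * R) * Ck + Ck^2) * norm d"
  proof -
   have "norm (\<beta> u d) <= (Ck * R) * (Ck * norm d)"
    using ku kd \<kappa>_nonneg R0 Ck_pos by (intro order_trans[OF \<beta>_bound] mult_mono) auto
   moreover have "Ck^2 * (norm d)^2 <= Ck^2 * norm d"
    using ud by (intro mult_left_mono) (auto simp: power2_eq_square mult_left_le)
   moreover have "norm b <= 2 * norm (\<beta> u d) + norm (\<beta> d d)"
    unfolding b_def using norm_triangle_ineq[of "2 *\<^sub>R \<beta> u d" "\<beta> d d"] by simp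
   ultimately show ?thesis using ndd by (simp add: algebra_simps)
  qed
  then have t3: "(norm b)^2 <= (2 * (Ck * R) * Ck + Ck^2)^2 * (norm d)^2"
   by (metis norm_ge_zero power_mono power_mult_distrib)
  have g1: "0 <= G (u + d) - G u - inner (D2 u) d" using G_convex[of u "u + d"] by simp
  have "G (u + d) - G u - inner (D2 u) d <= inner (D2 (u + d) - D2 u) d"
   using G_convex[of "u + d" u] by (simp add: inner_diff_left)
  also have "... <= Cg * \<kappa> d powr (q - 1) * \<kappa> d" using D2_diff[of "u + d" u d] by (simp add: abs_le_iff)
  also have "... = Cg * \<kappa> d powr q"
   using \<kappa>_nonneg[of d] q_bounds by (cases "\<kappa> d = 0") (auto simp: powr_diff powr_mult_base)
  also have "... <= Cg * (Ck powr q * norm d powr q)"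
   using Cg_pos q_bounds by (intro mult_left_mono \<kappa>_powr) auto
  finally have g2: "G (u + d) - G u - inner (D2 u) d <= Cg * Ck powr q * norm d powr q" by (simp add: mult_ac)
  have "\<bar>I (u + d) - I u - inner (grad u) d\<bar> <= K * (norm d)^2 / 2 + (Ck * R)^2 * (Ck^2 * (norm d)^2) / 2
    + (2 * (Ck * R) * Ck + Ck^2)^2 * (norm d)^2 / 4 + Cg * Ck powr q * norm d powr q"
   unfolding split using t1 t2 t3 g1 g2 zero_le_power2[of "norm b"] by linarith
  also have "... = (K / 2 + (Ck * R)^2 * Ck^2 / 2 + (2 * (Ck * R) * Ck + Ck^2)^2 / 4) * (norm d)^2 + Cg * Ck powr q * norm d powr q"
   by (simp add: algebra_simps)
  also have "... <= (K / 2 + (Ck * R)^2 * Ck^2 / 2 + (2 * (Ck * R) * Ck + Ck^2)^2 / 4) * norm d powr q + Cg * Ck powr q * norm d powr q"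
   using d2 K(1) by (intro add_right_mono mult_left_mono) auto
  also have "... = C * norm d powr q" by (simp add: C_def algebra_simps)
  finally show ?thesis .
 qed
 moreover have "C >= 0" using K Cg_pos by (simp add: C_def)
 ultimately show ?thesis by blast
qed

lemma D2_zero: "D2 0 = 0"
proof -
 have "2 *\<^sub>R D2 0 = 0" using D2_odd[of 0] by (simp add: scaleR_2 eq_neg_iff_add_eq_0)
 then show ?thesis by simp
qed

lemma D_zero: "D 0 = 0"
proof -
 have "2 *\<^sub>R D 0 = 0" using D_odd[of 0] by (simp add: scaleR_2 eq_neg_iff_add_eq_0)
 then show ?thesis by simp
qed

lemma D_ball_bound: "\<exists>M\<ge>0. \<forall>u. norm u <= R --> norm (D u) <= M"
proof (intro exI[of _ "3 * Ck ^ 3 * R^2 * (Ck * \<bar>R\<bar>) + Cg * Ck * (Ck * \<bar>R\<bar>) powr (q - 1)"] conjI allI impI)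
 fix u :: 'a assume u: "norm u <= R"
 then have "R >= 0" using norm_ge_zero order_trans by blast
 have k: "\<kappa> u <= Ck * \<bar>R\<bar>" using order_trans[OF \<kappa>_bound[of u] mult_left_mono[OF u, of Ck]] Ck_pos \<open>R >= 0\<close> by simp
 have "norm (D u - D 0) <= 3 * Ck ^ 3 * R^2 * \<kappa> (u - 0) + Cg * Ck * \<kappa> (u - 0) powr (q - 1)"
  using u \<open>R >= 0\<close> by (intro D_diff) auto
 also have "... <= 3 * Ck ^ 3 * R^2 * (Ck * \<bar>R\<bar>) + Cg * Ck * (Ck * \<bar>R\<bar>) powr (q - 1)"
  using k \<kappa>_nonneg Ck_pos Cg_pos q_bounds by (intro add_mono mult_left_mono powr_mono2) auto
 finally show "norm (D u) <= ..." by (simp add: D_zero)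
qed (use Ck_pos Cg_pos in simp)

lemma grad_ball_bound: "\<exists>M\<ge>0. \<forall>u. norm u <= R --> norm (grad u) <= M"
proof -
 obtain K where K: "K > 0" "!!x. norm (L x) <= norm x * K" using bounded_linear.pos_bounded[OF L_bl] by blast
 obtain M where M: "M >= 0" "!!u. norm u <= R ==> norm (D u) <= M" using D_ball_bound by blast
 have "norm (grad u) <= \<bar>R\<bar> * K + M" if "norm u <= R" for u
 proof -
  have "norm u * K <= \<bar>R\<bar> * K" using that K(1) by (intro mult_right_mono) auto
  then show ?thesis using norm_triangle_ineq4[of "L u" "D u"] K(2)[of u] M(2)[OF that] by (simp add: grad_def)
 qed
 then show ?thesis using K(1) M(1) by (intro exI[of _ "\<bar>R\<bar> * K + M"]) auto
qed

lemma I_cont: "continuous_on A I"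
proof (rule continuous_on_modulus[of "q - 1"])
 fix R
 obtain C where C: "C >= 0" "!!u d. norm u <= R ==> norm d <= 1 ==> \<bar>I (u + d) - I u - inner (grad u) d\<bar> <= C * norm d powr q"
  using I_expand by blast
 obtain M where M: "M >= 0" "!!u. norm u <= R ==> norm (grad u) <= M" using grad_ball_bound by blast
 have "norm (I u - I w) <= (M + C) * norm (u - w) powr (q - 1)" if a: "norm u <= R" "norm w <= R" "norm (u - w) <= 1" for u w
 proof -
  let ?d = "u - w"
  have "\<bar>I (w + ?d) - I w - inner (grad w) ?d\<bar> <= C * norm ?d powr q" using a by (intro C) auto
  moreover have "\<bar>inner (grad w) ?d\<bar> <= M * norm ?d"
   using Cauchy_Schwarz_ineq2[of "grad w" ?d] mult_right_mono[OF M(2)[OF a(2)], of "norm ?d"] by simp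
  ultimately have "\<bar>I u - I w\<bar> <= M * norm ?d + C * norm ?d powr q" by simp
  also have "... <= M * norm ?d powr (q - 1) + C * norm ?d powr (q - 1)"
   using powr_le_1[of "norm ?d"] a(3) M(1) C(1) by (intro add_mono mult_left_mono) auto
  finally show ?thesis by (simp add: algebra_simps)
 qed
 then show "\<exists>C. \<forall>u w. norm u <= R --> norm w <= R --> norm (u - w) <= 1 --> norm (I u - I w) <= C * norm (u - w) powr (q - 1)"
  by blast
qed (use q_bounds in simp)

text \<open>Read backwards: points at levels tending to infinity have norms tending to
  infinity.\<close>

lemma I_ball_bound: "\<exists>M. \<forall>u. norm u <= R --> I u <= M"
proof -
 obtain K where K: "K > 0" "!!x. norm (L x) <= norm x * K" using bounded_linear.pos_bounded[OF L_bl] by blast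
 obtain M where M: "M >= 0" "!!u. norm u <= R ==> norm (grad u) <= M" using grad_ball_bound by blast
 have G0: "G 0 = 0" using D2_euler[of 0] q_bounds by simp
 have "I u <= K * R^2 + G_b" if "norm u <= R" "G u <= G_b" for u G_b
 proof -
  have "inner (L u) u <= (norm u * K) * norm u"
   using norm_cauchy_schwarz[of "L u" u] mult_right_mono[OF K(2)[of u], of "norm u"] by simp
  also have "... = K * (norm u)^2" by (simp add: power2_eq_square)
  also have "... <= K * R^2" using that K by (intro mult_left_mono power_mono) auto
  finally have "inner (L u) u <= K * R^2" .
  moreover have "0 <= K * R^2" using K(1) by simp
  ultimately have "inner (L u) u / 2 <= K * R^2" by linarith
  then show ?thesis using that unfolding I_def by (smt (verit) zero_le_power2 divide_nonneg_pos)
 qed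
 moreover have "G u <= Cg * (Ck * \<bar>R\<bar>) powr (q - 1) * (Ck * \<bar>R\<bar>)" if "norm u <= R" for u
 proof -
  have "\<kappa> u <= Ck * \<bar>R\<bar>" using order_trans[OF \<kappa>_bound[of u] mult_left_mono[of "norm u" "\<bar>R\<bar>" Ck]] Ck_pos that by auto
  have "G u <= q * G u" using G_nonneg[of u] q_bounds mult_right_mono[of 1 q "G u"] by simp
  also have "... = inner (D2 u - D2 0) u" by (simp add: D2_euler D2_zero)
  also have "... <= Cg * \<kappa> u powr (q - 1) * \<kappa> u" using D2_diff[of u 0 u] by (simp add: abs_le_iff)
  also have "... <= Cg * (Ck * \<bar>R\<bar>) powr (q - 1) * (Ck * \<bar>R\<bar>)"
   using \<open>\<kappa> u <= Ck * \<bar>R\<bar>\<close> \<kappa>_nonneg[of u] Cg_pos q_bounds Ck_pos by (intro mult_mono powr_mono2) auto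
  finally show ?thesis .
 qed
 ultimately show ?thesis by blast
qed

end

section \<open>Compactness of the lower order terms\<close>

lemma compact_finite_net:
 assumes "compact K" "e > 0"
 shows "\<exists>T. finite T \<and> T \<subseteq> K \<and> (\<forall>x\<in>K. \<exists>t\<in>T. dist x t < e)"
proof -
 have "K \<subseteq> (\<Union>t\<in>K. ball t e)" using assms(2) by auto
 then obtain T where "T \<subseteq> K" "finite T" "K \<subseteq> (\<Union>t\<in>T. ball t e)"
  using compactE_image[OF assms(1), of K "%t. ball t e"] by auto
 then show ?thesis by (intro exI[of _ T]) (fastforce simp: dist_commute)
qed

context indef_functional
begin

text \<open>A norm weaker than the given one, with
  \<open>w u ^ 4 <= Cq * (norm (\<beta> u u))^2\<close> by \<open>Q_bound\<close>.\<close>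

definition w :: "'a => real" where "w u = sqrt (inner (Q u) u)"

lemma w_nonneg: "0 <= w u" by (simp add: w_def Q_pos)

lemma w_sq: "(w u)^2 = inner (Q u) u" by (simp add: w_def Q_pos)

lemma Q_cauchy_schwarz: "inner (Q u) v <= w u * w v"
proof -
 interpret Q: bounded_linear Q by (rule Q_bl)
 let ?A = "inner (Q u) u" and ?B = "inner (Q u) v" and ?C = "inner (Q v) v"
 have sym: "inner (Q v) u = ?B" by (metis Q_sym inner_commute)
 have quad: "0 <= ?A + 2 * t * ?B + t^2 * ?C" for t
  using Q_pos[of "u + t *\<^sub>R v"]
  by (simp add: Q.add Q.scaleR inner_add_left inner_add_right sym power2_eq_square algebra_simps)
 have "?B\<^sup>2 <= ?A * ?C"
 proof (cases "?C = 0")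
  case True
  have "?B = 0"
  proof (rule ccontr)
   assume "?B ~= 0"
   then have "0 <= ?A + 2 * (- (?A + 1) / (2 * ?B)) * ?B" using quad[of "- (?A + 1) / (2 * ?B)"] True by simp
   then show False using \<open>?B ~= 0\<close> by (simp add: field_simps)
  qed
  then show ?thesis using Q_pos[of u] True by simp
 next
  case False
  then have C: "?C > 0" using Q_pos[of v] by simp
  have "0 <= ?A + 2 * (- ?B / ?C) * ?B + (- ?B / ?C)^2 * ?C" by (rule quad)
  also have "... = ?A - ?B\<^sup>2 / ?C" using C by (simp add: power2_eq_square field_simps)
  finally show ?thesis using C by (simp add: field_simps)
 qed
 also have "?A * ?C = (w u * w v)^2" by (simp add: power_mult_distrib w_sq)
 finally show ?thesis using w_nonneg by (meson mult_nonneg_nonneg power2_le_imp_le)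
qed

text \<open>The unit ball of \<open>span A\<close> is approximated by finitely many vectors
  \<open>Q v\<close>, as \<open>Q\<close> has dense range, and \<open>(u, Q v) <= w u * w v\<close>.
  So a finite-dimensional component of \<open>u\<close> is seen by the weak norm, up to a small
  multiple of the norm.\<close>

lemma proj_control:
 assumes A: "finite A" and e: "e > 0"
 shows "\<exists>C\<ge>0. \<forall>u. norm (proj A u) <= e * norm u + C * w u"
proof -
 define K where "K = span A \<inter> cball 0 1"
 have "compact K" unfolding K_def by (rule compact_finite_span_ball[OF A])
 then obtain T where T: "finite T" "T \<subseteq> K" "!!x. x \<in> K ==> \<exists>t\<in>T. dist x t < e / 2"
  using compact_finite_net[of K "e / 2"] e by auto
 have "\<exists>v. norm (Q v - t) < e / 2" for t
  using symmetric_injective_dense_range[OF Q_bl Q_sym Q_inj, of "e / 2"] e by simp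
 then obtain v where v: "!!t. norm (Q (v t) - t) < e / 2" by metis
 define C where "C = (\<Sum>t\<in>T. w (v t))"
 have "norm (proj A u) <= e * norm u + C * w u" for u
 proof (cases "proj A u = 0")
  case True
  then show ?thesis using e w_nonneg by (simp add: C_def sum_nonneg)
 next
  case False
  define y where "y = (1 / norm (proj A u)) *\<^sub>R proj A u"
  have "y \<in> K" unfolding K_def y_def using proj_in[OF A] False by (auto intro: span_scale)
  then obtain t where t: "t \<in> T" "dist y t < e / 2" using T(3) by blast
  have "inner u (proj A u) = norm (proj A u) * norm (proj A u)"
   using proj_inner[OF A proj_in[OF A], of u u] by (simp add: dot_square_norm power2_eq_square)
  then have "inner u y = norm (proj A u)"
   using False by (simp add: y_def)
  moreover have "inner u y = inner u (y - t) + inner u (t - Q (v t)) + inner (Q u) (v t)"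
   by (simp add: inner_diff_right Q_sym)
  moreover have "inner u (y - t) <= norm u * (e / 2)"
   using t(2) by (intro order_trans[OF norm_cauchy_schwarz] mult_left_mono) (auto simp: dist_norm)
  moreover have "inner u (t - Q (v t)) <= norm u * (e / 2)"
   using v[of t] by (intro order_trans[OF norm_cauchy_schwarz] mult_left_mono) (auto simp: norm_minus_commute)
  moreover have "inner (Q u) (v t) <= w u * C"
  proof -
   have "w (v t) <= C" unfolding C_def by (rule member_le_sum[OF t(1) _ T(1)]) (simp add: w_nonneg)
   then show ?thesis using Q_cauchy_schwarz[of u "v t"] w_nonneg by (meson mult_left_mono order_trans)
  qed
  ultimately show ?thesis by (simp add: mult.commute)
 qed
 moreover have "C >= 0" by (simp add: C_def sum_nonneg w_nonneg)
 ultimately show ?thesis by blast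
qed

text \<open>Off the finitely many directions of \<open>\<kappa>_compact\<close> the value of
  \<open>\<kappa>\<close> is small against the norm; the component along them is handled by
  \<open>proj_control\<close>. The fractions of \<open>e\<close> compensate the factor 2 in
  \<open>\<kappa>_add\<close>.\<close>

lemma ehrling:
 assumes e: "e > 0"
 shows "\<exists>C\<ge>0. \<forall>u. \<kappa> u <= e * norm u + C * w u"
proof -
 obtain A where A: "finite A" "!!u. (\<forall>a\<in>A. inner u a = 0) ==> \<kappa> u <= e / 4 * norm u"
  using \<kappa>_compact[of "e / 4"] e by auto
 obtain C where C: "C >= 0" "!!u. norm (proj A u) <= e / (4 * Ck) * norm u + C * w u"
  using proj_control[OF A(1), of "e / (4 * Ck)"] e Ck_pos by auto
 have "\<kappa> u <= e * norm u + 2 * Ck * C * w u" for u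
 proof -
  have "\<kappa> u <= 2 * (\<kappa> (u - proj A u) + \<kappa> (proj A u))" using \<kappa>_add[of "u - proj A u" "proj A u"] by simp
  moreover have ku: "\<kappa> (u - proj A u) <= e / 4 * norm u"
  proof -
   have "\<kappa> (u - proj A u) <= e / 4 * norm (u - proj A u)"
    using proj_orth[OF A(1)] by (intro A(2)) (auto intro: span_base)
   also have "... <= e / 4 * norm u" using e by (intro mult_left_mono proj_diff_norm[OF A(1)]) auto
   finally show ?thesis .
  qed
  have kp: "\<kappa> (proj A u) <= Ck * (e / (4 * Ck) * norm u + C * w u)"
   using C(2)[of u] Ck_pos by (intro order_trans[OF \<kappa>_bound] mult_left_mono) auto
  have "Ck * (e / (4 * Ck) * norm u + C * w u) = e / 4 * norm u + Ck * C * w u"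
   using Ck_pos by (simp add: field_simps)
  then have "\<kappa> (proj A u) <= e / 4 * norm u + Ck * C * w u" using kp by simp
  moreover have "x <= 2 * (p + (p + r))" if "x <= 2 * (y + z)" "z <= p + r" "y <= p" for x y z p r :: real
   using that by argo
  ultimately have "\<kappa> u <= 2 * (e / 4 * norm u + (e / 4 * norm u + Ck * C * w u))" using ku by blast
  then show ?thesis by (simp add: algebra_simps)
 qed
 then show ?thesis using C(1) Ck_pos by (intro exI[of _ "2 * Ck * C"]) auto
qed

text \<open>Points of the ball whose projections on finitely many directions are close are close in
  \<open>\<kappa>\<close>, hence have close images under \<open>D\<close>. Finitely many cells of
  the projection suffice.\<close>

lemma D_totally_bounded:
 assumes e: "e > 0"
 shows "\<exists>T. finite T \<and> (\<forall>u. norm u <= R --> (\<exists>t\<in>T. norm (D u - t) <= e))"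
proof -
 have "((%x. 3 * Ck ^ 3 * R^2 * x + Cg * Ck * x powr (q - 1)) \<longlongrightarrow> 3 * Ck ^ 3 * R^2 * 0 + Cg * Ck * 0) (at_right 0)"
  using q_bounds by (intro tendsto_intros tendsto_zero_powrI[where b = "q - 1"] tendsto_ident_at)
   (auto simp: eventually_at_filter)
 then have "\<forall>\<^sub>F x in at_right 0. 3 * Ck ^ 3 * R^2 * x + Cg * Ck * x powr (q - 1) < e"
  using e by (intro order_tendstoD(2)) auto
 moreover have "\<forall>\<^sub>F x in at_right (0::real). 0 < x" by (rule eventually_at_right_less)
 ultimately have "\<forall>\<^sub>F x in at_right 0. 3 * Ck ^ 3 * R^2 * x + Cg * Ck * x powr (q - 1) < e \<and> 0 < x"
  by eventually_elim auto
 then obtain \<delta> where \<delta>: "3 * Ck ^ 3 * R^2 * \<delta> + Cg * Ck * \<delta> powr (q - 1) < e" "\<delta> > 0"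
  using eventually_happens[of _ "at_right (0::real)"] by auto
 define R' where "R' = \<bar>R\<bar> + 1"
 obtain A where A: "finite A" "!!u. (\<forall>a\<in>A. inner u a = 0) ==> \<kappa> u <= \<delta> / (8 * R') * norm u"
  using \<kappa>_compact[of "\<delta> / (8 * R')"] \<delta>(2) by (auto simp: R'_def)
 define K where "K = span A \<inter> cball 0 R'"
 have "compact K" unfolding K_def by (rule compact_finite_span_ball[OF A(1)])
 then obtain N where N: "finite N" "N \<subseteq> K" "!!x. x \<in> K ==> \<exists>t\<in>N. dist x t < \<delta> / (8 * Ck)"
  using compact_finite_net[of K "\<delta> / (8 * Ck)"] \<delta>(2) Ck_pos by auto
 define cell where "cell t = {u. norm u <= R \<and> dist (proj A u) t < \<delta> / (8 * Ck)}" for t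
 \<comment> \<open>Only nonempty cells matter: the choice is used for a cell that contains the given
   \<open>u\<close>.\<close>
 define pick where "pick t = (SOME u. u \<in> cell t)" for t
 have close: "\<kappa> (u - v) <= \<delta>" if "u \<in> cell t" "v \<in> cell t" for u v t
 proof -
  let ?d = "u - v"
  have nd: "norm ?d <= 2 * R'" using that norm_triangle_ineq4[of u v] by (auto simp: cell_def R'_def)
  have pd: "proj A ?d = proj A u - proj A v"
   using linear_diff[OF bounded_linear.linear[OF proj_bounded_linear[OF A(1)]]] .
  have "norm (proj A ?d) <= \<delta> / (4 * Ck)"
   unfolding pd dist_norm[symmetric] using that dist_triangle2[of "proj A u" "proj A v" t]
   by (auto simp: cell_def field_simps)
  then have k1: "\<kappa> (proj A ?d) <= \<delta> / 4"
   using order_trans[OF \<kappa>_bound[of "proj A ?d"] mult_left_mono[of _ "\<delta> / (4 * Ck)" Ck]] Ck_pos by auto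
  have "\<kappa> (?d - proj A ?d) <= \<delta> / (8 * R') * norm (?d - proj A ?d)"
   using proj_orth[OF A(1)] by (intro A(2)) (auto intro: span_base)
  also have "... <= \<delta> / (8 * R') * (2 * R')"
   using \<delta>(2) order_trans[OF proj_diff_norm[OF A(1)] nd] by (intro mult_left_mono) (auto simp: R'_def)
  also have "... = \<delta> / 4" by (simp add: R'_def field_simps)
  finally have k2: "\<kappa> (?d - proj A ?d) <= \<delta> / 4" .
  show ?thesis using \<kappa>_add[of "?d - proj A ?d" "proj A ?d"] k1 k2 by simp
 qed
 have "\<exists>t\<in>(%t. D (pick t)) ` N. norm (D u - t) <= e" if u: "norm u <= R" for u
 proof -
  have "norm (proj A u) <= R'" using order_trans[OF proj_norm[OF A(1)] u] by (simp add: R'_def)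
  then obtain t where t: "t \<in> N" "dist (proj A u) t < \<delta> / (8 * Ck)"
   using N(3)[of "proj A u"] proj_in[OF A(1)] by (auto simp: K_def)
  then have uc: "u \<in> cell t" using u by (simp add: cell_def)
  then have pc: "pick t \<in> cell t" unfolding pick_def by (rule someI)
  have "norm (D u - D (pick t)) <= 3 * Ck ^ 3 * R^2 * \<kappa> (u - pick t) + Cg * Ck * \<kappa> (u - pick t) powr (q - 1)"
   using u pc by (intro D_diff) (auto simp: cell_def)
  also have "... <= 3 * Ck ^ 3 * R^2 * \<delta> + Cg * Ck * \<delta> powr (q - 1)"
   using close[OF uc pc] \<kappa>_nonneg q_bounds Ck_pos Cg_pos by (intro add_mono mult_left_mono powr_mono2) auto
  finally have "norm (D u - D (pick t)) <= e" using \<delta>(1) by linarith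
  then show ?thesis using t(1) by blast
 qed
 then show ?thesis using N(1) by (intro exI[of _ "(%t. D (pick t)) ` N"]) auto
qed

end

text \<open>\<open>S\<close> is the sign operator of \<open>L\<close>: its eigenspaces for 1 and -1
  are the positive and the negative part.\<close>

locale indef_functional_split = indef_functional +
 fixes S :: "'a => 'a" and c1 :: real
 assumes S_bl: "bounded_linear S" and S_sym: "!!x y. inner (S x) y = inner x (S y)"
  and S_inv: "!!x. S (S x) = x" and SL: "!!x. S (L x) = L (S x)"
  and c1_pos: "c1 > 0" and LS: "!!x. c1 * (norm x)^2 <= inner (L x) (S x)"
begin

section \<open>A priori bounds and linking geometry\<close>

lemma S_norm: "norm (S x) = norm x"
proof -
 have "(norm (S x))^2 = (norm x)^2" by (simp add: power2_norm_eq_inner S_sym S_inv)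
 then show ?thesis by simp
qed

lemma S_linear: "S (x + y) = S x + S y" "S (r *\<^sub>R x) = r *\<^sub>R S x" "S (x - y) = S x - S y" "S (- x) = - S x" "S 0 = 0"
 using S_bl by (simp_all add: linear_simps)

lemma L_linear: "L (x + y) = L x + L y" "L (r *\<^sub>R x) = r *\<^sub>R L x" "L (x - y) = L x - L y" "L (- x) = - L x" "L 0 = 0"
 using L_bl by (simp_all add: linear_simps)

lemma L_pos: "S y = y ==> c1 * (norm y)^2 <= inner (L y) y" using LS[of y] by simp
lemma L_neg: "S z = - z ==> inner (L z) z <= - c1 * (norm z)^2" using LS[of z] by simp

lemma L_cross:
 assumes "S y = y" "S z = - z"
 shows "inner (L y) z = 0"
proof -
 have "inner (L y) z = inner (L (S y)) z" using assms by simp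
 also have "... = inner (L y) (S z)" by (simp add: SL[symmetric] S_sym)
 finally show ?thesis using assms by simp
qed

lemma orth_cross:
 assumes "S y = y" "S z = - z"
 shows "inner y z = 0"
proof -
 have "inner y z = inner (S y) z" using assms by simp
 also have "... = inner y (S z)" by (simp add: S_sym)
 finally show ?thesis using assms by simp
qed

lemma S_span: "(!!v. v \<in> B ==> S v \<in> span B) ==> u \<in> span B ==> S u \<in> span B"
 by (rule span_induct[of u B "%u. S u \<in> span B"])
  (auto simp: subspace_def S_linear intro: span_add span_scale span_zero)

lemma S_fix_span: "(!!v. v \<in> B ==> S v = r *\<^sub>R v) ==> u \<in> span B ==> S u = r *\<^sub>R u"
 by (rule span_induct[of u B "%u. S u = r *\<^sub>R u"]) (auto simp: subspace_def S_linear algebra_simps)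

text \<open>Testing with \<open>u\<close> leaves
  \<open>I u = |\<beta> u u|^2 / 4 + (1 - q / 2) G u\<close>, so the level bounds both terms and
  hence \<open>w u\<close>. Testing with \<open>S u\<close> then bounds \<open>c1 |u|^2\<close>; the
  Ehrling inequality makes the quadratic contribution of the quartic term at most half of it.
  Invariance of \<open>span B\<close> under \<open>S\<close> admits the second test, and
  \<open>R\<close> is uniform in \<open>B\<close>.\<close>

lemma apriori_bound:
 "\<exists>R. \<forall>B u. (\<forall>v\<in>B. S v \<in> span B) --> u \<in> span B --> (\<forall>v\<in>span B. inner (grad u) v = 0) --> I u <= b --> norm u <= R"
proof -
 define b1 where "b1 = max b 0"
 define g where "g = b1 / (1 - q / 2)"
 define W where "W = sqrt (sqrt (4 * b1 * Cq))"
 have b1: "b1 >= 0" "b <= b1" by (auto simp: b1_def)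
 define n where "n = sqrt (4 * b1)"
 \<comment> \<open>Chosen so that \<open>n * Ck * e <= c1 / 2\<close>; the summand 1 covers
   \<open>n = 0\<close>.\<close>
 define e where "e = c1 / (2 * (n * Ck + 1))"
 have n0: "n >= 0" using b1 by (simp add: n_def)
 have e0: "e > 0" using c1_pos n0 Ck_pos by (simp add: e_def add_nonneg_pos)
 obtain C where C: "C >= 0" "!!u. \<kappa> u <= e * norm u + C * w u" using ehrling[OF e0] by blast
 define P where "P = n * (C * W) * Ck + Cg * (1 + g) * Ck"
 have "norm u <= 2 * P / c1" if B: "\<forall>v\<in>B. S v \<in> span B" "u \<in> span B" "\<forall>v\<in>span B. inner (grad u) v = 0" "I u <= b" for B u
 proof -
  define N where "N = (norm (\<beta> u u))^2"
  have "inner (grad u) u = 0" using B by blast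
  then have "inner (L u) u - N + q * G u = 0" by (simp add: grad_inner N_def dot_square_norm D2_euler)
  then have Iu: "I u = N / 4 + (1 - q / 2) * G u" unfolding I_def N_def by (simp add: algebra_simps)
  have N0: "N >= 0" by (simp add: N_def)
  have "(1 - q / 2) * G u >= 0" using q_bounds G_nonneg by simp
  then have N: "N <= 4 * b1" and "(1 - q / 2) * G u <= b1" using Iu B(4) b1 N0 by linarith+
  then have g: "G u <= g" using q_bounds by (simp add: g_def field_simps)
  have nN: "norm (\<beta> u u) <= n" unfolding n_def using N by (intro real_le_rsqrt) (simp add: N_def)
  have "(inner (Q u) u)^2 <= 4 * b1 * Cq" using order_trans[OF Q_bound[of u] mult_left_mono[OF N[unfolded N_def], of Cq]] Cq_pos by (simp add: mult_ac)
  then have "inner (Q u) u <= sqrt (4 * b1 * Cq)" by (rule real_le_rsqrt)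
  then have wW: "w u <= W" unfolding w_def W_def by (rule real_sqrt_le_mono)
  have "S u \<in> span B" using S_span[of B u] B by blast
  then have "inner (grad u) (S u) = 0" using B by blast
  then have "inner (L u) (S u) = inner (\<beta> u u) (\<beta> u (S u)) - inner (D2 u) (S u)" by (simp add: grad_inner)
  then have "c1 * (norm u)^2 <= inner (\<beta> u u) (\<beta> u (S u)) - inner (D2 u) (S u)" using LS[of u] by simp
  moreover have "inner (\<beta> u u) (\<beta> u (S u)) <= n * ((e * norm u + C * W) * (Ck * norm u))"
  proof -
   have "inner (\<beta> u u) (\<beta> u (S u)) <= norm (\<beta> u u) * norm (\<beta> u (S u))" by (rule norm_cauchy_schwarz)
   also have "norm (\<beta> u (S u)) <= \<kappa> u * \<kappa> (S u)" by (rule \<beta>_bound)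
   then have "norm (\<beta> u u) * norm (\<beta> u (S u)) <= n * (\<kappa> u * \<kappa> (S u))"
    using nN n0 by (intro mult_mono) auto
   also have "... <= n * ((e * norm u + C * W) * (Ck * norm u))"
   proof (intro mult_left_mono mult_mono n0 \<kappa>_nonneg)
    show "\<kappa> (S u) <= Ck * norm u" using \<kappa>_bound[of "S u"] by (simp add: S_norm)
    have "C * w u <= C * W" using wW C(1) by (rule mult_left_mono)
    then show "\<kappa> u <= e * norm u + C * W" using C(2)[of u] by linarith
    have "0 <= W" using order_trans[OF w_nonneg wW] .
    then show "0 <= e * norm u + C * W" using e0 C(1) by simp
   qed
   finally show ?thesis .
  qed
  moreover have "- inner (D2 u) (S u) <= Cg * (1 + g) * (Ck * norm u)"
  proof -
   have "- inner (D2 u) (S u) <= Cg * (1 + G u) * \<kappa> (S u)" using D2_bound[of u "S u"] by (simp add: abs_le_iff)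
   also have "... <= Cg * (1 + g) * (Ck * norm u)"
    using g G_nonneg[of u] Cg_pos \<kappa>_nonneg \<kappa>_bound[of "S u"] by (intro mult_mono) (auto simp: S_norm)
   finally show ?thesis .
  qed
  ultimately have "c1 * (norm u)^2 <= n * Ck * e * (norm u)^2 + P * norm u"
   by (simp add: P_def power2_eq_square algebra_simps)
  also have "n * Ck * e <= c1 / 2"
  proof -
   have "n * Ck * e = c1 / 2 * (n * Ck / (n * Ck + 1))" by (simp add: e_def)
   also have "... <= c1 / 2 * 1" using n0 Ck_pos c1_pos by (intro mult_left_mono) (auto simp: add_nonneg_pos)
   finally show ?thesis by simp
  qed
  then have "n * Ck * e * (norm u)^2 <= c1 / 2 * (norm u)^2" by (rule mult_right_mono) simp
  finally have "c1 / 2 * norm u * norm u <= P * norm u" by (simp add: power2_eq_square)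
  moreover have "0 <= P"
  proof -
   have "0 <= W" using order_trans[OF w_nonneg wW] .
   moreover have "0 <= g" using G_nonneg[of u] g by linarith
   ultimately show ?thesis using n0 C(1) Ck_pos Cg_pos by (simp add: P_def)
  qed
  ultimately have "c1 / 2 * norm u <= P"
   by (cases "u = 0") (auto simp: mult_le_cancel_right)
  then show ?thesis using c1_pos by (simp add: field_simps)
 qed
 then show ?thesis by blast
qed

lemma L_norm_bound: "\<exists>M>0. \<forall>x. inner (L x) x <= M * (norm x)^2 \<and> norm (L x) <= M * norm x"
proof -
 obtain K where K: "K > 0" "!!x. norm (L x) <= norm x * K" using bounded_linear.pos_bounded[OF L_bl] by blast
 have "inner (L x) x <= K * (norm x)^2" for x
  using norm_cauchy_schwarz[of "L x" x] mult_right_mono[OF K(2)[of x], of "norm x"]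
  by (simp add: power2_eq_square mult_ac)
 then show ?thesis using K by (intro exI[of _ K]) (auto simp: mult.commute)
qed

lemma G_growth: "G u <= Cg * Ck powr q * norm u powr q"
proof -
 have "G u <= q * G u" using G_nonneg[of u] q_bounds mult_right_mono[of 1 q "G u"] by simp
 also have "... = inner (D2 u - D2 0) u"
  by (simp add: D2_euler D2_zero)
 also have "... <= Cg * \<kappa> u powr (q - 1) * \<kappa> u" using D2_diff[of u 0 u] by (simp add: abs_le_iff)
 also have "... = Cg * \<kappa> u powr q"
  using \<kappa>_nonneg[of u] q_bounds by (cases "\<kappa> u = 0") (auto simp: powr_diff)
 also have "... <= Cg * (Ck powr q * norm u powr q)"
  using Cg_pos q_bounds by (intro mult_left_mono \<kappa>_powr) auto
 finally show ?thesis by (simp add: mult_ac)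
qed

text \<open>Only the finite-dimensional component \<open>y\<close> and the subquadratic
  \<open>G\<close> can raise the functional. By \<open>proj_control\<close>, \<open>y\<close> is
  bounded by a small multiple of \<open>z\<close>, absorbed by the negative form, and a multiple of
  \<open>w u\<close>; the resulting \<open>(w u)^2\<close> is beaten by the quartic term, since
  \<open>|\<beta> u u|^2 >= (w u)^4 / Cq\<close>.\<close>

lemma sup_bound:
 assumes A: "finite A" "!!a. a \<in> A ==> S a = a"
 shows "\<exists>b. \<forall>y z. y \<in> span A --> S z = - z --> I (y + z) <= b"
proof -
 obtain M where M: "M > 0" "!!x. inner (L x) x <= M * (norm x)^2" using L_norm_bound by blast
 \<comment> \<open>The bound \<open>1 / 2\<close> lets \<open>e * norm y\<close> be absorbed on the
   left; the square root yields \<open>4 * M * e^2 <= c1 / 8\<close>.\<close>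
 define e where "e = min (1 / 2) (sqrt (c1 / (32 * (M + 1))))"
 have e: "e > 0" "e <= 1 / 2" using c1_pos M(1) by (auto simp: e_def)
 have "e^2 <= (sqrt (c1 / (32 * (M + 1))))^2"
  using e(1) by (intro power_mono) (auto simp: e_def)
 also have "... = c1 / (32 * (M + 1))" using c1_pos M(1) by simp
 finally have "M * e^2 <= M * (c1 / (32 * (M + 1)))" using M(1) by (intro mult_left_mono) auto
 also have "... <= c1 / 32" using M(1) c1_pos by (simp add: field_simps)
 finally have Me: "4 * M * e^2 <= c1 / 8" by simp
 obtain C where C: "C >= 0" "!!u. norm (proj A u) <= e * norm u + C * w u"
  using proj_control[OF A(1) e(1)] by blast
 define C' where "C' = Cg * Ck powr q"
 have C'0: "C' >= 0" using Cg_pos by (simp add: C'_def)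
 define \<eta> where "\<eta> = c1 / (64 * (C' + 1))"
 have \<eta>: "\<eta> > 0" using c1_pos C'0 by (simp add: \<eta>_def add_nonneg_pos)
 have "C' * \<eta> = c1 / 64 * (C' / (C' + 1))" using C'0 by (simp add: \<eta>_def)
 also have "... <= c1 / 64 * 1" using C'0 c1_pos by (intro mult_left_mono) auto
 finally have C'\<eta>: "C' * \<eta> <= c1 / 64" by simp
 obtain K where K: "K >= 0" "!!x. x >= 0 ==> x powr q <= \<eta> * x^2 + K"
  using powr_le_square[of q \<eta>] q_bounds \<eta> by auto
 define P where "P = 4 * M * C^2 + c1 / 8 * C^2"
 have "I (y + z) <= Cq * P^2 + C' * K" if yz: "y \<in> span A" "S z = - z" for y z
 proof -
  define u where "u = y + z"
  have Sy: "S y = y" using S_fix_span[of A 1 y] A(2) yz(1) by simp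
  have "proj A u = y"
  proof (rule proj_unique[OF A(1) yz(1)])
   fix v assume "v \<in> span A"
   then have "S v = v" using S_fix_span[of A 1 v] A(2) by simp
   then show "inner (u - y) v = 0" using orth_cross[of v z] yz(2) by (simp add: u_def inner_commute)
  qed
  then have y1: "norm y <= e * norm u + C * w u" using C(2)[of u] by simp
  have nu: "norm u <= norm y + norm z" unfolding u_def by (rule norm_triangle_ineq)
  have "e * norm u <= e * norm y + e * norm z" using mult_left_mono[OF nu, of e] e by (simp add: distrib_left)
  moreover have "e * norm y <= 1 / 2 * norm y" using e by (intro mult_right_mono) auto
  moreover have "x <= 2 * (p + r)" if "a <= b + p" "b <= 1 / 2 * x" "x <= a + r" for x a b p r :: real
   using that by argo
  ultimately have y2: "norm y <= 2 * (e * norm z + C * w u)" using y1 by blast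
  have sq: "(2 * (a + b))^2 <= 8 * a^2 + 8 * b^2" for a b :: real
   using zero_le_power2[of "a - b"] by (simp add: power2_eq_square algebra_simps)
  have "(norm y)^2 <= (2 * (e * norm z + C * w u))^2" using y2 by (intro power_mono) auto
  also have "... <= 8 * (e * norm z)^2 + 8 * (C * w u)^2" by (rule sq)
  finally have y3: "(norm y)^2 <= 8 * e^2 * (norm z)^2 + 8 * C^2 * (w u)^2" by (simp add: power_mult_distrib)
  have "e * norm z <= 1 / 2 * norm z" using e by (intro mult_right_mono) auto
  moreover have "x <= 2 * (z + r)" if "p <= 1 / 2 * z" "x <= y + z" "y <= 2 * (p + r)" for x y z p r :: real
   using that by argo
  ultimately have "norm u <= 2 * (norm z + C * w u)" using nu y2 by blast
  then have "(norm u)^2 <= (2 * (norm z + C * w u))^2" by (intro power_mono) auto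
  also have "... <= 8 * (norm z)^2 + 8 * (C * w u)^2" by (rule sq)
  finally have u3: "(norm u)^2 <= 8 * (norm z)^2 + 8 * C^2 * (w u)^2" by (simp add: power_mult_distrib)
  have "M * (norm y)^2 <= M * (8 * e^2 * (norm z)^2 + 8 * C^2 * (w u)^2)"
   using y3 M(1) by (intro mult_left_mono) auto
  also have "... = 2 * (4 * M * e^2) * (norm z)^2 + 8 * M * C^2 * (w u)^2" by (simp add: algebra_simps)
  also have "... <= 2 * (c1 / 8) * (norm z)^2 + 8 * M * C^2 * (w u)^2"
   using Me by (intro add_right_mono mult_right_mono mult_left_mono) auto
  finally have t1: "M * (norm y)^2 / 2 <= c1 / 8 * (norm z)^2 + 4 * M * C^2 * (w u)^2" by simp
  have "C' * norm u powr q <= C' * (\<eta> * (norm u)^2 + K)"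
   using K(2)[of "norm u"] C'0 by (intro mult_left_mono) auto
  also have "... = C' * \<eta> * (norm u)^2 + C' * K" by (simp add: algebra_simps)
  also have "... <= c1 / 64 * (8 * (norm z)^2 + 8 * C^2 * (w u)^2) + C' * K"
   using C'\<eta> u3 c1_pos by (intro add_right_mono mult_mono) auto
  finally have t2: "C' * norm u powr q <= c1 / 8 * (norm z)^2 + c1 / 8 * C^2 * (w u)^2 + C' * K" by (simp add: field_simps)
  have cross: "inner (L y) z = 0" "inner (L z) y = 0"
   using L_cross[OF Sy yz(2)] by (metis L_sym inner_commute)+
  have "inner (L u) u = inner (L y) y + inner (L z) z"
   by (simp add: u_def L_linear inner_add_left inner_add_right cross)
  then have Lu: "inner (L u) u / 2 <= M * (norm y)^2 / 2 - c1 / 2 * (norm z)^2"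
   using M(2)[of y] L_neg[OF yz(2)] by simp
  have wu: "((w u)^2)^2 / Cq <= (norm (\<beta> u u))^2"
   using Q_bound[of u] Cq_pos by (simp add: w_sq field_simps)
  have "I u <= (M * (norm y)^2 / 2 - c1 / 2 * (norm z)^2) - ((w u)^2)\<^sup>2 / Cq / 4 + C' * norm u powr q"
  proof -
   have gen: "a - n / 4 + g <= a' - n' / 4 + g'" if "a <= a'" "n' <= n" "g <= g'" for a a' n n' g g' :: real
    using that by linarith
   show ?thesis unfolding I_def C'_def by (rule gen[OF Lu wu G_growth])
  qed
  also have "... <= P * (w u)^2 - ((w u)^2)\<^sup>2 / Cq / 4 + C' * K - c1 / 4 * (norm z)^2"
   using t1 t2 by (simp add: P_def algebra_simps)
  also have "... <= P * (w u)^2 - ((w u)^2)\<^sup>2 / Cq / 4 + C' * K" using c1_pos by simp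
  \<comment> \<open>Completing the square in \<open>(w u)^2\<close>.\<close>
  also have "... <= Cq * P^2 + C' * K"
  proof -
   have "0 <= ((w u)^2 - 2 * Cq * P)^2 / (4 * Cq)" using Cq_pos by simp
   also have "... = ((w u)^2)^2 / Cq / 4 - P * (w u)^2 + Cq * P^2"
    using Cq_pos by (simp add: power2_diff field_simps power2_eq_square)
   finally show ?thesis by simp
  qed
  finally show ?thesis by (simp add: u_def)
 qed
 then show ?thesis by blast
qed

text \<open>On a finite-dimensional space the weak norm is equivalent to the norm, so the negative
  quartic term dominates the quadratic form and \<open>G\<close>.\<close>

lemma finite_span_coercive:
 assumes B: "finite B"
 shows "\<exists>R. \<forall>u\<in>span B. m <= I u --> norm u <= R"
proof -
 obtain C where C: "C >= 0" "!!u. norm (proj B u) <= 1 / 2 * norm u + C * w u"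
  using proj_control[OF B, of "1 / 2"] by auto
 obtain M where M: "M > 0" "!!x. inner (L x) x <= M * (norm x)^2" using L_norm_bound by blast
 define C' where "C' = Cg * Ck powr q"
 have C'0: "C' >= 0" using Cg_pos by (simp add: C'_def)
 obtain K where K: "K >= 0" "!!x. x >= 0 ==> x powr q <= 1 * x^2 + K"
  using powr_le_square[of q 1] q_bounds by auto
 \<comment> \<open>\<open>2 * C + 1\<close> in place of \<open>2 * C\<close> keeps the divisor
   nonzero when \<open>C = 0\<close>.\<close>
 define k where "k = 1 / (4 * Cq * (2 * C + 1) ^ 4)"
 define P where "P = M / 2 + C'"
 have k0: "k > 0" using Cq_pos C(1) by (simp add: k_def)
 have "norm u <= sqrt ((P + \<bar>C' * K - m\<bar>) / k + 1)" if u: "u \<in> span B" "m <= I u" for u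
 proof -
  have "proj B u = u" by (rule proj_unique[OF B u(1)]) simp
  then have "norm u <= 2 * C * w u" using C(2)[of u] by simp
  also have "... <= (2 * C + 1) * w u" using w_nonneg[of u] by (simp add: mult_right_mono)
  finally have "norm u ^ 4 <= ((2 * C + 1) * w u) ^ 4" by (intro power_mono) auto
  also have "... = (2 * C + 1) ^ 4 * ((w u)^2)^2" by (simp add: power_mult_distrib)
  also have "... <= (2 * C + 1) ^ 4 * (Cq * (norm (\<beta> u u))^2)"
   using Q_bound[of u] C(1) by (intro mult_left_mono) (auto simp: w_sq)
  finally have "k * norm u ^ 4 <= (norm (\<beta> u u))^2 / 4"
   using Cq_pos C(1) by (simp add: k_def field_simps)
  moreover have "G u <= C' * ((norm u)^2 + K)"
   using order_trans[OF G_growth[of u, folded C'_def] mult_left_mono[OF K(2)[of "norm u"] C'0]] by simp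
  ultimately have "m <= P * (norm u)^2 + C' * K - k * norm u ^ 4"
   using u(2) M(2)[of u] unfolding I_def P_def by (simp add: algebra_simps)
  then have 1: "k * ((norm u)^2 * (norm u)^2) <= P * (norm u)^2 + \<bar>C' * K - m\<bar>"
   by (simp flip: power_add)
  show ?thesis
  proof (cases "norm u <= 1")
   case True
   have "1 <= sqrt ((P + \<bar>C' * K - m\<bar>) / k + 1)" using k0 M(1) C'0 by (simp add: P_def)
   then show ?thesis using True by linarith
  next
   case False
   then have n1: "1 <= (norm u)^2" by (simp add: one_le_power)
   have "\<bar>C' * K - m\<bar> * 1 <= \<bar>C' * K - m\<bar> * (norm u)^2" using n1 by (intro mult_left_mono) auto
   then have "(k * (norm u)^2) * (norm u)^2 <= (P + \<bar>C' * K - m\<bar>) * (norm u)^2"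
    using 1 by (simp add: algebra_simps)
   moreover have "0 < (norm u)\<^sup>2" using n1 by linarith
   ultimately have "k * (norm u)^2 <= P + \<bar>C' * K - m\<bar>" by (rule mult_right_le_imp_le)
   then have "(norm u)^2 <= (P + \<bar>C' * K - m\<bar>) / k + 1" using k0 by (simp add: field_simps)
   then show ?thesis by (rule real_le_rsqrt)
  qed
 qed
 then show ?thesis by blast
qed

definition pp :: "'a => 'a" where "pp u = (1 / 2) *\<^sub>R (u + S u)"
definition pm :: "'a => 'a" where "pm u = (1 / 2) *\<^sub>R (u - S u)"

lemma pp_pm: "pp u + pm u = u" "S (pp u) = pp u" "S (pm u) = - pm u"
 by (simp_all add: pp_def pm_def S_linear S_inv algebra_simps flip: scaleR_add_left)

lemma pp_inner: "S u = u ==> inner u (pp a) = inner u a"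
proof -
 assume "S u = u"
 then have "inner u (S a) = inner u a" by (metis S_sym)
 then show ?thesis by (simp add: pp_def inner_add_right)
qed

lemma pp_sym: "inner (pp u) v = inner u (pp v)"
 by (simp add: pp_def inner_add_left inner_add_right S_sym)

text \<open>The Galerkin critical point on the finite-dimensional space spanned by
 \<^term>\<open>insert e A\<close>, the positive parts and the negative parts of \<^term>\<open>T\<close>. The class of odd maps on the sphere
 orthogonal to \<^term>\<open>A\<close> is stable under composition with a gradient step, and by Borsuk--Ulam each of its members meets
 the set on which the functional is bounded by \<^term>\<open>b\<close>.\<close>
lemma galerkin:
 assumes A: "finite A" "!!a. a \<in> A ==> S a = a" and e: "e ~= 0" "S e = e" "!!a. a \<in> A ==> inner e a = 0"
  and low: "!!u. S u = u ==> (!!a. a \<in> A ==> inner u a = 0) ==> norm u = r ==> a0 <= I u" and r: "r > 0"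
  and up: "!!y z. y \<in> span (insert e A) ==> S z = - z ==> I (y + z) <= b"
  and T: "finite T"
 shows "\<exists>B u. finite B \<and> (\<forall>v\<in>B. S v \<in> span B) \<and> T \<subseteq> span B \<and> u \<in> span B \<and>
  (\<forall>v\<in>span B. inner (grad u) v = 0) \<and> a0 <= I u \<and> I u <= b"
proof -
 define Y where "Y = insert e A"
 have Y: "finite Y" "!!y. y \<in> Y ==> S y = y" using A e by (auto simp: Y_def)
 \<comment> \<open>The positive parts of \<open>T\<close> are made orthogonal to \<open>Y\<close>.
   Then \<open>span Y\<close>, \<open>span C\<close> and \<open>span N\<close> are mutually
   orthogonal, and inner products with \<open>C\<close> detect the component of a vector in
   \<open>span C\<close>.\<close>
 define T' where "T' = (%t. pp t - proj Y (pp t)) ` T"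
 have "finite T'" using T by (simp add: T'_def)
 then obtain C0 where C0: "finite C0" "span C0 = span T'" "pairwise orthogonal C0"
  using basis_orthogonal by blast
 define C where "C = C0 - {0}"
 have C: "finite C" "span C = span T'" "pairwise orthogonal C" "0 \<notin> C"
  using C0 by (auto simp: C_def span_delete_0 pairwise_def)
 have SY: "S y = y" if "y \<in> span Y" for y using S_fix_span[of Y 1 y] Y that by simp
 have T'S: "S t = t" if "t \<in> T'" for t
  using that SY[OF proj_in[OF Y(1)]] by (auto simp: T'_def S_linear pp_pm)
 have SC: "S c = c" if "c \<in> span C" for c using S_fix_span[of T' 1 c] T'S that C(2) by simp
 have CY: "inner c y = 0" if "c \<in> span C" "y \<in> span Y" for c y
 proof -
  have "orthogonal y c"
  proof (rule orthogonal_to_span)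
   show "c \<in> span T'" using that C by simp
   show "!!t. t \<in> T' ==> orthogonal y t"
    using proj_orth[OF Y(1) that(2)] by (auto simp: T'_def orthogonal_def inner_commute)
  qed
  then show ?thesis by (simp add: orthogonal_def inner_commute)
 qed
 define N where "N = pm ` T"
 have N: "finite N" using T by (simp add: N_def)
 have SN: "S z = - z" if "z \<in> span N" for z
 proof -
  have "S v = (- 1) *\<^sub>R v" if "v \<in> N" for v using that by (auto simp: N_def pp_pm)
  then show ?thesis using S_fix_span[of N "-1" z] that by simp
 qed
 define B where "B = Y \<union> C \<union> N"
 have B: "finite B" using Y(1) C(1) N by (simp add: B_def)
 have subB: "span Y \<subseteq> span B" "span C \<subseteq> span B" "span N \<subseteq> span B"
  by (auto simp: B_def intro: span_mono[THEN subsetD])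
 have decomp: "\<exists>y\<in>span Y. \<exists>c\<in>span C. \<exists>z\<in>span N. u = y + c + z" if "u \<in> span B" for u
  using that unfolding B_def span_Un by force
 have SB: "S v \<in> span B" if "v \<in> B" for v
 proof -
  have "S v = v \<or> S v = - v"
   using that SY[of v] SC[of v] SN[of v] by (auto simp: B_def span_base)
  then show ?thesis using that span_base[of v B] span_neg[of v B] by auto
 qed
 have TB: "T \<subseteq> span B"
 proof
  fix t assume t: "t \<in> T"
  have "pp t - proj Y (pp t) \<in> span C" unfolding C(2) using t by (auto simp: T'_def intro: span_base)
  moreover have "pm t \<in> span N" using t by (auto simp: N_def intro: span_base)
  ultimately have "(pp t - proj Y (pp t)) + proj Y (pp t) + pm t \<in> span B"
   using subB proj_in[OF Y(1), of "pp t"] by (intro span_add) auto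
  then show "t \<in> span B" by (simp add: pp_pm)
 qed
 obtain cs where cs: "set cs = C" "distinct cs" using finite_distinct_list[OF C(1)] by blast
 define es where "es = e # cs"
 \<comment> \<open>One dimension more than \<open>card C\<close>, the number of odd conditions that
   orthogonality to \<open>C\<close> imposes.\<close>
 define X where "X = span (insert e C)"
 have eC: "inner c e = 0" if "c \<in> C" for c
  using CY[of c e] that by (auto simp: Y_def span_base)
 have eC': "e \<notin> C" using eC[of e] e(1) by auto
 have ind: "independent (set es)" "distinct es" "set es = insert e C" "length es = Suc (card C)"
 proof -
  have "pairwise orthogonal (insert e C)"
   using C(3) eC by (auto simp: pairwise_insert orthogonal_def inner_commute)
  then show "independent (set es)"
   using pairwise_orthogonal_independent[of "insert e C"] C(4) e(1) by (auto simp: es_def cs)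
  show "distinct es" "set es = insert e C" using cs eC' by (auto simp: es_def)
  show "length es = Suc (card C)" using distinct_card[OF cs(2)] cs(1) by (simp add: es_def)
 qed
 have X: "S x = x" "a \<in> A ==> inner x a = 0" "x \<in> span B" if x0: "x \<in> X" for x a
 proof -
  obtain k where k: "x - k *\<^sub>R e \<in> span C" using x0 by (auto simp: X_def span_insert)
  define x' where "x' = x - k *\<^sub>R e"
  have x: "x = k *\<^sub>R e + x'" "x' \<in> span C" using k by (auto simp: x'_def)
  show "S x = x" unfolding x(1) using SC[OF x(2)] by (simp add: S_linear e)
  show "inner x a = 0" if "a \<in> A"
   unfolding x(1) using CY[OF x(2), of a] e(3)[OF that] that by (simp add: inner_add_left Y_def span_base)
  show "x \<in> span B" unfolding x(1) using x(2) subB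
   by (intro span_add span_scale) (auto simp: B_def Y_def intro: span_base)
 qed
 define Sp where "Sp = X \<inter> sphere 0 1"
 have Sp: "compact Sp"
 proof -
  have Sp_eq: "Sp = (X \<inter> cball 0 1) \<inter> sphere 0 1" by (auto simp: Sp_def)
  have "compact (X \<inter> cball 0 1)"
   unfolding X_def by (rule compact_finite_span_ball) (use C(1) in simp)
  moreover have "closed (sphere (0::'a) 1)"
   unfolding sphere_def by (intro closed_Collect_eq continuous_intros)
  ultimately have "compact ((X \<inter> cball 0 1) \<inter> sphere 0 1)" by (rule compact_Int_closed)
  then show ?thesis using Sp_eq by simp
 qed
 define DB where "DB u = proj B (grad u)" for u
 have DB_inner: "inner (DB u) d = inner (grad u) d" if "d \<in> span B" for u d
  unfolding DB_def by (rule proj_inner[OF B that])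
 have "\<exists>u\<in>span B. DB u = 0 \<and> a0 <= I u \<and> I u <= b"
 proof (rule fd_minimax[where S = Sp and hs = "%x. r *\<^sub>R x" and q = q])
  show "finite B" by (rule B)
  show "!!u. u \<in> span B ==> DB u \<in> span B" unfolding DB_def by (rule proj_in[OF B])
  show "!!u. u \<in> span B ==> DB (- u) = - DB u" unfolding DB_def grad_odd by (rule proj_minus[OF B])
  show "continuous_on (span B) DB" unfolding DB_def
   by (rule continuous_on_compose2[OF linear_continuous_on[OF proj_bounded_linear[OF B], of UNIV] grad_cont]) auto
  show "continuous_on (span B) I" by (rule I_cont)
  show "1 < q" using q_bounds by simp
  show "!!R. \<exists>C. \<forall>u\<in>span B. \<forall>d\<in>span B. norm u <= R --> norm d <= 1 --> \<bar>I (u + d) - I u - inner (DB u) d\<bar> <= C * norm d powr q"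
   using I_expand DB_inner by (metis (no_types, lifting))
  show "!!m. \<exists>R. \<forall>u\<in>span B. m <= I u --> norm u <= R" by (rule finite_span_coercive[OF B])
  show "compact Sp" by (rule Sp)
  have "(1 / norm e) *\<^sub>R e \<in> Sp" using e(1) by (auto simp: Sp_def X_def intro: span_scale span_base)
  then show "Sp ~= {}" by blast
  show "!!x. x \<in> Sp ==> - x \<in> Sp" by (auto simp: Sp_def X_def intro: span_neg)
  show "continuous_on Sp (%x. r *\<^sub>R x)" by (intro continuous_intros)
  show "!!x. x \<in> Sp ==> r *\<^sub>R - x = - (r *\<^sub>R x)" by simp
  show "!!x. x \<in> Sp ==> r *\<^sub>R x \<in> span B" using X(3) by (auto simp: Sp_def intro: span_scale)
  show "a0 <= I (r *\<^sub>R x)" if "x \<in> Sp" for x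
   using that X r by (intro low) (auto simp: Sp_def S_linear)
  fix h assume h: "continuous_on Sp h" "!!x. x \<in> Sp ==> h (- x) = - h x" "!!x. x \<in> Sp ==> h x \<in> span B"
  \<comment> \<open>Radial normalization carries \<open>h\<close> from the sphere to the punctured
    span, the domain in \<open>borsuk_ulam_span\<close>.\<close>
  define n where "n x = (1 / norm x) *\<^sub>R x" for x :: 'a
  have n: "n x \<in> Sp" if "x \<in> span (set es)" "x ~= 0" for x
   using that by (auto simp: n_def Sp_def X_def ind intro: span_scale)
  have "\<exists>x\<in>span (set es). x ~= 0 \<and> (\<forall>j<card C. inner (h (n x)) (cs ! j) = 0)"
  proof (rule borsuk_ulam_span)
   show "continuous_on (span (set es) - {0}) (%x. inner (h (n x)) (cs ! j))" for j
   proof -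
    have "continuous_on (span (set es) - {0}) n" unfolding n_def by (intro continuous_intros) auto
    then have "continuous_on (span (set es) - {0}) (%x. h (n x))"
     by (rule continuous_on_compose2[OF h(1)]) (use n in auto)
    then show ?thesis by (intro continuous_intros)
   qed
   show "inner (h (n (- x))) (cs ! j) = - inner (h (n x)) (cs ! j)" if "x \<in> span (set es)" "x ~= 0" for j x
   proof -
    have "n (- x) = - n x" by (simp add: n_def)
    then show ?thesis using h(2)[OF n[OF that]] by simp
   qed
  qed (use ind in auto)
  then obtain x where x: "x \<in> span (set es)" "x ~= 0" "!!j. j < card C ==> inner (h (n x)) (cs ! j) = 0" by blast
  have hC: "inner (h (n x)) c = 0" if "c \<in> C" for c
   using that x(3) distinct_card[OF cs(2)] unfolding cs(1)[symmetric] by (metis cs(1) in_set_conv_nth)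
  obtain y k z where ykz: "y \<in> span Y" "k \<in> span C" "z \<in> span N" "h (n x) = y + k + z"
   using decomp[OF h(3)[OF n[OF x(1,2)]]] by blast
  \<comment> \<open>Orthogonality to \<open>C\<close> leaves only the components in
    \<open>span Y\<close> and in the negative part, where \<open>up\<close> applies.\<close>
  have "orthogonal (h (n x)) k"
   using orthogonal_to_span[OF ykz(2)] hC by (auto simp: orthogonal_def)
  then have "inner y k + inner k k + inner z k = 0" by (simp add: orthogonal_def ykz(4) inner_add_left)
  moreover have "inner y k = 0" using CY[OF ykz(2,1)] by (simp add: inner_commute)
  moreover have "inner z k = 0" using orth_cross[OF SC[OF ykz(2)] SN[OF ykz(3)]] by (simp add: inner_commute)
  ultimately have "k = 0" by simp
  then have "I (h (n x)) <= b" using up[of y z] ykz SN[OF ykz(3)] by (simp add: Y_def)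
  then show "\<exists>x\<in>Sp. I (h x) <= b" using n[OF x(1,2)] by blast
 qed
 then obtain u where u: "u \<in> span B" "DB u = 0" "a0 <= I u" "I u <= b" by blast
 have "inner (grad u) v = 0" if "v \<in> span B" for v using DB_inner[OF that, of u] u(2) by simp
 then show ?thesis using B SB TB u by blast
qed

text \<open>The Galerkin space contains the preimages under \<open>L\<close> of a finite net for the
  image of a ball under \<open>D\<close>. Then \<open>v = u - Li t\<close> is an admissible vector,
  testing with \<open>S v\<close> gives \<open>c1 |v| <= \<delta>\<close>, and the full gradient,
  not only its projection to \<open>span B\<close>, is small. As \<open>\<delta>\<close> tends to 0,
  \<open>D (u n)\<close> converges along a subsequence, hence so does \<open>L (u n)\<close> and,
  \<open>L\<close> being bounded below, \<open>u n\<close>.\<close>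

lemma critical_level: "\<exists>u. grad u = 0 \<and> a <= I u"
proof -
 define a' where "a' = max a 1"
 \<comment> \<open>With \<open>r\<close> below one gets \<open>c1 * r^2 = 4 * a'\<close> and
   \<open>\<epsilon> ^ 4 * r ^ 4 = 4 * a'\<close>, so on the sphere
   \<open>I >= 2 * a' - a'\<close>.\<close>
 define \<epsilon> where "\<epsilon> = sqrt (c1 / (2 * sqrt a'))"
 have a': "a' >= 1" "a <= a'" by (auto simp: a'_def)
 have \<epsilon>: "\<epsilon> > 0" using c1_pos a' by (simp add: \<epsilon>_def)
 have \<epsilon>2: "\<epsilon>^2 = c1 / (2 * sqrt a')" using c1_pos a' by (simp add: \<epsilon>_def)
 have \<epsilon>4: "\<epsilon> ^ 4 = c1^2 / (4 * a')"
 proof -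
  have "\<epsilon> ^ 4 = (\<epsilon>^2)^2" by simp
  then show ?thesis unfolding \<epsilon>2 using a' by (simp add: power_divide power_mult_distrib)
 qed
 obtain A0 where A0: "finite A0" "!!u. (\<forall>a\<in>A0. inner u a = 0) ==> \<kappa> u <= \<epsilon> * norm u"
  using \<kappa>_compact[OF \<epsilon>] by auto
 define A where "A = pp ` A0"
 have A: "finite A" "!!a. a \<in> A ==> S a = a" using A0 by (auto simp: A_def pp_pm)
 obtain u0 where u0: "\<forall>a\<in>A. inner u0 a = 0" "0 < inner (L u0) u0" using posdir[OF A(1)] by blast
 define e where "e = pp u0"
 have e: "e ~= 0" "S e = e" "!!a. a \<in> A ==> inner e a = 0"
 proof -
  show "e ~= 0"
  proof
   assume "e = 0"
   then have "u0 = pm u0" using pp_pm(1)[of u0] by (simp add: e_def)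
   then have "inner (L u0) u0 <= - c1 * (norm u0)^2" using L_neg[of u0] pp_pm(3)[of u0] by simp
   then show False using u0(2) c1_pos zero_le_power2[of "norm u0"] by (smt (verit) mult_nonneg_nonneg mult_minus_left)
  qed
  show "S e = e" by (simp add: e_def pp_pm)
  show "inner e a = 0" if "a \<in> A" for a
  proof -
   have "pp a = a" using A(2)[OF that] by (simp add: pp_def flip: scaleR_2)
   then show ?thesis using u0(1) that by (simp add: e_def pp_sym)
  qed
 qed
 define r where "r = sqrt c1 / \<epsilon>^2"
 have r: "r > 0" using c1_pos \<epsilon> by (simp add: r_def)
 have low: "a <= I u" if "S u = u" "!!a. a \<in> A ==> inner u a = 0" "norm u = r" for u
 proof -
  have "inner u a = 0" if "a \<in> A0" for a
   using \<open>!!a. a \<in> A ==> inner u a = 0\<close>[of "pp a"] pp_inner[OF \<open>S u = u\<close>, of a] that by (simp add: A_def)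
  then have "\<kappa> u <= \<epsilon> * r" using A0(2)[of u] that(3) by simp
  then have "\<kappa> u * \<kappa> u <= (\<epsilon> * r) * (\<epsilon> * r)" using \<kappa>_nonneg by (intro mult_mono) (auto intro: order_trans)
  then have "norm (\<beta> u u) <= (\<epsilon> * r)^2" using \<beta>_bound[of u u] by (simp add: power2_eq_square)
  then have "(norm (\<beta> u u))^2 <= ((\<epsilon> * r)^2)^2" by (intro power_mono) auto
  then have 1: "(norm (\<beta> u u))^2 <= \<epsilon> ^ 4 * r ^ 4" by (simp add: power_mult_distrib)
  have r2: "r^2 = c1 / \<epsilon> ^ 4" using c1_pos by (simp add: r_def power_divide)
  have "r ^ 4 = (r^2)^2" by simp
  moreover have "E * (c1 / E)^2 = c1^2 / E" if "E > 0" for E :: real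
   using that by (simp add: power2_eq_square)
  ultimately have "\<epsilon> ^ 4 * r ^ 4 = c1^2 / \<epsilon> ^ 4" unfolding r2 using \<epsilon> by simp
  moreover have "c1 * r^2 = c1^2 / \<epsilon> ^ 4" unfolding r2 by (simp add: power2_eq_square)
  moreover have "c1^2 / \<epsilon> ^ 4 = 4 * a'" unfolding \<epsilon>4 using c1_pos a' by simp
  ultimately have "(norm (\<beta> u u))^2 <= 4 * a'" "c1 * r^2 = 4 * a'" using 1 by simp_all
  then have "a' <= I u" using L_pos[OF that(1)] that(3) G_nonneg[of u] by (simp add: I_def)
  then show ?thesis using a' by simp
 qed
 have SeA: "S a = a" if "a \<in> insert e A" for a using that A(2) e(2) by auto
 have "finite (insert e A)" using A(1) by simp
 from sup_bound[OF this SeA] obtain b where b: "!!y z. y \<in> span (insert e A) ==> S z = - z ==> I (y + z) <= b"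
  by blast
 obtain R where R: "!!B u. (\<forall>v\<in>B. S v \<in> span B) ==> u \<in> span B ==> (\<forall>v\<in>span B. inner (grad u) v = 0) ==> I u <= b ==> norm u <= R"
  using apriori_bound[of b] by blast
 obtain M where M: "M > 0" "!!x. norm (L x) <= M * norm x" using L_norm_bound by blast
 have approx: "\<exists>u. norm u <= R \<and> a <= I u \<and> norm (grad u) <= (M / c1 + 1) * \<delta>" if \<delta>: "\<delta> > 0" for \<delta>
 proof -
  obtain T where T: "finite T" "!!u. norm u <= R ==> \<exists>t\<in>T. norm (D u - t) <= \<delta>"
   using D_totally_bounded[OF \<delta>] by blast
  have "\<exists>x. L x = y" for y by (rule symmetric_bounded_below_surj[OF L_bl L_sym c_pos L_bb])
  then obtain Li where Li: "!!y. L (Li y) = y" by metis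
  obtain B u where B: "finite B" "\<forall>v\<in>B. S v \<in> span B" "Li ` T \<subseteq> span B" "u \<in> span B"
   "\<forall>v\<in>span B. inner (grad u) v = 0" "a <= I u" "I u <= b"
   using galerkin[OF A e low r b, of "Li ` T"] T(1) by blast
  have nu: "norm u <= R" using R B by blast
  obtain t where t: "t \<in> T" "norm (D u - t) <= \<delta>" using T(2)[OF nu] by blast
  define v where "v = u - Li t"
  have v: "v \<in> span B" using B(3,4) t(1) by (auto simp: v_def intro: span_diff)
  then have "S v \<in> span B" using S_span[of B v] B(2) by blast
  then have "inner (L u) (S v) = inner (D u) (S v)" using B(5) by (simp add: grad_def inner_diff_left)
  then have "inner (L v) (S v) = inner (D u - t) (S v)" by (simp add: v_def L_linear Li inner_diff_left)
  then have "c1 * (norm v)^2 <= inner (D u - t) (S v)" using LS[of v] by simp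
  also have "... <= norm (D u - t) * norm v" using norm_cauchy_schwarz[of "D u - t" "S v"] by (simp add: S_norm)
  also have "... <= \<delta> * norm v" using t(2) by (intro mult_right_mono) auto
  finally have "c1 * norm v <= \<delta>" by (cases "v = 0") (use \<delta> in \<open>auto simp: power2_eq_square\<close>)
  then have nv: "norm v <= \<delta> / c1" using c1_pos by (simp add: field_simps)
  have "grad u = L v - (D u - t)" by (simp add: grad_def v_def L_linear Li)
  then have "norm (grad u) <= M * norm v + \<delta>" using norm_triangle_ineq4[of "L v" "D u - t"] M(2)[of v] t(2) by simp
  also have "... <= M * (\<delta> / c1) + \<delta>" using nv M(1) by (intro add_right_mono mult_left_mono) auto
  finally show ?thesis using nu B(6) by (intro exI[of _ u]) (simp add: algebra_simps)
 qed
 obtain u where u: "!!n. norm (u n) <= R" "!!n. a <= I (u n)" "!!n. norm (grad (u n)) <= (M / c1 + 1) * (1 / real (Suc n))"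
  using approx[of "1 / real (Suc _)"] by (metis of_nat_0_less_iff zero_less_Suc zero_less_divide_1_iff)
 have cpt: "compact (closure (D ` cball 0 R))"
  unfolding compact_eq_totally_bounded
 proof (intro conjI allI impI)
  show "Topological_Spaces.complete (closure (D ` cball 0 R))" by (simp add: complete_eq_closed)
  fix e :: real assume "e > 0"
  then have "e / 2 > 0" by simp
  then obtain T where T: "finite T" "!!u. norm u <= R ==> \<exists>t\<in>T. norm (D u - t) <= e / 2"
   using D_totally_bounded[of "e / 2" R] by blast
  have "D ` cball 0 R \<subseteq> (\<Union>t\<in>T. cball t (e / 2))"
   using T(2) by (fastforce simp: dist_norm norm_minus_commute)
  then have "closure (D ` cball 0 R) \<subseteq> (\<Union>t\<in>T. cball t (e / 2))"
   using T(1) by (intro closure_minimal closed_UN) auto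
  also have "... \<subseteq> (\<Union>t\<in>T. ball t e)" using \<open>e > 0\<close> by force
  finally show "\<exists>k. finite k \<and> closure (D ` cball 0 R) \<subseteq> (\<Union>x\<in>k. ball x e)" using T(1) by blast
 qed
 have "D (u n) \<in> closure (D ` cball 0 R)" for n using u(1) closure_subset by fastforce
 then have "\<exists>l\<in>closure (D ` cball 0 R). \<exists>\<sigma>. strict_mono \<sigma> \<and> ((%n. D (u n)) \<circ> \<sigma>) \<longlonglongrightarrow> l"
  by (rule cpt[unfolded compact_def, rule_format])
 then obtain l \<sigma> where \<sigma>: "strict_mono \<sigma>" "(%n. D (u (\<sigma> n))) \<longlonglongrightarrow> l"
  unfolding comp_def by blast
 have g0: "(%n. grad (u n)) \<longlonglongrightarrow> 0"
 proof (rule Lim_null_comparison)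
  show "\<forall>\<^sub>F n in sequentially. norm (grad (u n)) <= (M / c1 + 1) * (1 / real (Suc n))" using u(3) by simp
  have "(%n. 1 / real (Suc n)) \<longlonglongrightarrow> 0" using LIMSEQ_inverse_real_of_nat by (simp add: inverse_eq_divide)
  then show "(%n. (M / c1 + 1) * (1 / real (Suc n))) \<longlonglongrightarrow> 0" by (rule tendsto_mult_right_zero)
 qed
 have "(%n. grad (u (\<sigma> n)) + D (u (\<sigma> n))) \<longlonglongrightarrow> 0 + l"
  using LIMSEQ_subseq_LIMSEQ[OF g0 \<sigma>(1)] \<sigma>(2) by (intro tendsto_add) (auto simp: comp_def)
 then have Ll: "(%n. L (u (\<sigma> n))) \<longlonglongrightarrow> l" by (simp add: grad_def)
 obtain ul where ul: "L ul = l" using symmetric_bounded_below_surj[OF L_bl L_sym c_pos L_bb] by blast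
 have lim: "(%n. u (\<sigma> n)) \<longlonglongrightarrow> ul"
 proof (rule LIM_zero_cancel, rule Lim_null_comparison)
  have "norm (u (\<sigma> n) - ul) <= 1 / c * norm (L (u (\<sigma> n)) - l)" for n
   using L_bb[of "u (\<sigma> n) - ul"] c_pos by (simp add: L_linear ul field_simps)
  then show "\<forall>\<^sub>F n in sequentially. norm (u (\<sigma> n) - ul) <= 1 / c * norm (L (u (\<sigma> n)) - l)" by simp
  have "(%n. norm (L (u (\<sigma> n)) - l)) \<longlonglongrightarrow> 0" using LIM_zero[OF Ll] by (rule tendsto_norm_zero)
  then show "(%n. 1 / c * norm (L (u (\<sigma> n)) - l)) \<longlonglongrightarrow> 0" by (rule tendsto_mult_right_zero)
 qed
 have cont: "(%n. F (u (\<sigma> n))) \<longlonglongrightarrow> F ul" if "continuous_on UNIV F" for F :: "'a => 'c::topological_space"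
  by (rule continuous_on_tendsto_compose[OF that lim]) auto
 have "(%n. grad (u (\<sigma> n))) \<longlonglongrightarrow> 0" using LIMSEQ_subseq_LIMSEQ[OF g0 \<sigma>(1)] by (simp add: comp_def)
 then have "grad ul = 0" using cont[OF grad_cont] LIMSEQ_unique by blast
 moreover have "a <= I ul"
  by (rule LIMSEQ_le_const[OF cont[OF I_cont]]) (use u(2) in auto)
 ultimately show ?thesis by blast
qed

end

theorem (in indef_functional) infinitely_many_critical_points:
 "\<exists>u. (\<forall>n v. inner (L (u n)) v - inner (\<beta> (u n) (u n)) (\<beta> (u n) v) + inner (D2 (u n)) v = 0) \<and>
  filterlim (%n. norm (u n)) at_top sequentially"
proof (rule sign_operator[OF L_bl L_sym c_pos L_bb])
 fix S :: "'a => 'a" and c1 :: real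
 assume S: "bounded_linear S" "!!x y. inner (S x) y = inner x (S y)" "!!x. S (S x) = x"
  "!!x. S (L x) = L (S x)" "c1 > 0" "!!x. c1 * (norm x)^2 <= inner (L x) (S x)"
 interpret indef_functional_split L \<beta> G D2 \<kappa> Q c Ck Cq Cg q S c1
  by (intro indef_functional_split.intro indef_functional_split_axioms.intro indef_functional_axioms S)
 have "\<forall>n. \<exists>u. grad u = 0 \<and> real n <= I u" using critical_level by blast
 from choice[OF this] obtain u where u: "!!n. grad (u n) = 0" "!!n. real n <= I (u n)" by blast
 have "filterlim (%n. norm (u n)) at_top sequentially"
  unfolding filterlim_at_top
 proof
  fix R
  obtain M where M: "!!v. norm v <= R ==> I v <= M" using I_ball_bound by blast
  have "R <= norm (u n)" if "n >= nat \<lceil>M + 1\<rceil>" for n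
  proof (rule ccontr)
   assume "\<not> ?thesis"
   then have "I (u n) <= M" by (intro M) simp
   moreover have "M + 1 <= real n" using that by linarith
   ultimately show False using u(2)[of n] by linarith
  qed
  then show "\<forall>\<^sub>F n in sequentially. R <= norm (u n)" by (auto simp: eventually_sequentially)
 qed
 moreover have "inner (L (u n)) v - inner (\<beta> (u n) (u n)) (\<beta> (u n) v) + inner (D2 (u n)) v = 0" for n v
  using u(1)[of n] grad_inner[of "u n" v] by simp
 ultimately show ?thesis by blast
qed

section \<open>The Hilbert space of square integrable functions\<close>

definition L2fun :: "(real^3 => 'b::euclidean_space) => bool" where
 "L2fun f \<longleftrightarrow> f \<in> borel_measurable lborel \<and> integrable lborel (%x. (norm (f x))\<^sup>2)"

lemma L2fun_measurable [measurable_dest]: "L2fun f ==> f \<in> borel_measurable borel"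
 by (simp add: L2fun_def)

lemma L2fun_nn_iff:
 "L2fun f \<longleftrightarrow> f \<in> borel_measurable lborel \<and> (\<integral>\<^sup>+x. ennreal ((norm (f x))^2) \<partial>lborel) < \<infinity>"
 by (auto simp: L2fun_def integrable_iff_bounded)

lemma L2fun_zero [simp]: "L2fun (%x. 0)" by (simp add: L2fun_def)

lemma L2fun_bound:
 assumes "f \<in> borel_measurable lborel" "integrable lborel g" "AA x. (norm (f x))\<^sup>2 <= g x"
 shows "L2fun f"
 unfolding L2fun_def
proof
 show "integrable lborel (%x. (norm (f x))\<^sup>2)"
 proof (rule bint_bound[OF assms(2)])
  show "(%x. (norm (f x))\<^sup>2) \<in> borel_measurable lborel" using assms(1) by measurable
  show "AA x. norm ((norm (f x))^2) <= norm (g x)"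
   using assms(3) by eventually_elim simp
 qed
qed (rule assms(1))

lemma norm_add_square_le: "(norm (a + b))^2 <= 2 * (norm a)^2 + 2 * (norm (b::'a::real_inner))^2"
proof -
 have "0 <= (norm (a - b))^2" by simp
 then show ?thesis
  by (simp only: power2_norm_eq_inner) (simp add: inner_add_left inner_add_right inner_diff_left inner_diff_right inner_commute)
qed

lemma L2fun_integrable: "L2fun f ==> integrable lborel (%x. (norm (f x))\<^sup>2)"
 by (simp add: L2fun_def)

lemma L2fun_add:
 assumes "L2fun f" "L2fun g" shows "L2fun (%x. f x + g x)"
proof (rule L2fun_bound)
 show "(%x. f x + g x) \<in> borel_measurable lborel"
  using L2fun_measurable[OF assms(1)] L2fun_measurable[OF assms(2)] by (intro borel_measurable_add) simp_all
 show "integrable lborel (%x. 2 * (norm (f x))^2 + 2 * (norm (g x))^2)"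
  using L2fun_integrable[OF assms(1)] L2fun_integrable[OF assms(2)] by (intro bint_add integrable_mult_right)
qed (simp add: norm_add_square_le)

lemma L2fun_scaleR:
 assumes "L2fun f" shows "L2fun (%x. r *\<^sub>R f x)"
proof (rule L2fun_bound)
 show "(%x. r *\<^sub>R f x) \<in> borel_measurable lborel"
  using L2fun_measurable[OF assms] by (intro borel_measurable_scaleR) simp_all
 show "integrable lborel (%x. r\<^sup>2 * (norm (f x))^2)"
  using L2fun_integrable[OF assms] by (rule integrable_mult_right)
qed (simp add: power_mult_distrib)

lemma L2fun_minus: "L2fun f ==> L2fun (%x. - f x)"
 using L2fun_scaleR[of f "-1"] by simp

lemma L2fun_diff: "L2fun f ==> L2fun g ==> L2fun (%x. f x - g x)"
 using L2fun_add[of f "%x. - g x"] L2fun_minus[of g] by simp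

lemma L2fun_AE:
 assumes "L2fun f" "g \<in> borel_measurable lborel" "AA x. f x = g x"
 shows "L2fun g"
proof (rule L2fun_bound[OF assms(2) L2fun_integrable[OF assms(1)]])
 show "AA x. (norm (g x))\<^sup>2 <= (norm (f x))^2" using assms(3) by eventually_elim simp
qed

lemma integrable_inner_L2:
 assumes "L2fun f" "L2fun g" shows "integrable lborel (%x. inner (f x) (g x))"
proof (rule bint_bound)
 show "integrable lborel (%x. (norm (f x))\<^sup>2 + (norm (g x))^2)" using assms by (auto simp: L2fun_def)
 show "(%x. inner (f x) (g x)) \<in> borel_measurable lborel"
  using L2fun_measurable[OF assms(1)] L2fun_measurable[OF assms(2)] by (intro borel_measurable_inner) simp_all
 have "norm (inner (f x) (g x)) <= norm ((norm (f x))^2 + (norm (g x))^2)" for x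
 proof -
  have "\<bar>inner (f x) (g x)\<bar> <= norm (f x) * norm (g x)" by (rule Cauchy_Schwarz_ineq2)
  also have "... <= (norm (f x))^2 + (norm (g x))^2"
   using sum_squares_bound[of "norm (f x)" "norm (g x)"] zero_le_power2[of "norm (f x)"] zero_le_power2[of "norm (g x)"]
    mult_nonneg_nonneg[of "norm (f x)" "norm (g x)"] by linarith
  finally show ?thesis by simp
 qed
 then show "AA x. norm (inner (f x) (g x)) <= norm ((norm (f x))^2 + (norm (g x))^2)" by simp
qed

definition L2_rel :: "(real^3 => 'b::euclidean_space) => (real^3 => 'b) => bool" where
 "L2_rel f g \<longleftrightarrow> L2fun f \<and> L2fun g \<and> (AA x. f x = g x)"

lemma L2_rel_part_equivp: "part_equivp L2_rel"
proof (rule part_equivpI)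
 show "\<exists>f. L2_rel f f" by (rule exI[of _ "%x. 0"]) (simp add: L2_rel_def)
 show "symp L2_rel" by (rule sympI) (auto simp: L2_rel_def)
 show "transp L2_rel" by (rule transpI) (auto simp: L2_rel_def)
qed

\<comment> \<open>Functions modulo null sets form a type, so that the Hilbert space results above,
  stated for \<open>real_inner\<close> and \<open>banach\<close>, apply to them. The relation is
  partial because only square integrable functions represent elements.\<close>
quotient_type (overloaded) 'b L2 = "real^3 => 'b::euclidean_space" / partial: L2_rel
 morphisms rep_L2 abs_L2 by (rule L2_rel_part_equivp)

lemma rep_L2fun [simp]: "L2fun (rep_L2 a)"
 using Quotient3_rep_reflp[OF Quotient3_L2, of a] by (simp add: L2_rel_def)

lemma rep_L2_measurable [measurable]: "rep_L2 a \<in> borel_measurable borel"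
 by (rule L2fun_measurable) simp

lemma abs_rep [simp]: "abs_L2 (rep_L2 a) = a"
 by (rule Quotient3_abs_rep[OF Quotient3_L2])

lemma abs_L2_cong: "L2fun f ==> L2fun g ==> AA x. f x = g x ==> abs_L2 f = abs_L2 g"
 by (rule Quotient3_rel_abs[OF Quotient3_L2]) (simp add: L2_rel_def)

lemma rep_abs: "L2fun f ==> AA x. rep_L2 (abs_L2 f) x = f x"
 using Quotient3_rep_abs[OF Quotient3_L2, of f] by (simp add: L2_rel_def)

lemma L2_eqI: "AA x. rep_L2 a x = rep_L2 b x ==> a = b"
 using abs_L2_cong[of "rep_L2 a" "rep_L2 b"] by simp

lemma abs_L2_eqI: "L2fun f ==> AA x. f x = rep_L2 b x ==> abs_L2 f = b"
 using abs_L2_cong[of f "rep_L2 b"] by simp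

instantiation L2 :: (euclidean_space) real_vector
begin

definition "0 = abs_L2 (%x. 0)"
definition "a + b = abs_L2 (%x. rep_L2 a x + rep_L2 b x)"
definition "a - b = abs_L2 (%x. rep_L2 a x - rep_L2 b x)"
definition "- a = abs_L2 (%x. - rep_L2 a x)"
definition "r *\<^sub>R a = abs_L2 (%x. r *\<^sub>R rep_L2 a x)"

lemma rep_zero: "AA x. rep_L2 (0::'a L2) x = 0"
 unfolding zero_L2_def by (rule rep_abs) simp
lemma rep_add: "AA x. rep_L2 (a + b) x = rep_L2 a x + rep_L2 (b::'a L2) x"
 unfolding plus_L2_def by (rule rep_abs) (simp add: L2fun_add)
lemma rep_diff: "AA x. rep_L2 (a - b) x = rep_L2 a x - rep_L2 (b::'a L2) x"
 unfolding minus_L2_def by (rule rep_abs) (simp add: L2fun_diff)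
lemma rep_uminus: "AA x. rep_L2 (- a) x = - rep_L2 (a::'a L2) x"
 unfolding uminus_L2_def by (rule rep_abs) (simp add: L2fun_minus)
lemma rep_scaleR: "AA x. rep_L2 (r *\<^sub>R a) x = r *\<^sub>R rep_L2 (a::'a L2) x"
 unfolding scaleR_L2_def by (rule rep_abs) (simp add: L2fun_scaleR)

instance
proof
 fix a b c :: "'a L2" and r s :: real
 show "a + b + c = a + (b + c)"
  by (rule L2_eqI, use rep_add[of "a + b" c] rep_add[of a b] rep_add[of a "b + c"] rep_add[of b c] in eventually_elim) (simp)
 show "a + b = b + a" by (simp add: plus_L2_def add.commute)
 show "0 + a = a"
  by (rule L2_eqI, use rep_add[of 0 a] rep_zero in eventually_elim) (simp)
 show "- a + a = 0"
  by (rule L2_eqI, use rep_add[of "- a" a] rep_zero rep_uminus[of a] in eventually_elim) (simp)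
 show "a - b = a + - b"
  by (rule L2_eqI, use rep_add[of a "- b"] rep_uminus[of b] rep_diff[of a b] in eventually_elim) (simp)
 show "r *\<^sub>R (a + b) = r *\<^sub>R a + r *\<^sub>R b"
  by (rule L2_eqI, use rep_add[of a b] rep_scaleR[of r "a + b"] rep_add[of "r *\<^sub>R a" "r *\<^sub>R b"] rep_scaleR[of r a] rep_scaleR[of r b] in eventually_elim) (simp add: scaleR_add_right)
 show "(r + s) *\<^sub>R a = r *\<^sub>R a + s *\<^sub>R a"
  by (rule L2_eqI, use rep_scaleR[of "r + s" a] rep_add[of "r *\<^sub>R a" "s *\<^sub>R a"] rep_scaleR[of r a] rep_scaleR[of s a] in eventually_elim) (simp add: scaleR_add_left)
 show "r *\<^sub>R s *\<^sub>R a = (r * s) *\<^sub>R a"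
  by (rule L2_eqI, use rep_scaleR[of "r * s" a] rep_scaleR[of r "s *\<^sub>R a"] rep_scaleR[of s a] in eventually_elim) (simp)
 show "1 *\<^sub>R a = a"
  by (rule L2_eqI, use rep_scaleR[of 1 a] in eventually_elim) (simp)
qed

end

instantiation L2 :: (euclidean_space) real_inner
begin

definition "inner a b = (LBINT x. inner (rep_L2 a x) (rep_L2 b x))"
definition "norm (a::'a L2) = sqrt (inner a a)"
definition "dist (a::'a L2) b = norm (a - b)"
definition "sgn (a::'a L2) = inverse (norm a) *\<^sub>R a"
definition "(uniformity :: ('a L2 \<times> 'a L2) filter) = (INF e\<in>{0<..}. principal {(x, y). dist x y < e})"
definition "open (U :: 'a L2 set) = (\<forall>x\<in>U. \<forall>\<^sub>F (x', y) in uniformity. x' = x --> y \<in> U)"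

instance
proof
 fix a b c :: "'a L2" and r :: real and U :: "'a L2 set"
 show "dist a b = norm (a - b)" by (rule dist_L2_def)
 show "sgn a = inverse (norm a) *\<^sub>R a" by (rule sgn_L2_def)
 show "uniformity = (INF e\<in>{0<..}. principal {(x :: 'a L2, y). dist x y < e})" by (rule uniformity_L2_def)
 show "open U = (\<forall>x\<in>U. \<forall>\<^sub>F (x', y) in uniformity. x' = x --> y \<in> U)" by (rule open_L2_def)
 show "inner a b = inner b a" by (simp add: inner_L2_def inner_commute)
 show "inner (a + b) c = inner a c + inner b c"
 proof -
  have "inner (a + b) c = (LBINT x. inner (rep_L2 a x) (rep_L2 c x) + inner (rep_L2 b x) (rep_L2 c x))"
   unfolding inner_L2_def
  proof (rule integral_cong_AE)
   show "AA x. inner (rep_L2 (a + b) x) (rep_L2 c x) = inner (rep_L2 a x) (rep_L2 c x) + inner (rep_L2 b x) (rep_L2 c x)"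
    using rep_add[of a b] by eventually_elim (simp add: inner_add_left)
  qed measurable
  then show ?thesis by (simp add: inner_L2_def integrable_inner_L2)
 qed
 show "inner (r *\<^sub>R a) b = r * inner a b"
 proof -
  have "inner (r *\<^sub>R a) b = (LBINT x. r * inner (rep_L2 a x) (rep_L2 b x))"
   unfolding inner_L2_def
  proof (rule integral_cong_AE)
   show "AA x. inner (rep_L2 (r *\<^sub>R a) x) (rep_L2 b x) = r * inner (rep_L2 a x) (rep_L2 b x)"
    using rep_scaleR[of r a] by eventually_elim simp
  qed measurable
  then show ?thesis by (simp add: inner_L2_def)
 qed
 show "0 <= inner a a" by (simp add: inner_L2_def)
 show "(inner a a = 0) = (a = 0)"
 proof
  assume "inner a a = 0"
  then have *: "AA x. inner (rep_L2 a x) (rep_L2 a x) = 0"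
   unfolding inner_L2_def by (subst (asm) integral_nonneg_eq_0_iff_AE) (auto simp: integrable_inner_L2)
  show "a = 0" by (rule L2_eqI, use * rep_zero in eventually_elim) simp
 next
  assume "a = 0"
  have "AA x. inner (rep_L2 (0::'a L2) x) (rep_L2 (0::'a L2) x) = 0"
   using rep_zero by eventually_elim simp
  then have "inner (0::'a L2) 0 = 0"
   unfolding inner_L2_def by (rule integral_eq_zero_AE)
  then show "inner a a = 0" using \<open>a = 0\<close> by simp
 qed
 show "norm a = sqrt (inner a a)" by (rule norm_L2_def)
qed

end

lemma norm_L2_square: "(norm (a::'b::euclidean_space L2))^2 = (LBINT x. (norm (rep_L2 a x))\<^sup>2)"
 by (simp add: power2_norm_eq_inner inner_L2_def)

lemma nn_norm_L2: "(\<integral>\<^sup>+x. ennreal ((norm (rep_L2 a x))^2) \<partial>lborel) = ennreal ((norm a)^2)"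
 unfolding norm_L2_square by (rule nn_integral_eq_integral) (use rep_L2fun[of a] in \<open>auto simp: L2fun_def\<close>)

lemma inner_abs_L2:
 assumes "L2fun f" "L2fun g"
 shows "inner (abs_L2 f) (abs_L2 g) = (LBINT x. inner (f x) (g x))"
 unfolding inner_L2_def
proof (rule integral_cong_AE)
 show "AA x. inner (rep_L2 (abs_L2 f) x) (rep_L2 (abs_L2 g) x) = inner (f x) (g x)"
  using rep_abs[OF assms(1)] rep_abs[OF assms(2)] by eventually_elim simp
qed (use assms in measurable)

lemma norm_abs_L2: "L2fun f ==> (norm (abs_L2 f))\<^sup>2 = (LBINT x. (norm (f x))\<^sup>2)"
 by (simp add: power2_norm_eq_inner inner_abs_L2)

lemma nn_norm_abs_L2: "L2fun f ==> ennreal ((norm (abs_L2 f))^2) = (\<integral>\<^sup>+x. ennreal ((norm (f x))^2) \<partial>lborel)"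
 by (simp add: norm_abs_L2 nn_integral_eq_integral L2fun_def)

lemma abs_L2_add:
 assumes "L2fun f" "L2fun g"
 shows "abs_L2 (%x. f x + g x) = abs_L2 f + abs_L2 g"
proof (rule abs_L2_eqI)
 show "L2fun (%x. f x + g x)" using assms by (rule L2fun_add)
 show "AA x. f x + g x = rep_L2 (abs_L2 f + abs_L2 g) x"
  using rep_abs[OF assms(1)] rep_abs[OF assms(2)] rep_add[of "abs_L2 f" "abs_L2 g"] by eventually_elim simp
qed

lemma abs_L2_diff:
 assumes "L2fun f" "L2fun g"
 shows "abs_L2 (%x. f x - g x) = abs_L2 f - abs_L2 g"
proof (rule abs_L2_eqI)
 show "L2fun (%x. f x - g x)" using assms by (rule L2fun_diff)
 show "AA x. f x - g x = rep_L2 (abs_L2 f - abs_L2 g) x"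
  using rep_abs[OF assms(1)] rep_abs[OF assms(2)] rep_diff[of "abs_L2 f" "abs_L2 g"] by eventually_elim simp
qed

lemma abs_L2_scaleR:
 assumes "L2fun f"
 shows "abs_L2 (%x. r *\<^sub>R f x) = r *\<^sub>R abs_L2 f"
proof (rule abs_L2_eqI)
 show "L2fun (%x. r *\<^sub>R f x)" using assms by (rule L2fun_scaleR)
 show "AA x. r *\<^sub>R f x = rep_L2 (r *\<^sub>R abs_L2 f) x"
  using rep_abs[OF assms] rep_scaleR[of r "abs_L2 f"] by eventually_elim simp
qed

text \<open>Riesz-Fischer. Along a subsequence with steps \<open>(1 / 2) ^ k\<close>, the series of
  \<open>2 ^ k * |f (k + 1) - f k|^2\<close> has finite integral; where it converges, the increments
  are below a multiple of \<open>sqrt (1 / 2) ^ k\<close>, which gives a limit almost everywhere.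
  Fatou's lemma turns this into convergence in norm.\<close>

instance L2 :: (euclidean_space) banach
proof
 fix X :: "nat => 'a L2"
 assume "Cauchy X"
 have "\<exists>N. \<forall>m\<ge>N. \<forall>n\<ge>N. norm (X m - X n) < (1 / 2) ^ k" for k
  using CauchyD[OF \<open>Cauchy X\<close>, of "(1 / 2) ^ k"] by simp
 then obtain N where N: "!!k m n. m >= N k ==> n >= N k ==> norm (X m - X n) < (1 / 2) ^ k"
  by metis
 define r where "r = rec_nat (N 0) (%k p. max (Suc p) (N (Suc k)))"
 have r0: "r 0 = N 0" and rS: "r (Suc k) = max (Suc (r k)) (N (Suc k))" for k by (simp_all add: r_def)
 have r: "strict_mono r" by (rule strict_monoI_Suc) (simp add: rS)
 have rN: "N k <= r k" for k by (cases k) (simp_all add: r0 rS)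
 have step: "norm (X (r m) - X (r k)) <= (1 / 2) ^ k" if "m >= k" for m k
 proof -
  have "r k <= r m" using strict_mono_less_eq[OF r] that by blast
  then show ?thesis using N[of k "r m" "r k"] rN[of k] by auto
 qed
 define f where "f k = rep_L2 (X (r k))" for k
 have f_meas [measurable]: "f k \<in> borel_measurable lborel" for k by (simp add: f_def)
 have fL2: "L2fun (f k)" for k by (simp add: f_def)
 have absf: "abs_L2 (f k) = X (r k)" for k by (simp add: f_def)
 have fd: "(\<integral>\<^sup>+x. ennreal ((norm (f m x - f k x))^2) \<partial>lborel) <= ennreal (((1 / 2) ^ k)^2)" if "m >= k" for m k
 proof -
  have "abs_L2 (%x. f m x - f k x) = X (r m) - X (r k)" by (simp add: abs_L2_diff fL2 absf)
  then have "(\<integral>\<^sup>+x. ennreal ((norm (f m x - f k x))^2) \<partial>lborel) = ennreal ((norm (X (r m) - X (r k)))^2)"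
   using nn_norm_abs_L2[OF L2fun_diff[OF fL2[of m] fL2[of k]]] by simp
  also have "... <= ennreal (((1 / 2) ^ k)^2)" using step[OF that] by (intro ennreal_leI power_mono) auto
  finally show ?thesis .
 qed
 have "(\<integral>\<^sup>+x. (\<Sum>k. ennreal (2 ^ k * (norm (f (Suc k) x - f k x))^2)) \<partial>lborel)
   = (\<Sum>k. \<integral>\<^sup>+x. ennreal (2 ^ k * (norm (f (Suc k) x - f k x))^2) \<partial>lborel)"
  by (rule nn_integral_suminf) measurable
 also have "... <= (\<Sum>k. ennreal ((1 / 2) ^ k))"
 proof (intro suminf_le allI)
  fix k
  have "(\<integral>\<^sup>+x. ennreal (2 ^ k * (norm (f (Suc k) x - f k x))^2) \<partial>lborel)
    = ennreal (2 ^ k) * (\<integral>\<^sup>+x. ennreal ((norm (f (Suc k) x - f k x))^2) \<partial>lborel)"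
   by (simp add: ennreal_mult nn_integral_cmult)
  also have "... <= ennreal (2 ^ k) * ennreal (((1 / 2) ^ k)^2)"
   by (intro mult_left_mono fd) auto
  also have "... = ennreal (2 ^ k * ((1 / 2) ^ k)^2)" by (simp add: ennreal_mult)
  also have "2 ^ k * ((1 / 2 :: real) ^ k)^2 = (1 / 2) ^ k"
   by (simp add: power2_eq_square power_divide)
  finally show "(\<integral>\<^sup>+x. ennreal (2 ^ k * (norm (f (Suc k) x - f k x))^2) \<partial>lborel) <= ennreal ((1 / 2) ^ k)" .
 qed auto
 also have "... = ennreal (\<Sum>k. (1 / 2) ^ k)"
  by (intro suminf_ennreal2) (auto intro: summable_geometric)
 finally have "(\<integral>\<^sup>+x. (\<Sum>k. ennreal (2 ^ k * (norm (f (Suc k) x - f k x))^2)) \<partial>lborel) < \<infinity>"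
  by (rule order_le_less_trans) simp
 then have "(\<integral>\<^sup>+x. (\<Sum>k. ennreal (2 ^ k * (norm (f (Suc k) x - f k x))^2)) \<partial>lborel) ~= \<infinity>"
  by simp
 then have "AA x. (\<Sum>k. ennreal (2 ^ k * (norm (f (Suc k) x - f k x))^2)) ~= \<infinity>"
  by (rule nn_integral_PInf_AE[rotated]) measurable
 then have conv: "AA x. convergent (%k. f k x)"
 proof eventually_elim
  case (elim x)
  let ?d = "%k. norm (f (Suc k) x - f k x)"
  have "summable (%k. 2 ^ k * (?d k)^2)"
   by (rule summable_suminf_not_top) (use elim in auto)
  then obtain H where H: "!!k. norm (2 ^ k * (?d k)^2) <= H"
   using summable_imp_bounded[of "%k. 2 ^ k * (?d k)^2"] by (auto simp: bounded_iff)
  have dk: "?d k <= sqrt H * (sqrt (1 / 2)) ^ k" for k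
  proof (rule power2_le_imp_le)
   have H0: "0 <= H" using H[of 0] by (smt (verit) norm_ge_zero)
   have "(sqrt H * (sqrt (1 / 2)) ^ k)^2 = H * (1 / 2) ^ k"
    using H0 by (simp add: power_mult_distrib power_commutes flip: power_mult) (simp add: power_mult mult.commute[of k])
   moreover have "(?d k)^2 <= H * (1 / 2) ^ k" using H[of k] by (simp add: power_divide field_simps)
   ultimately show "(?d k)^2 <= (sqrt H * (sqrt (1 / 2)) ^ k)^2" by simp
   show "0 <= sqrt H * (sqrt (1 / 2)) ^ k" using H0 by simp
  qed
  have "summable (%k. sqrt H * (sqrt (1 / 2)) ^ k)"
   by (intro summable_mult summable_geometric) (simp add: real_sqrt_lt_1_iff)
  then have "summable (%k. f (Suc k) x - f k x)"
   by (rule summable_comparison_test'[where N = 0]) (use dk in auto)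
  then have "convergent (%n. \<Sum>k<n. f (Suc k) x - f k x)" by (simp add: summable_iff_convergent)
  then have "convergent (%n. f n x - f 0 x)" using sum_lessThan_telescope[of "%n. f n x"] by simp
  then show ?case using convergent_add[of "%n. f n x - f 0 x" "%n. f 0 x"] by (simp add: convergent_const)
 qed
 define F where "F x = lim (%k. f k x)" for x
 have [measurable]: "F \<in> borel_measurable lborel" unfolding F_def by measurable
 have Ff: "(\<integral>\<^sup>+x. ennreal ((norm (F x - f k x))^2) \<partial>lborel) <= ennreal (((1 / 2) ^ k)^2)" for k
 proof -
  have "(\<integral>\<^sup>+x. ennreal ((norm (F x - f k x))^2) \<partial>lborel) = (\<integral>\<^sup>+x. liminf (%m. ennreal ((norm (f m x - f k x))^2)) \<partial>lborel)"
  proof (rule nn_integral_cong_AE, use conv in eventually_elim)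
   case (elim x)
   then have "(%m. f m x) \<longlonglongrightarrow> F x" unfolding F_def by (simp add: convergent_LIMSEQ_iff)
   then have T: "(%m. ennreal ((norm (f m x - f k x))^2)) \<longlonglongrightarrow> ennreal ((norm (F x - f k x))^2)"
    by (intro tendsto_ennrealI tendsto_intros)
   show ?case by (rule lim_imp_Liminf[OF sequentially_bot T, symmetric])
  qed
  also have "... <= liminf (%m. \<integral>\<^sup>+x. ennreal ((norm (f m x - f k x))^2) \<partial>lborel)"
   by (rule nn_integral_liminf) measurable
  also have "... <= ennreal (((1 / 2) ^ k)^2)"
   by (rule Liminf_le) (auto simp: eventually_sequentially intro!: fd exI[of _ k])
  finally show ?thesis .
 qed
 have FfL2: "L2fun (%x. F x - f k x)" for k
  unfolding L2fun_nn_iff using Ff[of k] by (auto intro: order_le_less_trans)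
 then have FL2: "L2fun F" using L2fun_add[OF FfL2[of 0] fL2[of 0]] by simp
 have "norm (abs_L2 F - X (r k)) <= (1 / 2) ^ k" for k
 proof -
  have "ennreal ((norm (abs_L2 F - X (r k)))^2) <= ennreal (((1 / 2) ^ k)^2)"
   using nn_norm_abs_L2[OF FfL2[of k]] Ff[of k] by (simp add: abs_L2_diff FL2 fL2 absf)
  then have "(norm (abs_L2 F - X (r k)))^2 <= ((1 / 2) ^ k)^2" by simp
  then show ?thesis by (rule power2_le_imp_le) simp
 qed
 then have "(X \<circ> r) \<longlonglongrightarrow> abs_L2 F"
 proof (intro metric_LIMSEQ_I)
  fix e :: real assume "e > 0"
  then obtain n where n: "(1 / 2) ^ n < e" using real_arch_pow_inv[of e "1 / 2"] by auto
  have "dist ((X \<circ> r) k) (abs_L2 F) < e" if "k >= n" for k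
  proof -
   have "norm (abs_L2 F - X (r k)) <= (1 / 2) ^ k" by fact
   also have "... <= (1 / 2) ^ n" using that by (intro power_decreasing) auto
   finally show ?thesis using n by (simp add: dist_norm norm_minus_commute)
  qed
  then show "\<exists>no. \<forall>n\<ge>no. dist ((X \<circ> r) n) (abs_L2 F) < e" by blast
 qed
 then have "X \<longlonglongrightarrow> abs_L2 F" using Cauchy_converges_subseq[OF \<open>Cauchy X\<close> r] by blast
 then show "convergent X" by (auto simp: convergent_def)
qed

section \<open>The Fourier transform\<close>

definition kern :: "real^3 => real^3 => complex" where
 "kern x xi = exp (- \<i> * cor (x \<bullet> xi))"

lemma norm_kern [simp]: "cmod (kern x xi) = 1"
 by (simp add: kern_def norm_exp_eq_Re)

lemma kern_commute: "kern x xi = kern xi x" by (simp add: kern_def inner_commute)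

lemma kern_add: "kern (x + y) xi = kern x xi * kern y xi"
 by (simp add: kern_def inner_add_left distrib_left exp_add[symmetric] algebra_simps)

lemma kern_uminus: "kern (- x) xi = cnj (kern x xi)" "kern x (- xi) = cnj (kern x xi)"
 by (simp_all add: kern_def exp_cnj)

lemma kern_measurable [measurable]:
 assumes [measurable]: "f \<in> borel_measurable M" "g \<in> borel_measurable M"
 shows "(%x. kern (f x) (g x)) \<in> borel_measurable M"
 unfolding kern_def by measurable

text \<open>No normalizing factor, in agreement with \<open>is_FT\<close>; hence the constants
  \<open>(2 * pi) ^ 3\<close> in Plancherel's identity and in the inversion formula.\<close>

definition fint :: "(real^3 => complex) => real^3 => complex" where
 "fint f xi = (LBINT x. kern x xi * f x)"

lemma fint_integrable:
 assumes "integrable lborel f"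
 shows "integrable lborel (%x. kern x xi * f x)"
proof (rule bint_bound[OF assms])
 have [measurable]: "f \<in> borel_measurable lborel" using assms by simp
 show "(%x. kern x xi * f x) \<in> borel_measurable lborel" by measurable
qed (simp add: norm_mult)

lemma fint_measurable:
 assumes [measurable]: "f \<in> borel_measurable borel"
 shows "fint f \<in> borel_measurable borel"
 unfolding fint_def[abs_def] by measurable

lemma fint_bound:
 assumes "integrable lborel f"
 shows "cmod (fint f xi) <= (LBINT x. cmod (f x))"
proof -
 have "cmod (fint f xi) <= (LBINT x. cmod (kern x xi * f x))"
  unfolding fint_def by (rule integral_norm_bound)
 then show ?thesis by (simp add: norm_mult)
qed

lemma integrable_pair_lborel:
 fixes H :: "real^3 => real^3 => complex"
 assumes f: "integrable lborel f" and g: "integrable lborel g"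
  and H: "(%p. H (fst p) (snd p)) \<in> borel_measurable (lborel \<Otimes>\<^sub>M lborel)"
  and bound: "!!x y. cmod (H x y) <= f x * g y"
 shows "integrable (lborel \<Otimes>\<^sub>M lborel) (%(x, y). H x y)"
proof (rule lborel_pair.Fubini_integrable)
 have [measurable]: "(%(x, y). H x y) \<in> borel_measurable (lborel \<Otimes>\<^sub>M lborel)"
  using H by (simp add: case_prod_unfold)
 show "(%(x, y). H x y) \<in> borel_measurable (lborel \<Otimes>\<^sub>M lborel)" by measurable
 have meas: "H x \<in> borel_measurable lborel" for x
  using measurable_compose[OF measurable_Pair1' H, of x] by simp
 have int: "integrable lborel (H x)" for x
 proof (rule bint_bound)
  show "integrable lborel (%y. f x * g y)" using g by simp
  show "AA y. norm (H x y) <= norm (f x * g y)"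
   using bound[of x] by (auto intro: order_trans[OF _ abs_ge_self])
 qed (rule meas)
 then show "AA x. integrable lborel (%y. case (x, y) of (x, y) => H x y)" by simp
 show "integrable lborel (%x. LBINT y. norm (case (x, y) of (x, y) => H x y))"
 proof (rule bint_bound)
  show "integrable lborel (%x. f x * (LBINT y. g y))" using f by simp
  show "(%x. LBINT y. norm (case (x, y) of (x, y) => H x y)) \<in> borel_measurable lborel"
   by (rule lborel.borel_measurable_lebesgue_integral) measurable
  show "AA x. norm (LBINT y. norm (case (x, y) of (x, y) => H x y)) <= norm (f x * (LBINT y. g y))"
  proof (rule AE_I2)
   fix x
   have "norm (LBINT y. norm (H x y)) = (LBINT y. norm (H x y))" by simp
   also have "... <= (LBINT y. f x * g y)"
    using int[of x] g bound by (intro integral_mono) auto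
   also have "... <= norm (f x * (LBINT y. g y))" by simp
   finally show "norm (LBINT y. norm (case (x, y) of (x, y) => H x y)) <= norm (f x * (LBINT y. g y))" by simp
  qed
 qed
qed

text \<open>The multiplication formula, by Fubini's theorem and the symmetry of the kernel.
  Plancherel's identity and the inversion formula both rest on it.\<close>

lemma fint_mult:
 assumes f: "integrable lborel f" and h: "integrable lborel h"
 shows "(LBINT xi. fint f xi * h xi) = (LBINT x. f x * fint h x)"
proof -
 have [measurable]: "f \<in> borel_measurable lborel" "h \<in> borel_measurable lborel" using f h by auto
 have "integrable (lborel \<Otimes>\<^sub>M lborel) (%(x, xi). kern x xi * f x * h xi)"
  by (rule integrable_pair_lborel[of "%x. cmod (f x)" "%x. cmod (h x)"]) (use f h in \<open>auto simp: norm_mult\<close>)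
 then have "(LBINT xi. LBINT x. kern x xi * f x * h xi) = (LBINT x. LBINT xi. kern x xi * f x * h xi)"
  by (rule lborel_pair.Fubini_integral)
 moreover have e1: "(LBINT x. kern x xi * f x * h xi) = fint f xi * h xi" for xi
  by (simp add: fint_def)
 moreover have e2: "(LBINT xi. kern x xi * f x * h xi) = f x * fint h x" for x
 proof -
  have "(LBINT xi. kern x xi * f x * h xi) = (LBINT xi. f x * (kern xi x * h xi))"
   by (simp add: mult_ac kern_commute[of x])
  then show ?thesis by (simp add: fint_def)
 qed
 ultimately show ?thesis by (simp only: e1 e2)
qed

section \<open>Affine substitutions and Gaussian integrals\<close>

lemma lborel_integral_affine:
 fixes f :: "real^3 => 'b::{banach,second_countable_topology}" and c :: real
 assumes c: "c ~= 0" and [measurable]: "f \<in> borel_measurable borel"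
 shows "integral\<^sup>L lborel f = \<bar>c\<bar> ^ 3 *\<^sub>R (LBINT x. f (t + c *\<^sub>R x))"
proof -
 have "integral\<^sup>L lborel f = integral\<^sup>L (density (distr lborel borel (%x. t + c *\<^sub>R x)) (%_. \<bar>c\<bar> ^ DIM(real^3))) f"
  using lborel_affine[OF c, of t] by simp
 also have "... = (LINT x|distr lborel borel (%x. t + c *\<^sub>R x). \<bar>c\<bar> ^ 3 *\<^sub>R f x)"
  by (subst integral_density) auto
 also have "... = (LBINT x. \<bar>c\<bar> ^ 3 *\<^sub>R f (t + c *\<^sub>R x))"
  by (subst integral_distr) auto
 finally show ?thesis by simp
qed

lemma lborel_integrable_affine:
 fixes f :: "real^3 => 'b::{banach,second_countable_topology}" and c :: real
 assumes c: "c ~= 0" and [measurable]: "f \<in> borel_measurable borel" and "integrable lborel f"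
 shows "integrable lborel (%x. f (t + c *\<^sub>R x))"
proof -
 have "integrable (density (distr lborel borel (%x. t + c *\<^sub>R x)) (%_. \<bar>c\<bar> ^ DIM(real^3))) f"
  using lborel_affine[OF c, of t] assms(3) by simp
 then have "integrable (distr lborel borel (%x. t + c *\<^sub>R x)) (%x. \<bar>c\<bar> ^ 3 *\<^sub>R f x)"
  by (subst (asm) integrable_density) auto
 then have "integrable lborel (%x. \<bar>c\<bar> ^ 3 *\<^sub>R f (t + c *\<^sub>R x))"
  by (subst (asm) integrable_distr_eq) auto
 then have "integrable lborel (%x. (1 / \<bar>c\<bar> ^ 3) *\<^sub>R (\<bar>c\<bar> ^ 3 *\<^sub>R f (t + c *\<^sub>R x)))"
  by (rule integrable_scaleR_right)
 then show ?thesis using c by simp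
qed

text \<open>\<open>lborel\<close> on \<open>real^3\<close> is the image of a product measure, which
  reduces product functions to one-dimensional integrals.\<close>

lemma lborel_prod_integral:
 fixes f :: "real^3 => real => complex"
 assumes f: "!!b. b \<in> Basis ==> integrable lborel (f b)"
 shows "integrable lborel (%x::real^3. \<Prod>b\<in>Basis. f b (x \<bullet> b))"
  and "(LBINT x. (\<Prod>b\<in>Basis. f b (x \<bullet> b))) = (\<Prod>b\<in>Basis. integral\<^sup>L lborel (f b))"
proof -
 interpret product_sigma_finite "%b::real^3. lborel :: real measure"
  by (simp add: product_sigma_finite_def sigma_finite_lborel)
 have m[measurable]: "f b \<in> borel_measurable borel" if "b \<in> Basis" for b using f[OF that] by auto
 have meas: "(%x::real^3. \<Prod>b\<in>Basis. f b (x \<bullet> b)) \<in> borel_measurable borel"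
  by (intro borel_measurable_prod measurable_compose[OF _ m]) auto
 have T: "(%g. \<Sum>b\<in>Basis. g b *\<^sub>R b) \<in> measurable (\<Pi>\<^sub>M b\<in>(Basis::(real^3) set). lborel) borel"
  by measurable
 have eq: "(\<Prod>b\<in>Basis. f b ((\<Sum>b\<in>Basis. g b *\<^sub>R b) \<bullet> b)) = (\<Prod>b\<in>Basis. f b (g b))" for g
  by (intro prod.cong refl) (simp add: inner_sum_left_Basis)
 show "integrable lborel (%x::real^3. \<Prod>b\<in>Basis. f b (x \<bullet> b))"
  apply (subst lborel_eq)
  unfolding integrable_distr_eq[OF T meas] eq
  by (rule product_integrable_prod) (use f in auto)
 show "(LBINT x. (\<Prod>b\<in>Basis. f b (x \<bullet> b))) = (\<Prod>b\<in>Basis. integral\<^sup>L lborel (f b))"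
  apply (subst lborel_eq)
  unfolding integral_distr[OF T meas] eq
  by (rule product_integral_prod) (use f in auto)
qed

text \<open>The characteristic function of the standard normal distribution, rescaled by
  \<open>sqrt (2 * tau)\<close>.\<close>

lemma gauss_1d:
 fixes z :: real
 assumes "tau > 0"
 shows "has_bochner_integral lborel (%x. exp (- \<i> * cor (z * x)) * cor (exp (- tau * x^2)))
  (cor (sqrt (pi / tau) * exp (- z\<^sup>2 / (4 * tau))))"
proof -
 define s where "s = sqrt (2 * tau)"
 have s: "s > 0" "s^2 = 2 * tau" using assms by (auto simp: s_def)
 define t where "t = - z / s"
 interpret real_distribution std_normal_distribution by (rule real_dist_normal_dist)
 have "char std_normal_distribution t = cor (exp (- t\<^sup>2 / 2))"
  by (simp add: char_std_normal_distribution)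
 moreover have "integrable std_normal_distribution (%x. iexp (t * x))"
  by (rule integrable_const_bound[of _ 1]) auto
 moreover have "integrable std_normal_distribution (%x. iexp (t * x)) \<longleftrightarrow> integrable lborel (%x. std_normal_density x *\<^sub>R iexp (t * x))"
  by (rule integrable_density) auto
 moreover have "integral\<^sup>L std_normal_distribution (%x. iexp (t * x)) = (CLBINT x. std_normal_density x *\<^sub>R iexp (t * x))"
  by (rule integral_density) auto
 ultimately have "has_bochner_integral lborel (%x. std_normal_density x *\<^sub>R iexp (t * x)) (cor (exp (- t\<^sup>2 / 2)))"
  by (simp only: has_bochner_integral_iff char_def simp_thms)
 then have "has_bochner_integral lborel (%x. std_normal_density (0 + s * x) *\<^sub>R iexp (t * (0 + s * x))) (cor (exp (- t\<^sup>2 / 2)) /\<^sub>R \<bar>s\<bar>)"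
  using lborel_has_bochner_integral_real_affine_iff[of s "%x. std_normal_density x *\<^sub>R iexp (t * x)" _ 0] s by simp
 then have "has_bochner_integral lborel (%x. sqrt (2 * pi) *\<^sub>R (std_normal_density (s * x) *\<^sub>R iexp (t * (s * x))))
   (sqrt (2 * pi) *\<^sub>R (cor (exp (- t\<^sup>2 / 2)) /\<^sub>R \<bar>s\<bar>))"
  by (intro has_bochner_integral_scaleR_right) auto
 moreover have "sqrt (2 * pi) *\<^sub>R (std_normal_density (s * x) *\<^sub>R iexp (t * (s * x))) =
   exp (- \<i> * cor (z * x)) * cor (exp (- tau * x^2))" for x
 proof -
  have "t * (s * x) = - (z * x)" using s by (simp add: t_def)
  moreover have "sqrt (2 * pi) * std_normal_density (s * x) = exp (- tau * x^2)"
   using s by (simp add: std_normal_density_def power_mult_distrib)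
  then have "sqrt (2 * pi) *\<^sub>R (std_normal_density (s * x) *\<^sub>R iexp (t * (s * x))) = exp (- tau * x^2) *\<^sub>R iexp (t * (s * x))"
   by (metis scaleR_scaleR)
  ultimately show ?thesis by (simp add: scaleR_conv_of_real mult.commute)
 qed
 moreover have "sqrt (2 * pi) *\<^sub>R (cor (exp (- t\<^sup>2 / 2)) /\<^sub>R \<bar>s\<bar>) = cor (sqrt (pi / tau) * exp (- z\<^sup>2 / (4 * tau)))"
 proof -
  have "sqrt (2 * pi) / s = sqrt (pi / tau)"
   using assms by (simp add: s_def flip: real_sqrt_divide)
  moreover have "- t\<^sup>2 / 2 = - z\<^sup>2 / (4 * tau)" using s assms by (simp add: t_def power_divide)
  moreover have "a *\<^sub>R (cor b /\<^sub>R \<bar>s\<bar>) = cor (a / s * b)" for a b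
   using s(1) by (simp add: complex_eq_iff field_simps)
  ultimately show ?thesis by metis
 qed
 ultimately show ?thesis by simp
qed

lemma gauss_fint:
 fixes z :: "real^3"
 assumes "tau > 0"
 shows "integrable lborel (%x::real^3. cor (exp (- tau * (norm x)^2)))"
  and "fint (%x. cor (exp (- tau * (norm x)^2))) z = cor ((sqrt (pi / tau)) ^ 3 * exp (- (norm z)\<^sup>2 / (4 * tau)))"
proof -
 have nrm: "(norm x)^2 = (\<Sum>b\<in>Basis. (x \<bullet> b)\<^sup>2)" for x :: "real^3"
 proof -
  have "(norm x)^2 = x \<bullet> x" by (rule power2_norm_eq_inner)
  also have "... = (\<Sum>b\<in>Basis. (x \<bullet> b) * (x \<bullet> b))" by (rule euclidean_inner)
  finally show ?thesis by (simp add: power2_eq_square)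
 qed
 define f where "f z b x = exp (- \<i> * cor ((z \<bullet> b) * x)) * cor (exp (- tau * x^2))" for z b :: "real^3" and x
 have I: "integrable lborel (f z b)" "integral\<^sup>L lborel (f z b) = cor (sqrt (pi / tau) * exp (- (z \<bullet> b)\<^sup>2 / (4 * tau)))" for z b
  using gauss_1d[OF assms, of "z \<bullet> b"] by (simp_all add: f_def[abs_def] has_bochner_integral_iff)
 have prod: "(\<Prod>b\<in>Basis. f z b (x \<bullet> b)) = kern x z * cor (exp (- tau * (norm x)^2))" for z x :: "real^3"
 proof -
  have "(\<Prod>b\<in>Basis. f z b (x \<bullet> b)) = (\<Prod>b\<in>Basis. exp (- \<i> * cor ((z \<bullet> b) * (x \<bullet> b)))) * (\<Prod>b\<in>Basis. cor (exp (- tau * (x \<bullet> b)^2)))"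
   by (simp add: f_def prod.distrib)
  also have "(\<Prod>b\<in>Basis. exp (- \<i> * cor ((z \<bullet> b) * (x \<bullet> b)))) = exp (\<Sum>b\<in>Basis. - \<i> * cor ((z \<bullet> b) * (x \<bullet> b)))"
   by (simp add: exp_sum)
  also have "... = kern x z"
   by (simp add: kern_def euclidean_inner[of x z] sum_distrib_left sum_negf mult.commute)
  also have "(\<Prod>b\<in>Basis. cor (exp (- tau * (x \<bullet> b)^2))) = cor (exp (\<Sum>b\<in>Basis. - tau * (x \<bullet> b)^2))"
   by (subst exp_sum) simp_all
  also have "(\<Sum>b\<in>Basis. - tau * (x \<bullet> b)^2) = - tau * (norm x)^2"
   by (simp add: nrm sum_distrib_left)
  finally show ?thesis .
 qed
 show "integrable lborel (%x::real^3. cor (exp (- tau * (norm x)^2)))"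
  using lborel_prod_integral(1)[of "f 0"] I prod[of 0] by (simp add: kern_def)
 have "fint (%x. cor (exp (- tau * (norm x)^2))) z = (\<Prod>b\<in>Basis. cor (sqrt (pi / tau) * exp (- (z \<bullet> b)\<^sup>2 / (4 * tau))))"
  unfolding fint_def prod[symmetric] using lborel_prod_integral(2)[of "f z"] I by simp
 also have "... = cor ((\<Prod>b\<in>(Basis::(real^3) set). sqrt (pi / tau)) * (\<Prod>b\<in>Basis. exp (- (z \<bullet> b)\<^sup>2 / (4 * tau))))"
  by (simp add: prod.distrib)
 also have "(\<Prod>b\<in>(Basis::(real^3) set). sqrt (pi / tau)) = (sqrt (pi / tau)) ^ 3" by simp
 also have "(\<Prod>b\<in>Basis. exp (- (z \<bullet> b)\<^sup>2 / (4 * tau))) = exp (- (norm z)\<^sup>2 / (4 * tau))"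
  by (simp add: exp_sum[symmetric] nrm sum_divide_distrib sum_negf)
 finally show "fint (%x. cor (exp (- tau * (norm x)^2))) z = cor ((sqrt (pi / tau)) ^ 3 * exp (- (norm z)\<^sup>2 / (4 * tau)))" .
qed

section \<open>Plancherel's identity\<close>

lemma cnj_measurable [measurable]: "cnj \<in> borel_measurable borel"
 by (intro borel_measurable_continuous_onI continuous_intros)

text \<open>Continuous functions of compact support: the dense class on which Plancherel's identity
  is computed.\<close>

definition nice :: "(real^3 => complex) => bool" where
 "nice f \<longleftrightarrow> continuous_on UNIV f \<and> (\<exists>R. \<forall>x. norm x > R --> f x = 0)"

lemma nice_measurable: "nice f ==> f \<in> borel_measurable borel"
 unfolding nice_def by (intro borel_measurable_continuous_onI) auto

lemma nice_bounded:
 assumes "nice f" shows "\<exists>M R. 0 <= M \<and> 0 <= R \<and> (\<forall>x. cmod (f x) <= M * indicator (cball 0 R) x)"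
proof -
 obtain R where R: "!!x. norm x > R ==> f x = 0" using assms by (auto simp: nice_def)
 have "compact (f ` cball 0 \<bar>R\<bar>)"
  using assms by (intro compact_continuous_image) (auto simp: nice_def intro: continuous_on_subset)
 then obtain M where M: "M > 0" "!!x. norm x <= \<bar>R\<bar> ==> cmod (f x) <= M"
  using compact_imp_bounded[of "f ` cball 0 \<bar>R\<bar>"] unfolding bounded_pos by auto
 have "cmod (f x) <= M * indicator (cball 0 \<bar>R\<bar>) x" for x
  using M(2)[of x] R[of x] by (cases "norm x <= \<bar>R\<bar>") (auto simp: indicator_def)
 then show ?thesis using M(1) by (intro exI[of _ M] exI[of _ "\<bar>R\<bar>"]) auto
qed

lemma integrable_indicator_cball: "integrable lborel (%x::real^3. M * indicator (cball 0 R) x :: real)"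
 by (intro integrable_mult_right)
  (use emeasure_bounded_finite[of "cball (0::real^3) R"] in \<open>simp add: integrable_indicator_iff\<close>)

lemma nice_integrable: assumes "nice f" shows "integrable lborel f"
proof -
 obtain M R where M: "!!x. cmod (f x) <= M * indicator (cball 0 R) x" using nice_bounded[OF assms] by blast
 show ?thesis
  by (rule bint_bound[OF integrable_indicator_cball[of M R]])
   (use nice_measurable[OF assms] M in \<open>auto intro: order_trans[OF _ abs_ge_self]\<close>)
qed

lemma nice_L2: assumes "nice f" shows "L2fun f"
proof -
 obtain M R where M: "!!x. cmod (f x) <= M * indicator (cball 0 R) x" using nice_bounded[OF assms] by blast
 show ?thesis
 proof (rule L2fun_bound[OF _ integrable_indicator_cball[of "M^2" R]])
  have "(cmod (f x))^2 <= (M * indicator (cball 0 R) x)^2" for x using M[of x] by (intro power_mono) auto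
  moreover have "(M * indicator (cball 0 R) x)^2 = M^2 * indicator (cball 0 R) x" for x :: "real^3"
   by (cases "x \<in> cball 0 R") auto
  ultimately show "AA x. (cmod (f x))\<^sup>2 <= M^2 * indicator (cball 0 R) x" by simp
 qed (use nice_measurable[OF assms] in simp)
qed

text \<open>Gaussian averages of shrinking width form an approximate identity;
  \<open>sqrt pi ^ 3\<close> is the total mass of the Gaussian.\<close>

lemma tendsto_gauss_scaled:
 assumes f: "nice f"
 shows "(%n. LBINT x. f x * (LBINT w. cor (exp (- (norm w)\<^sup>2)) * cnj (f (x - (1 / real (Suc n)) *\<^sub>R w))))
  \<longlonglongrightarrow> cor (sqrt pi ^ 3) * (LBINT x. cor ((cmod (f x))^2))"
proof -
 have [measurable]: "f \<in> borel_measurable borel" by (rule nice_measurable[OF f])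
 obtain M R where M: "M >= 0" "!!x. cmod (f x) <= M * indicator (cball 0 R) x" using nice_bounded[OF f] by blast
 have M': "cmod (f x) <= M" for x using M(2)[of x] M(1) by (cases "x \<in> cball 0 R") auto
 have cont: "isCont f x" for x using f by (auto simp: nice_def continuous_on_eq_continuous_at)
 have gi: "integrable lborel (%w::real^3. M * exp (- (norm w)\<^sup>2))"
 proof -
  have "integrable lborel (%w::real^3. cor (exp (- (norm w)\<^sup>2)))" using gauss_fint(1)[of 1] by simp
  from integrable_norm[OF this] show ?thesis by (intro integrable_mult_right) simp
 qed
 have g0: "(LBINT w. cor (exp (- (norm (w::real^3))\<^sup>2))) = cor (sqrt pi ^ 3)"
  using gauss_fint(2)[of 1 0] by (simp add: fint_def kern_def)
 define J where "J n x = (LBINT w. cor (exp (- (norm w)\<^sup>2)) * cnj (f (x - (1 / real (Suc n)) *\<^sub>R w)))" for n x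
 have Jlim: "(%n. J n x) \<longlonglongrightarrow> (LBINT w. cor (exp (- (norm (w::real^3))\<^sup>2)) * cnj (f x))" for x
  unfolding J_def
 proof (rule integral_dominated_convergence[OF _ _ gi])
  show "AA w. (%n. cor (exp (- (norm w)\<^sup>2)) * cnj (f (x - (1 / real (Suc n)) *\<^sub>R w)))
    \<longlonglongrightarrow> cor (exp (- (norm w)\<^sup>2)) * cnj (f x)"
  proof (rule AE_I2)
   fix w :: "real^3"
   have "(%n. 1 / real (Suc n)) \<longlonglongrightarrow> 0" using LIMSEQ_inverse_real_of_nat by (simp add: inverse_eq_divide)
   then have "(%n. x - (1 / real (Suc n)) *\<^sub>R w) \<longlonglongrightarrow> x - 0 *\<^sub>R w" by (intro tendsto_intros)
   then have "(%n. f (x - (1 / real (Suc n)) *\<^sub>R w)) \<longlonglongrightarrow> f x"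
    using isCont_tendsto_compose[OF cont[of x]] by simp
   then show "(%n. cor (exp (- (norm w)\<^sup>2)) * cnj (f (x - (1 / real (Suc n)) *\<^sub>R w)))
    \<longlonglongrightarrow> cor (exp (- (norm w)\<^sup>2)) * cnj (f x)"
    by (intro tendsto_intros)
  qed
  show "AA w. norm (cor (exp (- (norm w)\<^sup>2)) * cnj (f (x - (1 / real (Suc n)) *\<^sub>R w))) <= M * exp (- (norm w)\<^sup>2)" for n
   using M' by (simp add: norm_mult mult.commute mult_right_mono)
 qed measurable
 have Jb: "cmod (J n x) <= M * sqrt pi ^ 3" for n x
 proof -
  have bd: "norm (cor (exp (- (norm w)\<^sup>2)) * cnj (f (x - (1 / real (Suc n)) *\<^sub>R w))) <= M * exp (- (norm w)\<^sup>2)" for w :: "real^3"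
   using M' by (simp add: norm_mult mult.commute mult_right_mono)
  have "cmod (J n x) <= (LBINT w. norm (cor (exp (- (norm w)\<^sup>2)) * cnj (f (x - (1 / real (Suc n)) *\<^sub>R w))))"
   unfolding J_def by (rule integral_norm_bound)
  also have "... <= (LBINT w. M * exp (- (norm (w::real^3))\<^sup>2))"
  proof (rule integral_mono[OF integrable_norm gi bd])
   show "integrable lborel (%w. cor (exp (- (norm w)\<^sup>2)) * cnj (f (x - (1 / real (Suc n)) *\<^sub>R w)))"
   proof (rule bint_bound[OF gi])
    show "AA w. norm (cor (exp (- (norm w)\<^sup>2)) * cnj (f (x - (1 / real (Suc n)) *\<^sub>R w))) <= norm (M * exp (- (norm w)\<^sup>2))"
     using bd M(1) by simp
   qed measurable
  qed
  also have "... = M * sqrt pi ^ 3"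
  proof -
   have "cor (LBINT w. exp (- (norm (w::real^3))\<^sup>2)) = cor (sqrt pi ^ 3)"
    using g0 by (simp only: integral_complex_of_real)
   then show ?thesis by (simp only: of_real_eq_iff integral_mult_right_zero)
  qed
  finally show ?thesis .
 qed
 have Jm [measurable]: "J n \<in> borel_measurable borel" for n unfolding J_def[abs_def] by measurable
 have "(%n. LBINT x. f x * J n x) \<longlonglongrightarrow> (LBINT x. f x * (LBINT w. cor (exp (- (norm (w::real^3))\<^sup>2)) * cnj (f x)))"
 proof (rule integral_dominated_convergence)
  show "integrable lborel (%x::real^3. M * (M * sqrt pi ^ 3) * indicator (cball 0 R) x)" by (rule integrable_indicator_cball)
  show "AA x. (%n. f x * J n x) \<longlonglongrightarrow> f x * (LBINT w. cor (exp (- (norm (w::real^3))\<^sup>2)) * cnj (f x))"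
   by (intro AE_I2 tendsto_intros Jlim)
  show "AA x. norm (f x * J n x) <= M * (M * sqrt pi ^ 3) * indicator (cball 0 R) x" for n
  proof (rule AE_I2)
   fix x
   have "norm (f x * J n x) <= (M * indicator (cball 0 R) x) * (M * sqrt pi ^ 3)"
    unfolding norm_mult using M Jb by (intro mult_mono) auto
   then show "norm (f x * J n x) <= M * (M * sqrt pi ^ 3) * indicator (cball 0 R) x" by (simp add: mult_ac)
  qed
 qed measurable
 moreover have "f x * (LBINT w. cor (exp (- (norm (w::real^3))\<^sup>2)) * cnj (f x)) = cor (sqrt pi ^ 3) * cor ((cmod (f x))^2)" for x
 proof -
  have "(LBINT w. cor (exp (- (norm (w::real^3))\<^sup>2)) * cnj (f x)) = cor (sqrt pi ^ 3) * cnj (f x)"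
   by (simp only: integral_mult_left_zero g0)
  then show ?thesis by (simp only: complex_norm_square mult_ac)
 qed
 ultimately show ?thesis by (simp only: J_def integral_mult_right_zero)
qed

text \<open>The Gaussian weight makes all integrals absolutely convergent. The multiplication
  formula moves the transform from \<open>f\<close> to the Gaussian times
  \<open>cnj (fint f)\<close>, whose transform is a Gaussian average of \<open>cnj f\<close>; the
  substitution with factor \<open>2 * sqrt tau\<close> normalizes the Gaussian.\<close>

lemma gauss_parseval:
 assumes f: "nice f" and tau: "tau > 0"
 shows "cor (LBINT xi. exp (- tau * (norm xi)^2) * (cmod (fint f xi))^2)
  = cor (8 * sqrt pi ^ 3) * (LBINT x. f x * (LBINT w. cor (exp (- (norm w)\<^sup>2)) * cnj (f (x - (2 * sqrt tau) *\<^sub>R w))))"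
proof -
 have [measurable]: "f \<in> borel_measurable borel" by (rule nice_measurable[OF f])
 have fi: "integrable lborel f" by (rule nice_integrable[OF f])
 have [measurable]: "fint f \<in> borel_measurable borel" by (rule fint_measurable) measurable
 define v where "v xi = cor (exp (- tau * (norm xi)^2)) * cnj (fint f xi)" for xi
 have gi: "integrable lborel (%x::real^3. cor (exp (- tau * (norm x)^2)))" using gauss_fint(1)[OF tau] .
 have bnd: "cmod (fint f xi) <= (LBINT x. cmod (f x))" for xi by (rule fint_bound[OF fi])
 have vi: "integrable lborel v"
 proof (rule bint_bound)
  show "integrable lborel (%xi::real^3. cor (exp (- tau * (norm xi)^2)) * cor (LBINT x. cmod (f x)))"
   by (rule integrable_mult_left) (rule gi)
  show "v \<in> borel_measurable lborel" unfolding v_def[abs_def] by measurable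
  show "AA x. norm (v x) <= norm (cor (exp (- tau * (norm x)^2)) * cor (LBINT x. cmod (f x)))"
   using bnd by (auto simp: v_def norm_mult intro!: mult_left_mono order_trans[OF _ abs_ge_self])
 qed
 \<comment> \<open>Its transform is the conjugate of \<open>fint f\<close>, which allows a second
   use of the multiplication formula.\<close>
 define fs where "fs y = cnj (f (- y))" for y
 have fsi: "integrable lborel fs"
 proof -
  have "integrable lborel (%x. f (0 + (- 1) *\<^sub>R x))"
   by (rule lborel_integrable_affine[OF _ _ fi]) auto
  then show ?thesis unfolding fs_def[abs_def] by simp
 qed
 have fs_fint: "fint fs xi = cnj (fint f xi)" for xi
 proof -
  have "cnj (fint f xi) = (LBINT x. cnj (kern x xi * f x))" unfolding fint_def
   by (rule integral_bounded_linear[OF bounded_linear_cnj fint_integrable[OF fi], symmetric])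
  also have "... = \<bar>- 1\<bar> ^ 3 *\<^sub>R (LBINT x. cnj (kern (0 + (- 1) *\<^sub>R x) xi * f (0 + (- 1) *\<^sub>R x)))"
   by (rule lborel_integral_affine) auto
  also have "... = fint fs xi" by (simp add: fint_def fs_def kern_uminus)
  finally show ?thesis by simp
 qed
 have fv: "fint v x = (LBINT y. cor (sqrt (pi / tau) ^ 3 * exp (- (norm (x + y))\<^sup>2 / (4 * tau))) * fs y)" for x
 proof -
  define e where "e xi = kern x xi * cor (exp (- tau * (norm xi)^2))" for xi
  have ei: "integrable lborel e"
   by (rule bint_bound[OF gi]) (auto simp: e_def[abs_def] norm_mult)
  have "fint v x = (LBINT xi. fint fs xi * e xi)"
   unfolding fint_def[of v] by (simp add: v_def e_def fs_fint kern_commute[of _ x] mult_ac)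
  also have "... = (LBINT y. fs y * fint e y)" by (rule fint_mult[OF fsi ei])
  also have "... = (LBINT y. cor (sqrt (pi / tau) ^ 3 * exp (- (norm (x + y))\<^sup>2 / (4 * tau))) * fs y)"
  proof -
   have "fint e y = fint (%x. cor (exp (- tau * (norm x)^2))) (x + y)" for y
    unfolding fint_def e_def
    by (simp add: kern_commute[of _ "x + y"] kern_commute[of _ y] kern_add mult_ac)
   then show ?thesis by (simp only: gauss_fint(2)[OF tau] mult.commute)
  qed
  finally show ?thesis .
 qed
 define c where "c = 2 * sqrt tau"
 have c: "c > 0" "c^2 = 4 * tau" "c ^ 3 * sqrt (pi / tau) ^ 3 = 8 * sqrt pi ^ 3"
  using tau by (auto simp: c_def power_mult_distrib real_sqrt_divide power_divide)
 have fv2: "fint v x = cor (8 * sqrt pi ^ 3) * (LBINT w. cor (exp (- (norm w)\<^sup>2)) * cnj (f (x - c *\<^sub>R w)))" for x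
 proof -
  have "fint v x = \<bar>c\<bar> ^ 3 *\<^sub>R (LBINT w. cor (sqrt (pi / tau) ^ 3 * exp (- (norm (x + (- x + c *\<^sub>R w)))\<^sup>2 / (4 * tau))) * fs (- x + c *\<^sub>R w))"
   unfolding fv by (rule lborel_integral_affine) (use c in \<open>auto simp: fs_def\<close>)
  also have "(%w. cor (sqrt (pi / tau) ^ 3 * exp (- (norm (x + (- x + c *\<^sub>R w)))\<^sup>2 / (4 * tau))) * fs (- x + c *\<^sub>R w))
   = (%w. cor (sqrt (pi / tau) ^ 3) * (cor (exp (- (norm w)\<^sup>2)) * cnj (f (x - c *\<^sub>R w))))"
   using c tau by (auto simp: fs_def power_mult_distrib)
  also have "\<bar>c\<bar> ^ 3 *\<^sub>R (LBINT w. cor (sqrt (pi / tau) ^ 3) * (cor (exp (- (norm w)\<^sup>2)) * cnj (f (x - c *\<^sub>R w))))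
   = cor (c ^ 3 * sqrt (pi / tau) ^ 3) * (LBINT w. cor (exp (- (norm w)\<^sup>2)) * cnj (f (x - c *\<^sub>R w)))"
   using c(1) by (simp add: scaleR_conv_of_real)
  finally show ?thesis unfolding c(3) .
 qed
 have "cor (LBINT xi. exp (- tau * (norm xi)^2) * (cmod (fint f xi))^2)
  = (LBINT xi. cor (exp (- tau * (norm xi)^2) * (cmod (fint f xi))^2))"
  by (simp only: integral_complex_of_real)
 also have "... = (LBINT xi. fint f xi * v xi)"
 proof (rule arg_cong[where f = "integral\<^sup>L lborel"], rule ext)
  fix xi
  have "cor ((cmod (fint f xi))^2) = fint f xi * cnj (fint f xi)" by (rule complex_norm_square)
  then show "cor (exp (- tau * (norm xi)^2) * (cmod (fint f xi))^2) = fint f xi * v xi"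
   by (simp add: v_def mult_ac)
 qed
 also have "... = (LBINT x. f x * fint v x)" by (rule fint_mult[OF fi vi])
 also have "... = cor (8 * sqrt pi ^ 3) * (LBINT x. f x * (LBINT w. cor (exp (- (norm w)\<^sup>2)) * cnj (f (x - c *\<^sub>R w))))"
  unfolding fv2 by (simp add: mult.left_commute[of "f _"] del: of_real_mult of_real_power)
 finally show ?thesis unfolding c_def .
qed

text \<open>The Gaussian weight is removed by monotone convergence on the frequency side and by the
  approximate identity on the other.\<close>

lemma plancherel_nice:
 assumes f: "nice f"
 shows "(\<integral>\<^sup>+xi. ennreal ((cmod (fint f xi))^2) \<partial>lborel) = ennreal ((2 * pi) ^ 3) * (\<integral>\<^sup>+x. ennreal ((cmod (f x))^2) \<partial>lborel)"
proof -
 have [measurable]: "f \<in> borel_measurable borel" by (rule nice_measurable[OF f])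
 have fi: "integrable lborel f" by (rule nice_integrable[OF f])
 have [measurable]: "fint f \<in> borel_measurable borel" by (rule fint_measurable) measurable
 \<comment> \<open>Chosen so that \<open>2 * sqrt (tau n)\<close> is the width
   \<open>1 / real (Suc n)\<close> in \<open>tendsto_gauss_scaled\<close>.\<close>
 define tau where "tau n = (1 / (2 * real (Suc n)))^2" for n
 have tau: "tau n > 0" "2 * sqrt (tau n) = 1 / real (Suc n)" for n
  by (simp_all add: tau_def) (simp add: field_simps)
 define u where "u n xi = exp (- tau n * (norm xi)^2) * (cmod (fint f xi))^2" for n and xi :: "real^3"
 define A where "A = (LBINT x. (cmod (f x))\<^sup>2)"
 have "(%n. cor (LBINT xi. u n xi)) \<longlonglongrightarrow> cor (8 * sqrt pi ^ 3) * (cor (sqrt pi ^ 3) * (LBINT x. cor ((cmod (f x))^2)))"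
  unfolding u_def gauss_parseval[OF f tau(1)] tau(2) by (intro tendsto_mult tendsto_const tendsto_gauss_scaled[OF f])
 also have "cor (8 * sqrt pi ^ 3) * (cor (sqrt pi ^ 3) * (LBINT x. cor ((cmod (f x))^2))) = cor ((2 * pi) ^ 3 * A)"
 proof -
  have "sqrt pi ^ 3 * sqrt pi ^ 3 = pi ^ 3" by (simp flip: power_mult_distrib)
  then have "8 * sqrt pi ^ 3 * (sqrt pi ^ 3 * A) = (2 * pi) ^ 3 * A" by (simp add: power_mult_distrib mult.assoc[symmetric])
  then show ?thesis unfolding A_def by (metis integral_complex_of_real of_real_mult)
 qed
 finally have lim: "(%n. LBINT xi. u n xi) \<longlonglongrightarrow> (2 * pi) ^ 3 * A" by (simp only: tendsto_of_real_iff)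
 have ui: "integrable lborel (u n)" for n
 proof (rule bint_bound)
  show "integrable lborel (%xi::real^3. cor (exp (- tau n * (norm xi)^2)) * cor ((LBINT x. cmod (f x))^2))"
   by (rule integrable_mult_left) (rule gauss_fint(1)[OF tau(1)[of n]])
  show "u n \<in> borel_measurable lborel" unfolding u_def[abs_def] by measurable
  show "AA x. norm (u n x) <= norm (cor (exp (- tau n * (norm x)^2)) * cor ((LBINT x. cmod (f x))^2))"
  proof (rule AE_I2)
   fix x :: "real^3"
   have "(cmod (fint f x))^2 <= (LBINT x. cmod (f x))^2" using fint_bound[OF fi] by (intro power_mono) auto
   then have "u n x <= exp (- tau n * (norm x)^2) * (LBINT x. cmod (f x))^2"
    unfolding u_def by (intro mult_left_mono) auto
   then show "norm (u n x) <= norm (cor (exp (- tau n * (norm x)^2)) * cor ((LBINT x. cmod (f x))^2))"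
    by (simp only: norm_of_real flip: of_real_mult) (simp add: u_def)
  qed
 qed
 have "(%n. \<integral>\<^sup>+xi. ennreal (u n xi) \<partial>lborel) \<longlonglongrightarrow> (\<integral>\<^sup>+xi. ennreal ((cmod (fint f xi))^2) \<partial>lborel)"
 proof (rule nn_integral_LIMSEQ)
  show "incseq (%n xi. ennreal (u n xi))"
  proof (rule incseq_SucI, rule le_funI, rule ennreal_leI)
   fix n and xi :: "real^3"
   have "tau (Suc n) <= tau n" unfolding tau_def by (intro power_mono divide_left_mono) auto
   then have "tau (Suc n) * (norm xi)^2 <= tau n * (norm xi)^2" by (rule mult_right_mono) simp
   then show "u n xi <= u (Suc n) xi" unfolding u_def by (intro mult_right_mono) auto
  qed
  show "(%xi. ennreal (u n xi)) \<in> borel_measurable lborel" for n unfolding u_def by measurable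
  show "(%n. ennreal (u n xi)) \<longlonglongrightarrow> ennreal ((cmod (fint f xi))^2)" for xi :: "real^3"
  proof (rule tendsto_ennrealI)
   have "(%n. 1 / real (Suc n)) \<longlonglongrightarrow> 0" using LIMSEQ_inverse_real_of_nat by (simp add: inverse_eq_divide)
   then have "(%n. (1 / 2 * (1 / real (Suc n)))\<^sup>2) \<longlonglongrightarrow> (1 / 2 * 0)\<^sup>2" by (intro tendsto_intros)
   then have "tau \<longlonglongrightarrow> 0" unfolding tau_def[abs_def] by simp
   then have "(%n. u n xi) \<longlonglongrightarrow> exp (- 0 * (norm xi)^2) * (cmod (fint f xi))^2"
    unfolding u_def by (intro tendsto_intros)
   then show "(%n. u n xi) \<longlonglongrightarrow> (cmod (fint f xi))\<^sup>2" by simp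
  qed
 qed
 moreover have "(\<integral>\<^sup>+xi. ennreal (u n xi) \<partial>lborel) = ennreal (LBINT xi. u n xi)" for n
  by (rule nn_integral_eq_integral[OF ui]) (simp add: u_def)
 ultimately have "(\<integral>\<^sup>+xi. ennreal ((cmod (fint f xi))^2) \<partial>lborel) = ennreal ((2 * pi) ^ 3 * A)"
  using tendsto_ennrealI[OF lim] LIMSEQ_unique by auto
 also have "... = ennreal ((2 * pi) ^ 3) * ennreal A" by (simp add: ennreal_mult A_def)
 also have "ennreal A = (\<integral>\<^sup>+x. ennreal ((cmod (f x))^2) \<partial>lborel)"
  unfolding A_def using nice_L2[OF f] by (intro nn_integral_eq_integral[symmetric]) (auto simp: L2fun_def)
 finally show ?thesis .
qed

text \<open>A measurable function is almost everywhere a limit of continuous ones; the radial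
  retraction \<open>\<phi>\<close> onto the ball of radius \<open>M\<close> and the cutoff
  \<open>chi\<close> impose bound and support without changing the limit.\<close>

lemma nice_approx:
 fixes f :: "real^3 => complex"
 assumes f[measurable]: "f \<in> borel_measurable borel" and M: "M > 0" "!!x. cmod (f x) <= M" and R: "!!x. norm x > R ==> f x = 0"
 shows "\<exists>g. (\<forall>n. nice (g n)) \<and> (\<forall>n x. cmod (g n x) <= M * indicator (cball 0 (R + 1)) x) \<and> (AA x. (%n. g n x) \<longlonglongrightarrow> f x)"
proof -
 have "f \<in> borel_measurable lebesgue" using f by (intro measurable_completion) simp
 then have "f measurable_on UNIV" by (rule lebesgue_measurable_imp_measurable_on) simp
 then obtain N g where g: "negligible N" "!!n. continuous_on UNIV (g n)" "!!x. x \<notin> N ==> (%n. g n x) \<longlonglongrightarrow> f x"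
  unfolding measurable_on_def by auto
 define \<phi> where "\<phi> z = (M / max M (cmod z)) *\<^sub>R z" for z :: complex
 define chi where "chi x = max 0 (min 1 (R + 1 - norm x))" for x :: "real^3"
 have \<phi>c: "continuous_on UNIV \<phi>" unfolding \<phi>_def using M(1) by (intro continuous_intros) auto
 have chic: "continuous_on UNIV chi" unfolding chi_def by (intro continuous_intros)
 have \<phi>b: "cmod (\<phi> z) <= M" for z
  using M(1) by (auto simp: \<phi>_def max_def field_simps)
 have \<phi>f: "\<phi> (f x) = f x" for x using M by (simp add: \<phi>_def max_absorb1)
 define h where "h n x = chi x *\<^sub>R \<phi> (g n x)" for n x
 have "nice (h n)" for n
  unfolding nice_def
 proof
  show "continuous_on UNIV (h n)" unfolding h_def
   by (intro continuous_intros chic continuous_on_compose2[OF \<phi>c g(2)]) auto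
  show "\<exists>R. \<forall>x. norm x > R --> h n x = 0" by (intro exI[of _ "R + 1"]) (auto simp: h_def chi_def)
 qed
 moreover have "cmod (h n x) <= M * indicator (cball 0 (R + 1)) x" for n x
 proof (cases "norm x <= R + 1")
  case True
  have "cmod (h n x) <= 1 * M" unfolding h_def norm_scaleR using \<phi>b by (intro mult_mono) (auto simp: chi_def)
  then show ?thesis using True by simp
 qed (auto simp: h_def chi_def)
 moreover have "AA x. (%n. h n x) \<longlonglongrightarrow> f x"
 proof -
  have "AE x in lebesgue. x \<notin> N" using g(1) by (simp add: negligible_iff_null_sets AE_not_in)
  then have "AA x. x \<notin> N" by (simp add: AE_completion_iff)
  then show ?thesis
  proof eventually_elim
   case (elim x)
   have "(%n. \<phi> (g n x)) \<longlonglongrightarrow> \<phi> (f x)"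
    by (rule continuous_on_tendsto_compose[OF \<phi>c g(3)[OF elim]]) auto
   then have "(%n. h n x) \<longlonglongrightarrow> chi x *\<^sub>R \<phi> (f x)" unfolding h_def by (intro tendsto_intros)
   moreover have "chi x *\<^sub>R f x = f x" using R[of x] by (cases "norm x > R") (auto simp: chi_def)
   ultimately show ?case by (simp add: \<phi>f)
  qed
 qed
 ultimately show ?thesis by blast
qed

text \<open>Fatou's lemma for the transforms, dominated convergence for the functions. Only an
  inequality survives; equality is recovered by density in \<open>norm_FTc\<close>.\<close>

lemma bessel_bound_limit:
 fixes f :: "real^3 => complex"
 assumes fm[measurable]: "f \<in> borel_measurable borel" and gm[measurable]: "!!n. g n \<in> borel_measurable borel"
  and h: "integrable lborel h" "integrable lborel (%x. (h x)\<^sup>2)"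
  and bound: "!!n x. cmod (g n x) <= h x"
  and lim: "AA x. (%n. g n x) \<longlonglongrightarrow> f x"
  and bessel: "!!n. (\<integral>\<^sup>+xi. ennreal ((cmod (fint (g n) xi))^2) \<partial>lborel) <= C * (\<integral>\<^sup>+x. ennreal ((cmod (g n x))^2) \<partial>lborel)"
  and C: "C < \<infinity>"
 shows "(\<integral>\<^sup>+xi. ennreal ((cmod (fint f xi))^2) \<partial>lborel) <= C * (\<integral>\<^sup>+x. ennreal ((cmod (f x))^2) \<partial>lborel)"
proof -
 have [measurable]: "fint f \<in> borel_measurable borel" "!!n. fint (g n) \<in> borel_measurable borel"
  by (rule fint_measurable, measurable)+
 have fl: "(%n. fint (g n) xi) \<longlonglongrightarrow> fint f xi" for xi
  unfolding fint_def
 proof (rule integral_dominated_convergence[OF _ _ h(1)])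
  show "AA x. (%n. kern x xi * g n x) \<longlonglongrightarrow> kern x xi * f x"
   using lim by eventually_elim (intro tendsto_intros)
  show "AA x. norm (kern x xi * g n x) <= h x" for n using bound by (simp add: norm_mult)
 qed measurable
 have "(\<integral>\<^sup>+xi. ennreal ((cmod (fint f xi))^2) \<partial>lborel) = (\<integral>\<^sup>+xi. liminf (%n. ennreal ((cmod (fint (g n) xi))^2)) \<partial>lborel)"
 proof (rule nn_integral_cong)
  fix xi
  have T: "(%n. ennreal ((cmod (fint (g n) xi))^2)) \<longlonglongrightarrow> ennreal ((cmod (fint f xi))^2)"
   by (intro tendsto_ennrealI tendsto_intros fl)
  show "ennreal ((cmod (fint f xi))^2) = liminf (%n. ennreal ((cmod (fint (g n) xi))^2))"
   by (rule lim_imp_Liminf[OF sequentially_bot T, symmetric])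
 qed
 also have "... <= liminf (%n. \<integral>\<^sup>+xi. ennreal ((cmod (fint (g n) xi))^2) \<partial>lborel)"
  by (rule nn_integral_liminf) measurable
 also have "... <= liminf (%n. C * (\<integral>\<^sup>+x. ennreal ((cmod (g n x))^2) \<partial>lborel))"
  by (rule Liminf_mono) (simp add: bessel)
 also have "... = C * (\<integral>\<^sup>+x. ennreal ((cmod (f x))^2) \<partial>lborel)"
 proof (rule lim_imp_Liminf[OF sequentially_bot])
  have "(%n. \<integral>\<^sup>+x. ennreal ((cmod (g n x))^2) \<partial>lborel) \<longlonglongrightarrow> (\<integral>\<^sup>+x. ennreal ((cmod (f x))^2) \<partial>lborel)"
  proof (rule nn_integral_dominated_convergence[where w = "%x. ennreal ((h x)^2)"])
   show "AA x. ennreal ((cmod (g n x))^2) <= ennreal ((h x)^2)" for n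
    using bound by (intro AE_I2 ennreal_leI power_mono) auto
   show "(\<integral>\<^sup>+x. ennreal ((h x)^2) \<partial>lborel) < \<infinity>" using h(2) by (simp add: integrable_iff_bounded)
   show "AA x. (%n. ennreal ((cmod (g n x))^2)) \<longlonglongrightarrow> ennreal ((cmod (f x))^2)"
    using lim by eventually_elim (intro tendsto_ennrealI tendsto_intros)
  qed (use h(1) in measurable)
  then show "(%n. C * (\<integral>\<^sup>+x. ennreal ((cmod (g n x))^2) \<partial>lborel)) \<longlonglongrightarrow> C * (\<integral>\<^sup>+x. ennreal ((cmod (f x))^2) \<partial>lborel)"
   using C by (intro ennreal_tendsto_cmult) auto
 qed
 finally show ?thesis .
qed

lemma bounded_support_integrable:
 assumes "L2fun f" "!!x. norm x > R ==> f x = (0::complex)"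
 shows "integrable lborel f"
proof (rule bint_bound)
 show "integrable lborel (%x. 1 * indicator (cball 0 R) x + (cmod (f x))^2)"
  using L2fun_integrable[OF assms(1)] integrable_indicator_cball by (rule bint_add[rotated])
 show "f \<in> borel_measurable lborel" using L2fun_measurable[OF assms(1)] by simp
 have "cmod (f x) <= 1 * indicator (cball 0 R) x + (cmod (f x))^2" for x
 proof (cases "norm x > R")
  case False
  have "2 * cmod (f x) <= 1 + (cmod (f x))^2" using zero_le_power2[of "cmod (f x) - 1"] by (simp add: power2_diff)
  then have "cmod (f x) <= 1 + (cmod (f x))^2" using norm_ge_zero[of "f x"] by linarith
  then show ?thesis using False by simp
 qed (use assms(2) in simp)
 then show "AA x. norm (f x) <= norm (1 * indicator (cball 0 R) x + (cmod (f x))^2)"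
  by (auto intro: order_trans[OF _ abs_ge_self])
qed

text \<open>Two passages to the limit: from continuous functions to bounded measurable ones on a
  ball, then by truncating values to square integrable ones.\<close>

lemma bessel_bound:
 assumes f: "L2fun f" "!!x. norm x > R ==> f x = (0::complex)"
 shows "(\<integral>\<^sup>+xi. ennreal ((cmod (fint f xi))^2) \<partial>lborel) <= ennreal ((2 * pi) ^ 3) * (\<integral>\<^sup>+x. ennreal ((cmod (f x))^2) \<partial>lborel)"
proof -
 have [measurable]: "f \<in> borel_measurable borel" using f by auto
 have bounded: "(\<integral>\<^sup>+xi. ennreal ((cmod (fint g xi))^2) \<partial>lborel) <= ennreal ((2 * pi) ^ 3) * (\<integral>\<^sup>+x. ennreal ((cmod (g x))^2) \<partial>lborel)"
  if gm[measurable]: "g \<in> borel_measurable borel" and g: "!!x. norm x > R ==> g x = 0" "M > 0" "!!x. cmod (g x) <= M" for g M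
 proof -
  obtain k where k: "!!n. nice (k n)" "!!n x. cmod (k n x) <= M * indicator (cball 0 (R + 1)) x" "AA x. (%n. k n x) \<longlonglongrightarrow> g x"
   using nice_approx[OF gm g(2,3,1)] by blast
  show ?thesis
  proof (rule bessel_bound_limit[OF gm nice_measurable[OF k(1)] integrable_indicator_cball _ k(2,3)])
   have "(M * indicator (cball 0 (R + 1)) x)^2 = M^2 * indicator (cball 0 (R + 1)) x" for x :: "real^3"
    by (cases "x \<in> cball 0 (R + 1)") auto
   then show "integrable lborel (%x::real^3. (M * indicator (cball 0 (R + 1)) x)\<^sup>2)"
    using integrable_indicator_cball by simp
  qed (simp_all add: plancherel_nice[OF k(1)])
 qed
 show ?thesis
 proof (rule bessel_bound_limit[where g = "%n x. if cmod (f x) <= real n then f x else 0" and h = "%x. cmod (f x)"])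
  show "integrable lborel (%x. cmod (f x))" using bounded_support_integrable[OF f] by (rule integrable_norm)
  show "integrable lborel (%x. (cmod (f x))\<^sup>2)" by (rule L2fun_integrable[OF f(1)])
  show "AA x. (%n. if cmod (f x) <= real n then f x else 0) \<longlonglongrightarrow> f x"
  proof (rule AE_I2)
   fix x
   obtain N where N: "cmod (f x) <= real N" using real_arch_simple by blast
   show "(%n. if cmod (f x) <= real n then f x else 0) \<longlonglongrightarrow> f x"
    by (rule tendsto_eventually) (use N in \<open>auto simp: eventually_sequentially intro!: exI[of _ N]\<close>)
  qed
  show "(\<integral>\<^sup>+xi. ennreal ((cmod (fint (%x. if cmod (f x) <= real n then f x else 0) xi))^2) \<partial>lborel)
   <= ennreal ((2 * pi) ^ 3) * (\<integral>\<^sup>+x. ennreal ((cmod (if cmod (f x) <= real n then f x else 0))^2) \<partial>lborel)" for n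
   by (rule bounded[where M = "real n + 1"]) (use f(2) in auto)
  show "(%x. if cmod (f x) <= real n then f x else 0) \<in> borel_measurable borel" for n by measurable
  show "f \<in> borel_measurable borel" by measurable
  show "cmod (if cmod (f x) <= real n then f x else 0) <= cmod (f x)" for n x by simp
 qed simp
qed

section \<open>The Fourier transform on square integrable functions\<close>

definition cut :: "real => complex L2 => complex L2" where
 "cut R f = abs_L2 (%x. indicator (cball 0 R) x *\<^sub>R rep_L2 f x)"

lemma L2fun_indicator:
 fixes f :: "real^3 => 'b::euclidean_space"
 assumes "L2fun f" and [measurable]: "A \<in> sets borel"
 shows "L2fun (%x. indicator A x *\<^sub>R f x)"
proof (rule L2fun_bound[OF _ L2fun_integrable[OF assms(1)]])
 have [measurable]: "f \<in> borel_measurable borel" using assms(1) by auto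
 show "(%x. indicator A x *\<^sub>R f x) \<in> borel_measurable lborel" by measurable
qed (simp add: indicator_def)

lemma L2fun_cut: "L2fun (%x. indicator (cball 0 R) x *\<^sub>R rep_L2 f x)" for f :: "'b::euclidean_space L2"
 by (rule L2fun_indicator) auto

lemma rep_cut: "AA x. rep_L2 (cut R f) x = indicator (cball 0 R) x *\<^sub>R rep_L2 f x"
 unfolding cut_def by (rule rep_abs[OF L2fun_cut])

lemma cut_add: "cut R (f + g) = cut R f + cut R g"
 by (rule L2_eqI, use rep_cut[of R "f + g"] rep_cut[of R f] rep_cut[of R g] rep_add[of f g] rep_add[of "cut R f" "cut R g"] in eventually_elim)
  (simp add: scaleR_add_right)

lemma cut_scaleR: "cut R (r *\<^sub>R f) = r *\<^sub>R cut R f"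
 by (rule L2_eqI, use rep_cut[of R "r *\<^sub>R f"] rep_cut[of R f] rep_scaleR[of r f] rep_scaleR[of r "cut R f"] in eventually_elim)
  simp

lemma L2_norm_mono:
 fixes f :: "'b::euclidean_space L2" and g :: "'c::euclidean_space L2"
 assumes "AA x. norm (rep_L2 f x) <= C * norm (rep_L2 g x)" "0 <= C"
 shows "norm f <= C * norm g"
proof (rule power2_le_imp_le)
 have "(norm f)^2 = (LBINT x. (norm (rep_L2 f x))\<^sup>2)" by (rule norm_L2_square)
 also have "... <= (LBINT x. C\<^sup>2 * (norm (rep_L2 g x))^2)"
 proof (rule integral_mono_AE)
  show "AA x. (norm (rep_L2 f x))\<^sup>2 <= C^2 * (norm (rep_L2 g x))^2"
   using assms(1)
  proof eventually_elim
   case (elim x)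
   then have "(norm (rep_L2 f x))^2 <= (C * norm (rep_L2 g x))^2" by (intro power_mono) auto
   then show ?case by (simp add: power_mult_distrib)
  qed
 qed (auto intro: L2fun_integrable integrable_mult_right)
 also have "... = (C * norm g)^2" by (simp add: norm_L2_square power_mult_distrib)
 finally show "(norm f)^2 <= (C * norm g)^2" .
qed (use assms(2) in simp)

lemma cut_norm: "norm (cut R f) <= norm f"
proof -
 have "AA x. norm (rep_L2 (cut R f) x) <= 1 * norm (rep_L2 f x)"
  using rep_cut[of R f] by eventually_elim (auto simp: indicator_def)
 from L2_norm_mono[OF this] show ?thesis by simp
qed

lemma L2_tendsto_dominated:
 fixes f :: "nat => real^3 => 'b::euclidean_space"
 assumes f: "!!n. L2fun (f n)" and g: "L2fun g" and w: "L2fun w"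
  and bound: "!!n. AA x. norm (f n x) <= norm (w x)"
  and lim: "AA x. (%n. f n x) \<longlonglongrightarrow> g x"
 shows "(%n. abs_L2 (f n)) \<longlonglongrightarrow> abs_L2 g"
proof (rule LIM_zero_cancel)
 have [measurable]: "!!n. f n \<in> borel_measurable borel" "g \<in> borel_measurable borel" "w \<in> borel_measurable borel"
  using f g w by auto
 have "(%n. LBINT x. (norm (f n x - g x))\<^sup>2) \<longlonglongrightarrow> (LINT x::real^3|lborel. 0)"
 proof (rule integral_dominated_convergence)
  show "integrable lborel (%x. 2 * (norm (w x))^2 + 2 * (norm (g x))^2)"
   using L2fun_integrable[OF w] L2fun_integrable[OF g] by auto
  show "AA x. (%n. (norm (f n x - g x))\<^sup>2) \<longlonglongrightarrow> 0"
   using lim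
  proof eventually_elim
   case (elim x)
   then have "(%n. (norm (f n x - g x))\<^sup>2) \<longlonglongrightarrow> (norm (g x - g x))\<^sup>2" by (intro tendsto_intros)
   then show ?case by simp
  qed
  show "AA x. norm ((norm (f n x - g x))^2) <= 2 * (norm (w x))^2 + 2 * (norm (g x))^2" for n
   using bound[of n]
  proof eventually_elim
   case (elim x)
   have "(norm (f n x - g x))^2 <= 2 * (norm (f n x))^2 + 2 * (norm (g x))^2"
    using norm_add_square_le[of "f n x" "- g x"] by simp
   also have "(norm (f n x))^2 <= (norm (w x))^2" using elim by (intro power_mono) auto
   finally show ?case by simp
  qed
 qed measurable
 then have "(%n. (norm (abs_L2 (f n) - abs_L2 g))\<^sup>2) \<longlonglongrightarrow> 0"
  using norm_abs_L2[OF L2fun_diff[OF f g]] by (simp add: abs_L2_diff f g)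
 then have "(%n. sqrt ((norm (abs_L2 (f n) - abs_L2 g))^2)) \<longlonglongrightarrow> sqrt 0" by (intro tendsto_intros)
 then show "(%n. abs_L2 (f n) - abs_L2 g) \<longlonglongrightarrow> 0" by (simp add: tendsto_norm_zero_iff)
qed

lemma cut_tendsto: "(%n. cut (real n) f) \<longlonglongrightarrow> f"
proof -
 have "(%n. abs_L2 (%x. indicator (cball 0 (real n)) x *\<^sub>R rep_L2 f x)) \<longlonglongrightarrow> abs_L2 (rep_L2 f)"
 proof (rule L2_tendsto_dominated)
  show "AA x. (%n. indicator (cball 0 (real n)) x *\<^sub>R rep_L2 f x) \<longlonglongrightarrow> rep_L2 f x"
  proof (rule AE_I2)
   fix x :: "real^3"
   obtain N where N: "norm x <= real N" using real_arch_simple by blast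
   show "(%n. indicator (cball 0 (real n)) x *\<^sub>R rep_L2 f x) \<longlonglongrightarrow> rep_L2 f x"
    by (rule tendsto_eventually) (use N in \<open>auto simp: eventually_sequentially intro!: exI[of _ N]\<close>)
  qed
  show "AA x. norm (indicator (cball 0 (real n)) x *\<^sub>R rep_L2 f x) <= norm (rep_L2 f x)" for n
   by (auto simp: indicator_def)
 qed (auto intro: L2fun_cut)
 then show ?thesis by (simp add: cut_def)
qed

lemma cut_tendsto_at_top: "((%R. norm (f - cut R f)) \<longlongrightarrow> 0) at_top"
proof (rule tendstoI)
 fix e :: real assume "e > 0"
 then obtain n where n: "norm (cut (real n) f - f) < e"
  using LIMSEQ_D[OF cut_tendsto[of f]] by blast
 have "norm (f - cut R f) < e" if "R >= real n" for R
 proof -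
  have "norm (f - cut R f) <= 1 * norm (f - cut (real n) f)"
  proof (rule L2_norm_mono)
   show "AA x. norm (rep_L2 (f - cut R f) x) <= 1 * norm (rep_L2 (f - cut (real n) f) x)"
    using rep_diff[of f "cut R f"] rep_diff[of f "cut (real n) f"] rep_cut[of R f] rep_cut[of "real n" f]
    by eventually_elim (use that in \<open>auto simp: indicator_def\<close>)
  qed simp
  then show ?thesis using n by (simp add: norm_minus_commute)
 qed
 then show "\<forall>\<^sub>F R in at_top. dist (norm (f - cut R f)) 0 < e"
  by (auto simp: eventually_at_top_linorder intro!: exI[of _ "real n"])
qed

definition fcut :: "real => complex L2 => real^3 => complex" where
 "fcut R f = fint (%x. indicator (cball 0 R) x *\<^sub>R rep_L2 f x)"

text \<open>The limit over balls is the one in \<open>is_FT\<close>, so that both notions can be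
  identified later.\<close>

definition FTc :: "complex L2 => complex L2" where
 "FTc f = lim (%n. abs_L2 (fcut (real n) f))"

definition cFT :: real where "cFT = sqrt ((2 * pi) ^ 3)"

lemma cFT_square: "cFT^2 = (2 * pi) ^ 3" and cFT_nonneg [simp]: "0 <= cFT"
 unfolding cFT_def by simp_all

lemma L2fun_fint:
 assumes "L2fun f" "!!x. norm x > R ==> f x = 0"
 shows "L2fun (fint f)"
 unfolding L2fun_nn_iff
proof
 have [measurable]: "f \<in> borel_measurable borel" using assms(1) by auto
 show "fint f \<in> borel_measurable lborel" using fint_measurable[of f] by simp
 have "(\<integral>\<^sup>+x. ennreal ((cmod (fint f x))^2) \<partial>lborel) <= ennreal ((2 * pi) ^ 3) * (\<integral>\<^sup>+x. ennreal ((cmod (f x))^2) \<partial>lborel)"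
  by (rule bessel_bound[OF assms])
 also have "... < \<infinity>" using assms(1) unfolding L2fun_nn_iff by (simp add: ennreal_mult_less_top)
 finally show "(\<integral>\<^sup>+x. ennreal ((cmod (fint f x))^2) \<partial>lborel) < \<infinity>" .
qed

lemma indicator_cball_zero: "norm x > R ==> indicator (cball 0 R) x *\<^sub>R y = (0::complex)"
 by (simp add: indicator_def)

lemma cut_measurable [measurable]: "(%x. indicator (cball 0 R) x *\<^sub>R rep_L2 (f::complex L2) x) \<in> borel_measurable borel"
 by (rule L2fun_measurable[OF L2fun_cut])

lemma cut_integrable: "integrable lborel (%x. indicator (cball 0 R) x *\<^sub>R rep_L2 (f::complex L2) x)"
 by (rule bounded_support_integrable[OF L2fun_cut]) (rule indicator_cball_zero)

lemma L2fun_fcut: "L2fun (fcut R f)"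
 unfolding fcut_def by (rule L2fun_fint[OF L2fun_cut]) (rule indicator_cball_zero)

lemma norm_fcut: "norm (abs_L2 (fcut R f)) <= cFT * norm (cut R f)"
proof (rule power2_le_imp_le)
 have "ennreal ((norm (abs_L2 (fcut R f)))^2) = (\<integral>\<^sup>+x. ennreal ((cmod (fcut R f x))^2) \<partial>lborel)"
  by (rule nn_norm_abs_L2[OF L2fun_fcut])
 also have "... <= ennreal ((2 * pi) ^ 3) * (\<integral>\<^sup>+x. ennreal ((cmod (indicator (cball 0 R) x *\<^sub>R rep_L2 f x))^2) \<partial>lborel)"
  unfolding fcut_def by (rule bessel_bound[OF L2fun_cut]) (rule indicator_cball_zero)
 also have "... = ennreal ((2 * pi) ^ 3) * ennreal ((norm (cut R f))^2)"
  unfolding cut_def nn_norm_abs_L2[OF L2fun_cut] ..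
 also have "... = ennreal ((cFT * norm (cut R f))^2)"
  unfolding power_mult_distrib[of cFT] cFT_square by (rule ennreal_mult''[symmetric]) simp
 finally show "(norm (abs_L2 (fcut R f)))^2 <= (cFT * norm (cut R f))^2" by (simp add: ennreal_le_iff)
qed simp

lemma fint_cong_AE:
 assumes [measurable]: "f \<in> borel_measurable borel" "g \<in> borel_measurable borel" and "AA x. f x = g x"
 shows "fint f = fint g"
proof
 fix xi
 show "fint f xi = fint g xi" unfolding fint_def
 proof (rule integral_cong_AE)
  show "AA x. kern x xi * f x = kern x xi * g x" using assms(3) by eventually_elim simp
 qed measurable
qed

lemma fcut_diff: "fcut R (f - g) = (%xi. fcut R f xi - fcut R g xi)"
proof
 fix xi
 have "fcut R (f - g) = fint (%x. indicator (cball 0 R) x *\<^sub>R rep_L2 f x - indicator (cball 0 R) x *\<^sub>R rep_L2 g x)"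
  unfolding fcut_def
 proof (rule fint_cong_AE)
  show "AA x. indicator (cball 0 R) x *\<^sub>R rep_L2 (f - g) x = indicator (cball 0 R) x *\<^sub>R rep_L2 f x - indicator (cball 0 R) x *\<^sub>R rep_L2 g x"
   using rep_diff[of f g] by eventually_elim (simp add: scaleR_diff_right)
 qed (simp_all add: cut_measurable borel_measurable_diff borel_measurable_scaleR)
 then have "fcut R (f - g) xi = (LBINT x. kern x xi * (indicator (cball 0 R) x *\<^sub>R rep_L2 f x) - kern x xi * (indicator (cball 0 R) x *\<^sub>R rep_L2 g x))"
  by (simp add: fint_def right_diff_distrib)
 also have "... = fcut R f xi - fcut R g xi" unfolding fcut_def fint_def
  by (rule bint_difference) (rule fint_integrable[OF cut_integrable])+
 finally show "fcut R (f - g) xi = fcut R f xi - fcut R g xi" .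
qed

lemma fcut_scaleR: "fcut R (r *\<^sub>R f) = (%xi. r *\<^sub>R fcut R f xi)"
proof
 fix xi
 have "fcut R (r *\<^sub>R f) = fint (%x. r *\<^sub>R (indicator (cball 0 R) x *\<^sub>R rep_L2 f x))"
  unfolding fcut_def
 proof (rule fint_cong_AE)
  show "(%x. r *\<^sub>R (indicator (cball 0 R) x *\<^sub>R rep_L2 f x)) \<in> borel_measurable borel"
   by (rule borel_measurable_scaleR[OF borel_measurable_const cut_measurable])
  show "AA x. indicator (cball 0 R) x *\<^sub>R rep_L2 (r *\<^sub>R f) x = r *\<^sub>R (indicator (cball 0 R) x *\<^sub>R rep_L2 f x)"
   using rep_scaleR[of r f] by eventually_elim simp
 qed (rule cut_measurable)
 then have "fcut R (r *\<^sub>R f) xi = (LBINT x. r *\<^sub>R (kern x xi * (indicator (cball 0 R) x *\<^sub>R rep_L2 f x)))"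
  unfolding fint_def by (simp only: mult_scaleR_right)
 also have "... = r *\<^sub>R fcut R f xi" unfolding fcut_def fint_def by (rule integral_scaleR_right)
 finally show "fcut R (r *\<^sub>R f) xi = r *\<^sub>R fcut R f xi" .
qed

lemma fcut_cut: "R <= R' ==> fcut R' (cut R f) = fcut R f"
 unfolding fcut_def
proof (rule fint_cong_AE)
 assume "R <= R'"
 show "AA x. indicator (cball 0 R') x *\<^sub>R rep_L2 (cut R f) x = indicator (cball 0 R) x *\<^sub>R rep_L2 f x"
  using rep_cut[of R f] by eventually_elim (use \<open>R <= R'\<close> in \<open>auto simp: indicator_def\<close>)
qed (simp_all add: cut_measurable)

lemma fcut_dist:
 assumes "R <= R'" shows "norm (abs_L2 (fcut R' f) - abs_L2 (fcut R f)) <= cFT * norm (f - cut R f)"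
proof -
 have "abs_L2 (fcut R' f) - abs_L2 (fcut R f) = abs_L2 (fcut R' (f - cut R f))"
  by (simp add: fcut_diff fcut_cut assms abs_L2_diff L2fun_fcut)
 then have "norm (abs_L2 (fcut R' f) - abs_L2 (fcut R f)) <= cFT * norm (cut R' (f - cut R f))"
  using norm_fcut by simp
 also have "... <= cFT * norm (f - cut R f)" by (intro mult_left_mono cut_norm) simp
 finally show ?thesis .
qed

lemma FTc_tendsto: "(%n. abs_L2 (fcut (real n) f)) \<longlonglongrightarrow> FTc f"
proof -
 have "Cauchy (%n. abs_L2 (fcut (real n) f))"
 proof (rule metric_CauchyI)
  fix e :: real assume e: "e > 0"
  have "(%n. cFT * norm (f - cut (real n) f)) \<longlonglongrightarrow> cFT * norm (f - f)"
   by (intro tendsto_intros cut_tendsto)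
  then obtain N where N: "!!n. n >= N ==> cFT * norm (f - cut (real n) f) < e / 2"
   using order_tendstoD(2)[of "%n. cFT * norm (f - cut (real n) f)" 0 sequentially "e / 2"] e
   by (auto simp: eventually_sequentially)
  have *: "norm (abs_L2 (fcut (real n) f) - abs_L2 (fcut (real N) f)) < e / 2" if "n >= N" for n
   using fcut_dist[of "real N" "real n" f] N[of N] that by simp
  show "\<exists>M. \<forall>m\<ge>M. \<forall>n\<ge>M. dist (abs_L2 (fcut (real m) f)) (abs_L2 (fcut (real n) f)) < e"
  proof (intro exI[of _ N] allI impI)
   fix m n assume "m >= N" "n >= N"
   then show "dist (abs_L2 (fcut (real m) f)) (abs_L2 (fcut (real n) f)) < e"
    using *[OF \<open>m >= N\<close>] *[OF \<open>n >= N\<close>] unfolding dist_norm[symmetric] by - (rule dist_triangle_half_l)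
  qed
 qed
 then have "convergent (%n. abs_L2 (fcut (real n) f))" by (rule Cauchy_convergent)
 then show ?thesis unfolding FTc_def by (simp add: convergent_LIMSEQ_iff)
qed

lemma FTc_fcut_dist: "norm (FTc f - abs_L2 (fcut R f)) <= cFT * norm (f - cut R f)"
proof (rule LIMSEQ_le_const2)
 show "(%n. norm (abs_L2 (fcut (real n) f) - abs_L2 (fcut R f))) \<longlonglongrightarrow> norm (FTc f - abs_L2 (fcut R f))"
  by (intro tendsto_intros FTc_tendsto)
 obtain N where "R <= real N" using real_arch_simple by blast
 then show "\<exists>N. \<forall>n\<ge>N. norm (abs_L2 (fcut (real n) f) - abs_L2 (fcut R f)) <= cFT * norm (f - cut R f)"
  by (intro exI[of _ N] allI impI fcut_dist) simp
qed

lemma FTc_diff: "FTc (f - g) = FTc f - FTc g"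
proof (rule LIMSEQ_unique[OF FTc_tendsto])
 show "(%n. abs_L2 (fcut (real n) (f - g))) \<longlonglongrightarrow> FTc f - FTc g"
  unfolding fcut_diff abs_L2_diff[OF L2fun_fcut L2fun_fcut] by (intro tendsto_intros FTc_tendsto)
qed

lemma FTc_scaleR: "FTc (r *\<^sub>R f) = r *\<^sub>R FTc f"
proof (rule LIMSEQ_unique[OF FTc_tendsto])
 show "(%n. abs_L2 (fcut (real n) (r *\<^sub>R f))) \<longlonglongrightarrow> r *\<^sub>R FTc f"
  unfolding fcut_scaleR abs_L2_scaleR[OF L2fun_fcut] by (intro tendsto_intros FTc_tendsto)
qed

lemma FTc_bound: "norm (FTc f) <= cFT * norm f"
proof (rule LIMSEQ_le_const2)
 show "(%n. norm (abs_L2 (fcut (real n) f))) \<longlonglongrightarrow> norm (FTc f)" by (intro tendsto_intros FTc_tendsto)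
 show "\<exists>N. \<forall>n\<ge>N. norm (abs_L2 (fcut (real n) f)) <= cFT * norm f"
  by (intro exI[of _ 0] allI impI order_trans[OF norm_fcut] mult_left_mono cut_norm cFT_nonneg)
qed

lemma FTc_bl: "bounded_linear FTc"
proof (rule bounded_linear_intro[where K = cFT])
 show "FTc (f + g) = FTc f + FTc g" for f g
  using FTc_diff[of f "(-1) *\<^sub>R g"] FTc_scaleR[of "-1" g] by simp
 show "norm (FTc f) <= norm f * cFT" for f using FTc_bound[of f] by (simp add: mult.commute)
qed (rule FTc_scaleR)

lemma FTc_tendsto_at_top: "((%R. norm (FTc f - abs_L2 (fcut R f))) \<longlongrightarrow> 0) at_top"
proof (rule tendsto_sandwich[OF _ _ tendsto_const])
 show "((%R. cFT * norm (f - cut R f)) \<longlongrightarrow> 0) at_top"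
  using tendsto_mult_left[OF cut_tendsto_at_top, of cFT f] by simp
qed (simp_all add: FTc_fcut_dist always_eventually)

lemma FTc_bounded_support:
 assumes f: "L2fun f" "!!x. norm x > R ==> f x = 0"
 shows "FTc (abs_L2 f) = abs_L2 (fint f)"
proof -
 have [measurable]: "f \<in> borel_measurable borel" using f by auto
 have "cut R (abs_L2 f) = abs_L2 f"
  by (rule L2_eqI, use rep_cut[of R "abs_L2 f"] rep_abs[OF f(1)] in eventually_elim) (use f(2) in \<open>auto simp: indicator_def\<close>)
 moreover have "fcut R (abs_L2 f) = fint f" unfolding fcut_def
 proof (rule fint_cong_AE)
  show "AA x. indicator (cball 0 R) x *\<^sub>R rep_L2 (abs_L2 f) x = f x"
   using rep_abs[OF f(1)] by eventually_elim (use f(2) in \<open>auto simp: indicator_def\<close>)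
 qed measurable
 ultimately show ?thesis using FTc_fcut_dist[of "abs_L2 f" R] by simp
qed

lemma norm_FTc_nice:
 assumes "nice f" shows "norm (FTc (abs_L2 f)) = cFT * norm (abs_L2 f)"
proof -
 obtain R where R: "!!x. norm x > R ==> f x = 0" using assms by (auto simp: nice_def)
 note f2 = nice_L2[OF assms]
 have "ennreal ((norm (FTc (abs_L2 f)))^2) = ennreal ((2 * pi) ^ 3) * ennreal ((norm (abs_L2 f))^2)"
  using FTc_bounded_support[OF f2 R] nn_norm_abs_L2[OF L2fun_fint[OF f2 R]] nn_norm_abs_L2[OF f2] plancherel_nice[OF assms]
  by simp
 also have "... = ennreal ((cFT * norm (abs_L2 f))^2)"
  unfolding power_mult_distrib[of cFT] cFT_square by (rule ennreal_mult''[symmetric]) simp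
 finally have "(norm (FTc (abs_L2 f)))^2 = (cFT * norm (abs_L2 f))^2" by (simp only: ennreal_inj zero_le_power2)
 then show ?thesis by (rule power2_eq_imp_eq) simp_all
qed

lemma norm_of_nat_plus_1: "cmod (complex_of_nat n + 1) = real n + 1"
 by (metis norm_of_nat of_nat_Suc of_nat_1 of_nat_add add.commute)

lemma nice_dense: "f \<in> closure (abs_L2 ` {h. nice h})"
proof -
 let ?S = "abs_L2 ` {h::real^3 => complex. nice h}"
 define k where "k n x = (if norm x <= real n \<and> cmod (rep_L2 f x) <= real n then rep_L2 f x else 0)" for n x
 have [measurable]: "k n \<in> borel_measurable borel" for n unfolding k_def by measurable
 have kL2: "L2fun (k n)" for n
  by (rule L2fun_bound[OF _ L2fun_integrable[OF rep_L2fun[of f]]]) (auto simp: k_def)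
 have in_cl: "abs_L2 (k n) \<in> closure ?S" for n
 proof -
  obtain g where g: "!!m. nice (g m)" "!!m x. cmod (g m x) <= (real n + 1) * indicator (cball 0 (real n + 1)) x"
   "AA x. (%m. g m x) \<longlonglongrightarrow> k n x"
   using nice_approx[of "k n" "real n + 1" "real n"] by (force simp: k_def)
  have w: "L2fun (%x. cor ((real n + 1) * indicator (cball 0 (real n + 1)) x))"
   by (rule L2fun_bound[OF _ integrable_indicator_cball[of "(real n + 1)^2" "real n + 1"]])
    (auto simp: indicator_def norm_power norm_of_nat_plus_1)
  have "(%m. abs_L2 (g m)) \<longlonglongrightarrow> abs_L2 (k n)"
  proof (rule L2_tendsto_dominated[OF nice_L2[OF g(1)] kL2 _ _ g(3)])
   show "L2fun (%x::real^3. cor ((real n + 1) * indicator (cball 0 (real n + 1)) x))"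
    by (rule w)
   show "AA x. cmod (g m x) <= cmod (cor ((real n + 1) * indicator (cball 0 (real n + 1)) x))" for m
    unfolding norm_of_real by (intro AE_I2 order_trans[OF g(2) abs_ge_self])
  qed
  moreover have "abs_L2 (g m) \<in> ?S" for m using g(1) by blast
  ultimately show ?thesis unfolding closure_sequential by (intro exI[of _ "%m. abs_L2 (g m)"]) simp
 qed
 have "(%n. abs_L2 (k n)) \<longlonglongrightarrow> abs_L2 (rep_L2 f)"
 proof (rule L2_tendsto_dominated[OF kL2 rep_L2fun rep_L2fun[of f]])
  show "AA x. (%n. k n x) \<longlonglongrightarrow> rep_L2 f x"
  proof (rule AE_I2)
   fix x
   obtain N where N: "max (norm x) (cmod (rep_L2 f x)) <= real N" using real_arch_simple by blast
   show "(%n. k n x) \<longlonglongrightarrow> rep_L2 f x"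
    by (rule tendsto_eventually) (use N in \<open>auto simp: k_def eventually_sequentially intro!: exI[of _ N]\<close>)
  qed
 qed (auto simp: k_def)
 then have "(%n. abs_L2 (k n)) \<longlonglongrightarrow> f" by simp
 then have "f \<in> closure (closure ?S)" unfolding closure_sequential[of f] using in_cl by (intro exI[of _ "%n. abs_L2 (k n)"]) simp
 then show ?thesis by simp
qed

text \<open>Both sides are continuous and agree on a dense set.\<close>

lemma norm_FTc: "norm (FTc f) = cFT * norm f"
proof -
 interpret bounded_linear FTc by (rule FTc_bl)
 have "continuous_on UNIV FTc" by (rule linear_continuous_on[OF FTc_bl])
 then have "closed {f. norm (FTc f) = cFT * norm f}"
  by (intro closed_Collect_eq continuous_intros) auto
 then have "closure (abs_L2 ` {h. nice h}) \<subseteq> {f. norm (FTc f) = cFT * norm f}"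
  by (intro closure_minimal) (auto simp: norm_FTc_nice)
 then show ?thesis using nice_dense by auto
qed

lemma inner_FTc: "inner (FTc f) (FTc g) = (2 * pi) ^ 3 * inner f g"
proof -
 interpret bounded_linear FTc by (rule FTc_bl)
 have "(norm (FTc h))^2 = (2 * pi) ^ 3 * (norm h)^2" for h
  by (simp only: norm_FTc power_mult_distrib[of cFT] cFT_square)
 from this[of "f + g"] this[of f] this[of g] show ?thesis
  unfolding power2_norm_eq_inner by (simp add: add inner_add_left inner_add_right inner_commute algebra_simps)
qed

section \<open>Inversion and transforms of real functions\<close>

definition cj :: "complex L2 => complex L2" where "cj f = abs_L2 (%x. cnj (rep_L2 f x))"
definition refl :: "complex L2 => complex L2" where "refl f = abs_L2 (%x. rep_L2 f (- x))"

lemma lborel_uminus: "distr lborel borel uminus = (lborel :: (real^3) measure)"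
 using lborel_affine[of "-1" "0::real^3"] by (simp add: density_1)

lemma AE_lborel_uminus:
 assumes "AA x. P x" shows "AA x. P (- x)"
proof -
 have "AE x::real^3 in distr lborel borel uminus. P x" unfolding lborel_uminus by (rule assms)
 then show ?thesis by (intro AE_distrD[of uminus lborel borel]) simp_all
qed

lemma L2fun_cnj: assumes "L2fun f" shows "L2fun (%x. cnj (f x))"
proof -
 have [measurable]: "f \<in> borel_measurable borel" using assms by auto
 show ?thesis by (rule L2fun_bound[OF _ L2fun_integrable[OF assms]]) auto
qed

lemma L2fun_refl: assumes "L2fun (f :: real^3 => complex)" shows "L2fun (%x. f (- x))"
proof -
 have [measurable]: "f \<in> borel_measurable borel" using assms by auto
 have "integrable lborel (%x. (cmod (f (0 + (-1) *\<^sub>R x)))\<^sup>2)"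
  by (rule lborel_integrable_affine[of "-1" "%x. (cmod (f x))\<^sup>2"]) (use L2fun_integrable[OF assms] in auto)
 then show ?thesis unfolding L2fun_def by simp
qed

lemma rep_cj: "AA x. rep_L2 (cj f) x = cnj (rep_L2 f x)"
 unfolding cj_def by (rule rep_abs) (rule L2fun_cnj, simp)

lemma rep_refl: "AA x. rep_L2 (refl f) x = rep_L2 f (- x)"
 unfolding refl_def by (rule rep_abs) (rule L2fun_refl, simp)

lemma norm_cj: "norm (cj f) = norm f"
proof -
 have "(norm (cj f))^2 = (norm f)^2"
  unfolding cj_def norm_abs_L2[OF L2fun_cnj[OF rep_L2fun]] by (simp add: norm_L2_square)
 then show ?thesis by simp
qed

lemma norm_refl: "norm (refl f) = norm f"
proof -
 have "(norm (refl f))^2 = (LBINT x. (cmod (rep_L2 f (- x)))\<^sup>2)"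
  unfolding refl_def by (rule norm_abs_L2[OF L2fun_refl[OF rep_L2fun]])
 then have "(norm (refl f))^2 = (norm f)^2"
  unfolding norm_L2_square[of f]
  using lborel_integral_affine[of "-1" "%x. (cmod (rep_L2 f x))\<^sup>2" 0] by simp
 then show ?thesis by simp
qed

lemma cj_bl: "bounded_linear cj"
proof (rule bounded_linear_intro[where K = 1])
 show "cj (f + g) = cj f + cj g" for f g
  by (rule L2_eqI, use rep_cj[of "f + g"] rep_cj[of f] rep_cj[of g] rep_add[of f g] rep_add[of "cj f" "cj g"] in eventually_elim) simp
 show "cj (r *\<^sub>R f) = r *\<^sub>R cj f" for f r
  by (rule L2_eqI, use rep_cj[of "r *\<^sub>R f"] rep_cj[of f] rep_scaleR[of r f] rep_scaleR[of r "cj f"] in eventually_elim) (simp add: scaleR_conv_of_real)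
qed (simp add: norm_cj)

lemma refl_bl: "bounded_linear refl"
proof (rule bounded_linear_intro[where K = 1])
 show "refl (f + g) = refl f + refl g" for f g
  by (rule L2_eqI, use rep_refl[of "f + g"] rep_refl[of f] rep_refl[of g] AE_lborel_uminus[OF rep_add[of f g]] rep_add[of "refl f" "refl g"] in eventually_elim) simp
 show "refl (r *\<^sub>R f) = r *\<^sub>R refl f" for f r
  by (rule L2_eqI, use rep_refl[of "r *\<^sub>R f"] rep_refl[of f] AE_lborel_uminus[OF rep_scaleR[of r f]] rep_scaleR[of r "refl f"] in eventually_elim) simp
qed (simp add: norm_refl)

lemma cj_cj [simp]: "cj (cj f) = f"
 by (rule L2_eqI, use rep_cj[of "cj f"] rep_cj[of f] in eventually_elim) simp

lemma refl_refl [simp]: "refl (refl f) = f"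
 by (rule L2_eqI, use rep_refl[of "refl f"] AE_lborel_uminus[OF rep_refl[of f]] in eventually_elim) simp

lemma cut_bl: "bounded_linear (cut R)"
 by (rule bounded_linear_intro[where K = 1]) (simp_all add: cut_add cut_scaleR cut_norm)

lemma FTc_cut: "FTc (cut R f) = abs_L2 (fcut R f)"
 unfolding cut_def fcut_def by (rule FTc_bounded_support[OF L2fun_cut]) (rule indicator_cball_zero)

lemma cut_tendsto_bl:
 assumes "bounded_linear T" shows "(%n. T (cut (real n) f)) \<longlonglongrightarrow> T f"
 by (rule bounded_linear.tendsto[OF assms cut_tendsto])

text \<open>The multiplication formula for the real inner product \<open>Re (a * cnj b)\<close>,
  which explains the conjugations; it holds for truncations and passes to the limit.\<close>

lemma inner_FTc_cj: "inner (FTc f) (cj h) = inner f (cj (FTc h))"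
proof (rule LIMSEQ_unique)
 have b: "bounded_linear (%h. cj (FTc h))" by (rule bounded_linear_compose[OF cj_bl FTc_bl])
 show "(%n. inner (FTc (cut (real n) f)) (cj (cut (real n) h))) \<longlonglongrightarrow> inner (FTc f) (cj h)"
  by (intro tendsto_intros cut_tendsto_bl FTc_bl cj_bl)
 have "inner (FTc (cut R f)) (cj (cut R h)) = inner (cut R f) (cj (FTc (cut R h)))" for R
 proof -
  let ?f = "%x. indicator (cball 0 R) x *\<^sub>R rep_L2 f x" and ?h = "%x. indicator (cball 0 R) x *\<^sub>R rep_L2 h x"
  have re: "inner a (cnj b) = Re (a * b)" for a b by (simp add: inner_complex_def)
  have c: "cj (abs_L2 k) = abs_L2 (%x. cnj (k x))" if "L2fun k" for k
   unfolding cj_def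
   by (rule abs_L2_cong, simp_all add: L2fun_cnj that, use rep_abs[OF that] in eventually_elim) simp
  have mi: "integrable lborel (%x. fint k x * l x)" if "integrable lborel k" "integrable lborel l" for k l
  proof (rule bint_bound[of _ "%x. (LBINT y. cmod (k y)) * cmod (l x)"])
   have [measurable]: "k \<in> borel_measurable borel" "l \<in> borel_measurable borel" using that by auto
   have [measurable]: "fint k \<in> borel_measurable borel" by (rule fint_measurable) measurable
   show "(%x. fint k x * l x) \<in> borel_measurable lborel" by measurable
   show "integrable lborel (%x. (LBINT y. cmod (k y)) * cmod (l x))" using that(2) by simp
   show "AA x. cmod (fint k x * l x) <= norm ((LBINT y. cmod (k y)) * cmod (l x))"
    using fint_bound[OF that(1)] by (auto simp: norm_mult abs_mult intro!: mult_mono)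
  qed
  have "inner (FTc (cut R f)) (cj (cut R h)) = (LBINT x. Re (fint ?f x * ?h x))"
   unfolding FTc_cut cut_def[of R h] c[OF L2fun_cut] inner_abs_L2[OF L2fun_fcut L2fun_cnj[OF L2fun_cut]] re
   by (simp only: fcut_def)
  also have "... = Re (LBINT x. fint ?f x * ?h x)"
   by (rule integral_Re[OF mi[OF cut_integrable cut_integrable]])
  also have "(LBINT x. fint ?f x * ?h x) = (LBINT x. ?f x * fint ?h x)"
   by (rule fint_mult[OF cut_integrable cut_integrable])
  also have "Re ... = (LBINT x. Re (?f x * fint ?h x))"
   using integral_Re[OF mi[OF cut_integrable cut_integrable]] by (simp only: mult.commute)
  also have "... = inner (cut R f) (cj (FTc (cut R h)))"
   unfolding FTc_cut cut_def[of R f] c[OF L2fun_fcut] inner_abs_L2[OF L2fun_cut L2fun_cnj[OF L2fun_fcut]] re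
   by (simp only: fcut_def)
  finally show ?thesis .
 qed
 then show "(%n. inner (FTc (cut (real n) f)) (cj (cut (real n) h))) \<longlonglongrightarrow> inner f (cj (FTc h))"
  by simp (intro tendsto_intros cut_tendsto cut_tendsto_bl[OF b])
qed

lemma FTc_cj_refl: "FTc (cj (refl f)) = cj (FTc f)"
proof (rule LIMSEQ_unique)
 show "(%n. FTc (cj (refl (cut (real n) f)))) \<longlonglongrightarrow> FTc (cj (refl f))"
  by (rule cut_tendsto_bl[OF bounded_linear_compose[OF FTc_bl bounded_linear_compose[OF cj_bl refl_bl]]])
 have "FTc (cj (refl (cut R f))) = cj (FTc (cut R f))" for R
 proof -
  let ?f = "%x. indicator (cball 0 R) x *\<^sub>R rep_L2 f x"
  have [measurable]: "?f \<in> borel_measurable borel" by measurable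
  have g2: "L2fun (%x. cnj (?f (- x)))" by (rule L2fun_cnj[OF L2fun_refl[OF L2fun_cut]])
  have "cj (refl (cut R f)) = abs_L2 (%x. cnj (?f (- x)))"
   by (rule abs_L2_eqI[symmetric, OF g2], use rep_cj[of "refl (cut R f)"] rep_refl[of "cut R f"] AE_lborel_uminus[OF rep_cut[of R f]] in eventually_elim) simp
  then have "FTc (cj (refl (cut R f))) = abs_L2 (fint (%x. cnj (?f (- x))))"
   using FTc_bounded_support[OF g2, of R] by (simp add: indicator_def)
  also have "fint (%x. cnj (?f (- x))) = (%xi. cnj (fint ?f xi))"
  proof
   fix xi
   have "fint (%x. cnj (?f (- x))) xi = (LBINT x. cnj (kern (- x) xi * ?f (- x)))"
    by (simp add: fint_def kern_uminus)
   also have "... = cnj (LBINT x. kern (- x) xi * ?f (- x))"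
   proof (rule integral_bounded_linear[OF bounded_linear_cnj])
    show "integrable lborel (%x. kern (- x) xi * ?f (- x))"
     using lborel_integrable_affine[of "-1" "%x. kern x xi * ?f x" 0] fint_integrable[OF cut_integrable] by simp
   qed
   also have "(LBINT x. kern (- x) xi * ?f (- x)) = fint ?f xi"
   proof -
    have "(%x. kern x xi * ?f x) \<in> borel_measurable borel" by measurable
    from lborel_integral_affine[OF _ this, of "-1" 0] show ?thesis unfolding fint_def by simp
   qed
   finally show "fint (%x. cnj (?f (- x))) xi = cnj (fint ?f xi)" .
  qed
  also have "abs_L2 (%xi. cnj (fint ?f xi)) = cj (FTc (cut R f))"
   unfolding FTc_cut
   by (rule abs_L2_eqI, rule L2fun_cnj[OF L2fun_fcut[of R f, unfolded fcut_def]],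
    use rep_cj[of "abs_L2 (fcut R f)"] rep_abs[OF L2fun_fcut[of R f]] in eventually_elim) (simp add: fcut_def)
  finally show ?thesis .
 qed
 then show "(%n. FTc (cj (refl (cut (real n) f)))) \<longlonglongrightarrow> cj (FTc f)"
  by simp (rule cut_tendsto_bl[OF bounded_linear_compose[OF cj_bl FTc_bl]])
qed

text \<open>Equality in the Cauchy-Schwarz inequality: both sides have norm
  \<open>(2 * pi) ^ 3 * norm f\<close>, and their inner product is the product of these
  norms.\<close>

lemma FTc_FTc: "FTc (FTc f) = (2 * pi) ^ 3 *\<^sub>R refl f"
proof -
 let ?a = "(2 * pi) ^ 3"
 have n: "(norm (FTc h))^2 = ?a * (norm h)^2" for h
  by (simp only: norm_FTc power_mult_distrib[of cFT] cFT_square)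
 have "inner (FTc (FTc f)) (refl f) = inner (FTc (FTc f)) (cj (cj (refl f)))" by simp
 also have "... = inner (FTc f) (cj (FTc (cj (refl f))))" by (rule inner_FTc_cj)
 also have "... = ?a * (norm f)^2" by (simp add: FTc_cj_refl n power2_norm_eq_inner[symmetric])
 finally have i: "inner (FTc (FTc f)) (refl f) = ?a * (norm f)^2" .
 have "(norm (x - r *\<^sub>R y))^2 = (norm x)^2 - 2 * r * inner x y + r^2 * (norm y)^2" for x y :: "complex L2" and r
  unfolding power2_norm_eq_inner by (simp add: inner_diff_left inner_diff_right inner_commute power2_eq_square algebra_simps)
 then have "(norm (FTc (FTc f) - ?a *\<^sub>R refl f))^2 = (norm (FTc (FTc f)))^2 - 2 * ?a * inner (FTc (FTc f)) (refl f) + ?a\<^sup>2 * (norm (refl f))^2"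
  by this
 also have "... = 0" unfolding i n norm_refl by (simp add: power2_eq_square)
 finally show ?thesis by simp
qed

lemmas bl_add = linear_add[OF bounded_linear.linear]
lemmas bl_diff = linear_diff[OF bounded_linear.linear]
lemmas bl_scaleR = linear_scale[OF bounded_linear.linear]

lemma inj_FTc: "FTc f = FTc g ==> f = g"
proof -
 assume "FTc f = FTc g"
 then have "norm (FTc (f - g)) = 0" by (simp add: FTc_diff)
 then have "cFT * norm (f - g) = 0" by (simp only: norm_FTc)
 then show "f = g" by (simp add: cFT_def)
qed

definition cx :: "real L2 => complex L2" where "cx f = abs_L2 (%x. cor (rep_L2 f x))"

lemma L2fun_of_real: assumes "L2fun f" shows "L2fun (%x. cor (f x))"
proof -
 have [measurable]: "f \<in> borel_measurable borel" using assms by auto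
 show ?thesis by (rule L2fun_bound[OF _ L2fun_integrable[OF assms]]) auto
qed

lemma rep_cx: "AA x. rep_L2 (cx f) x = cor (rep_L2 f x)"
 unfolding cx_def by (rule rep_abs) (rule L2fun_of_real, simp)

lemma inner_cx: "inner (cx f) (cx g) = inner f g"
 unfolding cx_def inner_abs_L2[OF L2fun_of_real[OF rep_L2fun] L2fun_of_real[OF rep_L2fun]]
 by (simp add: inner_L2_def inner_complex_def)

lemma norm_cx: "norm (cx f) = norm f"
 by (simp add: norm_eq_sqrt_inner inner_cx)

lemma cx_bl: "bounded_linear cx"
proof (rule bounded_linear_intro[where K = 1])
 show "cx (f + g) = cx f + cx g" for f g
  by (rule L2_eqI, use rep_cx[of "f + g"] rep_cx[of f] rep_cx[of g] rep_add[of f g] rep_add[of "cx f" "cx g"] in eventually_elim) simp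
 show "cx (r *\<^sub>R f) = r *\<^sub>R cx f" for f r
  by (rule L2_eqI, use rep_cx[of "r *\<^sub>R f"] rep_cx[of f] rep_scaleR[of r f] rep_scaleR[of r "cx f"] in eventually_elim) (simp add: scaleR_conv_of_real)
qed (simp add: norm_cx)

lemma cj_cx: "cj (cx f) = cx f"
 by (rule L2_eqI, use rep_cj[of "cx f"] rep_cx[of f] in eventually_elim) simp

lemma cx_surj:
 assumes "cj F = F" obtains f where "cx f = F"
proof
 have L: "L2fun (%x. Re (rep_L2 F x))"
 proof (rule L2fun_bound[OF _ L2fun_integrable[OF rep_L2fun[of F]]])
  show "AA x. (norm (Re (rep_L2 F x)))\<^sup>2 <= (cmod (rep_L2 F x))^2"
   by (intro AE_I2 power_mono) (simp_all add: abs_Re_le_cmod)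
 qed measurable
 show "cx (abs_L2 (%x. Re (rep_L2 F x))) = F"
 proof (rule L2_eqI, use rep_cx[of "abs_L2 (%x. Re (rep_L2 F x))"] rep_abs[OF L] rep_cj[of F] in eventually_elim)
  case (elim x)
  then have "rep_L2 F x = cnj (rep_L2 F x)" using assms by simp
  then show ?case using elim by (simp add: complex_eq_iff)
 qed
qed

definition hat :: "real L2 => complex L2" where "hat h = FTc (cx h)"

lemma hat_bl: "bounded_linear hat"
 unfolding hat_def[abs_def] by (rule bounded_linear_compose[OF FTc_bl cx_bl])

lemma inner_hat: "inner (hat f) (hat g) = (2 * pi) ^ 3 * inner f g"
 by (simp only: hat_def inner_FTc inner_cx)

lemma norm_hat: "norm (hat f) = cFT * norm f"
 by (simp only: hat_def norm_FTc norm_cx)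

lemma hat_inject: "hat f = hat g \<longleftrightarrow> f = g"
proof
 assume "hat f = hat g"
 then have "hat (f - g) = 0" by (simp add: bl_diff[OF hat_bl])
 then have "cFT * norm (f - g) = 0" by (metis norm_hat norm_zero)
 then show "f = g" by (simp add: cFT_def)
qed simp

lemma cj_refl_hat: "cj (refl (hat f)) = hat f"
proof -
 have "cj (hat f) = FTc (cj (refl (cx f)))" by (simp only: hat_def FTc_cj_refl)
 also have "... = refl (hat f)"
 proof -
  have "FTc (FTc (cj (refl (cx f)))) = FTc (refl (hat f))"
  proof -
   have "refl (cj (refl (cx f))) = cj (cx f)"
    by (rule L2_eqI, use rep_refl[of "cj (refl (cx f))"] AE_lborel_uminus[OF rep_cj[of "refl (cx f)"]] AE_lborel_uminus[OF rep_refl[of "cx f"]] rep_cj[of "cx f"] in eventually_elim) simp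
   then have 1: "FTc (FTc (cj (refl (cx f)))) = (2 * pi) ^ 3 *\<^sub>R cx f" by (simp only: FTc_FTc cj_cx)
   have "FTc (FTc (refl (hat f))) = FTc ((2 * pi) ^ 3 *\<^sub>R cx f)" by (simp only: FTc_FTc refl_refl hat_def FTc_scaleR)
   then have "FTc (refl (hat f)) = (2 * pi) ^ 3 *\<^sub>R cx f" by (rule inj_FTc)
   then show ?thesis using 1 by simp
  qed
  then show ?thesis by (rule inj_FTc)
 qed
 finally have "cj (hat f) = refl (hat f)" .
 then show ?thesis by (metis cj_cj)
qed

text \<open>By inversion \<open>G\<close> is the transform of \<open>H\<close>, and the Hermitian
  symmetry of \<open>G\<close> makes \<open>H\<close> equal to its conjugate, hence real.\<close>

lemma hat_surj:
 assumes "AA xi. cnj (rep_L2 G (- xi)) = rep_L2 G xi"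
 obtains h where "hat h = G"
proof -
 define H where "H = (1 / (2 * pi) ^ 3) *\<^sub>R FTc (refl G)"
 have G: "cj G = refl G"
  by (rule L2_eqI, use AE_lborel_uminus[OF assms] rep_cj[of G] rep_refl[of G] in eventually_elim) simp
 have "cj H = (1 / (2 * pi) ^ 3) *\<^sub>R FTc (cj (refl (refl G)))"
  unfolding FTc_cj_refl by (simp only: H_def bl_scaleR[OF cj_bl])
 also have "... = H" by (simp only: refl_refl G H_def)
 finally obtain h where h: "cx h = H" by (rule cx_surj)
 have "FTc H = G" unfolding H_def FTc_scaleR FTc_FTc refl_refl by simp
 then have "hat h = G" by (simp only: hat_def h)
 then show thesis by (rule that)
qed

section \<open>Fourier multipliers and Bessel potentials\<close>

definition pm :: "(real^3 => real) => 'b::euclidean_space L2 => 'b L2" where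
 "pm a f = abs_L2 (%x. a x *\<^sub>R rep_L2 f x)"

lemma in_LinfE:
 assumes "in_Linf a" obtains M where "0 < M" "AA x. \<bar>a x\<bar> <= M"
proof -
 obtain M where "AA x. \<bar>a x\<bar> <= M" using assms by (auto simp: in_Linf_def)
 then have "AA x. \<bar>a x\<bar> <= max M 1" by eventually_elim simp
 then show thesis by (intro that[of "max M 1"]) simp_all
qed

lemma in_Linf_measurable [measurable_dest]: "in_Linf a ==> a \<in> borel_measurable borel"
 by (simp add: in_Linf_def)

lemma L2fun_pm:
 assumes a: "in_Linf a" and f: "L2fun f" shows "L2fun (%x. a x *\<^sub>R f x)"
proof -
 obtain M where M: "0 < M" "AA x. \<bar>a x\<bar> <= M" using in_LinfE[OF a] .
 have [measurable]: "a \<in> borel_measurable borel" "f \<in> borel_measurable borel" using a f by auto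
 show ?thesis
 proof (rule L2fun_bound)
  show "integrable lborel (%x. M\<^sup>2 * (norm (f x))^2)" using L2fun_integrable[OF f] by simp
  show "AA x. (norm (a x *\<^sub>R f x))\<^sup>2 <= M^2 * (norm (f x))^2"
   using M(2)
  proof eventually_elim
   case (elim x)
   then have "\<bar>a x\<bar>\<^sup>2 <= M^2" by (intro power_mono) auto
   then show ?case by (simp add: power_mult_distrib mult_right_mono)
  qed
 qed measurable
qed

lemma rep_pm: "in_Linf a ==> AA x. rep_L2 (pm a f) x = a x *\<^sub>R rep_L2 f x"
 unfolding pm_def by (rule rep_abs) (rule L2fun_pm, simp_all)

lemma norm_pm:
 assumes a: "in_Linf a" and M: "AA x. \<bar>a x\<bar> <= M" "0 <= M"
 shows "norm (pm a f) <= M * norm f"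
proof (rule L2_norm_mono[OF _ M(2)])
 show "AA x. norm (rep_L2 (pm a f) x) <= M * norm (rep_L2 f x)"
  using M(1) rep_pm[OF a, of f] by eventually_elim (simp add: mult_right_mono)
qed

lemma pm_bl: assumes a: "in_Linf a" shows "bounded_linear (pm a)"
proof -
 obtain M where M: "0 < M" "AA x. \<bar>a x\<bar> <= M" using in_LinfE[OF a] .
 show ?thesis
 proof (rule bounded_linear_intro[where K = M])
  show "pm a (f + g) = pm a f + pm a g" for f g
   by (rule L2_eqI, use rep_pm[OF a, of "f + g"] rep_pm[OF a, of f] rep_pm[OF a, of g] rep_add[of f g] rep_add[of "pm a f" "pm a g"] in eventually_elim) (simp add: scaleR_add_right)
  show "pm a (r *\<^sub>R f) = r *\<^sub>R pm a f" for f r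
   by (rule L2_eqI, use rep_pm[OF a, of "r *\<^sub>R f"] rep_pm[OF a, of f] rep_scaleR[of r f] rep_scaleR[of r "pm a f"] in eventually_elim) simp
  show "norm (pm a f) <= norm f * M" for f using norm_pm[OF a M(2), of f] M(1) by (simp add: mult.commute)
 qed
qed

lemma inner_pm:
 assumes a: "in_Linf a" shows "inner (pm a f) g = (LBINT x. a x * inner (rep_L2 f x) (rep_L2 g x))"
 unfolding inner_L2_def
proof (rule integral_cong_AE)
 have [measurable]: "a \<in> borel_measurable borel" using a by auto
 show "(%x. a x * inner (rep_L2 f x) (rep_L2 g x)) \<in> borel_measurable lborel" by measurable
 show "AA x. inner (rep_L2 (pm a f) x) (rep_L2 g x) = a x * inner (rep_L2 f x) (rep_L2 g x)"
  using rep_pm[OF a, of f] by eventually_elim simp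
qed measurable

lemma pm_sym: "in_Linf a ==> inner (pm a f) g = inner f (pm a g)"
 by (simp add: inner_pm inner_commute[of f]) (simp add: inner_commute)

lemma in_Linf_mult: assumes "in_Linf a" "in_Linf b" shows "in_Linf (%x. a x * b x)"
proof -
 obtain M N where M: "0 < M" "AA x. \<bar>a x\<bar> <= M" and N: "0 < N" "AA x. \<bar>b x\<bar> <= N"
  using in_LinfE[OF assms(1)] in_LinfE[OF assms(2)] by metis
 have [measurable]: "a \<in> borel_measurable borel" "b \<in> borel_measurable borel" using assms by auto
 have "AA x. \<bar>a x * b x\<bar> <= M * N"
  using M(2) N(2) by eventually_elim (use M(1) in \<open>auto simp: abs_mult intro!: mult_mono\<close>)
 then show ?thesis unfolding in_Linf_def by auto
qed

definition symb :: "(real => real) => bool" where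
 "symb \<mu> \<longleftrightarrow> \<mu> \<in> borel_measurable borel \<and> (\<exists>M. \<forall>r\<ge>0. \<bar>\<mu> r\<bar> <= M)"

lemma symbI: "\<mu> \<in> borel_measurable borel ==> (!!r. r >= 0 ==> \<bar>\<mu> r\<bar> <= M) ==> symb \<mu>"
 by (auto simp: symb_def)

lemma symb_Linf: "symb \<mu> ==> in_Linf (%xi. \<mu> (norm xi))"
 unfolding symb_def in_Linf_def
proof (elim conjE exE, intro conjI)
 fix M assume "\<forall>r\<ge>0. \<bar>\<mu> r\<bar> <= M"
 then show "\<exists>M. AA xi. \<bar>\<mu> (norm xi)\<bar> <= M" by (intro exI[of _ M] AE_I2) simp
qed (auto intro: measurable_compose[OF borel_measurable_norm])

lemma symb_mult: assumes "symb a" "symb b" shows "symb (%r. a r * b r)"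
proof -
 obtain M N where M: "!!r. r >= 0 ==> \<bar>a r\<bar> <= M" and N: "!!r. r >= 0 ==> \<bar>b r\<bar> <= N" using assms by (auto simp: symb_def)
 show ?thesis
 proof (rule symbI[where M = "M * N"])
  show "(%r. a r * b r) \<in> borel_measurable borel" using assms by (auto simp: symb_def)
  show "\<bar>a r * b r\<bar> <= M * N" if "r >= 0" for r
   using M[OF that] N[OF that] by (auto simp: abs_mult intro!: mult_mono)
 qed
qed

definition fm :: "(real => real) => real L2 => real L2" where
 "fm \<mu> h = (THE k. hat k = pm (%xi. \<mu> (norm xi)) (hat h))"

lemma hat_sym: "AA xi. cnj (rep_L2 (hat h) (- xi)) = rep_L2 (hat h) xi"
 using rep_cj[of "refl (hat h)"] rep_refl[of "hat h"] unfolding cj_refl_hat by eventually_elim simp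

text \<open>A real radial symbol preserves Hermitian symmetry, so the product is again the transform
  of a real function and the description in \<open>fm\<close> is meaningful.\<close>

lemma hat_fm: assumes "symb \<mu>" shows "hat (fm \<mu> h) = pm (%xi. \<mu> (norm xi)) (hat h)"
proof -
 let ?G = "pm (%xi. \<mu> (norm xi)) (hat h)"
 have "AA xi. cnj (rep_L2 ?G (- xi)) = rep_L2 ?G xi"
  using rep_pm[OF symb_Linf[OF assms], of "hat h"] AE_lborel_uminus[OF rep_pm[OF symb_Linf[OF assms], of "hat h"]] hat_sym[of h]
  by eventually_elim (simp add: scaleR_conv_of_real)
 then obtain k where k: "hat k = ?G" by (rule hat_surj)
 then show ?thesis unfolding fm_def by (rule theI) (metis k hat_inject)
qed

lemma rep_hat_fm: "symb \<mu> ==> AA xi. rep_L2 (hat (fm \<mu> h)) xi = \<mu> (norm xi) *\<^sub>R rep_L2 (hat h) xi"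
 using rep_pm[OF symb_Linf, of \<mu> "hat h"] by (simp add: hat_fm)

lemma norm_fm:
 assumes "symb \<mu>" "!!r. r >= 0 ==> \<bar>\<mu> r\<bar> <= M" shows "norm (fm \<mu> h) <= M * norm h"
proof -
 have "0 <= M" using assms(2)[of 0] by simp
 then have "cFT * norm (fm \<mu> h) <= M * (cFT * norm h)"
  using norm_pm[OF symb_Linf[OF assms(1)], of M "hat h"] assms(2) unfolding norm_hat[symmetric] by (simp add: hat_fm assms(1))
 moreover have "0 < cFT" by (simp add: cFT_def)
 ultimately show ?thesis by (simp add: mult.left_commute)
qed

lemma fm_bl: assumes "symb \<mu>" shows "bounded_linear (fm \<mu>)"
proof -
 obtain M where M: "!!r. r >= 0 ==> \<bar>\<mu> r\<bar> <= M" using assms by (auto simp: symb_def)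
 note l = bl_add[OF pm_bl[OF symb_Linf[OF assms]]] bl_scaleR[OF pm_bl[OF symb_Linf[OF assms]]]
  bl_add[OF hat_bl] bl_scaleR[OF hat_bl]
 show ?thesis
 proof (rule bounded_linear_intro[where K = M])
  show "fm \<mu> (f + g) = fm \<mu> f + fm \<mu> g" for f g by (subst hat_inject[symmetric]) (simp add: hat_fm assms l)
  show "fm \<mu> (r *\<^sub>R f) = r *\<^sub>R fm \<mu> f" for f r by (subst hat_inject[symmetric]) (simp add: hat_fm assms l)
  show "norm (fm \<mu> f) <= norm f * M" for f using norm_fm[OF assms M] by (simp add: mult.commute)
 qed
qed

lemma fm_sym: assumes "symb \<mu>" shows "inner (fm \<mu> f) g = inner f (fm \<mu> g)"
proof -
 have "(2 * pi) ^ 3 * inner (fm \<mu> f) g = (2 * pi) ^ 3 * inner f (fm \<mu> g)"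
  unfolding inner_hat[symmetric] hat_fm[OF assms] by (rule pm_sym[OF symb_Linf[OF assms]])
 then show ?thesis by simp
qed

lemma fm_fm: assumes a: "symb a" and b: "symb b" shows "fm a (fm b h) = fm (%r. a r * b r) h"
proof (subst hat_inject[symmetric], rule L2_eqI)
 show "AA x. rep_L2 (hat (fm a (fm b h))) x = rep_L2 (hat (fm (%r. a r * b r) h)) x"
  using rep_hat_fm[OF a, of "fm b h"] rep_hat_fm[OF b, of h] rep_hat_fm[OF symb_mult[OF a b], of h] by eventually_elim simp
qed

text \<open>The origin is a null set, so the value of a symbol at 0, where \<open>powr\<close> is 0
  by convention, is immaterial.\<close>

lemma fm_cong: assumes a: "symb a" and b: "symb b" and "!!r. r > 0 ==> a r = b r" shows "fm a h = fm b h"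
proof (subst hat_inject[symmetric], rule L2_eqI)
 have "AA x. x ~= (0::real^3)" by (rule AE_lborel_singleton)
 then show "AA x. rep_L2 (hat (fm a h)) x = rep_L2 (hat (fm b h)) x"
  using rep_hat_fm[OF a, of h] rep_hat_fm[OF b, of h] by eventually_elim (simp add: assms(3))
qed

lemma fm_one: "fm (%r. 1) h = h"
proof (subst hat_inject[symmetric], rule L2_eqI)
 have "symb (%r. 1)" by (rule symbI[of _ 1]) auto
 from rep_hat_fm[OF this, of h] show "AA x. rep_L2 (hat (fm (%r. 1) h)) x = rep_L2 (hat h) x" by simp
qed

lemma fm_lincomb:
 assumes a: "symb a" and b: "symb b" and c: "symb c" and "!!r. r > 0 ==> c r = a r + b r" shows "fm c h = fm a h + fm b h"
proof (subst hat_inject[symmetric], rule L2_eqI)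
 have "AA x. x ~= (0::real^3)" by (rule AE_lborel_singleton)
 then show "AA x. rep_L2 (hat (fm c h)) x = rep_L2 (hat (fm a h + fm b h)) x"
  using rep_hat_fm[OF a, of h] rep_hat_fm[OF b, of h] rep_hat_fm[OF c, of h] rep_add[of "hat (fm a h)" "hat (fm b h)"]
  unfolding bl_add[OF hat_bl] by eventually_elim (simp add: assms(4) scaleR_add_left)
qed

lemma inner_fm_nonneg: assumes a: "symb a" and "!!r. r > 0 ==> 0 <= a r" shows "0 <= inner (fm a h) h"
proof -
 have "(2 * pi) ^ 3 * inner (fm a h) h = (LBINT xi. a (norm xi) * inner (rep_L2 (hat h) xi) (rep_L2 (hat h) xi))"
  unfolding inner_hat[symmetric] hat_fm[OF a] by (rule inner_pm[OF symb_Linf[OF a]])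
 also have "0 <= ..."
 proof (rule integral_nonneg_AE)
  show "AA xi. 0 <= a (norm xi) * inner (rep_L2 (hat h) xi) (rep_L2 (hat h) xi)"
   using AE_lborel_singleton[of "0::real^3"] by eventually_elim (simp add: assms(2))
 qed
 finally show ?thesis using pi_gt_zero by (simp add: zero_le_mult_iff)
qed

section \<open>The given spaces as ranges of Bessel potentials\<close>

lemma in_L2_iff: "in_L2 u \<longleftrightarrow> L2fun u" by (simp add: in_L2_def L2fun_def)

lemma set_integral_kern:
 assumes u: "L2fun u"
 shows "(LINT x:cball 0 R|lborel. exp (- \<i> * cor (x \<bullet> xi)) * cor (u x)) = fcut R (cx (abs_L2 u)) xi"
proof -
 have [measurable]: "u \<in> borel_measurable borel" using u by auto
 have "fcut R (cx (abs_L2 u)) = fint (%x. indicator (cball 0 R) x *\<^sub>R cor (u x))"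
  unfolding fcut_def
 proof (rule fint_cong_AE)
  show "AA x. indicator (cball 0 R) x *\<^sub>R rep_L2 (cx (abs_L2 u)) x = indicator (cball 0 R) x *\<^sub>R cor (u x)"
   using rep_cx[of "abs_L2 u"] rep_abs[OF u] by eventually_elim simp
  show "(%x. indicator (cball 0 R) x *\<^sub>R cor (u x)) \<in> borel_measurable borel"
   by (rule L2fun_measurable[OF L2fun_indicator[OF L2fun_of_real[OF u]]]) simp
 qed (rule cut_measurable)
 then show ?thesis by (simp add: set_lebesgue_integral_def fint_def kern_def mult.commute)
qed

text \<open>Both \<open>F\<close> and \<open>hat (abs_L2 u)\<close> are limits of the same integrals
  over balls, hence equal almost everywhere. This links the predicate of the problem to an operator
  on \<open>real L2\<close>.\<close>

lemma is_FT_iff: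
 "is_FT u F \<longleftrightarrow> L2fun u \<and> F \<in> borel_measurable borel \<and> (AA xi. F xi = rep_L2 (hat (abs_L2 u)) xi)"
proof
 assume F: "is_FT u F"
 then have u: "L2fun u" and FL: "L2fun F" by (auto simp: is_FT_def in_L2_iff L2fun_def)
 let ?f = "cx (abs_L2 u)"
 have "((%R. \<integral>\<^sup>+xi. ennreal ((cmod (F xi - fcut R ?f xi))^2) \<partial>lborel) \<longlongrightarrow> 0) at_top"
  using F unfolding is_FT_def set_integral_kern[OF u] by blast
 then have "((%R. ennreal ((norm (abs_L2 F - abs_L2 (fcut R ?f)))^2)) \<longlongrightarrow> ennreal 0) at_top"
  using nn_norm_abs_L2[OF L2fun_diff[OF FL L2fun_fcut]] by (simp add: abs_L2_diff FL L2fun_fcut)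
 then have "((%R. (norm (abs_L2 F - abs_L2 (fcut R ?f)))\<^sup>2) \<longlongrightarrow> 0) at_top"
  by (subst (asm) tendsto_ennreal_iff) auto
 then have "((%R. sqrt ((norm (abs_L2 F - abs_L2 (fcut R ?f)))^2)) \<longlongrightarrow> sqrt 0) at_top" by (intro tendsto_intros)
 then have 1: "((%R. norm (abs_L2 F - abs_L2 (fcut R ?f))) \<longlongrightarrow> 0) at_top" by simp
 have "((%R. norm (abs_L2 F - abs_L2 (fcut R ?f)) + norm (FTc ?f - abs_L2 (fcut R ?f))) \<longlongrightarrow> 0 + 0) at_top"
  by (intro tendsto_add 1 FTc_tendsto_at_top)
 then have "norm (abs_L2 F - FTc ?f) <= 0 + 0"
 proof (rule tendsto_lowerbound)
  show "\<forall>\<^sub>F R in at_top. norm (abs_L2 F - FTc ?f) <= norm (abs_L2 F - abs_L2 (fcut R ?f)) + norm (FTc ?f - abs_L2 (fcut R ?f))"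
  proof (rule always_eventually, rule allI)
   fix R show "norm (abs_L2 F - FTc ?f) <= norm (abs_L2 F - abs_L2 (fcut R ?f)) + norm (FTc ?f - abs_L2 (fcut R ?f))"
    using norm_triangle_ineq4[of "abs_L2 F - abs_L2 (fcut R ?f)" "FTc ?f - abs_L2 (fcut R ?f)"] by simp
  qed
 qed simp
 then have "abs_L2 F = hat (abs_L2 u)" by (simp add: hat_def)
 then have "AA xi. F xi = rep_L2 (hat (abs_L2 u)) xi" using rep_abs[OF FL] by auto
 then show "L2fun u \<and> F \<in> borel_measurable borel \<and> (AA xi. F xi = rep_L2 (hat (abs_L2 u)) xi)"
  using u FL by auto
next
 assume "L2fun u \<and> F \<in> borel_measurable borel \<and> (AA xi. F xi = rep_L2 (hat (abs_L2 u)) xi)"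
 then have u: "L2fun u" and [measurable]: "F \<in> borel_measurable borel" and F: "AA xi. rep_L2 (hat (abs_L2 u)) xi = F xi"
  by auto
 let ?f = "cx (abs_L2 u)"
 have FL: "L2fun F" by (rule L2fun_AE[OF _ _ F]) auto
 have "abs_L2 F = hat (abs_L2 u)" by (rule abs_L2_eqI[OF FL]) (use F in auto)
 then have aF: "abs_L2 F = FTc ?f" by (simp add: hat_def)
 have "((%R. ennreal ((norm (FTc ?f - abs_L2 (fcut R ?f)))^2)) \<longlongrightarrow> ennreal (0\<^sup>2)) at_top"
  by (intro tendsto_ennrealI tendsto_power FTc_tendsto_at_top)
 then have "((%R. \<integral>\<^sup>+xi. ennreal ((cmod (F xi - fcut R ?f xi))^2) \<partial>lborel) \<longlongrightarrow> 0) at_top"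
  using nn_norm_abs_L2[OF L2fun_diff[OF FL L2fun_fcut]] by (simp add: abs_L2_diff FL L2fun_fcut aF)
 then show "is_FT u F" unfolding is_FT_def set_integral_kern[OF u] in_L2_iff
  using u L2fun_integrable[OF FL] by auto
qed

text \<open>The symbol of the Bessel kernel of order \<open>a\<close>.\<close>

definition bes :: "real => real => real" where "bes a r = (1 + r^2) powr (- a / 2)"

lemma bes_measurable [measurable]: "bes a \<in> borel_measurable borel"
 unfolding bes_def[abs_def] by measurable

lemma one_plus_square [simp]: "0 < 1 + (r::real)^2" "1 + r^2 ~= 0"
 by (smt (verit) zero_le_power2)+

lemma cball_borel [measurable]: "cball x (r::real) \<in> sets borel"
 by (rule borel_closed) simp

lemma bes_pos: "0 < bes a r"
 unfolding bes_def by simp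

lemma bes_le_1: "0 <= a ==> bes a r <= 1"
 unfolding bes_def using powr_mono[of "- a / 2" 0 "1 + r^2"] by simp

lemma symb_bes: "0 <= a ==> symb (bes a)"
 by (rule symbI[where M = 1]) (use bes_pos[of a] bes_le_1[of a] in \<open>auto simp: less_imp_le\<close>)

lemma bes_mult: "bes a r * bes b r = bes (a + b) r"
 unfolding bes_def powr_add[symmetric] by (rule arg_cong[where f = "(powr) _"]) (simp add: field_simps)

lemma bes_square: "(bes a r)^2 = (1 + r^2) powr (- a)"
 unfolding power2_eq_square[of "bes a r"] bes_mult by (simp add: bes_def)

lemma bes_weight: "(1 + r^2) powr a * (bes a r)^2 = 1"
 unfolding bes_square by (simp add: powr_add[symmetric])

lemma bes_le_powr: "0 <= a ==> 0 < r ==> bes a r <= r powr (- a)"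
proof -
 assume "0 <= a" "0 < r"
 then have "bes a r <= (r^2) powr (- a / 2)"
  unfolding bes_def by (intro powr_mono2') auto
 also have "... = r powr (- a)" using \<open>0 < r\<close> by (simp add: powr_powr flip: powr_numeral)
 finally show ?thesis .
qed

definition J :: "real => real L2 => real L2" where "J a = fm (bes a)"

lemma J_bl: "0 <= a ==> bounded_linear (J a)"
 unfolding J_def by (rule fm_bl[OF symb_bes])

lemma J_sym: "0 <= a ==> inner (J a f) g = inner f (J a g)"
 unfolding J_def by (rule fm_sym[OF symb_bes])

lemma norm_J: "0 <= a ==> norm (J a h) <= norm h"
 using norm_fm[OF symb_bes, of a 1 h] bes_le_1[of a] bes_pos[of a] by (simp add: J_def less_imp_le)

lemma J_J: "0 <= a ==> 0 <= b ==> J a (J b h) = J (a + b) h"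
 unfolding J_def by (simp add: fm_fm symb_bes bes_mult flip: fun_eq_iff)

lemma rep_hat_J: "0 <= a ==> AA xi. rep_L2 (hat (J a h)) xi = bes a (norm xi) *\<^sub>R rep_L2 (hat h) xi"
 unfolding J_def by (rule rep_hat_fm[OF symb_bes])

lemma J_inject: assumes "0 <= a" "J a f = J a g" shows "f = g"
proof -
 have "hat f = hat g"
  by (rule L2_eqI, use rep_hat_J[OF assms(1), of f] rep_hat_J[OF assms(1), of g] in eventually_elim)
   (use assms(2) bes_pos[of a] in \<open>auto simp: less_le\<close>)
 then show ?thesis by (simp add: hat_inject)
qed

text \<open>Finiteness of the weighted integral allows the transform to be divided by the Bessel
  symbol; the quotient keeps Hermitian symmetry and so comes from a real function.\<close>

lemma divide_bes:
 assumes "integrable lborel (%xi. (1 + (norm xi)^2) powr a * (cmod (rep_L2 (hat f) xi))^2)" "0 <= a"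
 obtains h where "f = J a h"
proof -
 let ?g = "%xi. bes (- a) (norm xi) *\<^sub>R rep_L2 (hat f) xi"
 have L: "L2fun ?g"
  by (rule L2fun_bound[OF _ assms(1)]) (auto simp: power_mult_distrib bes_square)
 have "AA xi. cnj (rep_L2 (abs_L2 ?g) (- xi)) = rep_L2 (abs_L2 ?g) xi"
  using rep_abs[OF L] AE_lborel_uminus[OF rep_abs[OF L]] hat_sym[of f] by eventually_elim (simp add: scaleR_conv_of_real)
 then obtain h where h: "hat h = abs_L2 ?g" by (rule hat_surj)
 have "bes a r * bes (- a) r = 1" for r unfolding bes_mult by (simp add: bes_def)
 then have "hat f = hat (J a h)"
  by (intro L2_eqI, use rep_hat_J[OF assms(2), of h] rep_abs[OF L] in eventually_elim) (simp add: h)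
 then have "f = J a h" by (simp only: hat_inject)
 then show thesis by (rule that)
qed

lemma is_FT_rep: "L2fun u ==> is_FT u (rep_L2 (hat (abs_L2 u)))"
 by (simp add: is_FT_iff)

lemma weight_J:
 assumes F: "is_FT u F" and u: "abs_L2 u = J a h" and a: "0 <= a"
 shows "integrable lborel (%xi. (1 + (norm xi)^2) powr a * (cmod (F xi))^2)"
  and "(LBINT xi. (1 + (norm xi)^2) powr a * (cmod (F xi))^2) = (2 * pi) ^ 3 * (norm h)^2"
proof -
 have [measurable]: "F \<in> borel_measurable borel" using F by (simp add: is_FT_iff)
 have "AA xi. F xi = rep_L2 (hat (J a h)) xi" using F u by (simp add: is_FT_iff)
 then have e: "AA xi. (1 + (norm xi)^2) powr a * (cmod (F xi))^2 = (cmod (rep_L2 (hat h) xi))^2"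
  using rep_hat_J[OF a, of h]
 proof eventually_elim
  case (elim xi)
  have "(1 + (norm xi)^2) powr a * (cmod (F xi))^2 = ((1 + (norm xi)^2) powr a * (bes a (norm xi))^2) * (cmod (rep_L2 (hat h) xi))^2"
   using elim by (simp add: power_mult_distrib)
  then show ?case by (simp only: bes_weight mult_1_left)
 qed
 have i: "integrable lborel (%xi. (cmod (rep_L2 (hat h) xi))\<^sup>2)" by (rule L2fun_integrable[OF rep_L2fun])
 show "integrable lborel (%xi. (1 + (norm xi)^2) powr a * (cmod (F xi))^2)"
  by (subst integrable_cong_AE[OF _ _ e]) (use i in auto)
 have "(LBINT xi. (1 + (norm xi)^2) powr a * (cmod (F xi))^2) = (LBINT xi. (cmod (rep_L2 (hat h) xi))\<^sup>2)"
  by (rule integral_cong_AE[OF _ _ e]) auto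
 also have "... = (cFT * norm h)^2" unfolding norm_L2_square[symmetric] norm_hat ..
 finally show "(LBINT xi. (1 + (norm xi)^2) powr a * (cmod (F xi))^2) = (2 * pi) ^ 3 * (norm h)^2"
  by (simp only: power_mult_distrib[of cFT] cFT_square)
qed

lemma in_Hs_iff: assumes "0 <= s" shows "in_Hs s u \<longleftrightarrow> L2fun u \<and> (\<exists>h. abs_L2 u = J s h)"
proof
 assume "in_Hs s u"
 then obtain F where F: "is_FT u F" "integrable lborel (%xi. (1 + (norm xi)^2) powr s * (cmod (F xi))^2)"
  unfolding in_Hs_def by blast
 then have u: "L2fun u" and [measurable]: "F \<in> borel_measurable borel" and e: "AA xi. F xi = rep_L2 (hat (abs_L2 u)) xi"
  by (auto simp: is_FT_iff)
 have "AA xi. (1 + (norm xi)^2) powr s * (cmod (F xi))^2 = (1 + (norm xi)^2) powr s * (cmod (rep_L2 (hat (abs_L2 u)) xi))^2"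
  using e by eventually_elim simp
 from integrable_cong_AE[OF _ _ this] F(2)
 have "integrable lborel (%xi. (1 + (norm xi)^2) powr s * (cmod (rep_L2 (hat (abs_L2 u)) xi))^2)" by simp
 from divide_bes[OF this assms] u show "L2fun u \<and> (\<exists>h. abs_L2 u = J s h)" by metis
next
 assume "L2fun u \<and> (\<exists>h. abs_L2 u = J s h)"
 then show "in_Hs s u" unfolding in_Hs_def using is_FT_rep weight_J(1)[OF is_FT_rep _ assms] by blast
qed

text \<open>The factor \<open>(2 * pi) powr (-3)\<close> in the norm cancels Plancherel's
  constant.\<close>

lemma Hs_norm_J:
 assumes "L2fun u" "abs_L2 u = J s h" "0 <= s" shows "Hs_norm s u = norm h"
proof -
 have "is_FT u (SOME F. is_FT u F)" by (rule someI[where P = "is_FT u", OF is_FT_rep[OF assms(1)]])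
 from weight_J(2)[OF this assms(2,3)]
 have "Hs_norm s u = sqrt ((2 * pi) powr (- 3) * ((2 * pi) ^ 3 * (norm h)^2))"
  unfolding Hs_norm_def Let_def by simp
 also have "(2 * pi) powr (- 3) * ((2 * pi) ^ 3 * (norm h)^2) = (norm h)^2"
  by (simp add: powr_minus powr_numeral field_simps)
 finally show ?thesis by simp
qed

lemma symb_lap:
 assumes "0 <= a" "2 * a <= s" shows "symb (%r. r powr (2 * a) * bes s r)"
proof (rule symbI[where M = 1])
 fix r :: real assume r: "0 <= r"
 have "0 < 1 + r^2" by (simp add: add_pos_nonneg)
 have "r powr (2 * a) = (r^2) powr a"
 proof (cases "r = 0")
  case False
  then show ?thesis using r by (simp add: powr_powr flip: powr_numeral)
 qed simp
 also have "... <= (1 + r^2) powr a" using assms by (intro powr_mono2) auto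
 finally have "r powr (2 * a) * bes s r <= (1 + r^2) powr a * bes s r"
  using bes_pos[of s r] by (intro mult_right_mono) auto
 also have "... = bes (s - 2 * a) r" unfolding bes_def by (simp add: powr_add[symmetric] diff_divide_distrib)
 also have "... <= 1" using assms by (intro bes_le_1) simp
 finally show "\<bar>r powr (2 * a) * bes s r\<bar> <= 1" using bes_pos[of s r] by (simp add: abs_mult)
qed measurable

text \<open>The choice in \<open>frac_lap\<close> is unique up to null sets, so its class in
  \<open>real L2\<close> is determined.\<close>

lemma frac_lap_J:
 assumes u: "L2fun u" "abs_L2 u = J s h" and a: "0 <= a" "2 * a <= s"
 shows "L2fun (frac_lap a u)" "abs_L2 (frac_lap a u) = fm (%r. r powr (2 * a) * bes s r) h"
proof -
 have s: "0 <= s" using a by simp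
 let ?k = "fm (%r. r powr (2 * a) * bes s r) h"
 let ?P = "%w. \<exists>F. is_FT u F \<and> is_FT w (%xi. cor ((norm xi) powr (2 * a)) * F xi)"
 have e: "AA xi. cor ((norm xi) powr (2 * a)) * F xi = rep_L2 (hat ?k) xi"
  if "is_FT u F" for F
 proof -
  have "AA xi. F xi = rep_L2 (hat (J s h)) xi" using that u by (simp add: is_FT_iff)
  then show ?thesis using rep_hat_J[OF s, of h] rep_hat_fm[OF symb_lap[OF a], of h]
   by eventually_elim (simp add: scaleR_conv_of_real)
 qed
 have "?P (rep_L2 ?k)"
  using e[OF is_FT_rep[OF u(1)]] is_FT_rep[OF u(1)] by (intro exI[of _ "rep_L2 (hat (abs_L2 u))"]) (auto simp: is_FT_iff)
 then have "?P (frac_lap a u)" unfolding frac_lap_def by (rule someI[where P = ?P])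
 then obtain F where F: "is_FT u F" "is_FT (frac_lap a u) (%xi. cor ((norm xi) powr (2 * a)) * F xi)" by blast
 show "L2fun (frac_lap a u)" using F(2) by (simp add: is_FT_iff)
 have "AA xi. cor ((norm xi) powr (2 * a)) * F xi = rep_L2 (hat (abs_L2 (frac_lap a u))) xi"
  using F(2) by (simp add: is_FT_iff)
 then have "AA xi. rep_L2 (hat (abs_L2 (frac_lap a u))) xi = rep_L2 (hat ?k) xi"
  using e[OF F(1)] by eventually_elim simp
 then show "abs_L2 (frac_lap a u) = ?k" unfolding hat_inject[symmetric] by (rule L2_eqI)
qed

lemma bessel_rel_iff:
 assumes a: "0 <= a" shows "bessel_rel a f h \<longleftrightarrow> L2fun f \<and> L2fun h \<and> abs_L2 f = J (2 * a) (abs_L2 h)"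
proof -
 have w: "cor ((1 + (norm xi)^2) powr a) * z = y \<longleftrightarrow> z = bes (2 * a) (norm xi) *\<^sub>R y" for xi :: "real^3" and z y
 proof -
  have "0 < 1 + (norm xi)^2" by (simp add: add_pos_nonneg)
  then have "cor ((1 + (norm xi)^2) powr a) * cor (bes (2 * a) (norm xi)) = 1"
   unfolding of_real_mult[symmetric] by (simp add: bes_def powr_add[symmetric])
  moreover have "C * z = y \<longleftrightarrow> z = B * y" if "C * B = 1" for B C :: complex
  proof
   assume "C * z = y"
   then have "B * y = C * B * z" by (simp add: ac_simps flip: \<open>C * z = y\<close>)
   then show "z = B * y" using that by simp
  next
   assume "z = B * y"
   then have "C * z = C * B * y" by simp
   then show "C * z = y" using that by simp
  qed
  ultimately show ?thesis unfolding scaleR_conv_of_real by blast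
 qed
 have a2: "0 <= 2 * a" using a by simp
 show ?thesis
 proof
  assume "bessel_rel a f h"
  then obtain F where F: "is_FT f F" "is_FT h (%xi. cor ((1 + (norm xi)^2) powr a) * F xi)" unfolding bessel_rel_def by blast
  from F(1) have f: "L2fun f" and f1: "AA xi. F xi = rep_L2 (hat (abs_L2 f)) xi" by (auto simp: is_FT_iff)
  from F(2) have h: "L2fun h" and h1: "AA xi. cor ((1 + (norm xi)^2) powr a) * F xi = rep_L2 (hat (abs_L2 h)) xi"
   by (auto simp: is_FT_iff)
  have "AA xi. rep_L2 (hat (abs_L2 f)) xi = rep_L2 (hat (J (2 * a) (abs_L2 h))) xi"
   using f1 h1 rep_hat_J[OF a2, of "abs_L2 h"] unfolding w by eventually_elim simp
  then have "abs_L2 f = J (2 * a) (abs_L2 h)" unfolding hat_inject[symmetric] by (rule L2_eqI)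
  then show "L2fun f \<and> L2fun h \<and> abs_L2 f = J (2 * a) (abs_L2 h)" using f h by blast
 next
  assume *: "L2fun f \<and> L2fun h \<and> abs_L2 f = J (2 * a) (abs_L2 h)"
  show "bessel_rel a f h" unfolding bessel_rel_def
  proof (intro exI conjI)
   show "is_FT f (rep_L2 (hat (abs_L2 f)))" using * is_FT_rep by blast
   have "AA xi. cor ((1 + (norm xi)^2) powr a) * rep_L2 (hat (abs_L2 f)) xi = rep_L2 (hat (abs_L2 h)) xi"
    using rep_hat_J[OF a2, of "abs_L2 h"] * unfolding w by auto
   moreover have "(%xi. cor ((1 + (norm xi)^2) powr a) * rep_L2 (hat (abs_L2 f)) xi) \<in> borel_measurable borel"
    by measurable
   ultimately show "is_FT h (%xi. cor ((1 + (norm xi)^2) powr a) * rep_L2 (hat (abs_L2 f)) xi)"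
    unfolding is_FT_iff using * by blast
  qed
 qed
qed

lemma bessel_op_J:
 assumes f: "L2fun f" "abs_L2 f = J (2 * a) h" and a: "0 <= a"
 shows "L2fun (bessel_op a f)" "abs_L2 (bessel_op a f) = h"
proof -
 have "bessel_rel a f (rep_L2 h)" using f by (simp add: bessel_rel_iff[OF a])
 then have "bessel_rel a f (bessel_op a f)" unfolding bessel_op_def by (rule someI[where P = "bessel_rel a f"])
 then have b: "L2fun (bessel_op a f)" "J (2 * a) (abs_L2 (bessel_op a f)) = J (2 * a) h"
  using f by (auto simp: bessel_rel_iff[OF a])
 show "L2fun (bessel_op a f)" by fact
 show "abs_L2 (bessel_op a f) = h" by (rule J_inject[OF _ b(2)]) (use a in simp)
qed

lemma in_Lt2_iff: "0 <= t ==> in_Lt2 t f \<longleftrightarrow> L2fun f \<and> (\<exists>h. abs_L2 f = J t h)"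
proof -
 assume "0 <= t"
 then show ?thesis unfolding in_Lt2_def using bessel_rel_iff[of "t / 2" f]
  by (auto intro: exI[of _ "rep_L2 h" for h])
qed

section \<open>Low-frequency estimates\<close>

lemma symb_low: "symb (indicator {..A})" "symb (indicator {A<..})"
 by (rule symbI[where M = 1], auto simp: indicator_def)+

definition low :: "real => real L2 => real L2" where "low A = fm (indicator {..A})"

text \<open>The low-frequency part has a transform of bounded support, so inversion represents it by
  an absolutely convergent integral and makes point values meaningful.\<close>

lemma rep_low: "AA x. cor (rep_L2 (low A k) x) = fcut A (hat k) (- x) / (2 * pi) ^ 3"
proof -
 have hc: "hat (low A k) = cut A (hat k)"
  by (rule L2_eqI, use rep_hat_fm[OF symb_low(1)[of A], of k] rep_cut[of A "hat k"] in eventually_elim) (simp add: low_def indicator_def)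
 have "(2 * pi) ^ 3 *\<^sub>R refl (cx (low A k)) = abs_L2 (fcut A (hat k))"
  unfolding FTc_FTc[symmetric] hat_def[symmetric] hc FTc_cut ..
 then have "AA x. rep_L2 ((2 * pi) ^ 3 *\<^sub>R refl (cx (low A k))) x = fcut A (hat k) x"
  using rep_abs[OF L2fun_fcut[of A "hat k"]] by simp
 then have "AA x. (2 * pi) ^ 3 * cor (rep_L2 (low A k) (- x)) = fcut A (hat k) x"
  using rep_scaleR[of "(2 * pi) ^ 3" "refl (cx (low A k))"] rep_refl[of "cx (low A k)"] AE_lborel_uminus[OF rep_cx[of "low A k"]]
  by eventually_elim (simp add: scaleR_conv_of_real)
 from AE_lborel_uminus[OF this] show ?thesis
  by eventually_elim (simp add: field_simps)
qed

lemma integrable_powr_1d: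
 assumes "a < (1::real)" shows "integrable lborel (%x::real. \<bar>x\<bar> powr (- a) * indicator {-1..1} x)"
proof -
 have "(%x::real. x powr (- a)) integrable_on {0..1}" using assms by (intro integrable_on_powr_from_0) auto
 then have "(%x::real. x powr (- a)) absolutely_integrable_on {0..1}"
  by (subst absolutely_integrable_on_iff_nonneg) auto
 then have i: "integrable lborel (%x::real. indicator {0..1} x * x powr (- a))"
  unfolding set_integrable_def by (subst (asm) integrable_completion) (simp_all)
 then have "integrable lborel (%x::real. indicator {0..1} (- x) * (- x) powr (- a))"
  using lborel_integrable_real_affine[OF i, of "-1" 0] by simp
 then have "integrable lborel (%x::real. indicator {0..1} x * x powr (- a) + indicator {0..1} (- x) * (- x) powr (- a))"
  using i by (rule bint_add[rotated])
 also have "(%x::real. indicator {0..1} x * x powr (- a) + indicator {0..1} (- x) * (- x) powr (- a)) = (%x. \<bar>x\<bar> powr (- a) * indicator {-1..1} x)"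
  by (auto simp: indicator_def fun_eq_iff)
 finally show ?thesis .
qed

lemma AE_coordinates: "AA x. \<forall>b\<in>Basis. x \<bullet> b ~= 0"
proof (subst AE_ball_countable, simp add: countable_finite, rule ballI)
 fix b :: "real^3" assume "b \<in> Basis"
 then have "negligible {x. x \<bullet> b = 0}" by (rule negligible_standard_hyperplane)
 moreover have "{x. x \<bullet> b = 0} \<in> sets (lborel :: (real^3) measure)" by (auto intro!: borel_closed closed_hyperplane simp: inner_commute[of _ b])
 ultimately have "{x. x \<bullet> b = 0} \<in> null_sets lborel"
  by (simp add: negligible_iff_null_sets null_sets_completion_iff)
 then show "AA x. x \<bullet> b ~= 0" by (rule AE_I') auto
qed

text \<open>Each coordinate is at most the norm, so \<open>norm x powr (- 2 * s)\<close> is at most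
  the product over the coordinates of their powers \<open>- (2 * s / 3)\<close>, and
  \<open>2 * s / 3 < 1\<close>.\<close>

lemma integrable_riesz:
 assumes s: "0 <= s" "2 * s < 3"
 shows "integrable lborel (%xi::real^3. norm xi powr (- 2 * s) * indicator (cball 0 1) xi)"
proof -
 define f where "f x = \<bar>x\<bar> powr (- (2 * s / 3)) * indicator {-1..1} x" for x :: real
 have "integrable lborel f" unfolding f_def using s by (intro integrable_powr_1d) simp
 then have "integrable lborel (%x. cor (f x))" by simp
 then have "integrable lborel (%x::real^3. \<Prod>b\<in>Basis. cor (f (x \<bullet> b)))" by (intro lborel_prod_integral(1))
 then have i: "integrable lborel (%x::real^3. norm (\<Prod>b\<in>Basis. cor (f (x \<bullet> b))))" by (rule integrable_norm)
 show ?thesis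
 proof (rule bint_bound[OF i])
  show "AA x. norm (norm x powr (- 2 * s) * indicator (cball 0 1) x) <= norm (norm (\<Prod>b\<in>Basis. cor (f (x \<bullet> b))))"
   using AE_coordinates
  proof eventually_elim
   case (elim x)
   show ?case
   proof (cases "norm x <= 1")
    case True
    have b: "\<bar>x \<bullet> b\<bar> <= norm x" if "b \<in> Basis" for b using Basis_le_norm[OF that] .
    have f: "norm x powr (- (2 * s / 3)) <= f (x \<bullet> b)" if "b \<in> Basis" for b
    proof -
     have "norm x powr (- (2 * s / 3)) <= \<bar>x \<bullet> b\<bar> powr (- (2 * s / 3))"
      using elim that b[OF that] s by (intro powr_mono2') auto
     moreover have "x \<bullet> b \<in> {-1..1}" using b[OF that] True by auto
     ultimately show ?thesis by (simp add: f_def)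
    qed
    have "(\<Prod>b\<in>(Basis::(real^3) set). norm x powr (- (2 * s / 3))) <= (\<Prod>b\<in>Basis. f (x \<bullet> b))"
     by (intro prod_mono conjI f) auto
    also have "(\<Prod>b\<in>(Basis::(real^3) set). norm x powr (- (2 * s / 3))) = norm x powr (- 2 * s)"
     by (cases "x = 0") (simp_all add: powr_powr flip: powr_realpow)
    finally have "norm x powr (- 2 * s) <= \<bar>\<Prod>b\<in>Basis. f (x \<bullet> b)\<bar>" by simp
    then show ?thesis using True by (simp flip: of_real_prod)
   qed simp
  qed
 qed measurable
qed

lemma riesz_scaled:
 fixes A s :: real
 assumes s: "0 <= s" "2 * s < 3" and A: "0 < A"
 shows "integrable lborel (%xi::real^3. norm xi powr (- 2 * s) * indicator (cball 0 A) xi)"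
  and "(LBINT xi. norm (xi::real^3) powr (- 2 * s) * indicator (cball 0 A) xi)
   = A powr (3 - 2 * s) * (LBINT xi. norm (xi::real^3) powr (- 2 * s) * indicator (cball 0 1) xi)"
proof -
 let ?f = "%B xi::real^3. norm xi powr (- 2 * s) * indicator (cball 0 B) xi"
 have fm: "?f B \<in> borel_measurable borel" for B by measurable
 have sc: "?f A (A *\<^sub>R xi) = A powr (- 2 * s) * ?f 1 xi" for xi
  using A by (auto simp: indicator_def powr_mult abs_mult pos_le_divide_eq mult_le_cancel_left1 mult_left_le)
 have sc2: "A powr (- 2 * s) * ?f 1 ((1 / A) *\<^sub>R xi) = ?f A xi" for xi
  using sc[of "(1 / A) *\<^sub>R xi"] A by simp
 have "integrable lborel (%xi. ?f 1 (0 + (1 / A) *\<^sub>R xi))"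
  by (rule lborel_integrable_affine[OF _ fm integrable_riesz[OF s]]) (use A in simp)
 then have "integrable lborel (%xi. A powr (- 2 * s) * ?f 1 ((1 / A) *\<^sub>R xi))"
  by (intro integrable_mult_right) simp
 then show "integrable lborel (?f A)" unfolding sc2 .
 have "(LBINT xi. ?f A xi) = \<bar>A\<bar> ^ 3 *\<^sub>R (LBINT xi. ?f A (0 + A *\<^sub>R xi))"
  by (rule lborel_integral_affine[OF _ fm]) (use A in simp)
 also have "... = A ^ 3 * (LBINT xi. A powr (- 2 * s) * ?f 1 xi)" using A by (simp only: add_0 sc abs_of_pos real_scaleR_def)
 also have "... = A ^ 3 * (A powr (- 2 * s) * (LBINT xi. ?f 1 xi))" by (simp only: integral_mult_right_zero)
 also have "A ^ 3 = A powr 3" using A by simp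
 also have "A powr 3 * (A powr (- 2 * s) * (LBINT xi. ?f 1 xi)) = A powr (3 - 2 * s) * (LBINT xi. ?f 1 xi)"
  using powr_add[of A 3 "- 2 * s"] by simp
 finally show "(LBINT xi. ?f A xi) = A powr (3 - 2 * s) * (LBINT xi. ?f 1 xi)" .
qed

text \<open>Cauchy-Schwarz with \<open>norm xi powr (- s)\<close> restricted to the ball; scaling
  shows how its norm depends on \<open>A\<close>.\<close>

lemma low_freq_bound:
 assumes s: "0 <= s" "2 * s < 3"
 obtains C where "0 < C" "!!A h. 0 < A ==>
  (LBINT xi. cmod (indicator (cball 0 A) xi *\<^sub>R rep_L2 (hat (J s h)) xi)) <= C * A powr (3 / 2 - s) * norm h"
proof -
 define I where "I = (LBINT xi. norm (xi::real^3) powr (- 2 * s) * indicator (cball 0 1) xi)"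
 define C where "C = sqrt I * cFT + 1"
 have I: "0 <= I" unfolding I_def by simp
 have C: "0 < C" unfolding C_def using I by (simp add: add_nonneg_pos)
 have b: "(LBINT xi. cmod (indicator (cball 0 A) xi *\<^sub>R rep_L2 (hat (J s h)) xi)) <= C * A powr (3 / 2 - s) * norm h" if A: "0 < A" for A h
 proof -
  let ?f = "%xi::real^3. norm xi powr (- s) * indicator (cball 0 A) xi" and ?g = "%xi. cmod (rep_L2 (hat h) xi)"
  have sq: "(norm (?f xi))^2 = norm xi powr (- 2 * s) * indicator (cball 0 A) xi" for xi
   by (cases "xi = 0"; cases "xi \<in> cball 0 A") (simp_all add: powr_powr mult.commute[of s] flip: powr_numeral)
  have f: "L2fun ?f"
  proof (rule L2fun_bound[OF _ riesz_scaled(1)[OF s A]])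
   show "?f \<in> borel_measurable lborel" by measurable
  qed (simp only: sq order_refl eventually_True)
  have g: "L2fun ?g" by (rule L2fun_bound[OF _ L2fun_integrable[OF rep_L2fun[of "hat h"]]]) auto
  have nf: "norm (abs_L2 ?f) = A powr (3 / 2 - s) * sqrt I"
  proof -
   have "(norm (abs_L2 ?f))^2 = A powr (3 - 2 * s) * I"
    unfolding norm_abs_L2[OF f] sq riesz_scaled(2)[OF s A] I_def ..
   also have "A powr (3 - 2 * s) = (A powr (3 / 2 - s))^2" using A by (simp add: powr_powr algebra_simps flip: powr_numeral)
   also have "... * I = (A powr (3 / 2 - s) * sqrt I)^2" using I by (simp add: power_mult_distrib)
   finally show ?thesis by (rule power2_eq_imp_eq) (use I in simp_all)
  qed
  have ng: "norm (abs_L2 ?g) = cFT * norm h"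
  proof -
   have "(norm (abs_L2 ?g))^2 = (cFT * norm h)^2" unfolding norm_abs_L2[OF g] norm_hat[symmetric] norm_L2_square[of "hat h"] by simp
   then show ?thesis by (rule power2_eq_imp_eq) simp_all
  qed
  have "(LBINT xi. cmod (indicator (cball 0 A) xi *\<^sub>R rep_L2 (hat (J s h)) xi)) <= (LBINT xi. inner (?f xi) (?g xi))"
  proof (rule integral_mono_AE)
   show "integrable lborel (%xi. cmod (indicator (cball 0 A) xi *\<^sub>R rep_L2 (hat (J s h)) xi))" by (rule integrable_norm[OF cut_integrable])
   show "integrable lborel (%xi. inner (?f xi) (?g xi))" by (rule integrable_inner_L2[OF f g])
   show "AA xi. cmod (indicator (cball 0 A) xi *\<^sub>R rep_L2 (hat (J s h)) xi) <= inner (?f xi) (?g xi)"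
    using rep_hat_J[OF s(1), of h] AE_lborel_singleton[of "0::real^3"]
   proof eventually_elim
    case (elim xi)
    then have "bes s (norm xi) <= norm xi powr (- s)" by (intro bes_le_powr s) simp
    then show ?case using elim bes_pos[of s "norm xi"] by (simp add: indicator_def mult_right_mono)
   qed
  qed
  also have "... = inner (abs_L2 ?f) (abs_L2 ?g)" by (rule inner_abs_L2[OF f g, symmetric])
  also have "... <= norm (abs_L2 ?f) * norm (abs_L2 ?g)" by (rule norm_cauchy_schwarz)
  also have "... = (sqrt I * cFT) * (A powr (3 / 2 - s) * norm h)" unfolding nf ng by simp
  also have "... <= C * (A powr (3 / 2 - s) * norm h)" unfolding C_def by (intro mult_right_mono) auto
  finally show ?thesis by (simp add: mult.assoc)
 qed
 from that[OF C b] show thesis by blast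
qed

section \<open>Sobolev inequality and local compactness\<close>

lemma nn_integral_powr_from_0:
 assumes a: "a > (-1::real)" and c: "c >= 0"
 shows "(\<integral>\<^sup>+tau. ennreal (tau powr a) * indicator {0<..<c} tau \<partial>lborel) = ennreal (c powr (a + 1) / (a + 1))"
proof -
 have "((%x. x powr a) has_integral (c powr (a + 1) / (a + 1))) {0<..<c}"
  using has_integral_powr_from_0[OF a c] by (subst has_integral_Icc_iff_Ioo[symmetric])
 then have "((%x. x powr a * indicator {0<..<c} x) has_integral (c powr (a + 1) / (a + 1))) UNIV"
  unfolding has_integral_restrict_UNIV[symmetric, of _ _ "{0<..<c}"] by (rule has_integral_eq[rotated]) (auto simp: indicator_def)
 then have "(\<integral>\<^sup>+tau. ennreal (tau powr a * indicator {0<..<c} tau) \<partial>lborel) = ennreal (c powr (a + 1) / (a + 1))"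
  by (intro nn_integral_has_integral_lborel) auto
 then show ?thesis by (simp add: ennreal_mult' ennreal_indicator)
qed

lemma layer_cake:
 assumes p: "0 < p" and [measurable]: "v \<in> borel_measurable borel"
 shows "(\<integral>\<^sup>+x. ennreal (\<bar>v x\<bar> powr p) \<partial>(lborel::(real^3) measure))
  = (\<integral>\<^sup>+tau. ennreal (p * tau powr (p - 1)) * indicator {0<..} tau * (\<integral>\<^sup>+x. indicator {x. tau < \<bar>v x\<bar>} x \<partial>lborel) \<partial>lborel)"
proof -
 have "(\<integral>\<^sup>+x. ennreal (\<bar>v x\<bar> powr p) \<partial>lborel) = (\<integral>\<^sup>+x. (\<integral>\<^sup>+tau. ennreal (p * tau powr (p - 1)) * indicator {0<..} tau * indicator {x. tau < \<bar>v x\<bar>} x \<partial>lborel) \<partial>lborel)"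
 proof (rule nn_integral_cong)
  fix x
  have "(\<integral>\<^sup>+tau. ennreal (p * tau powr (p - 1)) * indicator {0<..} tau * indicator {x. tau < \<bar>v x\<bar>} x \<partial>lborel)
   = (\<integral>\<^sup>+tau. ennreal p * (ennreal (tau powr (p - 1)) * indicator {0<..<\<bar>v x\<bar>} tau) \<partial>lborel)"
   by (rule nn_integral_cong) (use p in \<open>auto simp: indicator_def ennreal_mult'\<close>)
  also have "... = ennreal p * ennreal (\<bar>v x\<bar> powr p / p)"
   using nn_integral_powr_from_0[of "p - 1" "\<bar>v x\<bar>"] p by (subst nn_integral_cmult) auto
  also have "... = ennreal (\<bar>v x\<bar> powr p)" using p by (simp add: ennreal_mult'[symmetric])
  finally show "ennreal (\<bar>v x\<bar> powr p) = (\<integral>\<^sup>+tau. ennreal (p * tau powr (p - 1)) * indicator {0<..} tau * indicator {x. tau < \<bar>v x\<bar>} x \<partial>lborel)" by simp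
 qed
 also have "... = (\<integral>\<^sup>+tau. (\<integral>\<^sup>+x. ennreal (p * tau powr (p - 1)) * indicator {0<..} tau * indicator {x. tau < \<bar>v x\<bar>} x \<partial>lborel) \<partial>lborel)"
 proof (rule lborel_pair.Fubini'[symmetric])
  have "(%(x, tau). ennreal (p * tau powr (p - 1)) * indicator {0<..} tau * indicator {(tau, x). tau < \<bar>v x\<bar>} (tau, x))
   \<in> borel_measurable ((lborel::(real^3) measure) \<Otimes>\<^sub>M lborel)" by measurable
  then show "(%(x, tau). ennreal (p * tau powr (p - 1)) * indicator {0<..} tau * indicator {x. tau < \<bar>v x\<bar>} x)
   \<in> borel_measurable ((lborel::(real^3) measure) \<Otimes>\<^sub>M lborel)" by (simp add: indicator_def)
 qed
 also have "... = (\<integral>\<^sup>+tau. ennreal (p * tau powr (p - 1)) * indicator {0<..} tau * (\<integral>\<^sup>+x. indicator {x. tau < \<bar>v x\<bar>} x \<partial>lborel) \<partial>lborel)"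
  by (intro nn_integral_cong nn_integral_cmult) measurable
 finally show ?thesis .
qed

lemma J_low_bound:
 assumes s: "0 <= s" "2 * s < 3"
 obtains B where "0 < B" "!!A h. 0 < A ==> AA x. \<bar>rep_L2 (low A (J s h)) x\<bar> <= B * A powr (3 / 2 - s) * norm h"
proof -
 obtain C where C: "0 < C" "!!A h. 0 < A ==>
  (LBINT xi. cmod (indicator (cball 0 A) xi *\<^sub>R rep_L2 (hat (J s h)) xi)) <= C * A powr (3 / 2 - s) * norm h"
  using low_freq_bound[OF s] by blast
 show thesis
 proof (rule that[of "C / (2 * pi) ^ 3"])
  fix A :: real and h assume A: "0 < A"
  show "AA x. \<bar>rep_L2 (low A (J s h)) x\<bar> <= C / (2 * pi) ^ 3 * A powr (3 / 2 - s) * norm h"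
   using rep_low[of A "J s h"]
  proof eventually_elim
   case (elim x)
   have "\<bar>rep_L2 (low A (J s h)) x\<bar> = cmod (cor (rep_L2 (low A (J s h)) x))" by simp
   also have "... = cmod (fcut A (hat (J s h)) (- x)) / (2 * pi) ^ 3" unfolding elim by (simp add: norm_divide norm_power norm_mult)
   also have "... <= C * A powr (3 / 2 - s) * norm h / (2 * pi) ^ 3"
    unfolding fcut_def by (intro divide_right_mono order_trans[OF fint_bound[OF cut_integrable] C(2)[OF A]]) simp
   finally show ?case by simp
  qed
 qed (use C in simp)
qed

lemma fm_uminus_low: "symb \<mu> ==> fm \<mu> h - low A (fm \<mu> h) = fm (%r. \<mu> r * indicator {A<..} r) h"
proof -
 assume \<mu>: "symb \<mu>"
 note s1 = symb_mult[OF symb_low(1) \<mu>] and s2 = symb_mult[OF \<mu> symb_low(2)]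
 have "fm \<mu> h = fm (%r. indicator {..A} r * \<mu> r) h + fm (%r. \<mu> r * indicator {A<..} r) h"
  by (rule fm_lincomb[OF s1 s2 \<mu>]) (auto simp: indicator_def)
 moreover have "low A (fm \<mu> h) = fm (%r. indicator {..A} r * \<mu> r) h" unfolding low_def by (rule fm_fm[OF symb_low(1) \<mu>])
 ultimately show ?thesis by (metis add_diff_cancel_left')
qed

text \<open>Frequencies are cut at a radius that depends on the height \<open>tau\<close>: the low
  part is then at most \<open>tau / 2\<close> almost everywhere, so \<open>|v| > tau\<close> forces
  the high part above \<open>tau / 2\<close>, and Chebyshev's inequality bounds the level set by the
  square norm of the high part. The layer cake formula and Fubini's theorem leave, for each
  frequency, an integral of \<open>tau powr (p - 3)\<close> over a bounded interval.\<close>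

lemma sobolev_inequality:
 assumes s: "0 < s" "2 * s < 3" and p: "p = 6 / (3 - 2 * s)"
 obtains C where "0 < C" "!!h. (\<integral>\<^sup>+x. ennreal (\<bar>rep_L2 (J s h) x\<bar> powr p) \<partial>lborel) <= ennreal (C * norm h powr p)"
proof -
 have s0: "0 <= s" using s by simp
 obtain B where B: "0 < B" "!!A h. 0 < A ==> AA x. \<bar>rep_L2 (low A (J s h)) x\<bar> <= B * A powr (3 / 2 - s) * norm h"
  using J_low_bound[OF s0 s(2)] by blast
 have p2: "2 < p" using s unfolding p by (simp add: field_simps)
 have ps: "p / 3 * (3 / 2 - s) = 1" "3 / p * (p - 2) = 2 * s" "p / 3 * (3 / p) = 1" using s unfolding p by (auto simp: field_simps)
 define C where "C = p * 4 * (2 * B) powr (p - 2) / (p - 2)"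
 have C: "0 < C" using p2 B(1) by (simp add: C_def)
 show thesis
 proof (rule that[OF C])
  fix h :: "real L2"
  define N where "N = norm h"
  define v where "v = rep_L2 (J s h)"
  define H where "H xi = (cmod (rep_L2 (hat h) xi))^2 / (2 * pi) ^ 3" for xi
  have [measurable]: "v \<in> borel_measurable borel" "H \<in> borel_measurable borel" unfolding v_def H_def by measurable
  have H0: "0 <= H xi" for xi by (simp add: H_def)
  have HN: "(\<integral>\<^sup>+xi. ennreal (H xi) \<partial>lborel) = ennreal (N^2)"
  proof -
   have "(\<integral>\<^sup>+xi. ennreal (H xi) \<partial>lborel) = (\<integral>\<^sup>+xi. ennreal (1 / (2 * pi) ^ 3) * ennreal ((cmod (rep_L2 (hat h) xi))^2) \<partial>lborel)"
    unfolding H_def by (intro nn_integral_cong) (simp add: ennreal_mult'[symmetric])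
   also have "... = ennreal (1 / (2 * pi) ^ 3) * ennreal ((cFT * norm h)^2)"
    by (subst nn_integral_cmult) (simp_all only: nn_norm_L2 norm_hat, measurable)
   also have "... = ennreal (N^2)" unfolding power_mult_distrib[of cFT] cFT_square N_def by (simp add: ennreal_mult'[symmetric])
   finally show ?thesis .
  qed
  show "(\<integral>\<^sup>+x. ennreal (\<bar>rep_L2 (J s h) x\<bar> powr p) \<partial>lborel) <= ennreal (C * norm h powr p)"
  proof (cases "h = 0")
   case True
   have z: "AA x. v x = 0" using rep_zero unfolding v_def True linear_0[OF bounded_linear.linear[OF J_bl[OF s0]]] .
   have "(\<integral>\<^sup>+x. ennreal (\<bar>v x\<bar> powr p) \<partial>lborel) = integral\<^sup>N (lborel :: (real^3) measure) (%x. 0)"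
    by (rule nn_integral_cong_AE, use z in eventually_elim) simp
   then show ?thesis by (simp add: v_def)
  next
   case False
   then have N: "0 < N" by (simp add: N_def)
   \<comment> \<open>For the cutoff \<open>A\<close> chosen below at height \<open>tau\<close>, the
     condition \<open>A < norm xi\<close> implies \<open>tau < w xi\<close>.\<close>
   define w where "w xi = 2 * B * N * norm xi powr (3 / p)" for xi :: "real^3"
   let ?N = "%tau. (\<integral>\<^sup>+x. indicator {x. tau < \<bar>v x\<bar>} x \<partial>lborel)"
   let ?E = "%xi tau. ennreal (4 * p * norm xi powr (- 2 * s) * H xi) * (ennreal (tau powr (p - 3)) * indicator {0<..<w xi} tau)"
   have [measurable]: "w \<in> borel_measurable borel" unfolding w_def by measurable
   have dist: "?N tau
    <= (\<integral>\<^sup>+xi. ennreal (4 * tau powr (-2)) * (ennreal (norm xi powr (- 2 * s) * H xi) * indicator {..<w xi} tau) \<partial>lborel)"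
    if l: "0 < tau" for tau
   proof -
    \<comment> \<open>Solves \<open>B * A powr (3 / 2 - s) * N = tau / 2\<close>, as
      \<open>p / 3\<close> is the inverse of \<open>3 / 2 - s\<close>.\<close>
    define A where "A = (tau / (2 * B * N)) powr (p / 3)"
    have A: "0 < A" using l B(1) N by (simp add: A_def)
    have A1: "B * A powr (3 / 2 - s) * N = tau / 2"
     unfolding A_def powr_powr ps using l B(1) N by (simp add: field_simps)
    let ?d = "fm (%r. bes s r * indicator {A<..} r) h"
    note sd = symb_mult[OF symb_bes[OF s0] symb_low(2)[of A]]
    have d: "J s h - low A (J s h) = ?d" unfolding J_def by (rule fm_uminus_low[OF symb_bes[OF s0]])
    have "?N tau <= (\<integral>\<^sup>+x. ennreal (4 * tau powr (-2)) * ennreal ((norm (rep_L2 ?d x))^2) \<partial>lborel)"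
    proof (rule nn_integral_mono_AE)
     show "AA x. indicator {x. tau < \<bar>v x\<bar>} x <= ennreal (4 * tau powr (-2)) * ennreal ((norm (rep_L2 ?d x))^2)"
      using B(2)[OF A, of h] rep_diff[of "J s h" "low A (J s h)"] unfolding d
     proof eventually_elim
      case (elim x)
      show ?case
      proof (cases "tau < \<bar>v x\<bar>")
       case True
       moreover have "\<bar>rep_L2 (low A (J s h)) x\<bar> <= tau / 2" using elim(1) A1 by (simp add: N_def)
       ultimately have "tau / 2 <= norm (rep_L2 ?d x)" unfolding v_def elim(2) real_norm_def by linarith
       then have "(tau / 2)^2 <= (norm (rep_L2 ?d x))^2" using l by (intro power_mono) auto
       then have "1 <= 4 * tau powr (-2) * (norm (rep_L2 ?d x))^2"
        using l by (simp add: powr_minus powr_numeral field_simps power2_eq_square)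
       then have "ennreal 1 <= ennreal (4 * tau powr (-2) * (norm (rep_L2 ?d x))^2)" by (rule ennreal_leI)
       then show ?thesis using True by (simp add: ennreal_mult')
      qed simp
     qed
    qed
    also have "... = ennreal (4 * tau powr (-2)) * ennreal ((norm ?d)^2)"
     by (subst nn_integral_cmult) (simp_all only: nn_norm_L2, measurable)
    also have "ennreal ((norm ?d)^2) = ennreal (1 / (2 * pi) ^ 3) * ennreal ((norm (hat ?d))^2)"
     unfolding norm_hat power_mult_distrib[of cFT] cFT_square by (simp add: ennreal_mult'[symmetric])
    also have "... = (\<integral>\<^sup>+xi. ennreal (1 / (2 * pi) ^ 3) * ennreal ((norm (rep_L2 (hat ?d) xi))^2) \<partial>lborel)"
     by (subst nn_integral_cmult) (simp_all only: nn_norm_L2, measurable)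
    also have "... <= (\<integral>\<^sup>+xi. ennreal (norm xi powr (- 2 * s) * H xi) * indicator {..<w xi} tau \<partial>lborel)"
    proof (rule nn_integral_mono_AE)
     show "AA xi. ennreal (1 / (2 * pi) ^ 3) * ennreal ((norm (rep_L2 (hat ?d) xi))^2) <= ennreal (norm xi powr (- 2 * s) * H xi) * indicator {..<w xi} tau"
      using rep_hat_fm[OF sd, of h]
     proof eventually_elim
      case (elim xi)
      show ?case
      proof (cases "A < norm xi")
       case True
       have "A powr (3 / p) < norm xi powr (3 / p)" using True A p2 by (intro powr_less_mono2) auto
       moreover have "A powr (3 / p) = tau / (2 * B * N)" unfolding A_def powr_powr ps using l B(1) N by simp
       ultimately have w: "tau < w xi" unfolding w_def using B(1) N by (simp add: field_simps)
       have "(bes s (norm xi))^2 <= (norm xi powr (- s))^2" using bes_pos[of s "norm xi"] bes_le_powr[OF s0 less_trans[OF A True]] by (intro power_mono) auto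
       also have "... = norm xi powr (- 2 * s)" using True A by (simp add: powr_powr mult.commute[of s] flip: powr_numeral)
       finally have le: "1 / (2 * pi) ^ 3 * ((bes s (norm xi))^2 * (cmod (rep_L2 (hat h) xi))^2) <= norm xi powr (- 2 * s) * H xi"
        unfolding H_def by (simp add: divide_right_mono mult_right_mono)
       have e: "(norm (rep_L2 (hat ?d) xi))^2 = (bes s (norm xi))^2 * (cmod (rep_L2 (hat h) xi))^2"
        using elim True by (simp add: power_mult_distrib)
       have "ennreal (1 / (2 * pi) ^ 3) * ennreal ((norm (rep_L2 (hat ?d) xi))^2)
        = ennreal (1 / (2 * pi) ^ 3 * ((bes s (norm xi))^2 * (cmod (rep_L2 (hat h) xi))^2))"
        unfolding e by (rule ennreal_mult''[symmetric]) simp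
       also have "... <= ennreal (norm xi powr (- 2 * s) * H xi)" by (rule ennreal_leI[OF le])
       also have "... = ... * indicator {..<w xi} tau" using w by simp
       finally show ?thesis .
      qed (use elim in simp)
     qed
    qed
    also have "ennreal (4 * tau powr (-2)) * ... = (\<integral>\<^sup>+xi. ennreal (4 * tau powr (-2)) * (ennreal (norm xi powr (- 2 * s) * H xi) * indicator {..<w xi} tau) \<partial>lborel)"
     by (rule nn_integral_cmult[symmetric]) (measurable, simp add: indicator_def)
    finally show ?thesis by (simp add: mult_left_mono)
   qed
   have "(\<integral>\<^sup>+x. ennreal (\<bar>v x\<bar> powr p) \<partial>lborel)
    = (\<integral>\<^sup>+tau. ennreal (p * tau powr (p - 1)) * indicator {0<..} tau * ?N tau \<partial>lborel)"
    by (rule layer_cake) (use p2 in auto)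
   also have "... <= (\<integral>\<^sup>+tau. (\<integral>\<^sup>+xi. ?E xi tau \<partial>lborel) \<partial>lborel)"
   proof (rule nn_integral_mono)
    fix tau :: real
    show "ennreal (p * tau powr (p - 1)) * indicator {0<..} tau * ?N tau
     <= (\<integral>\<^sup>+xi. ?E xi tau \<partial>lborel)"
    proof (cases "0 < tau")
     case l: True
     have pw: "tau powr (p - 3) = tau powr (p - 1) * tau powr (-2)" by (simp add: powr_add[symmetric])
     have "ennreal (p * tau powr (p - 1)) * ?N tau
      <= ennreal (p * tau powr (p - 1)) * (\<integral>\<^sup>+xi. ennreal (4 * tau powr (-2)) * (ennreal (norm xi powr (- 2 * s) * H xi) * indicator {..<w xi} tau) \<partial>lborel)"
      by (rule mult_left_mono[OF dist[OF l]]) simp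
     also have "... = (\<integral>\<^sup>+xi. ennreal (p * tau powr (p - 1)) * (ennreal (4 * tau powr (-2)) * (ennreal (norm xi powr (- 2 * s) * H xi) * indicator {..<w xi} tau)) \<partial>lborel)"
      by (rule nn_integral_cmult[symmetric]) (measurable, simp add: indicator_def)
     also have "... = (\<integral>\<^sup>+xi. ?E xi tau \<partial>lborel)"
     proof (rule nn_integral_cong)
      fix xi
      show "ennreal (p * tau powr (p - 1)) * (ennreal (4 * tau powr (-2)) * (ennreal (norm xi powr (- 2 * s) * H xi) * indicator {..<w xi} tau))
       = ?E xi tau"
       using l p2 H0[of xi] unfolding pw by (cases "tau < w xi") (simp_all add: ennreal_mult'[symmetric] ac_simps)
     qed
     finally show ?thesis using l by simp
    qed simp
   qed
   also have "... = (\<integral>\<^sup>+xi. (\<integral>\<^sup>+tau. ?E xi tau \<partial>lborel) \<partial>lborel)"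
   proof (rule lborel_pair.Fubini')
    have "(%(xi, tau). ennreal (4 * p * norm xi powr (- 2 * s) * H xi) * (ennreal (tau powr (p - 3)) * indicator {(xi, tau). 0 < tau \<and> tau < w xi} (xi, tau)))
     \<in> borel_measurable ((lborel::(real^3) measure) \<Otimes>\<^sub>M lborel)" by measurable
    then show "(%(xi, tau). ?E xi tau)
     \<in> borel_measurable ((lborel::(real^3) measure) \<Otimes>\<^sub>M lborel)" by (simp add: indicator_def)
   qed
   also have "... <= (\<integral>\<^sup>+xi. ennreal (C * N powr (p - 2)) * ennreal (H xi) \<partial>lborel)"
   proof (rule nn_integral_mono)
    fix xi :: "real^3"
    have w0: "0 <= w xi" unfolding w_def using B(1) N by simp
    have "(\<integral>\<^sup>+tau. ?E xi tau \<partial>lborel)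
     = ennreal (4 * p * norm xi powr (- 2 * s) * H xi) * ennreal (w xi powr (p - 2) / (p - 2))"
     using nn_integral_powr_from_0[of "p - 3" "w xi"] p2 w0 by (subst nn_integral_cmult) auto
    also have "... <= ennreal (C * N powr (p - 2) * H xi)"
    proof (cases "xi = 0")
     case True
     then show ?thesis using C H0 by simp
    next
     case False
     \<comment> \<open>The exponents match: \<open>w xi powr (p - 2)\<close> cancels the factor
       \<open>norm xi powr (- 2 * s)\<close> that bounds the squared Bessel symbol.\<close>
     have "w xi powr (p - 2) = (2 * B) powr (p - 2) * N powr (p - 2) * norm xi powr (2 * s)"
     proof -
      have "(3 * p - 6) / p = 2 * s" using ps(2) p2 by (simp add: field_simps)
      then show ?thesis unfolding w_def using B(1) N by (simp add: powr_mult powr_powr)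
     qed
     moreover have "norm xi powr (- 2 * s) * norm xi powr (2 * s) = 1" using False by (simp add: powr_add[symmetric])
     ultimately have "4 * p * norm xi powr (- 2 * s) * H xi * (w xi powr (p - 2) / (p - 2)) = C * N powr (p - 2) * H xi"
      unfolding C_def by (simp add: field_simps)
     then show ?thesis using p2 H0[of xi] by (simp add: ennreal_mult'[symmetric])
    qed
    also have "... = ennreal (C * N powr (p - 2)) * ennreal (H xi)" using C by (simp add: ennreal_mult')
    finally show "(\<integral>\<^sup>+tau. ?E xi tau \<partial>lborel)
     <= ennreal (C * N powr (p - 2)) * ennreal (H xi)" .
   qed
   also have "... = ennreal (C * N powr (p - 2)) * ennreal (N^2)"
    by (subst nn_integral_cmult) (simp_all only: HN, measurable)
   also have "... = ennreal (C * N powr p)"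
   proof -
    have "N powr (p - 2) * N^2 = N powr p" using N by (simp add: powr_add[symmetric] flip: powr_numeral)
    then show ?thesis using C by (simp add: ennreal_mult'[symmetric] mult.assoc)
   qed
   finally show ?thesis by (simp add: v_def N_def)
  qed
 qed
qed

lemma kern_lipschitz: "cmod (kern x xi - kern y xi) <= norm (x - y) * norm xi"
proof -
 have "kern x xi - kern y xi = kern y xi * (kern (x - y) xi - 1)"
  using kern_add[of y "x - y" xi] by (simp add: algebra_simps)
 then have "cmod (kern x xi - kern y xi) = cmod (kern (x - y) xi - 1)" by (simp add: norm_mult)
 also have "... = cmod (iexp (- ((x - y) \<bullet> xi)) - 1)" by (simp add: kern_def)
 also have "... <= \<bar>(x - y) \<bullet> xi\<bar>" using iexp_approx1[of "- ((x - y) \<bullet> xi)" 0] by simp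
 also have "... <= norm (x - y) * norm xi" by (rule Cauchy_Schwarz_ineq2)
 finally show ?thesis .
qed

lemma fcut_lipschitz:
 "cmod (fcut A f x - fcut A f y) <= norm (x - y) * (A * (LBINT xi. cmod (indicator (cball 0 A) xi *\<^sub>R rep_L2 f xi)))"
proof -
 let ?g = "%xi. indicator (cball 0 A) xi *\<^sub>R rep_L2 f xi"
 have i: "integrable lborel (%xi. kern xi x * ?g xi)" for x by (rule fint_integrable[OF cut_integrable])
 have "fcut A f x - fcut A f y = (LBINT xi. kern xi x * ?g xi - kern xi y * ?g xi)"
  unfolding fcut_def fint_def by (rule bint_difference[OF i i, symmetric])
 then have "cmod (fcut A f x - fcut A f y) <= (LBINT xi. cmod (kern xi x * ?g xi - kern xi y * ?g xi))"
  by (simp only: integral_norm_bound)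
 also have "... <= (LBINT xi. norm (x - y) * (A * cmod (?g xi)))"
 proof (rule integral_mono)
  show "integrable lborel (%xi. cmod (kern xi x * ?g xi - kern xi y * ?g xi))"
   by (intro integrable_norm bint_diff i)
  show "integrable lborel (%xi. norm (x - y) * (A * cmod (?g xi)))"
   by (intro integrable_mult_right integrable_norm cut_integrable)
  show "cmod (kern xi x * ?g xi - kern xi y * ?g xi) <= norm (x - y) * (A * cmod (?g xi))" for xi
  proof (cases "norm xi <= A")
   case True
   have "cmod (kern xi x * ?g xi - kern xi y * ?g xi) = cmod (kern x xi - kern y xi) * cmod (?g xi)"
    by (simp only: left_diff_distrib[symmetric] norm_mult kern_commute[of xi])
   also have "... <= norm (x - y) * norm xi * cmod (?g xi)" by (intro mult_right_mono kern_lipschitz) simp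
   also have "... <= norm (x - y) * A * cmod (?g xi)" using True by (intro mult_right_mono mult_left_mono) auto
   finally show ?thesis by (simp only: mult.assoc)
  qed simp
 qed
 finally show ?thesis by (simp only: integral_mult_right_zero)
qed

text \<open>Local compactness: orthogonality to finitely many vectors makes \<open>J s h\<close> small on a ball,
 since its low frequency part is Lipschitz and can be made to vanish on a finite net.\<close>

lemma local_compactness:
 assumes s: "0 < s" "2 * s < 3" and e: "0 < (\<epsilon>::real)"
 obtains F where "finite F" "!!h. (\<forall>f\<in>F. inner h f = 0) ==>
  (LBINT x. indicator (cball 0 R) x * (rep_L2 (J s h) x)^2) <= \<epsilon> * (norm h)^2"
proof -
 have s0: "0 <= s" using s by simp
 obtain C where C: "0 < C" "!!A h. 0 < A ==>
  (LBINT xi. cmod (indicator (cball 0 A) xi *\<^sub>R rep_L2 (hat (J s h)) xi)) <= C * A powr (3 / 2 - s) * norm h"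
  using low_freq_bound[OF s0 s(2)] by blast
 \<comment> \<open>Makes the square norm of the frequencies above \<open>A\<close> at most
   \<open>\<epsilon> / 4 * (norm h)^2\<close>.\<close>
 define A where "A = (\<epsilon> / 4) powr (- 1 / (2 * s))"
 have A: "0 < A" using e by (simp add: A_def)
 have Ae: "A powr (- 2 * s) = \<epsilon> / 4" unfolding A_def powr_powr using s e by simp
 define v where "v h x = fcut A (hat (J s h)) (- x) / (2 * pi) ^ 3" for h x
 define D where "D = C * A powr (3 / 2 - s)"
 have D: "0 < D" using C(1) A by (simp add: D_def)
 have vlip: "cmod (v h x - v h y) <= norm (x - y) * (A * D * norm h)" for h x y
 proof -
  have one: "1 <= (2 * pi) ^ 3" using pi_ge_two by (intro one_le_power) simp
  have "cmod (v h x - v h y) = cmod (fcut A (hat (J s h)) (- x) - fcut A (hat (J s h)) (- y)) / (2 * pi) ^ 3"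
   unfolding v_def diff_divide_distrib[symmetric] by (simp add: norm_divide norm_power norm_mult)
  also have "... <= cmod (fcut A (hat (J s h)) (- x) - fcut A (hat (J s h)) (- y)) / 1" by (rule divide_left_mono[OF one]) auto
  also have "... <= norm (- x - - y) * (A * (LBINT xi. cmod (indicator (cball 0 A) xi *\<^sub>R rep_L2 (hat (J s h)) xi)))"
   using fcut_lipschitz[of A "hat (J s h)" "- x" "- y"] by (simp only: div_by_1)
  also have "... <= norm (- x - - y) * (A * (D * norm h))"
   unfolding D_def by (intro mult_left_mono C(2)[OF A]) (use A in auto)
  finally show ?thesis by (simp add: norm_minus_commute mult.assoc)
 qed
 have vbd: "cmod (v h x) <= D * norm h" for h x
 proof -
  have one: "1 <= (2 * pi) ^ 3" using pi_ge_two by (intro one_le_power) simp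
  have "cmod (v h x) = cmod (fcut A (hat (J s h)) (- x)) / (2 * pi) ^ 3"
   unfolding v_def by (simp add: norm_divide norm_power norm_mult)
  also have "... <= cmod (fcut A (hat (J s h)) (- x)) / 1" by (rule divide_left_mono[OF one]) auto
  also have "... <= D * norm h"
   unfolding D_def fcut_def using order_trans[OF fint_bound[OF cut_integrable] C(2)[OF A]] by simp
  finally show ?thesis .
 qed
 have vbl: "bounded_linear (%h. v h x)" for x
 proof (rule bounded_linear_intro[where K = D])
  note l = bl_diff[OF hat_bl] bl_diff[OF J_bl[OF s0]] bl_scaleR[OF hat_bl] bl_scaleR[OF J_bl[OF s0]]
  have sc: "v (r *\<^sub>R h) x = r *\<^sub>R v h x" for r h by (simp only: v_def l fcut_scaleR) (simp add: scaleR_conv_of_real)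
  have df: "v (h - k) x = v h x - v k x" for h k by (simp only: v_def l fcut_diff diff_divide_distrib)
  show "v (h + k) x = v h x + v k x" for h k using df[of h "(-1) *\<^sub>R k"] sc[of "-1" k] by simp
  show "v (r *\<^sub>R h) x = r *\<^sub>R v h x" for r h by (rule sc)
  show "cmod (v h x) <= norm h * D" for h using vbd[of h x] by (simp add: mult.commute)
 qed
 have "\<exists>z. \<forall>h. Re (v h x) = inner z h" "\<exists>z. \<forall>h. Im (v h x) = inner z h" for x
  by (intro riesz_representation bounded_linear_compose[OF bounded_linear_Re vbl] bounded_linear_compose[OF bounded_linear_Im vbl])+
 \<comment> \<open>Point values of the low-frequency part are bounded functionals, so their
   vanishing is an orthogonality condition; real and imaginary parts are represented
   separately.\<close>
 then obtain z1 z2 where z: "!!x h. Re (v h x) = inner (z1 x) h" "!!x h. Im (v h x) = inner (z2 x) h" by metis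
 define V where "V = (LBINT x. indicator (cball (0::real^3) R) x :: real)"
 have V: "0 <= V" by (simp add: V_def)
 \<comment> \<open>Spacing of the net: the Lipschitz error, squared and integrated over the ball of
   volume \<open>V\<close>, costs at most \<open>\<epsilon> / 4\<close>. Squaring the sum of low and
   high part doubles both costs, which gives \<open>\<epsilon>\<close>.\<close>
 define \<delta> where "\<delta> = sqrt (\<epsilon> / (4 * (V + 1))) / (A * D)"
 have d: "0 < \<delta>" using e V A D by (simp add: \<delta>_def)
 have dV: "(\<delta> * (A * D))^2 * V <= \<epsilon> / 4"
 proof -
  have "(\<delta> * (A * D))^2 = \<epsilon> / (4 * (V + 1))" using A D e V by (simp add: \<delta>_def)
  moreover have "V / (V + 1) <= 1" using V by simp
  then have "\<epsilon> / 4 * (V / (V + 1)) <= \<epsilon> / 4" using e by (intro mult_left_le) auto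
  ultimately show ?thesis by simp
 qed
 have "compact (cball (0::real^3) R)" by simp
 then obtain X where X: "finite X" "cball (0::real^3) R \<subseteq> (\<Union>x\<in>X. ball x \<delta>)"
  using compact_eq_totally_bounded[of "cball (0::real^3) R"] d by meson
 show thesis
 proof (rule that[of "z1 ` X \<union> z2 ` X"])
  fix h assume h: "\<forall>f\<in>z1 ` X \<union> z2 ` X. inner h f = 0"
  have v0: "v h x = 0" if "x \<in> X" for x
  proof -
   have "inner h (z1 x) = 0" "inner h (z2 x) = 0" using that h by blast+
   then show ?thesis using z[of h x] by (simp add: complex_eq_iff inner_commute)
  qed
  have vb: "(cmod (v h x))^2 <= (\<delta> * (A * D))^2 * (norm h)^2" if xb: "x \<in> cball 0 R" for x
  proof -
   obtain y where y: "y \<in> X" "dist y x < \<delta>" using subsetD[OF X(2) xb] by auto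
   have "cmod (v h x) <= norm (x - y) * (A * D * norm h)" using vlip[of h x y] v0[OF y(1)] by simp
   also have "... <= \<delta> * (A * D * norm h)" using y(2) A D by (intro mult_right_mono) (auto simp: dist_norm norm_minus_commute)
   finally have "(cmod (v h x))^2 <= (\<delta> * (A * D * norm h))^2" by (intro power_mono) auto
   then show ?thesis by (simp add: power_mult_distrib mult_ac)
  qed
  let ?d = "fm (%r. bes s r * indicator {A<..} r) h"
  note sd = symb_mult[OF symb_bes[OF s0] symb_low(2)[of A]]
  have dd: "J s h - low A (J s h) = ?d" unfolding J_def by (rule fm_uminus_low[OF symb_bes[OF s0]])
  have nd: "(norm ?d)^2 <= \<epsilon> / 4 * (norm h)^2"
  proof -
   have "norm ?d <= A powr (- s) * norm h"
   proof (rule norm_fm[OF sd])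
    fix r :: real assume "0 <= r"
    have "bes s r <= A powr (- s)" if "A < r"
     using bes_le_powr[OF s0, of r] that A powr_mono2'[of "- s" A r] s0 by simp
    then show "\<bar>bes s r * indicator {A<..} r\<bar> <= A powr (- s)" using bes_pos[of s r] by (auto simp: indicator_def)
   qed
   then have "(norm ?d)^2 <= (A powr (- s) * norm h)^2" by (intro power_mono) auto
   also have "(A powr (- s) * norm h)^2 = \<epsilon> / 4 * (norm h)^2"
    unfolding Ae[symmetric] using A by (simp add: power_mult_distrib powr_powr mult.commute[of s] flip: powr_numeral[of "A powr (- s)"])
   finally show ?thesis .
  qed
  have "(LBINT x. indicator (cball 0 R) x * (rep_L2 (J s h) x)^2)
   <= (LBINT x. 2 * (norm (rep_L2 ?d x))^2 + 2 * ((\<delta> * (A * D))^2 * (norm h)^2) * indicator (cball 0 R) x)"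
  proof (rule integral_mono_AE)
   show "integrable lborel (%x. 2 * (norm (rep_L2 ?d x))^2 + 2 * ((\<delta> * (A * D))^2 * (norm h)^2) * indicator (cball 0 R) x)"
    by (intro bint_add integrable_mult_right L2fun_integrable rep_L2fun integrable_indicator_cball)
   show "integrable lborel (%x. indicator (cball 0 R) x * (rep_L2 (J s h) x)^2)"
    by (rule bint_bound[OF L2fun_integrable[OF rep_L2fun[of "J s h"]]]) (auto simp: indicator_def)
   show "AA x. indicator (cball 0 R) x * (rep_L2 (J s h) x)^2 <= 2 * (norm (rep_L2 ?d x))^2 + 2 * ((\<delta> * (A * D))^2 * (norm h)^2) * indicator (cball 0 R) x"
    using rep_low[of A "J s h"] rep_diff[of "J s h" "low A (J s h)"] unfolding dd
   proof eventually_elim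
    case (elim x)
    show ?case
    proof (cases "x \<in> cball 0 R")
     case True
     have "\<bar>rep_L2 (low A (J s h)) x\<bar> = cmod (v h x)" unfolding v_def elim(1)[symmetric] by simp
     then have "(rep_L2 (low A (J s h)) x)^2 <= (\<delta> * (A * D))^2 * (norm h)^2"
      using vb[OF True] by (metis power2_abs)
     moreover have "(rep_L2 (J s h) x)^2 <= 2 * (norm (rep_L2 ?d x))^2 + 2 * (norm (rep_L2 (low A (J s h)) x))^2"
      using norm_add_square_le[of "rep_L2 ?d x" "rep_L2 (low A (J s h)) x"] elim(2) by simp
     ultimately show ?thesis using True by simp
    qed simp
   qed
  qed
  also have "... = 2 * (norm ?d)^2 + 2 * ((\<delta> * (A * D))^2 * (norm h)^2) * V"
   unfolding V_def norm_L2_square[of ?d]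
   using L2fun_integrable[OF rep_L2fun[of ?d]] integrable_indicator_cball[of 1 R] by simp
  also have "... <= \<epsilon> / 2 * (norm h)^2 + \<epsilon> / 2 * (norm h)^2"
   using nd mult_right_mono[OF dV, of "(norm h)^2"] by (simp add: mult_ac)
  finally show "(LBINT x. indicator (cball 0 R) x * (rep_L2 (J s h) x)^2) <= \<epsilon> * (norm h)^2" by simp
 qed (use X(1) in simp)
qed

section \<open>Weighted Lebesgue norms\<close>

lemma powr_subadd:
 assumes a: "0 < a" "a <= (1::real)" and x: "0 <= x" "0 <= y"
 shows "(x + y) powr a <= x powr a + y powr a"
proof (cases "x + y = 0")
 case False
 have le: "u * (x + y) powr (a - 1) <= u powr a" if "0 <= u" "u <= x + y" for u
 proof (cases "u = 0")
  case False
  then have "u * (x + y) powr (a - 1) <= u * u powr (a - 1)"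
   using that a by (intro mult_left_mono powr_mono2') auto
  also have "... = u powr a" using that(1) by (simp add: powr_mult_base)
  finally show ?thesis .
 qed simp
 have "(x + y) powr a = x * (x + y) powr (a - 1) + y * (x + y) powr (a - 1)"
  using powr_mult_base[of "x + y" "a - 1"] x by (simp add: distrib_right)
 also have "... <= x powr a + y powr a" by (intro add_mono le) (use x in auto)
 finally show ?thesis .
qed simp

lemma powr_abs_add_le:
 assumes "0 <= r" shows "\<bar>a + b\<bar> powr r <= 2 powr r * (\<bar>a\<bar> powr r + \<bar>b\<bar> powr (r::real))"
proof -
 have "\<bar>a + b\<bar> powr r <= (2 * max \<bar>a\<bar> \<bar>b\<bar>) powr r" using assms by (intro powr_mono2) auto
 also have "... = 2 powr r * (max \<bar>a\<bar> \<bar>b\<bar>) powr r" by (simp add: powr_mult)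
 also have "... <= 2 powr r * (\<bar>a\<bar> powr r + \<bar>b\<bar> powr r)" by (intro mult_left_mono) (auto simp: max_def)
 finally show ?thesis .
qed

lemma young_simple:
 assumes "1 <= r" "0 <= a" "0 <= (b::real)" shows "a powr (r - 1) * b <= a powr r + b powr r"
proof (cases "b <= a")
 case True
 then have "a powr (r - 1) * b <= a powr (r - 1) * a" by (intro mult_left_mono) auto
 also have "... = a powr r" using assms(2) powr_mult_base[of a "r - 1"] by (simp add: mult.commute)
 finally show ?thesis using powr_ge_zero[of b r] by linarith
next
 case False
 then have "a powr (r - 1) * b <= b powr (r - 1) * b" using assms by (intro mult_right_mono powr_mono2) auto
 also have "... = b powr r" using assms(3) powr_mult_base[of b "r - 1"] by (simp add: mult.commute)
 finally show ?thesis using powr_ge_zero[of a r] by linarith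
qed

lemma young_dual:
 assumes "1 < \<rho>" "1 < \<sigma>" "1 / \<rho> + 1 / \<sigma> = 1" "0 <= a" "0 <= (b::real)"
 shows "a * b <= a powr \<rho> + b powr \<sigma>"
proof -
 have "a * b <= a powr \<rho> / \<rho> + b powr \<sigma> / \<sigma>" by (rule Youngs_inequality[OF assms])
 also have "... <= a powr \<rho> / 1 + b powr \<sigma> / 1" using assms by (intro add_mono divide_left_mono) auto
 finally show ?thesis by simp
qed

text \<open>Small values cost a constant, large ones a small multiple of the higher power, and
  values in between are bounded by a multiple of the square.\<close>

lemma powr_interp:
 assumes r: "0 < r" "r < p" and d: "0 < (\<delta>::real)"
 obtains B where "0 <= B" "!!y. \<bar>y\<bar> powr r <= \<delta> + \<delta> * \<bar>y\<bar> powr p + B * y^2"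
proof
 define a where "a = \<delta> powr (1 / r)"
 define b where "b = \<delta> powr (1 / (r - p))"
 have a: "0 < a" "a powr r = \<delta>" using d r by (simp_all add: a_def powr_powr)
 have b: "0 < b" "b powr (r - p) = \<delta>" using d r by (simp_all add: b_def powr_powr)
 define B where "B = b powr r / a^2"
 show B: "0 <= B" by (simp add: B_def)
 fix y :: real
 have nn: "0 <= \<delta> * \<bar>y\<bar> powr p" "0 <= B * y^2" using d B by auto
 consider "\<bar>y\<bar> <= a" | "b <= \<bar>y\<bar>" | "a < \<bar>y\<bar>" "\<bar>y\<bar> < b" by linarith
 then show "\<bar>y\<bar> powr r <= \<delta> + \<delta> * \<bar>y\<bar> powr p + B * y^2"
 proof cases
  case 1
  then have "\<bar>y\<bar> powr r <= a powr r" using r by (intro powr_mono2) auto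
  then show ?thesis using nn a(2) by linarith
 next
  case 2
  then have "\<bar>y\<bar> powr (r - p) <= b powr (r - p)" using r b(1) by (intro powr_mono2') auto
  then have "\<bar>y\<bar> powr (r - p) * \<bar>y\<bar> powr p <= \<delta> * \<bar>y\<bar> powr p" unfolding b(2) by (intro mult_right_mono) auto
  moreover have "\<bar>y\<bar> powr (r - p) * \<bar>y\<bar> powr p = \<bar>y\<bar> powr r" by (simp add: powr_add[symmetric])
  ultimately show ?thesis using nn d by linarith
 next
  case 3
  have "\<bar>y\<bar> powr r <= b powr r" using 3 r by (intro powr_mono2) auto
  also have "... = B * a^2" using a(1) by (simp add: B_def)
  also have "... <= B * y^2" using 3 a(1) B by (intro mult_left_mono) (auto simp: abs_le_square_iff[symmetric])
  finally show ?thesis using nn d by linarith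
 qed
qed

text \<open>Hoelder's inequality with exponents \<open>r / (r - 1)\<close> and \<open>r\<close>, up
  to a factor 2 from the unsharp \<open>young_simple\<close>, which is applied after normalization.
  A vanishing norm is treated apart, since normalization divides by it.\<close>

lemma holder_weighted:
 assumes r: "1 < r" and [measurable]: "w \<in> borel_measurable M" "a \<in> borel_measurable M" "b \<in> borel_measurable M"
  and nn: "!!x. 0 <= w x" "!!x. 0 <= a x" "!!x. 0 <= (b x::real)"
  and i: "integrable M (%x. w x * a x powr r)" "integrable M (%x. w x * b x powr r)"
 shows "integrable M (%x. w x * (a x powr (r - 1) * b x))"
  and "(LINT x|M. w x * (a x powr (r - 1) * b x)) <= 2 * ((LINT x|M. w x * a x powr r) powr (1 / r)) powr (r - 1) * (LINT x|M. w x * b x powr r) powr (1 / r)"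
proof -
 show int: "integrable M (%x. w x * (a x powr (r - 1) * b x))"
 proof (rule bint_bound[OF bint_add[OF i]])
  have "w x * (a x powr (r - 1) * b x) <= w x * a x powr r + w x * b x powr r" for x
   unfolding distrib_left[symmetric] using r nn by (intro mult_left_mono young_simple) auto
  then show "AE x in M. norm (w x * (a x powr (r - 1) * b x)) <= norm (w x * a x powr r + w x * b x powr r)"
   using nn by simp
 qed measurable
 let ?A = "LINT x|M. w x * a x powr r" and ?B = "LINT x|M. w x * b x powr r"
 have AB: "0 <= ?A" "0 <= ?B" using nn by (auto intro!: integral_nonneg_AE)
 show "(LINT x|M. w x * (a x powr (r - 1) * b x)) <= 2 * (?A powr (1 / r)) powr (r - 1) * ?B powr (1 / r)"
 proof (cases "?A = 0 \<or> ?B = 0")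
  case True
  then have "AE x in M. w x * (a x powr (r - 1) * b x) = 0"
  proof
   assume "?A = 0"
   then have "AE x in M. w x * a x powr r = 0" using nn i(1) by (subst (asm) integral_nonneg_eq_0_iff_AE) auto
   then show ?thesis by eventually_elim auto
  next
   assume "?B = 0"
   then have "AE x in M. w x * b x powr r = 0" using nn i(2) by (subst (asm) integral_nonneg_eq_0_iff_AE) auto
   then show ?thesis by eventually_elim auto
  qed
  then have "(LINT x|M. w x * (a x powr (r - 1) * b x)) = 0" by (rule integral_eq_zero_AE)
  then show ?thesis by simp
 next
  case False
  define \<alpha> where "\<alpha> = ?A powr (1 / r)"
  define \<beta> where "\<beta> = ?B powr (1 / r)"
  have al: "0 < \<alpha>" "\<alpha> powr r = ?A" using AB False r by (simp_all add: \<alpha>_def powr_powr)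
  have be: "0 < \<beta>" "\<beta> powr r = ?B" using AB False r by (simp_all add: \<beta>_def powr_powr)
  define c where "c = \<alpha> powr (r - 1) * \<beta>"
  have c: "0 < c" using al be by (simp add: c_def)
  have le: "w x * (a x powr (r - 1) * b x) <= (c / ?A) * (w x * a x powr r) + (c / ?B) * (w x * b x powr r)" for x
  proof -
   have "(a x / \<alpha>) powr (r - 1) * (b x / \<beta>) <= (a x / \<alpha>) powr r + (b x / \<beta>) powr r"
    using r nn al be by (intro young_simple) auto
   also have "(a x / \<alpha>) powr r = a x powr r / ?A" using nn al by (simp add: powr_divide)
   also have "(b x / \<beta>) powr r = b x powr r / ?B" using nn be by (simp add: powr_divide)
   also have "(a x / \<alpha>) powr (r - 1) * (b x / \<beta>) = a x powr (r - 1) * b x / c" using nn al be by (simp add: powr_divide c_def)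
   finally have "a x powr (r - 1) * b x <= c * (a x powr r / ?A + b x powr r / ?B)" using c by (simp add: pos_divide_le_eq mult.commute)
   then have "w x * (a x powr (r - 1) * b x) <= w x * (c * (a x powr r / ?A + b x powr r / ?B))" by (intro mult_left_mono nn)
   then show ?thesis by (simp add: algebra_simps)
  qed
  have "(LINT x|M. w x * (a x powr (r - 1) * b x)) <= (LINT x|M. (c / ?A) * (w x * a x powr r) + (c / ?B) * (w x * b x powr r))"
   by (rule integral_mono[OF int _ le]) (intro bint_add integrable_mult_right i)
  also have "... = (c / ?A) * ?A + (c / ?B) * ?B"
   using i by (subst bint_sum) (simp_all only: integrable_mult_right integral_mult_right_zero)
  also have "... = 2 * c" using False by simp
  finally show ?thesis by (simp add: c_def \<alpha>_def \<beta>_def mult.assoc)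
 qed
qed

lemma quarter_cancel: "a ~= 0 ==> b ~= 0 ==> a * b * (e / (4 * a * b)) = e / (4::real)"
 by (simp add: field_simps)

text \<open>\<open>\<rho>\<close> is the exponent conjugate to \<open>p / r\<close>, where
  \<open>p\<close> is the critical Sobolev exponent. Compactness of the weighted norm rests on the
  integrability of \<open>w powr \<rho>\<close>, which leaves little weight outside a set where
  position and weight are bounded.\<close>

locale sobolev_weight =
 fixes s p r \<rho> :: real and w :: "real^3 => real"
 assumes s: "0 < s" "2 * s < 3" and p: "p = 6 / (3 - 2 * s)" and r: "1 <= r" "r < p" and \<rho>: "\<rho> = p / (p - r)"
  and w_meas [measurable]: "w \<in> borel_measurable borel" and w_nonneg: "!!x. 0 <= w x"
  and w_int: "integrable lborel (%x. w x powr \<rho>)"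
begin

lemma s0: "0 <= s" using s by simp

lemma exponents: "1 < \<rho>" "1 < p / r" "1 / \<rho> + 1 / (p / r) = 1" "2 < p" "0 < p"
proof -
 show p2: "2 < p" using s unfolding p by (simp add: field_simps)
 then show "0 < p" by simp
 show "1 < \<rho>" "1 < p / r" "1 / \<rho> + 1 / (p / r) = 1" using r p2 unfolding \<rho> by (auto simp: field_simps)
qed

lemma sobolev_bochner:
 obtains C where "0 < C" "!!h. integrable lborel (%x. \<bar>rep_L2 (J s h) x\<bar> powr p)"
  "!!h. (LBINT x. \<bar>rep_L2 (J s h) x\<bar> powr p) <= C * norm h powr p"
proof -
 obtain C where C: "0 < C" "!!h. (\<integral>\<^sup>+x. ennreal (\<bar>rep_L2 (J s h) x\<bar> powr p) \<partial>lborel) <= ennreal (C * norm h powr p)"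
  using sobolev_inequality[OF s p] by blast
 have i: "integrable lborel (%x. \<bar>rep_L2 (J s h) x\<bar> powr p)" for h
  unfolding integrable_iff_bounded using order_le_less_trans[OF C(2)[of h] ennreal_less_top] by simp
 moreover have "(LBINT x. \<bar>rep_L2 (J s h) x\<bar> powr p) <= C * norm h powr p" for h
 proof -
  have "ennreal (LBINT x. \<bar>rep_L2 (J s h) x\<bar> powr p) <= ennreal (C * norm h powr p)"
   using C(2)[of h] nn_integral_eq_integral[OF i[of h]] by simp
  then show ?thesis using C(1) by (subst (asm) ennreal_le_iff) auto
 qed
 ultimately show thesis using that C(1) by blast
qed

lemma w_young: "w x * \<bar>y\<bar> powr r <= w x powr \<rho> + \<bar>y\<bar> powr p"
 using young_dual[OF exponents(1-3), of "w x" "\<bar>y\<bar> powr r"] w_nonneg r by (simp add: powr_powr)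

lemma w_integrable: "integrable lborel (%x. w x * \<bar>rep_L2 (J s h) x\<bar> powr r)"
proof -
 obtain C where C: "!!h. integrable lborel (%x. \<bar>rep_L2 (J s h) x\<bar> powr p)" using sobolev_bochner by blast
 show ?thesis
  by (rule bint_bound[OF bint_add[OF w_int C[of h]]])
   (use w_young w_nonneg in auto)
qed

definition m :: "real L2 => real" where
 "m h = (LBINT x. w x * \<bar>rep_L2 (J s h) x\<bar> powr r) powr (1 / r)"

lemma int_nonneg: "0 <= (LBINT x. w x * \<bar>rep_L2 (J s h) x\<bar> powr r)"
 using w_nonneg by (intro integral_nonneg_AE) auto

lemma m_nonneg: "0 <= m h" by (simp add: m_def)

lemma m_powr: "m h powr r = (LBINT x. w x * \<bar>rep_L2 (J s h) x\<bar> powr r)"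
 using int_nonneg r by (simp add: m_def powr_powr)

lemma m_scale: "m (a *\<^sub>R h) = \<bar>a\<bar> * m h"
proof -
 have "(LBINT x. w x * \<bar>rep_L2 (J s (a *\<^sub>R h)) x\<bar> powr r) = (LBINT x. \<bar>a\<bar> powr r * (w x * \<bar>rep_L2 (J s h) x\<bar> powr r))"
 proof (rule integral_cong_AE)
  show "AA x. w x * \<bar>rep_L2 (J s (a *\<^sub>R h)) x\<bar> powr r = \<bar>a\<bar> powr r * (w x * \<bar>rep_L2 (J s h) x\<bar> powr r)"
   using rep_scaleR[of a "J s h"] unfolding bl_scaleR[OF J_bl[OF s0]] by eventually_elim (simp add: abs_mult powr_mult)
 qed measurable
 also have "... = \<bar>a\<bar> powr r * (LBINT x. w x * \<bar>rep_L2 (J s h) x\<bar> powr r)" by (rule integral_mult_right_zero)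
 finally show ?thesis using int_nonneg r by (simp add: m_def powr_mult powr_powr)
qed

lemma m_zero: "m 0 = 0" using m_scale[of 0 0] by simp

text \<open>The factor 2 comes from bounding \<open>|a + b| powr r\<close> crudely; it is the origin
  of the factor in \<open>\<kappa>_add\<close>.\<close>

lemma m_add: "m (h + k) <= 2 * (m h + m k)"
proof -
 let ?I = "%h. LBINT x. w x * \<bar>rep_L2 (J s h) x\<bar> powr r"
 have "?I (h + k) <= (LBINT x. 2 powr r * (w x * \<bar>rep_L2 (J s h) x\<bar> powr r + w x * \<bar>rep_L2 (J s k) x\<bar> powr r))"
 proof (rule integral_mono_AE[OF w_integrable])
  show "integrable lborel (%x. 2 powr r * (w x * \<bar>rep_L2 (J s h) x\<bar> powr r + w x * \<bar>rep_L2 (J s k) x\<bar> powr r))"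
   by (intro integrable_mult_right bint_add w_integrable)
  show "AA x. w x * \<bar>rep_L2 (J s (h + k)) x\<bar> powr r <= 2 powr r * (w x * \<bar>rep_L2 (J s h) x\<bar> powr r + w x * \<bar>rep_L2 (J s k) x\<bar> powr r)"
   using rep_add[of "J s h" "J s k"] unfolding bl_add[OF J_bl[OF s0]]
  proof eventually_elim
   case (elim x)
   have "w x * \<bar>rep_L2 (J s h) x + rep_L2 (J s k) x\<bar> powr r <= w x * (2 powr r * (\<bar>rep_L2 (J s h) x\<bar> powr r + \<bar>rep_L2 (J s k) x\<bar> powr r))"
    using r by (intro mult_left_mono powr_abs_add_le w_nonneg) simp
   then show ?case unfolding elim by (simp add: algebra_simps)
  qed
 qed
 also have "... = 2 powr r * (?I h + ?I k)"
  unfolding integral_mult_right_zero by (subst bint_sum) (simp_all add: w_integrable)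
 finally have "?I (h + k) powr (1 / r) <= (2 powr r * (?I h + ?I k)) powr (1 / r)"
  using r by (intro powr_mono2 int_nonneg) auto
 also have "... = 2 * (?I h + ?I k) powr (1 / r)" using r int_nonneg[of h] int_nonneg[of k] by (simp add: powr_mult powr_powr)
 also have "... <= 2 * (?I h powr (1 / r) + ?I k powr (1 / r))"
  using r by (intro mult_left_mono powr_subadd int_nonneg) auto
 finally show ?thesis by (simp add: m_def)
qed

text \<open>Young's inequality yields bounds that are not homogeneous; by homogeneity of
  \<open>m\<close> it is enough to have them on unit vectors.\<close>

lemma homogeneous_bound:
 assumes "!!h. norm h = 1 ==> (\<forall>f\<in>F. inner h f = 0) ==> m h <= C" "\<forall>f\<in>F. inner h f = 0"
 shows "m h <= C * norm h"
proof (cases "h = 0")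
 case False
 have "m ((1 / norm h) *\<^sub>R h) <= C" using False assms(2) by (intro assms(1)) auto
 then show ?thesis using False by (simp add: m_scale field_simps)
qed (simp add: m_zero)

lemma m_bound: obtains C where "0 < C" "!!h. m h <= C * norm h"
proof -
 obtain C where C: "0 < C" "!!h. integrable lborel (%x. \<bar>rep_L2 (J s h) x\<bar> powr p)"
  "!!h. (LBINT x. \<bar>rep_L2 (J s h) x\<bar> powr p) <= C * norm h powr p" using sobolev_bochner by blast
 define D where "D = (LBINT x. w x powr \<rho>) + C"
 have "0 <= (LBINT x. w x powr \<rho>)" by simp
 then have D: "0 < D" using C(1) unfolding D_def by (rule add_nonneg_pos)
 have "m h <= D powr (1 / r) * norm h" for h
 proof (rule homogeneous_bound[where F = "{}"])
  fix h :: "real L2" assume h: "norm h = 1"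
  have "(LBINT x. w x * \<bar>rep_L2 (J s h) x\<bar> powr r) <= (LBINT x. w x powr \<rho> + \<bar>rep_L2 (J s h) x\<bar> powr p)"
   by (intro integral_mono w_integrable bint_add w_int C(2) w_young)
  also have "... = (LBINT x. w x powr \<rho>) + (LBINT x. \<bar>rep_L2 (J s h) x\<bar> powr p)"
   by (rule bint_sum[OF w_int C(2)])
  also have "... <= D" using C(3)[of h] by (simp add: D_def h)
  finally show "m h <= D powr (1 / r)" unfolding m_def using r by (intro powr_mono2 int_nonneg) auto
 qed simp
 then show thesis using D by (intro that[of "D powr (1 / r)"]) auto
qed

text \<open>Outside the region where position and weight are at most \<open>n\<close>, Young's
  inequality with parameter \<open>\<eta>\<close> and the small tail of \<open>w powr \<rho>\<close>
  suffice. Inside, \<open>powr_interp\<close> trades the power \<open>r\<close> for small multiples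
  of 1 and of the critical power, and for the square, which is small by
  \<open>local_compactness\<close>. Each of four contributions costs
  \<open>\<epsilon> / 4\<close>.\<close>

lemma m_compact:
 assumes e: "0 < e" shows "\<exists>F. finite F \<and> (\<forall>h. (\<forall>f\<in>F. inner h f = 0) --> m h <= e * norm h)"
proof -
 obtain C where C: "0 < C" "!!h. integrable lborel (%x. \<bar>rep_L2 (J s h) x\<bar> powr p)"
  "!!h. (LBINT x. \<bar>rep_L2 (J s h) x\<bar> powr p) <= C * norm h powr p" using sobolev_bochner by blast
 define \<epsilon> where "\<epsilon> = e powr r"
 have ep: "0 < \<epsilon>" "\<epsilon> powr (1 / r) = e" using e r by (simp_all add: \<epsilon>_def powr_powr)
 \<comment> \<open>The critical term gets the weight \<open>\<eta> powr (p / r)\<close>, which makes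
   its cost \<open>\<epsilon> / 4\<close>; the price \<open>\<eta> powr (- \<rho>)\<close> on the
   tail is paid by the choice of \<open>n\<close>.\<close>
 define \<eta> where "\<eta> = (\<epsilon> / (4 * C)) powr (r / p)"
 have et: "0 < \<eta>" "\<eta> powr (p / r) = \<epsilon> / (4 * C)" using ep C(1) r exponents by (simp_all add: \<eta>_def powr_powr)
 define f where "f n x = (if norm x <= real n \<and> w x <= real n then 0 else w x powr \<rho>)" for n x
 have [measurable]: "f n \<in> borel_measurable borel" for n unfolding f_def by measurable
 have fi: "integrable lborel (f n)" for n
  by (rule bint_bound[OF w_int]) (auto simp: f_def)
 have "(%n. LBINT x. f n x) \<longlonglongrightarrow> (LINT x::real^3|lborel. 0)"
 proof (rule integral_dominated_convergence[OF _ _ w_int])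
  show "AA x. (%n. f n x) \<longlonglongrightarrow> 0"
  proof (rule AE_I2)
   fix x
   obtain N where "max (norm x) (w x) <= real N" using real_arch_simple by blast
   then have N: "f n x = 0" if "n >= N" for n using that by (auto simp: f_def)
   show "(%n. f n x) \<longlonglongrightarrow> 0"
    by (rule tendsto_eventually) (use N in \<open>auto simp: eventually_sequentially intro!: exI[of _ N]\<close>)
  qed
 qed (auto simp: f_def)
 then have "(%n. LBINT x. f n x) \<longlonglongrightarrow> 0" by simp
 then obtain n where n: "(LBINT x. f n x) < \<eta> powr \<rho> * (\<epsilon> / 4)"
  using order_tendstoD(2)[of _ 0 sequentially "\<eta> powr \<rho> * (\<epsilon> / 4)"] et(1) ep(1)
  by (auto simp: eventually_sequentially)
 define V where "V = (LBINT x. 1 * indicator (cball (0::real^3) (real n)) x :: real)"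
 have V: "0 <= V" by (simp add: V_def)
 \<comment> \<open>The summands 1 here and in \<open>\<gamma>\<close> keep the divisors nonzero for
   \<open>n = 0\<close> and \<open>B = 0\<close>.\<close>
 define \<delta> where "\<delta> = \<epsilon> / (4 * (real n + 1) * (V + C))"
 have d: "0 < \<delta>" using ep C(1) V by (simp add: \<delta>_def)
 obtain B where B: "0 <= B" "!!y. \<bar>y\<bar> powr r <= \<delta> + \<delta> * \<bar>y\<bar> powr p + B * y^2"
  using powr_interp[OF _ r(2) d] r by auto
 define \<gamma> where "\<gamma> = \<epsilon> / (4 * (real n + 1) * (B + 1))"
 have g: "0 < \<gamma>" using ep B(1) by (simp add: \<gamma>_def)
 obtain F where F: "finite F" "!!h. (\<forall>f\<in>F. inner h f = 0) ==>
  (LBINT x. indicator (cball 0 (real n)) x * (rep_L2 (J s h) x)^2) <= \<gamma> * (norm h)^2"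
  using local_compactness[OF s g] by blast
 have "m h <= e * norm h" if hF: "\<forall>f\<in>F. inner h f = 0" for h
 proof (rule homogeneous_bound[OF _ hF])
  fix h :: "real L2" assume h: "norm h = 1" "\<forall>f\<in>F. inner h f = 0"
  let ?u = "rep_L2 (J s h)"
  let ?i = "indicator (cball 0 (real n)) :: real^3 => real"
  have i1: "integrable lborel (%x. \<eta> powr (- \<rho>) * f n x)" by (rule integrable_mult_right[OF fi])
  have i2: "integrable lborel (%x. \<eta> powr (p / r) * \<bar>?u x\<bar> powr p)" by (rule integrable_mult_right[OF C(2)])
  have i3: "integrable lborel (%x. real n * \<delta> * (1 * ?i x))" by (rule integrable_mult_right[OF integrable_indicator_cball])
  have i4: "integrable lborel (%x. real n * \<delta> * \<bar>?u x\<bar> powr p)" by (rule integrable_mult_right[OF C(2)])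
  have i50: "integrable lborel (%x. ?i x * (?u x)^2)"
   by (rule bint_bound[OF L2fun_integrable[OF rep_L2fun[of "J s h"]]]) (auto simp: indicator_def)
  have i5: "integrable lborel (%x. real n * B * (?i x * (?u x)^2))" by (rule integrable_mult_right[OF i50])
  have "(LBINT x. w x * \<bar>?u x\<bar> powr r) <= (LBINT x. \<eta> powr (- \<rho>) * f n x + \<eta> powr (p / r) * \<bar>?u x\<bar> powr p
   + real n * \<delta> * (1 * ?i x) + real n * \<delta> * \<bar>?u x\<bar> powr p + real n * B * (?i x * (?u x)^2))"
  proof (rule integral_mono[OF w_integrable])
   show "integrable lborel (%x. \<eta> powr (- \<rho>) * f n x + \<eta> powr (p / r) * \<bar>?u x\<bar> powr p
    + real n * \<delta> * (1 * ?i x) + real n * \<delta> * \<bar>?u x\<bar> powr p + real n * B * (?i x * (?u x)^2))"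
    by (intro bint_add i1 i2 i3 i4 i5)
   fix x
   have nn: "0 <= \<eta> powr (- \<rho>) * f n x" "0 <= \<eta> powr (p / r) * \<bar>?u x\<bar> powr p" "0 <= real n * \<delta> * (1 * ?i x)"
    "0 <= real n * \<delta> * \<bar>?u x\<bar> powr p" "0 <= real n * B * (?i x * (?u x)^2)"
    using d B(1) by (auto simp: f_def)
   show "w x * \<bar>?u x\<bar> powr r <= \<eta> powr (- \<rho>) * f n x + \<eta> powr (p / r) * \<bar>?u x\<bar> powr p
    + real n * \<delta> * (1 * ?i x) + real n * \<delta> * \<bar>?u x\<bar> powr p + real n * B * (?i x * (?u x)^2)"
   proof (cases "norm x <= real n \<and> w x <= real n")
    case True
    have "w x * \<bar>?u x\<bar> powr r <= real n * (\<delta> + \<delta> * \<bar>?u x\<bar> powr p + B * (?u x)^2)"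
     using True B(2) by (intro mult_mono) auto
    also have "... = real n * \<delta> * (1 * ?i x) + real n * \<delta> * \<bar>?u x\<bar> powr p + real n * B * (?i x * (?u x)^2)"
     using True by (simp add: algebra_simps)
    finally show ?thesis using nn by linarith
   next
    case False
    have "w x * \<bar>?u x\<bar> powr r = (w x / \<eta>) * (\<eta> * \<bar>?u x\<bar> powr r)" using et(1) by simp
    also have "... <= (w x / \<eta>) powr \<rho> + (\<eta> * \<bar>?u x\<bar> powr r) powr (p / r)"
     using w_nonneg et(1) by (intro young_dual exponents) auto
    also have "(w x / \<eta>) powr \<rho> = \<eta> powr (- \<rho>) * f n x"
    proof -
     have "f n x = w x powr \<rho>" using False by (auto simp: f_def)
     then show ?thesis using w_nonneg et(1) by (simp add: powr_divide powr_minus_divide)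
    qed
    also have "(\<eta> * \<bar>?u x\<bar> powr r) powr (p / r) = \<eta> powr (p / r) * \<bar>?u x\<bar> powr p"
     using et(1) r by (simp add: powr_mult powr_powr)
    finally show ?thesis using nn by linarith
   qed
  qed
  also have "... = \<eta> powr (- \<rho>) * (LBINT x. f n x) + \<eta> powr (p / r) * (LBINT x. \<bar>?u x\<bar> powr p)
   + real n * \<delta> * V + real n * \<delta> * (LBINT x. \<bar>?u x\<bar> powr p) + real n * B * (LBINT x. ?i x * (?u x)^2)"
   unfolding V_def bint_sum[OF bint_add[OF bint_add[OF bint_add[OF i1 i2] i3] i4] i5]
    bint_sum[OF bint_add[OF bint_add[OF i1 i2] i3] i4]
    bint_sum[OF bint_add[OF i1 i2] i3]
    bint_sum[OF i1 i2] integral_mult_right_zero ..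
  also have "... <= \<epsilon> / 4 + \<epsilon> / 4 + real n * \<delta> * (V + C) + \<epsilon> / 4"
  proof -
   have "\<eta> powr (- \<rho>) * (LBINT x. f n x) <= \<eta> powr (- \<rho>) * (\<eta> powr \<rho> * (\<epsilon> / 4))"
    using n by (intro mult_left_mono) auto
   also have "... = \<epsilon> / 4" using et(1) by (simp add: powr_minus)
   finally have 1: "\<eta> powr (- \<rho>) * (LBINT x. f n x) <= \<epsilon> / 4" .
   have Ch: "(LBINT x. \<bar>?u x\<bar> powr p) <= C" using C(3)[of h] h(1) by simp
   have "\<eta> powr (p / r) * (LBINT x. \<bar>?u x\<bar> powr p) <= \<epsilon> / (4 * C) * C"
    unfolding et(2) using Ch ep C(1) by (intro mult_left_mono) auto
   then have 2: "\<eta> powr (p / r) * (LBINT x. \<bar>?u x\<bar> powr p) <= \<epsilon> / 4" using C(1) by simp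
   have 3: "real n * \<delta> * (LBINT x. \<bar>?u x\<bar> powr p) <= real n * \<delta> * C"
    using Ch d by (intro mult_left_mono) auto
   have "real n * B * (LBINT x. ?i x * (?u x)^2) <= real n * B * \<gamma>"
    using F(2)[OF h(2)] B(1) by (intro mult_left_mono) (auto simp: h(1))
   also have "... <= (real n + 1) * (B + 1) * \<gamma>" using B(1) g by (intro mult_right_mono mult_mono) auto
   also have "... = \<epsilon> / 4" unfolding \<gamma>_def using B(1) by (intro quarter_cancel) auto
   finally have 4: "real n * B * (LBINT x. ?i x * (?u x)^2) <= \<epsilon> / 4" .
   show ?thesis using 1 2 3 4 by (simp add: distrib_left)
  qed
  also have "real n * \<delta> * (V + C) <= \<epsilon> / 4"
  proof -
   have "real n * \<delta> * (V + C) <= (real n + 1) * \<delta> * (V + C)" using d V C(1) by (intro mult_right_mono) auto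
   also have "... = \<epsilon> / 4" unfolding \<delta>_def using V C(1) by (subst mult.assoc, subst mult.commute[of _ "V + C"], subst mult.assoc[symmetric], intro quarter_cancel) auto
   finally show ?thesis .
  qed
  finally have "(LBINT x. w x * \<bar>?u x\<bar> powr r) <= \<epsilon>" by simp
  then have "m h <= \<epsilon> powr (1 / r)" unfolding m_def using r by (intro powr_mono2 int_nonneg) auto
  then show "m h <= e" by (simp only: ep(2))
 qed
 then show ?thesis using F(1) by blast
qed

end

text \<open>For integrable \<open>f\<close> the truncated transforms converge pointwise and
  boundedly; on each ball this gives convergence in norm, so the two limits agree there. Countably
  many balls cover the space.\<close>

lemma FTc_integrable:
 assumes f: "L2fun f" and fi: "integrable lborel f"
 shows "AA xi. rep_L2 (FTc (abs_L2 f)) xi = fint f xi"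
proof -
 have [measurable]: "f \<in> borel_measurable borel" using f by auto
 have [measurable]: "fint f \<in> borel_measurable borel" by (rule fint_measurable) measurable
 let ?f = "abs_L2 f"
 define D where "D = (LBINT x. cmod (f x))"
 have fc: "fcut R ?f = fint (%x. indicator (cball 0 R) x *\<^sub>R f x)" for R
  unfolding fcut_def
 proof (rule fint_cong_AE)
  show "(%x. indicator (cball 0 R) x *\<^sub>R f x) \<in> borel_measurable borel" by measurable
  show "AA x. indicator (cball 0 R) x *\<^sub>R rep_L2 ?f x = indicator (cball 0 R) x *\<^sub>R f x"
   using rep_abs[OF f] by eventually_elim simp
 qed (rule cut_measurable)
 have ci: "integrable lborel (%x. indicator (cball 0 R) x *\<^sub>R f x)" for R
  by (rule bint_bound[OF fi]) (auto simp: indicator_def)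
 have bd: "cmod (fcut R ?f xi) <= D" for R xi
 proof -
  have "cmod (fcut R ?f xi) <= (LBINT x. cmod (indicator (cball 0 R) x *\<^sub>R f x))"
   unfolding fc by (rule fint_bound[OF ci])
  also have "... <= D" unfolding D_def
   by (intro integral_mono integrable_norm ci fi) (auto simp: indicator_def)
  finally show ?thesis .
 qed
 have lim: "(%n. fcut (real n) ?f xi) \<longlonglongrightarrow> fint f xi" for xi
  unfolding fc fint_def
 proof (rule integral_dominated_convergence[OF _ _ integrable_norm[OF fi]])
  show "AA x. (%n. kern x xi * (indicator (cball 0 (real n)) x *\<^sub>R f x)) \<longlonglongrightarrow> kern x xi * f x"
  proof (rule AE_I2)
   fix x :: "real^3"
   obtain N where N: "norm x <= real N" using real_arch_simple by blast
   show "(%n. kern x xi * (indicator (cball 0 (real n)) x *\<^sub>R f x)) \<longlonglongrightarrow> kern x xi * f x"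
    by (rule tendsto_eventually) (use N in \<open>auto simp: eventually_sequentially intro!: exI[of _ N]\<close>)
  qed
 qed (measurable, auto simp: norm_mult indicator_def)
 have bd': "cmod (fint f xi) <= D" for xi unfolding D_def by (rule fint_bound[OF fi])
 have ball: "AA xi. xi \<in> cball 0 R --> rep_L2 (FTc ?f) xi = fint f xi" for R
 proof -
  have D0: "0 <= D" by (simp add: D_def)
  have w: "L2fun (%xi::real^3. D * indicator (cball 0 R) xi :: real)"
   by (rule L2fun_bound[OF _ integrable_indicator_cball[of "D^2" R]]) (auto simp: indicator_def)
  have g: "L2fun (%xi. indicator (cball 0 R) xi *\<^sub>R fint f xi)"
  proof (rule L2fun_bound[OF _ integrable_indicator_cball[of "D^2" R]])
   show "AA xi. (cmod (indicator (cball 0 R) xi *\<^sub>R fint f xi))\<^sup>2 <= D^2 * indicator (cball 0 R) xi"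
   proof (rule AE_I2)
    fix xi :: "real^3"
    have "(cmod (fint f xi))^2 <= D^2" using bd' by (intro power_mono) auto
    then show "(cmod (indicator (cball 0 R) xi *\<^sub>R fint f xi))^2 <= D^2 * indicator (cball 0 R) xi" by (simp add: indicator_def)
   qed
  qed measurable
  have 1: "(%n. cut R (abs_L2 (fcut (real n) ?f))) \<longlonglongrightarrow> cut R (FTc ?f)"
   by (rule bounded_linear.tendsto[OF cut_bl FTc_tendsto])
  have ce: "cut R (abs_L2 k) = abs_L2 (%xi. indicator (cball 0 R) xi *\<^sub>R k xi)" if "L2fun k" for k
   by (rule abs_L2_eqI[symmetric, OF L2fun_indicator[OF that]], simp, use rep_cut[of R "abs_L2 k"] rep_abs[OF that] in eventually_elim) simp
  have 2: "(%n. abs_L2 (%xi. indicator (cball 0 R) xi *\<^sub>R fcut (real n) ?f xi)) \<longlonglongrightarrow> abs_L2 (%xi. indicator (cball 0 R) xi *\<^sub>R fint f xi)"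
  proof (rule L2_tendsto_dominated[OF L2fun_indicator[OF L2fun_fcut] g])
   show "L2fun (%xi::real^3. cor (D * indicator (cball 0 R) xi))" by (rule L2fun_of_real[OF w])
   show "AA xi. cmod (indicator (cball 0 R) xi *\<^sub>R fcut (real n) ?f xi) <= cmod (cor (D * indicator (cball 0 R) xi))" for n
    using bd D0 by (auto simp: indicator_def)
   show "AA xi. (%n. indicator (cball 0 R) xi *\<^sub>R fcut (real n) ?f xi) \<longlonglongrightarrow> indicator (cball 0 R) xi *\<^sub>R fint f xi"
    by (intro AE_I2 tendsto_scaleR tendsto_const lim)
  qed simp
  have "cut R (FTc ?f) = abs_L2 (%xi. indicator (cball 0 R) xi *\<^sub>R fint f xi)"
   by (rule LIMSEQ_unique[OF 1]) (use 2 in \<open>simp add: ce[OF L2fun_fcut]\<close>)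
  then show ?thesis using rep_cut[of R "FTc ?f"] rep_abs[OF g] by (auto elim!: eventually_elim2 simp: indicator_def)
 qed
 have "AA xi. \<forall>n. xi \<in> cball 0 (real n) --> rep_L2 (FTc ?f) xi = fint f xi"
  unfolding AE_all_countable using ball by blast
 then show ?thesis
 proof eventually_elim
  case (elim xi)
  obtain n where "norm xi <= real n" using real_arch_simple by blast
  then show ?case using elim by auto
 qed
qed

section \<open>The Gaussian and high-frequency vectors\<close>

definition gauss :: "real^3 => real" where "gauss x = exp (- (1/2) * (norm x)^2)"

lemma gauss_pos: "0 < gauss x" and gauss_le: "gauss x <= 1" by (simp_all add: gauss_def)

lemma gauss_measurable [measurable]: "gauss \<in> borel_measurable borel"
 unfolding gauss_def[abs_def] by measurable

lemma gauss_integrable: "integrable lborel gauss"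
proof -
 have "integrable lborel (%x. cmod (cor (exp (- (1/2) * (norm (x::real^3))^2))))"
  by (rule integrable_norm[OF gauss_fint(1)]) simp
 then show ?thesis by (simp add: gauss_def[abs_def])
qed

lemma gauss_L2: "L2fun gauss"
proof (rule L2fun_bound[OF _ gauss_integrable])
 have "(gauss x)^2 <= gauss x * 1" for x
  unfolding power2_eq_square using gauss_pos[of x] gauss_le[of x] by (intro mult_left_mono) auto
 then show "AA x. (norm (gauss x))\<^sup>2 <= gauss x" by simp
qed measurable

lemma hat_gauss: "AA xi. rep_L2 (hat (abs_L2 gauss)) xi = cor ((sqrt (2 * pi)) ^ 3 * gauss xi)"
proof -
 have "cx (abs_L2 gauss) = abs_L2 (%x. cor (gauss x))"
  by (rule abs_L2_eqI[symmetric, OF L2fun_of_real[OF gauss_L2]], use rep_cx[of "abs_L2 gauss"] rep_abs[OF gauss_L2] in eventually_elim) simp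
 moreover have "fint (%x. cor (gauss x)) xi = cor ((sqrt (2 * pi)) ^ 3 * gauss xi)" for xi
  unfolding gauss_def using gauss_fint(2)[of "1/2" xi] by (simp add: mult.commute)
 ultimately show ?thesis unfolding hat_def
  using FTc_integrable[OF L2fun_of_real[OF gauss_L2]] gauss_integrable by simp
qed

text \<open>The transform of the Gaussian is a multiple of itself and outweighs the Bessel weight:
  for \<open>t <= 1\<close> one has
  \<open>(1 + r^2) powr t <= 1 + r^2 <= 2 * exp (r^2 / 2)\<close>.\<close>

lemma gauss_in_range:
 assumes t: "0 <= t" "t <= 1" obtains \<theta> where "abs_L2 gauss = J t \<theta>"
proof (rule divide_bes[OF _ t(1)])
 let ?c = "(sqrt (2 * pi)) ^ 3"
 show "integrable lborel (%xi. (1 + (norm xi)^2) powr t * (cmod (rep_L2 (hat (abs_L2 gauss)) xi))^2)"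
 proof (rule bint_bound[OF integrable_mult_right[OF gauss_integrable, of "2 * ?c\<^sup>2"]])
  show "AA xi. norm ((1 + (norm xi)^2) powr t * (cmod (rep_L2 (hat (abs_L2 gauss)) xi))^2) <= norm (2 * ?c\<^sup>2 * gauss xi)"
   using hat_gauss
  proof eventually_elim
   case (elim xi)
   have "(1 + (norm xi)^2) powr t <= (1 + (norm xi)^2) powr 1" using t by (intro powr_mono) auto
   also have "... = 1 + (norm xi)^2" by simp
   also have "... <= 2 * exp ((1/2) * (norm xi)^2)"
    using exp_ge_add_one_self[of "(1/2) * (norm xi)^2"] zero_le_power2[of "norm xi"] by linarith
   finally have "(1 + (norm xi)^2) powr t * gauss xi <= 2 * exp ((1/2) * (norm xi)^2) * gauss xi"
    using gauss_pos[of xi] by (intro mult_right_mono) auto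
   also have "... = 2" by (simp add: gauss_def exp_minus field_simps)
   finally have "(1 + (norm xi)^2) powr t * gauss xi * (?c\<^sup>2 * gauss xi) <= 2 * (?c\<^sup>2 * gauss xi)"
    using gauss_pos[of xi] by (intro mult_right_mono) auto
   moreover have "(cmod (rep_L2 (hat (abs_L2 gauss)) xi))^2 = ?c\<^sup>2 * (gauss xi)^2"
    unfolding elim norm_of_real power2_abs by (rule power_mult_distrib)
   ultimately show ?case using gauss_pos[of xi] by (simp add: power2_eq_square[of "gauss xi"] mult_ac)
  qed
 qed measurable
qed (rule that)

text \<open>Cutting the Gaussian to disjoint frequency annuli gives arbitrarily many orthogonal
  vectors. In the span of \<open>n + 1\<close> of them, \<open>n\<close> linear conditions have a
  nonzero common solution, for which the Borsuk-Ulam theorem is applied to linear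
  functionals.\<close>

lemma high_frequency_vector:
 assumes "finite A" obtains h where "h ~= 0" "!!a. a \<in> A ==> inner h a = 0" "fm (indicator {R<..}) h = h"
proof -
 obtain n and a :: "nat => real L2" where a: "A = a ` {i. i < n}" using finite_imp_nat_seg_image_inj_on[OF assms] by blast
 \<comment> \<open>The annuli must lie at nonnegative radii to be nonempty.\<close>
 define R' where "R' = max R 0"
 define S :: "nat => real => real" where "S j = indicator {R' + real j<..<R' + real j + 1}" for j
 have symb: "symb (S j)" for j unfolding S_def by (rule symbI[where M = 1]) (auto simp: indicator_def)
 define e where "e j = fm (S j) (abs_L2 gauss)" for j
 have z: "fm (%r. 0) h = 0" for h
 proof -
  have s0: "symb (%r. 0)" by (rule symbI[where M = 0]) auto
  have "norm (fm (%r. 0) h) <= 0 * norm h" by (rule norm_fm[OF s0]) simp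
  then show ?thesis by simp
 qed
 have orth: "inner (e i) (e j) = 0" if "i ~= j" for i j
 proof -
  have "S i r * S j r = 0" for r
  proof (cases "i < j")
   case True
   then have "real i + 1 <= real j" by linarith
   then show ?thesis by (auto simp: S_def indicator_def)
  next
   case False
   then have "real j + 1 <= real i" using that by linarith
   then show ?thesis by (auto simp: S_def indicator_def)
  qed
  then have "(%r. S i r * S j r) = (%r. 0)" by auto
  then have "fm (S i) (e j) = 0" unfolding e_def fm_fm[OF symb symb] by (simp only: z)
  then show ?thesis unfolding e_def[of i] fm_sym[OF symb] by simp
 qed
 have nz: "e j ~= 0" for j
 proof
  assume "e j = 0"
  then have "hat (e j) = 0" using linear_0[OF bounded_linear.linear[OF hat_bl]] by simp
  then have "AA xi. rep_L2 (hat (fm (S j) (abs_L2 gauss))) xi = 0" using rep_zero by (simp add: e_def)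
  then have "AA xi. S j (norm xi) = 0"
   using rep_hat_fm[OF symb[of j], of "abs_L2 gauss"] hat_gauss
  proof eventually_elim
   case (elim xi)
   then show ?case using gauss_pos[of xi] by auto
  qed
  then have ae: "AA xi. xi \<notin> {xi::real^3. R' + real j < norm xi \<and> norm xi < R' + real j + 1}" (is "AA xi. xi \<notin> ?U")
   by eventually_elim (simp add: S_def indicator_def split: if_splits)
  have op: "open ?U" by (intro open_Collect_conj open_Collect_less continuous_intros)
  have "?U \<in> null_sets lborel" using ae op AE_iff_null_sets[of ?U lborel] by simp
  then have "negligible ?U" using op by (simp add: negligible_iff_null_sets null_sets_completion_iff)
  moreover have "(R' + real j + 1/2) *\<^sub>R axis 1 1 \<in> ?U" by (simp add: R'_def)
  ultimately show False using open_not_negligible[OF op] by blast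
 qed
 define bs where "bs = map e [0..<Suc n]"
 have "inj_on e {0..<Suc n}" using orth nz by (intro inj_onI) (metis inner_eq_zero_iff)
 then have di: "distinct bs" unfolding bs_def by (simp add: distinct_map del: upt_Suc)
 have "pairwise orthogonal (set bs)"
  unfolding bs_def pairwise_def orthogonal_def using orth by (auto simp del: upt_Suc) (metis orth)
 then have ind: "independent (set bs)"
  by (rule pairwise_orthogonal_independent) (use nz in \<open>auto simp: bs_def simp del: upt_Suc\<close>)
 have "\<exists>x\<in>span (set bs). x ~= 0 \<and> (\<forall>j<n. inner x (a j) = 0)"
  by (rule borsuk_ulam_span[OF ind di]) (auto simp: bs_def intro!: continuous_intros simp del: upt_Suc)
 then obtain x where x: "x \<in> span (set bs)" "x ~= 0" "!!j. j < n ==> inner x (a j) = 0" by blast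
 show thesis
 proof (rule that[OF x(2)])
  show "inner x b = 0" if "b \<in> A" for b using that x(3) a by auto
  have s1: "symb (indicator {R<..})" by (rule symb_low(2))
  have "fm (indicator {R<..}) (e j) = e j" for j
   unfolding e_def fm_fm[OF s1 symb]
   by (rule fm_cong[OF symb_mult[OF s1 symb] symb]) (auto simp: S_def indicator_def R'_def)
  moreover have "subspace {x. fm (indicator {R<..}) x = x}"
   unfolding subspace_def using linear_0[OF bounded_linear.linear[OF fm_bl[OF s1]]] bl_add[OF fm_bl[OF s1]] bl_scaleR[OF fm_bl[OF s1]] by auto
  ultimately have "span (set bs) \<subseteq> {x. fm (indicator {R<..}) x = x}"
   by (intro span_minimal) (auto simp: bs_def simp del: upt_Suc)
  then show "fm (indicator {R<..}) x = x" using x(1) by blast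
 qed
qed

section \<open>The coupled system\<close>

lemma signed_power_abs: "\<bar>\<bar>y\<bar> powr (q - 2) * y\<bar> = \<bar>y\<bar> powr (q - 1)" for y q :: real
proof (cases "y = 0")
 case False
 then show ?thesis using powr_mult_base[of "\<bar>y\<bar>" "q - 2"] by (simp add: abs_mult mult.commute)
qed simp

lemma signed_power_self: "\<bar>y\<bar> powr (q - 2) * y * y = \<bar>y\<bar> powr q" for y q :: real
proof (cases "y = 0")
 case False
 have "\<bar>y\<bar> powr (q - 2) * \<bar>y\<bar> powr 2 = \<bar>y\<bar> powr q" unfolding powr_add[symmetric] by simp
 then show ?thesis by (simp add: power2_eq_square mult.assoc)
qed simp

lemma signed_power_nonneg: "0 <= y ==> \<bar>y\<bar> powr (q - 2) * y = y powr (q - 1)" for y q :: real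
 using signed_power_abs[of y q] by (simp add: abs_mult)

text \<open>For arguments of one sign this is the subadditivity of the power \<open>q - 1\<close>,
  which is below 1; opposite signs split at 0, which costs the factor 2.\<close>

lemma signed_power_holder:
 fixes a b q :: real
 assumes q: "1 < q" "q < 2"
 shows "\<bar>\<bar>a\<bar> powr (q - 2) * a - \<bar>b\<bar> powr (q - 2) * b\<bar> <= 2 * \<bar>a - b\<bar> powr (q - 1)"
proof -
 define S where "S y = \<bar>y\<bar> powr (q - 2) * y" for y :: real
 have neg: "S (- y) = - S y" for y by (simp add: S_def)
 have pos: "S y = y powr (q - 1)" if "0 <= y" for y using signed_power_nonneg[OF that] by (simp add: S_def)
 have 1: "\<bar>S x - S y\<bar> <= \<bar>x - y\<bar> powr (q - 1)" if "0 <= y" "y <= x" for x y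
 proof -
  have "x powr (q - 1) <= (x - y) powr (q - 1) + y powr (q - 1)"
   using powr_subadd[of "q - 1" "x - y" y] that q by simp
  moreover have "y powr (q - 1) <= x powr (q - 1)" using that q by (intro powr_mono2) auto
  ultimately show ?thesis using that by (simp add: pos)
 qed
 have 2: "\<bar>S x - S y\<bar> <= 2 * \<bar>x - y\<bar> powr (q - 1)" if "0 <= x" for x y
 proof (cases "0 <= y")
  case True
  have "\<bar>S x - S y\<bar> <= \<bar>x - y\<bar> powr (q - 1)"
   using 1[of y x] 1[of x y] True that by (cases "y <= x") (simp_all add: abs_minus_commute)
  then show ?thesis using powr_ge_zero[of "\<bar>x - y\<bar>" "q - 1"] by linarith
 next
  case False
  have "\<bar>S x - S y\<bar> = x powr (q - 1) + (- y) powr (q - 1)"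
   using neg[of "- y"] pos[of "- y"] pos[OF that] False by simp
  moreover have "x powr (q - 1) <= \<bar>x - y\<bar> powr (q - 1)" "(- y) powr (q - 1) <= \<bar>x - y\<bar> powr (q - 1)"
   using that False q by (intro powr_mono2; simp)+
  ultimately show ?thesis by linarith
 qed
 have "\<bar>S a - S b\<bar> <= 2 * \<bar>a - b\<bar> powr (q - 1)"
 proof (cases "0 <= a")
  case False
  then show ?thesis using 2[of "- a" "- b"] by (simp add: neg abs_minus_commute)
 qed (rule 2)
 then show ?thesis by (simp add: S_def)
qed

text \<open>The tangent inequality for the convex function \<open>|y| powr q / q\<close>, from
  Young's inequality with exponents \<open>q / (q - 1)\<close> and \<open>q\<close>.\<close>

lemma signed_power_convex:
 fixes a b q :: real
 assumes q: "1 < q"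
 shows "(1 / q) * \<bar>a\<bar> powr q + \<bar>a\<bar> powr (q - 2) * a * (b - a) <= (1 / q) * \<bar>b\<bar> powr q"
proof -
 have "\<bar>a\<bar> powr (q - 2) * a * b <= \<bar>\<bar>a\<bar> powr (q - 2) * a\<bar> * \<bar>b\<bar>" by (metis abs_ge_self abs_mult)
 also have "... = \<bar>a\<bar> powr (q - 1) * \<bar>b\<bar>" unfolding signed_power_abs ..
 also have "... <= (\<bar>a\<bar> powr (q - 1)) powr (q / (q - 1)) / (q / (q - 1)) + \<bar>b\<bar> powr q / q"
  using q by (intro Youngs_inequality) (auto simp: field_simps)
 also have "(\<bar>a\<bar> powr (q - 1)) powr (q / (q - 1)) = \<bar>a\<bar> powr q" using q by (simp add: powr_powr)
 also have "\<bar>a\<bar> powr q / (q / (q - 1)) = \<bar>a\<bar> powr q - (1 / q) * \<bar>a\<bar> powr q" using q by (simp add: field_simps)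
 finally show ?thesis using signed_power_self[of a q] by (simp add: right_diff_distrib)
qed

text \<open>With \<open>d = 3 - 2 * s\<close> the left side is the exponent \<open>\<rho>\<close> of
  \<open>sobolev_weight\<close>; the powers \<open>r = 4\<close> and \<open>r = q\<close> give the
  exponents in the assumptions on \<open>K\<close> and \<open>g\<close>.\<close>

lemma dual_exponent: "d ~= 0 ==> 6 / d / (6 / d - r) = 6 / (6 - r * (d::real))"
proof -
 assume "d ~= 0"
 then have "6 / d - r = (6 - r * d) / d" by (simp add: diff_divide_distrib)
 then show ?thesis using \<open>d ~= 0\<close> by simp
qed

lemma abs_inverse_le_1: "1 <= x ==> \<bar>1 / x\<bar> <= (1::real)"
 by simp

locale sp_system =
 fixes s t q :: real and V K g :: "real^3 => real"
 assumes s: "3/4 < s" "s < 1" and t: "0 < t" "t < 1"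
  and V: "continuous_on UNIV V" "bounded (range V)" "zero_in_spectral_gap s V"
  and K: "in_Lp (3 / (4 * s - 3)) K" "in_Linf K" "AA x. K x > 0"
  and q: "4/3 <= q" "q < 2"
  and g: "in_Lp (6 / (6 - q * (3 - 2 * s))) g" "AA x. g x < 0"
begin

abbreviation U :: "real L2 => real^3 => real" where "U h \<equiv> rep_L2 (J s h)"

lemma sb: "0 <= s" "0 < s" "2 * s < 3" and tb: "0 <= t" and qb: "1 < q" "1 <= q" "0 < q"
 using s t q by auto

lemma K_meas [measurable]: "K \<in> borel_measurable borel" and g_meas [measurable]: "g \<in> borel_measurable borel"
 and V_meas [measurable]: "V \<in> borel_measurable borel"
 using K(2) g(1) borel_measurable_continuous_onI[OF V(1)] by (auto simp: in_Linf_def in_Lp_def)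

text \<open>The weight \<open>K^2\<close> goes with the fourth power of \<open>u\<close>, since
  \<open>|K u^2|^2 = K^2 u^4\<close>. Its dual exponent is \<open>3 / (4 * s - 3)\<close>; as
  \<open>K\<close> is bounded, \<open>K^2\<close> lies in the same Lebesgue space as
  \<open>K\<close>. The critical exponent exceeds 4 because \<open>s > 3 / 4\<close>.\<close>

sublocale K4: sobolev_weight s "6 / (3 - 2 * s)" 4 "6 / (3 - 2 * s) / (6 / (3 - 2 * s) - 4)" "%x. (K x)\<^sup>2"
proof
 let ?r = "3 / (4 * s - 3)"
 have d: "3 - 2 * s ~= 0" and e: "6 - 4 * (3 - 2 * s) = 2 * (4 * s - 3)" using s by simp_all
 have r: "6 / (3 - 2 * s) / (6 / (3 - 2 * s) - 4) = ?r"
 proof -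
  have "6 / (2 * x) = 3 / x" for x :: real by simp
  then show ?thesis unfolding dual_exponent[OF d] e by this
 qed
 have rpos: "0 < ?r" using s by simp
 obtain M where M: "0 < M" "AA x. \<bar>K x\<bar> <= M" using in_LinfE[OF K(2)] .
 show "integrable lborel (%x. (K x)\<^sup>2 powr (6 / (3 - 2 * s) / (6 / (3 - 2 * s) - 4)))"
  unfolding r
 proof (rule bint_bound)
  show "integrable lborel (%x. M powr ?r * \<bar>K x\<bar> powr ?r)" using K(1) by (auto simp: in_Lp_def)
  show "AA x. norm ((K x)\<^sup>2 powr ?r) <= norm (M powr ?r * \<bar>K x\<bar> powr ?r)"
   using M(2)
  proof eventually_elim
   case (elim x)
   have "(K x)^2 = \<bar>K x\<bar> * \<bar>K x\<bar>" by (simp add: power2_eq_square)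
   then have "(K x)\<^sup>2 powr ?r = \<bar>K x\<bar> powr ?r * \<bar>K x\<bar> powr ?r" by (simp only: powr_mult)
   also have "... <= M powr ?r * \<bar>K x\<bar> powr ?r" using elim rpos by (intro mult_right_mono powr_mono2) auto
   finally show ?case by simp
  qed
 qed measurable
 show "4 < 6 / (3 - 2 * s)" using s by (simp add: field_simps)
qed (use sb in auto)

sublocale gq: sobolev_weight s "6 / (3 - 2 * s)" q "6 / (3 - 2 * s) / (6 / (3 - 2 * s) - q)" "%x. \<bar>g x\<bar>"
proof
 have p4: "4 < 6 / (3 - 2 * s)" using s by (simp add: field_simps)
 then show "q < 6 / (3 - 2 * s)" using q by linarith
 have "6 / (3 - 2 * s) / (6 / (3 - 2 * s) - q) = 6 / (6 - q * (3 - 2 * s))"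
  by (rule dual_exponent) (use s in simp)
 then show "integrable lborel (%x. \<bar>g x\<bar> powr (6 / (3 - 2 * s) / (6 / (3 - 2 * s) - q)))"
  using g(1) by (simp add: in_Lp_def)
qed (use sb qb in auto)

definition \<kappa> :: "real L2 => real" where "\<kappa> h = K4.m h + gq.m h"

lemma m_le_\<kappa>: "K4.m h <= \<kappa> h" "gq.m h <= \<kappa> h"
 using K4.m_nonneg[of h] gq.m_nonneg[of h] by (simp_all add: \<kappa>_def)

lemma \<kappa>_bounded: obtains C where "0 < C" "!!h. \<kappa> h <= C * norm h"
proof -
 obtain C D where C: "0 < C" "!!h. K4.m h <= C * norm h" and D: "0 < D" "!!h. gq.m h <= D * norm h"
  using K4.m_bound gq.m_bound by metis
 have "\<kappa> h <= (C + D) * norm h" for h using C(2)[of h] D(2)[of h] by (simp add: \<kappa>_def distrib_right)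
 then show thesis using that[of "C + D"] C(1) D(1) by auto
qed

lemma \<kappa>_small:
 assumes e: "0 < e" shows "\<exists>A. finite A \<and> (\<forall>u. (\<forall>a\<in>A. inner u a = 0) --> \<kappa> u <= e * norm u)"
proof -
 have e2: "0 < e / 2" using e by simp
 obtain A where A: "finite A" "!!u. (\<forall>a\<in>A. inner u a = 0) ==> K4.m u <= e / 2 * norm u"
  using K4.m_compact[OF e2] by blast
 obtain B where B: "finite B" "!!u. (\<forall>a\<in>B. inner u a = 0) ==> gq.m u <= e / 2 * norm u"
  using gq.m_compact[OF e2] by blast
 have "\<kappa> u <= e * norm u" if "\<forall>a\<in>A \<union> B. inner u a = 0" for u
  using A(2)[of u] B(2)[of u] that by (simp add: \<kappa>_def)
 then show ?thesis using A(1) B(1) by (intro exI[of _ "A \<union> B"]) auto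
qed

lemma U_add: "AA x. U (h + k) x = U h x + U k x"
 using rep_add[of "J s h" "J s k"] by (simp add: bl_add[OF J_bl[OF sb(1)]])

lemma U_scale: "AA x. U (r *\<^sub>R h) x = r * U h x"
 using rep_scaleR[of r "J s h"] by (simp add: bl_scaleR[OF J_bl[OF sb(1)]])

lemma U_diff: "AA x. U (h - k) x = U h x - U k x"
 using rep_diff[of "J s h" "J s k"] by (simp add: bl_diff[OF J_bl[OF sb(1)]])

lemma U_minus: "AA x. U (- h) x = - U h x"
 using U_scale[of "-1" h] by simp

section \<open>The nonlocal and the local nonlinear term\<close>

definition P :: "real L2 => real L2 => real^3 => real" where "P h k x = K x * (U h x * U k x)"

definition \<beta> :: "real L2 => real L2 => real L2" where "\<beta> h k = J t (abs_L2 (P h k))"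

lemma P_meas [measurable]: "P h k \<in> borel_measurable borel"
 unfolding P_def by measurable

lemma KUU: "L2fun (%x. \<bar>K x\<bar> * (U h x)^2)" "norm (abs_L2 (%x. \<bar>K x\<bar> * (U h x)^2)) = (K4.m h)^2"
proof -
 have e: "(norm (\<bar>K x\<bar> * (U h x)^2))^2 = (K x)^2 * \<bar>U h x\<bar> powr 4" for x
  by (simp add: power_mult_distrib)
 show L: "L2fun (%x. \<bar>K x\<bar> * (U h x)^2)"
  by (rule L2fun_bound[OF _ K4.w_integrable[of h]]) (simp_all only: e order_refl eventually_True, measurable)
 have "(norm (abs_L2 (%x. \<bar>K x\<bar> * (U h x)^2)))^2 = K4.m h powr 4"
  unfolding norm_abs_L2[OF L] e K4.m_powr ..
 also have "... = ((K4.m h)^2)^2" using K4.m_nonneg[of h] by simp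
 finally show "norm (abs_L2 (%x. \<bar>K x\<bar> * (U h x)^2)) = (K4.m h)^2" by (rule power2_eq_imp_eq) simp_all
qed

text \<open>Cauchy-Schwarz after writing \<open>|K u v|^2\<close> as the product of
  \<open>|K| u^2\<close> and \<open>|K| v^2\<close>.\<close>

lemma P_L2: "L2fun (P h k)"
 and P_norm: "norm (abs_L2 (P h k)) <= K4.m h * K4.m k"
proof -
 let ?a = "%h x. \<bar>K x\<bar> * (U h x)^2"
 have e: "(norm (P h k x))^2 = inner (?a h x) (?a k x)" for x
  by (simp add: P_def power_mult_distrib power2_eq_square[of "K x"] abs_mult mult_ac)
 show L: "L2fun (P h k)"
  by (rule L2fun_bound[OF _ integrable_inner_L2[OF KUU(1)[of h] KUU(1)[of k]]]) (simp_all only: e order_refl eventually_True, measurable)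
 have "(norm (abs_L2 (P h k)))^2 = inner (abs_L2 (?a h)) (abs_L2 (?a k))"
  unfolding norm_abs_L2[OF L] inner_abs_L2[OF KUU(1) KUU(1)] e ..
 also have "... <= norm (abs_L2 (?a h)) * norm (abs_L2 (?a k))" by (rule norm_cauchy_schwarz)
 also have "... = (K4.m h * K4.m k)^2" unfolding KUU(2) by (simp add: power_mult_distrib)
 finally show "norm (abs_L2 (P h k)) <= K4.m h * K4.m k"
  by (rule power2_le_imp_le) (simp add: K4.m_nonneg)
qed

lemma \<beta>_norm: "norm (\<beta> h k) <= \<kappa> h * \<kappa> k"
proof -
 have "norm (\<beta> h k) <= norm (abs_L2 (P h k))" unfolding \<beta>_def by (rule norm_J[OF tb])
 also have "... <= K4.m h * K4.m k" by (rule P_norm)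
 also have "... <= \<kappa> h * \<kappa> k" using K4.m_nonneg m_le_\<kappa> by (intro mult_mono) (auto intro: order_trans)
 finally show ?thesis .
qed

lemma \<beta>_add: "\<beta> (h + k) l = \<beta> h l + \<beta> k l"
proof -
 have "abs_L2 (P (h + k) l) = abs_L2 (%x. P h l x + P k l x)"
  by (rule abs_L2_cong[OF P_L2 L2fun_add[OF P_L2 P_L2]], use U_add[of h k] in eventually_elim) (simp add: P_def algebra_simps)
 then show ?thesis by (simp add: \<beta>_def abs_L2_add P_L2 bl_add[OF J_bl[OF tb]])
qed

lemma \<beta>_scale: "\<beta> (r *\<^sub>R h) l = r *\<^sub>R \<beta> h l"
proof -
 have "abs_L2 (P (r *\<^sub>R h) l) = abs_L2 (%x. r *\<^sub>R P h l x)"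
  by (rule abs_L2_cong[OF P_L2 L2fun_scaleR[OF P_L2]], use U_scale[of r h] in eventually_elim) (simp add: P_def algebra_simps)
 then show ?thesis unfolding \<beta>_def by (simp only: abs_L2_scaleR[OF P_L2] bl_scaleR[OF J_bl[OF tb]])
qed

lemma \<beta>_sym: "\<beta> h k = \<beta> k h"
proof -
 have "P h k = P k h" by (simp add: P_def fun_eq_iff)
 then show ?thesis by (simp add: \<beta>_def)
qed

text \<open>Since \<open>g < 0\<close>, \<open>|g| = - g\<close>, and the local term enters the
  functional with a positive sign; \<open>T\<close> below is its derivative.\<close>

definition G :: "real L2 => real" where "G h = (1 / q) * (LBINT x. \<bar>g x\<bar> * \<bar>U h x\<bar> powr q)"

definition T :: "real L2 => real L2 => real" where
 "T h k = (LBINT x. \<bar>g x\<bar> * (\<bar>U h x\<bar> powr (q - 2) * U h x * U k x))"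

text \<open>Serves twice: with \<open>c = 1\<close> for \<open>T\<close> itself and with
  \<open>c = 2\<close> for differences of signed powers.\<close>

lemma holder_g:
 assumes [measurable]: "F \<in> borel_measurable borel" and F: "AA x. \<bar>F x\<bar> <= c * \<bar>U h x\<bar> powr (q - 1)" and c: "0 <= c"
 shows "integrable lborel (%x. \<bar>g x\<bar> * (F x * U k x))"
  and "\<bar>LBINT x. \<bar>g x\<bar> * (F x * U k x)\<bar> <= 2 * c * gq.m h powr (q - 1) * gq.m k"
proof -
 let ?H = "%x. \<bar>g x\<bar> * (\<bar>U h x\<bar> powr (q - 1) * \<bar>U k x\<bar>)"
 have H: "integrable lborel ?H" "(LBINT x. ?H x) <= 2 * gq.m h powr (q - 1) * gq.m k"
  using holder_weighted[OF qb(1), of "%x. \<bar>g x\<bar>" lborel "%x. \<bar>U h x\<bar>" "%x. \<bar>U k x\<bar>"] gq.w_integrable[of h] gq.w_integrable[of k]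
  by (auto simp: gq.m_def)
 have le: "AA x. norm (\<bar>g x\<bar> * (F x * U k x)) <= norm (c * ?H x)"
  using F
 proof eventually_elim
  case (elim x)
  have "\<bar>g x\<bar> * (\<bar>F x\<bar> * \<bar>U k x\<bar>) <= \<bar>g x\<bar> * (c * \<bar>U h x\<bar> powr (q - 1) * \<bar>U k x\<bar>)"
   using elim by (intro mult_left_mono mult_right_mono) auto
  then show ?case using c by (simp add: abs_mult mult_ac)
 qed
 show i: "integrable lborel (%x. \<bar>g x\<bar> * (F x * U k x))"
  by (rule bint_bound[OF integrable_mult_right[OF H(1), of c] _ le]) measurable
 have "\<bar>LBINT x. \<bar>g x\<bar> * (F x * U k x)\<bar> <= (LBINT x. norm (\<bar>g x\<bar> * (F x * U k x)))"
  using integral_norm_bound[of lborel "%x. \<bar>g x\<bar> * (F x * U k x)"] by simp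
 also have "... <= (LBINT x. c * ?H x)"
  using le c by (intro integral_mono_AE integrable_norm i integrable_mult_right H(1)) (auto elim!: eventually_mono)
 also have "... <= c * (2 * gq.m h powr (q - 1) * gq.m k)" unfolding integral_mult_right_zero by (rule mult_left_mono[OF H(2) c])
 finally show "\<bar>LBINT x. \<bar>g x\<bar> * (F x * U k x)\<bar> <= 2 * c * gq.m h powr (q - 1) * gq.m k" by (simp add: mult_ac)
qed

lemma T_integrable: "integrable lborel (%x. \<bar>g x\<bar> * (\<bar>U h x\<bar> powr (q - 2) * U h x * U k x))"
 and T_bound: "\<bar>T h k\<bar> <= 2 * gq.m h powr (q - 1) * gq.m k"
 using holder_g[of "%x. \<bar>U h x\<bar> powr (q - 2) * U h x" 1 h k] by (auto simp: T_def signed_power_abs)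

lemma T_bl: "bounded_linear (T h)"
proof -
 obtain C where C: "0 < C" "!!h. gq.m h <= C * norm h" using gq.m_bound by blast
 show ?thesis
 proof (rule bounded_linear_intro[where K = "2 * gq.m h powr (q - 1) * C"])
  fix k l
  have "T h (k + l) = (LBINT x. \<bar>g x\<bar> * (\<bar>U h x\<bar> powr (q - 2) * U h x * U k x) + \<bar>g x\<bar> * (\<bar>U h x\<bar> powr (q - 2) * U h x * U l x))"
   unfolding T_def
  proof (rule integral_cong_AE)
   show "AA x. \<bar>g x\<bar> * (\<bar>U h x\<bar> powr (q - 2) * U h x * U (k + l) x) = \<bar>g x\<bar> * (\<bar>U h x\<bar> powr (q - 2) * U h x * U k x) + \<bar>g x\<bar> * (\<bar>U h x\<bar> powr (q - 2) * U h x * U l x)"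
    using U_add[of k l] by eventually_elim (simp add: distrib_left)
  qed measurable
  also have "... = T h k + T h l" unfolding T_def by (rule bint_sum[OF T_integrable T_integrable])
  finally show "T h (k + l) = T h k + T h l" .
 next
  fix r k
  have "T h (r *\<^sub>R k) = (LBINT x. r * (\<bar>g x\<bar> * (\<bar>U h x\<bar> powr (q - 2) * U h x * U k x)))"
   unfolding T_def
  proof (rule integral_cong_AE)
   show "AA x. \<bar>g x\<bar> * (\<bar>U h x\<bar> powr (q - 2) * U h x * U (r *\<^sub>R k) x) = r * (\<bar>g x\<bar> * (\<bar>U h x\<bar> powr (q - 2) * U h x * U k x))"
    using U_scale[of r k] by eventually_elim simp
  qed measurable
  then show "T h (r *\<^sub>R k) = r *\<^sub>R T h k" by (simp add: T_def)
 next
  fix k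
  have "\<bar>T h k\<bar> <= 2 * gq.m h powr (q - 1) * (C * norm k)"
   by (rule order_trans[OF T_bound mult_left_mono[OF C(2)]]) simp
  then show "norm (T h k) <= norm k * (2 * gq.m h powr (q - 1) * C)" by (simp add: mult_ac)
 qed
qed

definition D2 :: "real L2 => real L2" where "D2 h = (SOME z. \<forall>k. T h k = inner z k)"

lemma inner_D2: "inner (D2 h) k = T h k"
proof -
 have "\<forall>k. T h k = inner (D2 h) k"
  unfolding D2_def by (rule someI_ex) (rule riesz_representation[OF T_bl])
 then show ?thesis by simp
qed

lemma G_m: "G h = (1 / q) * gq.m h powr q" unfolding G_def gq.m_powr ..

lemma G_nonneg: "0 <= G h" using qb by (simp add: G_m)

lemma G_even: "G (- h) = G h" using gq.m_scale[of "-1" h] by (simp add: G_m)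

lemma D2_odd: "D2 (- h) = - D2 h"
proof -
 have "inner (D2 (- h)) k = inner (- D2 h) k" for k
 proof -
  have "T (- h) k = (LBINT x. - (\<bar>g x\<bar> * (\<bar>U h x\<bar> powr (q - 2) * U h x * U k x)))"
   unfolding T_def
  proof (rule integral_cong_AE)
   show "AA x. \<bar>g x\<bar> * (\<bar>U (- h) x\<bar> powr (q - 2) * U (- h) x * U k x) = - (\<bar>g x\<bar> * (\<bar>U h x\<bar> powr (q - 2) * U h x * U k x))"
    using U_minus[of h] by eventually_elim simp
  qed measurable
  then show ?thesis by (simp add: inner_D2 T_def)
 qed
 then show ?thesis by (metis vector_eq_rdot)
qed

lemma D2_euler: "inner (D2 h) h = q * G h"
 using qb unfolding inner_D2 T_def G_def signed_power_self by simp

lemma D2_convex: "G h + inner (D2 h) (k - h) <= G k"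
proof -
 let ?f = "%x. (1 / q) * (\<bar>g x\<bar> * \<bar>U h x\<bar> powr q) + \<bar>g x\<bar> * (\<bar>U h x\<bar> powr (q - 2) * U h x * U (k - h) x)"
 have "G h + inner (D2 h) (k - h) = (LBINT x. ?f x)"
  unfolding G_def inner_D2 T_def integral_mult_right_zero[symmetric]
  by (rule bint_sum[symmetric, OF integrable_mult_right[OF gq.w_integrable] T_integrable])
 also have "... <= (LBINT x. (1 / q) * (\<bar>g x\<bar> * \<bar>U k x\<bar> powr q))"
 proof (rule integral_mono_AE)
  show "integrable lborel ?f" by (rule bint_add[OF integrable_mult_right[OF gq.w_integrable] T_integrable])
  show "integrable lborel (%x. (1 / q) * (\<bar>g x\<bar> * \<bar>U k x\<bar> powr q))" by (rule integrable_mult_right[OF gq.w_integrable])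
  show "AA x. ?f x <= (1 / q) * (\<bar>g x\<bar> * \<bar>U k x\<bar> powr q)"
   using U_diff[of k h]
  proof eventually_elim
   case (elim x)
   have "\<bar>g x\<bar> * ((1 / q) * \<bar>U h x\<bar> powr q + \<bar>U h x\<bar> powr (q - 2) * U h x * (U k x - U h x)) <= \<bar>g x\<bar> * ((1 / q) * \<bar>U k x\<bar> powr q)"
    by (intro mult_left_mono signed_power_convex qb) simp
   then show ?case unfolding elim by (simp add: distrib_left mult_ac)
  qed
 qed
 finally show ?thesis by (simp add: G_def)
qed

lemma D2_bound: "\<bar>inner (D2 h) k\<bar> <= 4 * (1 + G h) * \<kappa> k"
proof -
 have "gq.m h powr (q - 1) * 1 <= gq.m h powr q + 1 powr q"
  using young_simple[of q "gq.m h" 1] qb gq.m_nonneg by simp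
 also have "gq.m h powr q = q * G h" using qb by (simp add: G_m)
 also have "q * G h <= 2 * G h" using q G_nonneg by (intro mult_right_mono) auto
 finally have step: "2 * gq.m h powr (q - 1) <= 4 * (1 + G h)" using G_nonneg[of h] by simp
 have "2 * gq.m h powr (q - 1) * gq.m k <= 4 * (1 + G h) * \<kappa> k"
  by (rule mult_mono[OF step m_le_\<kappa>(2)]) (use G_nonneg[of h] gq.m_nonneg in auto)
 then show ?thesis using T_bound[of h k] by (simp add: inner_D2)
qed

lemma D2_diff: "\<bar>inner (D2 h - D2 w) k\<bar> <= 4 * \<kappa> (h - w) powr (q - 1) * \<kappa> k"
proof -
 let ?F = "%x. \<bar>U h x\<bar> powr (q - 2) * U h x - \<bar>U w x\<bar> powr (q - 2) * U w x"
 have "inner (D2 h - D2 w) k = (LBINT x. \<bar>g x\<bar> * (\<bar>U h x\<bar> powr (q - 2) * U h x * U k x) - \<bar>g x\<bar> * (\<bar>U w x\<bar> powr (q - 2) * U w x * U k x))"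
  unfolding inner_diff_left inner_D2 T_def by (rule bint_difference[symmetric, OF T_integrable T_integrable])
 also have "... = (LBINT x. \<bar>g x\<bar> * (?F x * U k x))" by (simp only: right_diff_distrib left_diff_distrib)
 also have "\<bar>...\<bar> <= 2 * 2 * gq.m (h - w) powr (q - 1) * gq.m k"
 proof (rule holder_g(2))
  show "AA x. \<bar>?F x\<bar> <= 2 * \<bar>U (h - w) x\<bar> powr (q - 1)"
   using U_diff[of h w] by eventually_elim (simp add: signed_power_holder qb q)
  show "?F \<in> borel_measurable borel" by measurable
 qed simp
 also have "... <= 4 * \<kappa> (h - w) powr (q - 1) * \<kappa> k"
  using qb gq.m_nonneg m_le_\<kappa> by (intro mult_mono powr_mono2) auto
 finally show ?thesis .
qed

text \<open>Its form is the integral of \<open>K * gauss * u^2\<close>: definite because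
  \<open>K > 0\<close>, and bounded by the norm of \<open>\<beta> u u\<close> because the Gaussian
  is a Bessel potential of order \<open>t\<close>.\<close>

definition Q :: "real L2 => real L2" where "Q h = J s (pm (%x. K x * gauss x) (J s h))"

lemma gauss_Linf: "in_Linf gauss"
 unfolding in_Linf_def using gauss_pos gauss_le by (auto intro!: exI[of _ 1] simp: less_imp_le)

lemma KG: "in_Linf (%x. K x * gauss x)" by (rule in_Linf_mult[OF K(2) gauss_Linf])

lemma Q_bl: "bounded_linear Q"
 unfolding Q_def[abs_def] by (rule bounded_linear_compose[OF J_bl[OF sb(1)] bounded_linear_compose[OF pm_bl[OF KG] J_bl[OF sb(1)]]])

lemma Q_sym: "inner (Q h) k = inner h (Q k)"
 unfolding Q_def by (simp only: J_sym[OF sb(1)] pm_sym[OF KG])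

lemma inner_Q: "inner (Q h) h = (LBINT x. K x * gauss x * (U h x)^2)"
 unfolding Q_def J_sym[OF sb(1)] inner_pm[OF KG] by (simp add: power2_eq_square)

lemma KGU_integrable: "integrable lborel (%x. K x * gauss x * (U h x)^2)"
 using integrable_inner_L2[OF L2fun_pm[OF KG rep_L2fun[of "J s h"]] rep_L2fun[of "J s h"]] by (simp add: power2_eq_square mult.assoc)

lemma KGU_nonneg: "AA x. 0 <= K x * gauss x * (U h x)^2"
 using K(3) by eventually_elim (use gauss_pos in \<open>simp add: less_imp_le\<close>)

lemma Q_pos: "0 <= inner (Q h) h"
 unfolding inner_Q by (rule integral_nonneg_AE[OF KGU_nonneg])

lemma Q_inj: assumes "Q h = 0" shows "h = 0"
proof -
 have "(LBINT x. K x * gauss x * (U h x)^2) = 0" using assms inner_Q[of h] by simp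
 then have "AA x. K x * gauss x * (U h x)^2 = 0"
  using integral_nonneg_eq_0_iff_AE[OF KGU_integrable KGU_nonneg] by simp
 then have z: "AA x. U h x = 0"
  using K(3)
 proof eventually_elim
  case (elim x)
  then show ?case using gauss_pos[of x] by auto
 qed
 have "J s h = 0" by (rule L2_eqI, use z rep_zero in eventually_elim) simp
 then have "J s h = J s 0" using linear_0[OF bounded_linear.linear[OF J_bl[OF sb(1)]]] by simp
 then show ?thesis by (rule J_inject[OF sb(1)])
qed

text \<open>Writing the Gaussian as \<open>J t \<theta>\<close> and moving \<open>J t\<close> to
  \<open>K u^2\<close> gives \<open>(Q u, u) = (\<beta> u u, \<theta>)\<close>.\<close>

lemma Q_bound: obtains C where "0 < C" "!!u. (inner (Q u) u)\<^sup>2 <= C * (norm (\<beta> u u))^2"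
proof -
 obtain \<theta> where th: "abs_L2 gauss = J t \<theta>" using gauss_in_range[OF tb] t by auto
 have "(inner (Q u) u)^2 <= ((norm \<theta>)^2 + 1) * (norm (\<beta> u u))^2" for u
 proof -
  have "inner (Q u) u = (LBINT x. inner (P u u x) (gauss x))"
   unfolding inner_Q by (simp add: P_def power2_eq_square mult_ac)
  also have "... = inner (abs_L2 (P u u)) (J t \<theta>)" unfolding th[symmetric] by (rule inner_abs_L2[OF P_L2 gauss_L2, symmetric])
  also have "... = inner (\<beta> u u) \<theta>" unfolding \<beta>_def J_sym[OF tb] ..
  finally have "(inner (Q u) u)^2 <= (norm (\<beta> u u) * norm \<theta>)^2"
   using Cauchy_Schwarz_ineq2[of "\<beta> u u" \<theta>] by (simp add: abs_le_square_iff[symmetric])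
  also have "... <= ((norm \<theta>)^2 + 1) * (norm (\<beta> u u))^2" by (simp add: power_mult_distrib algebra_simps)
  finally show ?thesis .
 qed
 moreover have "0 < (norm \<theta>)\<^sup>2 + 1" by (simp add: add_nonneg_pos)
 ultimately show thesis using that by blast
qed

section \<open>The linear operator\<close>

definition a :: "real => real" where "a r = r powr (2 * s) * bes (2 * s) r"

text \<open>\<open>(L h, k)\<close> is the bilinear form of the fractional Schroedinger operator at
  \<open>J s h\<close> and \<open>J s k\<close>; the symbol \<open>a\<close> is
  \<open>r powr (2 * s)\<close> divided by the weight of \<open>H^s\<close>.\<close>

definition L :: "real L2 => real L2" where "L h = fm a h + J s (pm V (J s h))"

lemma symb_a: "symb a"
 unfolding a_def[abs_def] using symb_lap[of s "2 * s"] sb by simp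

lemma VM: obtains M where "0 < M" "!!x. \<bar>V x\<bar> <= M"
proof -
 obtain M where "0 < M" "\<forall>x\<in>range V. norm x <= M" using V(2) unfolding bounded_pos by blast
 then show thesis by (intro that[of M]) auto
qed

lemma V_Linf: "in_Linf V"
proof -
 obtain M where "0 < M" "!!x. \<bar>V x\<bar> <= M" using VM by blast
 then show ?thesis unfolding in_Linf_def by auto
qed

lemma L_bl: "bounded_linear L"
 unfolding L_def[abs_def]
 by (intro bounded_linear_add fm_bl[OF symb_a] bounded_linear_compose[OF J_bl[OF sb(1)] bounded_linear_compose[OF pm_bl[OF V_Linf] J_bl[OF sb(1)]]])

lemma L_sym: "inner (L h) k = inner h (L k)"
 unfolding L_def inner_add_left inner_add_right by (simp only: J_sym[OF sb(1)] pm_sym[OF V_Linf] fm_sym[OF symb_a])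

abbreviation c :: "real => real" where "c r \<equiv> a r + bes (2 * s) r"

text \<open>\<open>c r\<close> is \<open>1 + r powr (2 * s)\<close> divided by
  \<open>(1 + r^2) powr s\<close>, and the power \<open>s < 1\<close> is subadditive.\<close>

lemma c_ge_1: "r > 0 ==> 1 <= c r"
proof -
 assume r: "r > 0"
 have "(1 + r^2) powr s <= 1 powr s + (r^2) powr s" using s by (intro powr_subadd) auto
 also have "(r^2) powr s = r powr (2 * s)" using r by (simp add: powr_powr flip: powr_numeral)
 finally have "(1 + r^2) powr s * bes (2 * s) r <= (1 + r powr (2 * s)) * bes (2 * s) r"
  using bes_pos[of "2 * s" r] by (intro mult_right_mono) auto
 moreover have "(1 + r^2) powr s * bes (2 * s) r = 1" by (simp add: bes_def powr_add[symmetric])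
 ultimately show ?thesis by (simp add: a_def distrib_right)
qed

lemma symb_c: "symb c"
proof -
 obtain M where M: "!!r. r >= 0 ==> \<bar>a r\<bar> <= M" using symb_a by (auto simp: symb_def)
 have [measurable]: "a \<in> borel_measurable borel" using symb_a by (simp add: symb_def)
 show ?thesis
 proof (rule symbI[where M = "M + 1"])
  show "\<bar>c r\<bar> <= M + 1" if "0 <= r" for r
   using M[OF that] bes_le_1[of "2 * s" r] bes_pos[of "2 * s" r] sb by linarith
 qed measurable
qed

lemma fm_c: "fm c h = fm a h + J s (J s h)"
 using fm_lincomb[OF symb_a symb_bes[of "2 * s"] symb_c, of h] sb by (simp add: J_J) (simp add: J_def)

lemma L_quadratic: "(norm h)^2 - (norm (J s h))\<^sup>2 + inner (pm V (J s h)) (J s h) <= inner (L h) h"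
proof -
 have [measurable]: "c \<in> borel_measurable borel" using symb_c by (simp add: symb_def)
 obtain M where M: "!!r. r >= 0 ==> \<bar>c r\<bar> <= M" using symb_c by (auto simp: symb_def)
 have s1: "symb (%r. 1)" by (rule symbI[where M = 1]) auto
 have sd: "symb (%r. c r - 1)"
 proof (rule symbI[where M = "M + 1"])
  show "\<bar>c r - 1\<bar> <= M + 1" if "0 <= r" for r using M[OF that] by linarith
 qed measurable
 have "0 <= inner (fm (%r. c r - 1) h) h" by (rule inner_fm_nonneg[OF sd]) (use c_ge_1 in auto)
 moreover have "fm c h = fm (%r. c r - 1) h + h" using fm_lincomb[OF sd s1 symb_c, of h] by (simp add: fm_one)
 ultimately have "(norm h)^2 <= inner (fm c h) h" by (simp add: inner_add_left power2_norm_eq_inner)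
 then have "(norm h)^2 <= inner (fm a h) h + (norm (J s h))^2"
  unfolding fm_c inner_add_left J_sym[OF sb(1), of "J s h"] power2_norm_eq_inner .
 then show ?thesis unfolding L_def inner_add_left J_sym[OF sb(1), of "pm V (J s h)"] by simp
qed

text \<open>High frequencies make \<open>J s h\<close> small against \<open>h\<close>, and then the
  potential cannot outweigh the leading term of \<open>L_quadratic\<close>.\<close>

lemma positive_direction:
 assumes "finite A" shows "\<exists>u. (\<forall>a\<in>A. inner u a = 0) \<and> 0 < inner (L u) u"
proof -
 obtain M where M: "0 < M" "!!x. \<bar>V x\<bar> <= M" using VM by blast
 \<comment> \<open>For frequencies beyond this radius, \<open>(norm (J s h))^2\<close> is at most
   \<open>(norm h)^2 / (2 * (1 + M))\<close>.\<close>
 define R where "R = (2 * (1 + M)) powr (1 / (2 * s))"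
 have R: "0 < R" "R powr (- 2 * s) = 1 / (2 * (1 + M))" using M sb by (simp_all add: R_def powr_powr powr_minus_divide)
 obtain h where h: "h ~= 0" "!!a. a \<in> A ==> inner h a = 0" "fm (indicator {R<..}) h = h"
  using high_frequency_vector[OF assms] by blast
 note sB = symb_bes[OF sb(1)]
 have "J s h = fm (%r. bes s r * indicator {R<..} r) h"
  using fm_fm[OF sB symb_low(2)[of R], of h] unfolding h(3) by (simp add: J_def)
 also have "norm ... <= R powr (- s) * norm h"
 proof (rule norm_fm[OF symb_mult[OF sB symb_low(2)]])
  fix r :: real assume "0 <= r"
  have "bes s r <= R powr (- s)" if "R < r"
   using bes_le_powr[OF sb(1), of r] that R(1) powr_mono2'[of "- s" R r] sb by simp
  then show "\<bar>bes s r * indicator {R<..} r\<bar> <= R powr (- s)" using bes_pos[of s r] by (auto simp: indicator_def)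
 qed
 finally have "(norm (J s h))^2 <= (R powr (- s) * norm h)^2" by (intro power_mono) auto
 also have "... = R powr (- 2 * s) * (norm h)^2"
  using R(1) by (simp add: power_mult_distrib powr_powr mult.commute[of s] flip: powr_numeral[of "R powr (- s)"])
 finally have "(1 + M) * (norm (J s h))^2 <= (1 + M) * (1 / (2 * (1 + M)) * (norm h)^2)"
  unfolding R(2) using M(1) by (intro mult_left_mono) auto
 also have "... = (norm h)^2 / 2" using M(1) by (simp add: field_simps)
 finally have 1: "(norm (J s h))^2 + M * (norm (J s h))^2 <= (norm h)^2 / 2" by (simp add: distrib_right)
 have "\<bar>inner (pm V (J s h)) (J s h)\<bar> <= norm (pm V (J s h)) * norm (J s h)" by (rule Cauchy_Schwarz_ineq2)
 also have "... <= (M * norm (J s h)) * norm (J s h)"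
  using M by (intro mult_right_mono norm_pm[OF V_Linf]) auto
 finally have "- (M * (norm (J s h))^2) <= inner (pm V (J s h)) (J s h)" by (simp add: power2_eq_square mult_ac)
 moreover have "0 < (norm h)\<^sup>2" using h(1) by simp
 ultimately have "0 < inner (L h) h" using L_quadratic[of h] 1 by linarith
 then show ?thesis using h(2) by blast
qed

text \<open>Invertibility of \<open>L\<close>: writing \<open>h = k + z\<close> with \<open>k = fm (1/c) (L h)\<close>, the function \<open>J s z\<close> lies in the
 domain of the operator, which sends it to \<open>(1 - V) (J s k)\<close>; the spectral gap then bounds it by \<open>L h\<close>.\<close>

lemma L_bounded_below: obtains \<delta> where "0 < \<delta>" "!!h. \<delta> * norm h <= norm (L h)"
proof -
 obtain M where M: "0 < M" "!!x. \<bar>V x\<bar> <= M" using VM by blast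
 obtain C where C: "!!u. in_Hs (2 * s) u ==> (LBINT x. (u x)\<^sup>2) <= C * (LBINT x. (frac_lap s u x + V x * u x)\<^sup>2)"
  using V(3) unfolding zero_in_spectral_gap_def by blast
 have s2: "0 <= 2 * s" using sb by simp
 have cm[measurable]: "c \<in> borel_measurable borel" using symb_c by (simp add: symb_def)
 \<comment> \<open>The reciprocal of \<open>c\<close>, extended by 1 so that the bound 1 holds for
   all \<open>r\<close>.\<close>
 define mm where "mm r = (if r > 0 then 1 / c r else 1)" for r
 have mm1: "\<bar>mm r\<bar> <= 1" for r
  using abs_inverse_le_1[OF c_ge_1[of r]] by (cases "r > 0") (simp_all only: mm_def if_True if_False abs_one order_refl)
 have smm: "symb mm" by (rule symbI[where M = 1, OF _ mm1]) (simp add: mm_def[abs_def])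
 have nmm: "norm (fm mm h) <= norm h" for h using norm_fm[OF smm mm1, of h] by simp
 have s1: "symb (%r. 1)" by (rule symbI[where M = 1]) auto
 have mmc: "fm mm (fm c h) = h" for h
 proof -
  have "fm mm (fm c h) = fm (%r. 1) h" unfolding fm_fm[OF smm symb_c]
   by (rule fm_cong[OF symb_mult[OF smm symb_c] s1]) (use c_ge_1 in \<open>force simp: mm_def\<close>)
  then show ?thesis by (simp add: fm_one)
 qed
 have cmm: "fm c (fm mm h) = h" for h
  using mmc[of h] unfolding fm_fm[OF smm symb_c] fm_fm[OF symb_c smm] by (simp add: mult.commute)
 have mJ: "fm mm (J s h) = J s (fm mm h)" for h
  unfolding J_def fm_fm[OF smm symb_bes[OF sb(1)]] fm_fm[OF symb_bes[OF sb(1)] smm] by (simp add: mult.commute)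
 have nV: "norm (x - pm V x) <= (1 + M) * norm x" for x :: "real L2"
 proof -
  have "norm (pm V x) <= M * norm x" using M by (intro norm_pm[OF V_Linf]) auto
  then show ?thesis using norm_triangle_ineq4[of x "pm V x"] by (simp add: distrib_right)
 qed
 \<comment> \<open>The constant of the spectral gap is not assumed to be nonnegative, hence
   \<open>|C|\<close>.\<close>
 define D where "D = sqrt \<bar>C\<bar> * (1 + M)"
 have D: "0 <= D" using M by (simp add: D_def)
 define E where "E = 1 + (1 + M) * (D + 1)"
 have E: "0 < E" using M D by (simp add: E_def add_pos_nonneg)
 have main: "norm h <= E * norm (L h)" for h
 proof -
  define u where "u = J s h"
  define k where "k = fm mm (L h)"
  define w where "w = fm mm (u - pm V u)"
  define y where "y = J (2 * s) w"
  have nk: "norm k <= norm (L h)" unfolding k_def by (rule nmm)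
  have "fm c h = L h + J s (u - pm V u)"
   unfolding fm_c L_def bl_diff[OF J_bl[OF sb(1)]] u_def by simp
  \<comment> \<open>Applying the inverse of \<open>fm c\<close> to
    \<open>fm c h = L h + J s (u - pm V u)\<close> splits off \<open>J s w\<close>, which is
    smoother than \<open>k\<close> by the order \<open>s\<close>; so \<open>y = J (2 * s) w\<close>
    is in the domain of the operator.\<close>
  then have hk: "h = k + J s w"
   using mmc[of h] unfolding w_def k_def mJ[symmetric] by (simp add: bl_add[OF fm_bl[OF smm]])
  have yJ: "y = J s (J s w)" unfolding y_def J_J[OF sb(1) sb(1)] by simp
  have uy: "u - y = J s k" unfolding u_def yJ bl_diff[OF J_bl[OF sb(1)], symmetric] using hk by simp
  have uc: "u - pm V u = fm a w + y" using cmm[of "u - pm V u"] unfolding w_def[symmetric] fm_c yJ by simp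
  have ae: "abs_L2 (rep_L2 y) = J (2 * s) w" by (simp add: y_def)
  have fl: "L2fun (frac_lap s (rep_L2 y))" "abs_L2 (frac_lap s (rep_L2 y)) = fm a w"
   using frac_lap_J[OF rep_L2fun ae, of s] sb by (simp_all add: a_def[abs_def])
  have Vy: "L2fun (%x. V x * rep_L2 y x)" using L2fun_pm[OF V_Linf rep_L2fun[of y]] by simp
  have "abs_L2 (%x. frac_lap s (rep_L2 y) x + V x * rep_L2 y x) = fm a w + pm V y"
   using abs_L2_add[OF fl(1) Vy] fl(2) by (simp add: pm_def)
  also have "... = J s k - pm V (J s k)" using uc unfolding uy[symmetric] bl_diff[OF pm_bl[OF V_Linf]] by (simp add: algebra_simps)
  finally have op: "abs_L2 (%x. frac_lap s (rep_L2 y) x + V x * rep_L2 y x) = J s k - pm V (J s k)" .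
  have "(norm y)^2 = (LBINT x. (rep_L2 y x)\<^sup>2)" by (simp add: norm_L2_square)
  also have "... <= C * (LBINT x. (frac_lap s (rep_L2 y) x + V x * rep_L2 y x)\<^sup>2)"
   by (rule C) (use ae in_Hs_iff[OF s2] in auto)
  also have "(LBINT x. (frac_lap s (rep_L2 y) x + V x * rep_L2 y x)\<^sup>2) = (norm (J s k - pm V (J s k)))^2"
   unfolding op[symmetric] norm_abs_L2[OF L2fun_add[OF fl(1) Vy]] by simp
  also have "C * ... <= \<bar>C\<bar> * ..." by (intro mult_right_mono) auto
  also have "... <= \<bar>C\<bar> * ((1 + M) * norm (L h))^2"
  proof (intro mult_left_mono power_mono)
   have "norm (J s k - pm V (J s k)) <= (1 + M) * norm (J s k)" by (rule nV)
   also have "... <= (1 + M) * norm (L h)" using M order_trans[OF norm_J[OF sb(1)] nk] by (intro mult_left_mono) auto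
   finally show "norm (J s k - pm V (J s k)) <= (1 + M) * norm (L h)" .
  qed auto
  also have "... = (D * norm (L h))^2" by (simp add: D_def power_mult_distrib)
  finally have ny: "norm y <= D * norm (L h)" by (rule power2_le_imp_le) (use D in simp)
  have "norm u <= norm y + norm (J s k)" using norm_triangle_ineq[of y "J s k"] uy[symmetric] by simp
  also have "... <= (D + 1) * norm (L h)" using ny order_trans[OF norm_J[OF sb(1)] nk] by (simp add: distrib_right)
  finally have nu: "norm u <= (D + 1) * norm (L h)" .
  have "norm (J s w) <= norm w" by (rule norm_J[OF sb(1)])
  also have "... <= norm (u - pm V u)" unfolding w_def by (rule nmm)
  also have "... <= (1 + M) * norm u" by (rule nV)
  also have "... <= (1 + M) * ((D + 1) * norm (L h))" using M nu by (intro mult_left_mono) auto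
  finally have "norm (k + J s w) <= norm (L h) + (1 + M) * ((D + 1) * norm (L h))"
   using nk norm_triangle_ineq[of k "J s w"] by linarith
  then show ?thesis unfolding hk[symmetric] E_def by (simp add: algebra_simps)
 qed
 show thesis
 proof (rule that[of "1 / E"])
  show "1 / E * norm h <= norm (L h)" for h using main[of h] E by (simp add: pos_divide_le_eq mult.commute)
 qed (use E in simp)
qed

section \<open>Critical points and weak solutions\<close>

lemma critical_points:
 "\<exists>u. (\<forall>n v. inner (L (u n)) v - inner (\<beta> (u n) (u n)) (\<beta> (u n) v) + T (u n) v = 0) \<and>
  filterlim (%n. norm (u n)) at_top sequentially"
proof -
 obtain \<delta> where d: "0 < \<delta>" "!!h. \<delta> * norm h <= norm (L h)" using L_bounded_below by blast
 obtain Ck where Ck: "0 < Ck" "!!h. \<kappa> h <= Ck * norm h" using \<kappa>_bounded by blast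
 obtain Cq where Cq: "0 < Cq" "!!u. (inner (Q u) u)\<^sup>2 <= Cq * (norm (\<beta> u u))^2" using Q_bound by blast
 interpret F: indef_functional L \<beta> G D2 \<kappa> Q \<delta> Ck Cq 4 q
 proof (rule indef_functional.intro)
  show "0 <= \<kappa> x" for x using K4.m_nonneg[of x] gq.m_nonneg[of x] by (simp add: \<kappa>_def)
  show "\<kappa> (x + y) <= 2 * (\<kappa> x + \<kappa> y)" for x y using K4.m_add[of x y] gq.m_add[of x y] by (simp add: \<kappa>_def)
  show "\<kappa> (r *\<^sub>R x) = \<bar>r\<bar> * \<kappa> x" for r x by (simp add: \<kappa>_def K4.m_scale gq.m_scale distrib_left)
 qed (fact L_bl L_sym d positive_direction \<beta>_add \<beta>_scale \<beta>_sym \<beta>_norm Ck \<kappa>_small Q_bl Q_sym Q_inj Q_pos Cq qb(1) q(2)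
   G_nonneg G_even D2_odd D2_euler D2_convex D2_bound D2_diff | simp)+
 show ?thesis using F.infinitely_many_critical_points by (simp add: inner_D2)
qed

text \<open>\<open>bessel_op (t / 2)\<close> inverts \<open>J t\<close>, so both sides equal
  \<open>(\<beta> h h, k)\<close> for \<open>v = J t k\<close>.\<close>

lemma is_phi: "is_phi_u t K (U h) (rep_L2 (J t (\<beta> h h)))"
 unfolding is_phi_u_def
proof (intro conjI allI impI)
 show "in_Lt2 t (rep_L2 (J t (\<beta> h h)))" by (auto simp: in_Lt2_iff[OF tb])
 fix v assume "in_Lt2 t v"
 then obtain k where v: "L2fun v" "abs_L2 v = J t k" by (auto simp: in_Lt2_iff[OF tb])
 have t2: "0 <= t / 2" using t by simp
 have b1: "L2fun (bessel_op (t / 2) (rep_L2 (J t (\<beta> h h))))" "abs_L2 (bessel_op (t / 2) (rep_L2 (J t (\<beta> h h)))) = \<beta> h h"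
  using bessel_op_J[OF rep_L2fun, of "J t (\<beta> h h)" "t / 2" "\<beta> h h"] t2 by simp_all
 have b2: "L2fun (bessel_op (t / 2) v)" "abs_L2 (bessel_op (t / 2) v) = k"
  using bessel_op_J[OF v(1), of "t / 2" k] v(2) t2 by simp_all
 have "Lt2_inner t (rep_L2 (J t (\<beta> h h))) v = inner (abs_L2 (bessel_op (t / 2) (rep_L2 (J t (\<beta> h h))))) (abs_L2 (bessel_op (t / 2) v))"
  unfolding Lt2_inner_def inner_abs_L2[OF b1(1) b2(1)] by simp
 also have "... = inner (\<beta> h h) k" by (simp only: b1(2) b2(2))
 also have "... = inner (abs_L2 (P h h)) (abs_L2 v)" unfolding v(2) \<beta>_def J_sym[OF tb] ..
 also have "... = (LBINT x. K x * (U h x)^2 * v x)"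
  unfolding inner_abs_L2[OF P_L2 v(1)] by (simp add: P_def power2_eq_square mult_ac)
 finally show "Lt2_inner t (rep_L2 (J t (\<beta> h h))) v = (LBINT x. K x * (U h x)^2 * v x)" .
qed

text \<open>Each test function is \<open>J s k\<close> up to a null set, and the integrand splits
  into four integrable terms that match those of the critical point equation; \<open>g < 0\<close>
  turns \<open>- g\<close> into \<open>|g|\<close>.\<close>

lemma weak_solution_critical:
 assumes crit: "!!k. inner (L h) k - inner (\<beta> h h) (\<beta> h k) + T h k = 0"
 shows "weak_solution s t q V K g (U h) (rep_L2 (J t (\<beta> h h)))"
 unfolding weak_solution_def
proof (intro conjI allI impI is_phi)
 let ?\<phi> = "rep_L2 (J t (\<beta> h h))"
 show "in_Hs s (U h)" by (auto simp: in_Hs_iff[OF sb(1)])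
 show "in_Lt2 t ?\<phi>" by (auto simp: in_Lt2_iff[OF tb])
 fix v assume "in_Hs s v"
 then obtain k where v: "L2fun v" "abs_L2 v = J s k" by (auto simp: in_Hs_iff[OF sb(1)])
 have [measurable]: "v \<in> borel_measurable borel" using v(1) by auto
 have vU: "AA x. v x = U k x" using rep_abs[OF v(1)] unfolding v(2) by eventually_elim simp
 define b where "b r = r powr s * bes s r" for r
 have half: "0 <= s / 2" "2 * (s / 2) <= s" "2 * (s / 2) = s" using sb by simp_all
 have sbm: "symb b" unfolding b_def[abs_def] using symb_lap[OF half(1,2)] by simp
 have fU: "L2fun (frac_lap (s / 2) (U h))" "abs_L2 (frac_lap (s / 2) (U h)) = fm b h"
  using frac_lap_J[OF rep_L2fun, of "J s h" s h "s / 2"] half by (simp_all add: b_def[abs_def])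
 have fv: "L2fun (frac_lap (s / 2) v)" "abs_L2 (frac_lap (s / 2) v) = fm b k"
  using frac_lap_J[OF v half(1,2)] by (simp_all add: b_def[abs_def])
 have VU: "L2fun (%x. V x * U h x)" using L2fun_pm[OF V_Linf rep_L2fun[of "J s h"]] by simp
 let ?A = "%x. frac_lap (s / 2) (U h) x * frac_lap (s / 2) v x" and ?B = "%x. V x * U h x * v x"
  and ?C = "%x. K x * ?\<phi> x * U h x * U k x" and ?D = "%x. \<bar>g x\<bar> * (\<bar>U h x\<bar> powr (q - 2) * U h x * U k x)"
 have A: "integrable lborel ?A" "(LBINT x. ?A x) = inner (fm a h) k"
 proof -
  show "integrable lborel ?A" using integrable_inner_L2[OF fU(1) fv(1)] by simp
  have "(LBINT x. ?A x) = inner (fm b h) (fm b k)"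
   unfolding fU(2)[symmetric] fv(2)[symmetric] inner_abs_L2[OF fU(1) fv(1)] by simp
  also have "... = inner (fm b (fm b h)) k" using fm_sym[OF sbm, of "fm b h" k] by simp
  \<comment> \<open>Each factor carries half of the order: the square of the symbol \<open>b\<close>
    is \<open>a\<close> away from the origin.\<close>
  also have "fm b (fm b h) = fm a h"
   unfolding fm_fm[OF sbm sbm]
  proof (rule fm_cong[OF symb_mult[OF sbm sbm] symb_a])
   fix r :: real assume "0 < r"
   have "b r * b r = (r powr s * r powr s) * (bes s r * bes s r)" by (simp add: b_def mult_ac)
   then show "b r * b r = a r" unfolding bes_mult powr_add[symmetric] by (simp add: a_def)
  qed
  finally show "(LBINT x. ?A x) = inner (fm a h) k" .
 qed
 have B: "integrable lborel ?B" "(LBINT x. ?B x) = inner (J s (pm V (J s h))) k"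
 proof -
  show "integrable lborel ?B" using integrable_inner_L2[OF VU v(1)] by simp
  have "(LBINT x. ?B x) = inner (abs_L2 (%x. V x * U h x)) (abs_L2 v)"
   unfolding inner_abs_L2[OF VU v(1)] by simp
  then show "(LBINT x. ?B x) = inner (J s (pm V (J s h))) k" unfolding J_sym[OF sb(1)] v(2) by (simp add: pm_def)
 qed
 have C: "integrable lborel ?C" "(LBINT x. ?C x) = inner (\<beta> h h) (\<beta> h k)"
 proof -
  have e: "?C x = inner (?\<phi> x) (P h k x)" for x by (simp add: P_def mult_ac)
  show "integrable lborel ?C" unfolding e by (rule integrable_inner_L2[OF rep_L2fun P_L2])
  have "(LBINT x. ?C x) = inner (abs_L2 ?\<phi>) (abs_L2 (P h k))"
   unfolding e by (rule inner_abs_L2[OF rep_L2fun P_L2, symmetric])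
  also have "... = inner (\<beta> h h) (\<beta> h k)" by (simp add: J_sym[OF tb] \<beta>_def[of h k])
  finally show "(LBINT x. ?C x) = inner (\<beta> h h) (\<beta> h k)" .
 qed
 have "(LBINT x. ?A x + V x * U h x * v x - K x * ?\<phi> x * U h x * v x - g x * (\<bar>U h x\<bar> powr (q - 2) * U h x) * v x)
  = (LBINT x. ?A x + ?B x - ?C x + ?D x)"
 proof (rule integral_cong_AE)
  have [measurable]: "frac_lap (s / 2) (U h) \<in> borel_measurable borel" "frac_lap (s / 2) v \<in> borel_measurable borel"
   using fU(1) fv(1) by auto
  show "(%x. ?A x + V x * U h x * v x - K x * ?\<phi> x * U h x * v x - g x * (\<bar>U h x\<bar> powr (q - 2) * U h x) * v x) \<in> borel_measurable lborel"
   by measurable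
  show "(%x. ?A x + ?B x - ?C x + ?D x) \<in> borel_measurable lborel" by measurable
  show "AA x. ?A x + V x * U h x * v x - K x * ?\<phi> x * U h x * v x - g x * (\<bar>U h x\<bar> powr (q - 2) * U h x) * v x = ?A x + ?B x - ?C x + ?D x"
   using vU g(2) by eventually_elim simp
 qed
 also have "... = inner (fm a h) k + inner (J s (pm V (J s h))) k - inner (\<beta> h h) (\<beta> h k) + T h k"
  unfolding bint_sum[OF bint_diff[OF bint_add[OF A(1) B(1)] C(1)] T_integrable]
   bint_difference[OF bint_add[OF A(1) B(1)] C(1)]
   bint_sum[OF A(1) B(1)] A(2) B(2) C(2) T_def ..
 also have "... = 0" using crit[of k] by (simp add: L_def inner_add_left)
 finally show "(LBINT x. ?A x + V x * U h x * v x - K x * ?\<phi> x * U h x * v x - g x * (\<bar>U h x\<bar> powr (q - 2) * U h x) * v x) = 0" .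
qed

lemma infinitely_many_solutions:
 "\<exists>u \<phi>. (\<forall>n. weak_solution s t q V K g (u n) (\<phi> n)) \<and> filterlim (%n. Hs_norm s (u n)) at_top sequentially"
proof -
 obtain h where h: "!!n v. inner (L (h n)) v - inner (\<beta> (h n) (h n)) (\<beta> (h n) v) + T (h n) v = 0"
  "filterlim (%n. norm (h n)) at_top sequentially"
  using critical_points by blast
 have "Hs_norm s (U (h n)) = norm (h n)" for n by (rule Hs_norm_J[OF _ _ sb(1)]) simp_all
 then have "filterlim (%n. Hs_norm s (U (h n))) at_top sequentially" using h(2) by simp
 then show ?thesis using weak_solution_critical[OF h(1)]
  by (intro exI[of _ "%n. U (h n)"] exI[of _ "%n. rep_L2 (J t (\<beta> (h n) (h n)))"]) blast
qed

end

theorem theorem1p2: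
  fixes s t q :: real and V K g :: "real^3 \<Rightarrow> real"
  assumes s: "3/4 < s" "s < 1" and t: "0 < t" "t < 1"
    and V: "continuous_on UNIV V" "bounded (range V)" "zero_in_spectral_gap s V"
    and K: "in_Lp (3 / (4 * s - 3)) K" "in_Linf K" "AE x in lborel. K x > 0"
    and q: "4/3 \<le> q" "q < 2"
    and g: "in_Lp (6 / (6 - q * (3 - 2 * s))) g" "AE x in lborel. g x < 0"
  shows "\<exists>u \<phi> :: nat \<Rightarrow> real^3 \<Rightarrow> real.
           (\<forall>n. weak_solution s t q V K g (u n) (\<phi> n)) \<and>
           filterlim (\<lambda>n. Hs_norm s (u n)) at_top sequentially"
proof -
  interpret sp_system s t q V K g by unfold_locales (fact s t V K q g)+
  show ?thesis by (rule infinitely_many_solutions)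
qed

end
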